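(* (Rosenlicht's Main Theorem.) Let $C$ be a complete integral curve of arithmetic genus $g\ge2$ over an algebraically closed field $k$; let $C'\subset\mathbb P^{g-1}$ be its canonical model, and $\hat C$ the blowup of $C$ with respect to the canonical sheaf $\omega$. Assume $C$ is nonhyperelliptic. Then the canonical map $\hat\kappa\colon\hat C\to C'$ is an isomorphism.
   Context: The field $k$ has arbitrary characteristic. $\omega$ is the dualizing sheaf of $C$. $C$ is hyperelliptic if there is a map $C\to\mathbb P^1$ of degree $2$, and nonhyperelliptic otherwise. For an integral scheme $A$ and a map $\alpha\colon A\to C$, put $\mathcal O_A\omega:=\alpha^*\omega/\mathrm{Torsion}(\alpha^*\omega)$. Let $\nu\colon\bar C\to C$ be the normalization. The $g$-dimensional space $H^0(\omega)$ generates $\omega$, so $\mathcal O_{\bar C}\omega$ is invertible and generated by $H^0(\omega)$; this defines a nondegenerate map $\bar\kappa\colon\bar C\to\mathbb P^{g-1}$, whose image is the canonical model $C'$. Blowup with respect to $\omega$: for $n\ge0$ set $\omega^n:=\mathrm{Sym}^n\omega/\mathrm{Torsion}(\mathrm{Sym}^n\omega)$, and let $\hat C:=\mathrm{Proj}(\bigoplus_n\omega^n)$ with structure map $\beta\colon\hat C\to C$. Then $\hat C$ is an integral curve, $\beta$ is birational, and $\mathcal O_{\hat C}\omega$ is invertible and generated by $H^0(\omega)$. The normalization factors uniquely as $\nu=\beta\hat\nu$ with $\hat\nu\colon\bar C\to\hat C$, and $\bar\kappa$ factors uniquely as $\bar\kappa=\hat\kappa\hat\nu$; this defines $\hat\kappa\colon\hat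 C\to C'$, the map given by $H^0(\omega)$ as a space of sections of $\mathcal O_{\hat C}\omega$. *)

theory Defs
  imports
    "HOL-Algebra.Generated_Rings"
    "HOL-Algebra.QuotRing"
    "HOL-Algebra.Module"
    "HOL-Analysis.Abstract_Topology"
    "HOL-Library.Poly_Mapping"
    "HOL-Library.FuncSet"
    "HOL-Computational_Algebra.Polynomial"
    "HOL-Computational_Algebra.Fraction_Field"
begin

text \<open>
  All schemes here are integral, so the restriction maps of the structure sheaf are injective and
  the sheaf is canonically a subsheaf of the constant sheaf of rational functions.  An integral
  scheme is therefore given by a topological space together with a subring of a field for each
  \<^emph>\<open>nonempty\<close> open set; restriction is inclusion, and the value at the empty set is never used.
\<close>

section \<open>Commutative algebra inside a fixed ring or field\<close>

definition ring_on :: "'a::comm_ring_1 set \<Rightarrow> 'a ring" where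
  "ring_on A = \<lparr>carrier = A, monoid.mult = (*), one = 1, zero = 0, add = (+)\<rparr>"

abbreviation generated_subring :: "'a::comm_ring_1 set \<Rightarrow> 'a set" where
  "generated_subring S \<equiv> generate_ring (ring_on UNIV) S"

definition nonunits :: "'a::field set \<Rightarrow> 'a set" where
  "nonunits R = {a \<in> R. a = 0 \<or> inverse a \<notin> R}"

definition spec :: "'a::comm_ring_1 set \<Rightarrow> 'a set topology" where
  "spec A = topology_generated_by {{P. primeideal P (ring_on A) \<and> f \<notin> P} | f. f \<in> A}"

definition localization :: "'a::field set \<Rightarrow> 'a set \<Rightarrow> 'a set" where
  "localization A P = {a / s | a s. a \<in> A \<and> s \<in> A - P}"

definition integral_closure :: "'a::field set \<Rightarrow> 'a set" where
  "integral_closure A =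
     {a. \<exists>p. lead_coeff p = 1 \<and> (\<forall>i. coeff p i \<in> A) \<and> poly p a = 0}"

definition set_product :: "'a::comm_ring_1 set \<Rightarrow> 'a set \<Rightarrow> 'a set" where
  "set_product M N =
     {(\<Sum>i<n. x i * y i) | (n::nat) x y. \<forall>i<n. x i \<in> M \<and> y i \<in> N}"

primrec module_power :: "'a::comm_ring_1 set \<Rightarrow> 'a set \<Rightarrow> nat \<Rightarrow> 'a set" where
  "module_power A M 0 = A"
| "module_power A M (Suc n) = set_product (module_power A M n) M"

type_synonym 'a mpoly = "(nat \<Rightarrow>\<^sub>0 nat) \<Rightarrow>\<^sub>0 'a"

text \<open>Polynomials in the variables \<open>t\<^sub>0, \<dots>, t\<^sub>n\<^sub>-\<^sub>1\<close> with coefficients in \<open>A\<close>.\<close>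

definition polynomials :: "'a::comm_ring_1 set \<Rightarrow> nat \<Rightarrow> 'a mpoly set" where
  "polynomials A n =
     {F. \<forall>m. Poly_Mapping.lookup F m \<in> A
        \<and> (Poly_Mapping.lookup F m \<noteq> 0 \<longrightarrow> Poly_Mapping.keys m \<subseteq> {..<n})}"

definition monomial_degree :: "(nat \<Rightarrow>\<^sub>0 nat) \<Rightarrow> nat" where
  "monomial_degree m = (\<Sum>i\<in>Poly_Mapping.keys m. Poly_Mapping.lookup m i)"

definition homogeneous_of_degree :: "nat \<Rightarrow> 'a::zero mpoly \<Rightarrow> bool" where
  "homogeneous_of_degree d F \<longleftrightarrow> (\<forall>m\<in>Poly_Mapping.keys F. monomial_degree m = d)"

definition homogeneous_component :: "nat \<Rightarrow> 'a::comm_ring_1 mpoly \<Rightarrow> 'a mpoly" where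
  "homogeneous_component d F =
     (\<Sum>m\<in>{m \<in> Poly_Mapping.keys F. monomial_degree m = d}.
        Poly_Mapping.single m (Poly_Mapping.lookup F m))"

definition evaluate :: "('k::comm_ring_1 \<Rightarrow> 'a::comm_ring_1) \<Rightarrow> (nat \<Rightarrow> 'a) \<Rightarrow> 'k mpoly \<Rightarrow> 'a" where
  "evaluate \<iota> v F =
     (\<Sum>m\<in>Poly_Mapping.keys F. \<iota> (Poly_Mapping.lookup F m)
        * (\<Prod>i\<in>Poly_Mapping.keys m. v i ^ Poly_Mapping.lookup m i))"

section \<open>Integral schemes\<close>

record ('p, 'a) rspace =
  points :: "'p topology"
  sections :: "'p set \<Rightarrow> 'a set"

definition nopen :: "('p, 'a) rspace \<Rightarrow> 'p set \<Rightarrow> bool" where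
  "nopen X U \<longleftrightarrow> openin (points X) U \<and> U \<noteq> {}"

definition stalk :: "('p, 'a) rspace \<Rightarrow> 'p \<Rightarrow> 'a set" where
  "stalk X x = \<Union>{sections X U | U. openin (points X) U \<and> x \<in> U}"

definition basic_open :: "('p, 'a::field) rspace \<Rightarrow> 'p set \<Rightarrow> 'a \<Rightarrow> 'p set" where
  "basic_open X U f = {x \<in> U. f \<notin> nonunits (stalk X x)}"

text \<open>\<open>U\<close> is the spectrum of its ring of sections, as a ringed space.\<close>

definition affine_open :: "('p, 'a::field) rspace \<Rightarrow> 'p set \<Rightarrow> bool" where
  "affine_open X U \<longleftrightarrow> nopen X U
     \<and> homeomorphic_map (subtopology (points X) U) (spec (sections X U))
          (\<lambda>x. sections X U \<inter> nonunits (stalk X x))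
     \<and> (\<forall>f\<in>sections X U. f \<noteq> 0 \<longrightarrow>
          sections X (basic_open X U f) = {a / f ^ n | a n. a \<in> sections X U})"

text \<open>Integral schemes whose function field, the stalk at the generic point, is the whole
  type \<^typ>\<open>'a\<close>.\<close>

definition integral_scheme :: "('p, 'a::field) rspace \<Rightarrow> bool" where
  "integral_scheme X \<longleftrightarrow>
     topspace (points X) \<noteq> {}
   \<and> (\<forall>U V. nopen X U \<and> nopen X V \<longrightarrow> U \<inter> V \<noteq> {})
   \<and> (\<forall>U. nopen X U \<longrightarrow> subring (sections X U) (ring_on UNIV))
   \<and> (\<forall>\<V>. \<V> \<noteq> {} \<and> (\<forall>V\<in>\<V>. nopen X V) \<longrightarrow>
        sections X (\<Union>\<V>) = (\<Inter>V\<in>\<V>. sections X V))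
   \<and> (\<forall>x\<in>topspace (points X). \<exists>U. affine_open X U \<and> x \<in> U)
   \<and> (\<Union>U\<in>{U. nopen X U}. sections X U) = UNIV"

text \<open>A scheme over \<open>Spec k\<close>: the structure map is recorded by the field embedding \<open>\<iota>\<close> of \<open>k\<close> in the
  function field.\<close>

definition over_field :: "('p, 'a::field) rspace \<Rightarrow> ('k::field \<Rightarrow> 'a) \<Rightarrow> bool" where
  "over_field X \<iota> \<longleftrightarrow>
     \<iota> \<in> ring_hom (ring_on UNIV) (ring_on (sections X (topspace (points X))))"

definition finite_type :: "('p, 'a::field) rspace \<Rightarrow> ('k::field \<Rightarrow> 'a) \<Rightarrow> bool" where
  "finite_type X \<iota> \<longleftrightarrow> (\<exists>\<U>. finite \<U> \<and> \<Union>\<U> = topspace (points X)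
     \<and> (\<forall>U\<in>\<U>. affine_open X U
           \<and> (\<exists>S. finite S \<and> sections X U = generated_subring (range \<iota> \<union> S))))"

text \<open>The diagonal is a closed immersion: over the affine open \<open>U \<times> V\<close> of the product its source is
  \<open>U \<inter> V\<close>, which has to be affine with \<open>\<O>(U) \<otimes> \<O>(V) \<rightarrow> \<O>(U \<inter> V)\<close> surjective.\<close>

definition separated :: "('p, 'a::field) rspace \<Rightarrow> bool" where
  "separated X \<longleftrightarrow> (\<forall>U V. affine_open X U \<and> affine_open X V \<longrightarrow>
     affine_open X (U \<inter> V)
     \<and> sections X (U \<inter> V) = generated_subring (sections X U \<union> sections X V))"

text \<open>The underlying space of the scheme \<open>X \<times> A\<^sup>n\<close>.  Its points over \<open>x\<close> are the primes of
  \<open>\<O>\<^sub>x[t\<^sub>0, \<dots>, t\<^sub>n\<^sub>-\<^sub>1]\<close> lying over the maximal ideal of \<open>\<O>\<^sub>x\<close>; the basic open sets are the nonvanishing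
  loci of the \<open>F \<in> \<O>(U)[t\<^sub>0, \<dots>, t\<^sub>n\<^sub>-\<^sub>1]\<close> for \<open>U\<close> affine.\<close>

definition affine_space_points :: "('p, 'a::field) rspace \<Rightarrow> nat \<Rightarrow> ('p \<times> 'a mpoly set) set" where
  "affine_space_points X n =
     {(x, P). x \<in> topspace (points X)
        \<and> primeideal P (ring_on (polynomials (stalk X x) n))
        \<and> {c \<in> stalk X x. Poly_Mapping.single 0 c \<in> P} = nonunits (stalk X x)}"

definition affine_space_over :: "('p, 'a::field) rspace \<Rightarrow> nat \<Rightarrow> ('p \<times> 'a mpoly set) topology" where
  "affine_space_over X n = topology_generated_by
     {{(x, P). (x, P) \<in> affine_space_points X n \<and> x \<in> U \<and> F \<notin> P} | U F.
        affine_open X U \<and> F \<in> polynomials (sections X U) n}"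

text \<open>Closedness after the base changes \<open>A\<^sup>n \<rightarrow> Spec k\<close> implies it after every base change, for
  morphisms of finite type.\<close>

definition universally_closed :: "('p, 'a::field) rspace \<Rightarrow> ('k::field \<Rightarrow> 'a) \<Rightarrow> bool" where
  "universally_closed X \<iota> \<longleftrightarrow> (\<forall>n. closed_map (affine_space_over X n)
     (spec (polynomials (range \<iota>) n)) (\<lambda>(x, P). P \<inter> polynomials (range \<iota>) n))"

definition irreducible_closed :: "'p topology \<Rightarrow> 'p set \<Rightarrow> bool" where
  "irreducible_closed T Z \<longleftrightarrow> closedin T Z \<and> Z \<noteq> {}
     \<and> (\<forall>A B. closedin T A \<and> closedin T B \<and> Z \<subseteq> A \<union> B \<longrightarrow> Z \<subseteq> A \<or> Z \<subseteq> B)"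

definition irreducible_chain :: "'p topology \<Rightarrow> nat \<Rightarrow> bool" where
  "irreducible_chain T n \<longleftrightarrow>
     (\<exists>Z. (\<forall>i\<le>n. irreducible_closed T (Z i)) \<and> (\<forall>i<n. Z i \<subset> Z (Suc i)))"

definition has_dimension :: "'p topology \<Rightarrow> nat \<Rightarrow> bool" where
  "has_dimension T n \<longleftrightarrow> irreducible_chain T n \<and> \<not> irreducible_chain T (Suc n)"

definition complete_integral_curve :: "('p, 'a::field) rspace \<Rightarrow> ('k::field \<Rightarrow> 'a) \<Rightarrow> bool" where
  "complete_integral_curve X \<iota> \<longleftrightarrow> integral_scheme X \<and> over_field X \<iota>
     \<and> has_dimension (points X) 1
     \<and> finite_type X \<iota> \<and> separated X \<and> universally_closed X \<iota>"

text \<open>Dominant morphisms.  The sheaf map is the restriction of a single map \<open>\<theta>\<close> of function fields;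
  only the values of \<open>\<theta>\<close> on the function field of \<open>Y\<close> matter.\<close>

definition preimage :: "('p, 'a) rspace \<Rightarrow> ('p \<Rightarrow> 'q) \<Rightarrow> 'q set \<Rightarrow> 'p set" where
  "preimage X f V = {x \<in> topspace (points X). f x \<in> V}"

definition dominant_morphism ::
    "('p, 'a::field) rspace \<Rightarrow> ('q, 'b::field) rspace \<Rightarrow> ('p \<Rightarrow> 'q) \<Rightarrow> ('b \<Rightarrow> 'a) \<Rightarrow> bool" where
  "dominant_morphism X Y f \<theta> \<longleftrightarrow>
     continuous_map (points X) (points Y) f
   \<and> (\<forall>V. nopen Y V \<longrightarrow> preimage X f V \<noteq> {}
        \<and> \<theta> \<in> ring_hom (ring_on (sections Y V)) (ring_on (sections X (preimage X f V))))
   \<and> (\<forall>x\<in>topspace (points X). \<forall>b\<in>nonunits (stalk Y (f x)). \<theta> b \<in> nonunits (stalk X x))"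

definition isomorphism ::
    "('p, 'a::field) rspace \<Rightarrow> ('q, 'b::field) rspace \<Rightarrow> ('p \<Rightarrow> 'q) \<Rightarrow> ('b \<Rightarrow> 'a) \<Rightarrow> bool" where
  "isomorphism X Y f \<theta> \<longleftrightarrow> dominant_morphism X Y f \<theta>
   \<and> homeomorphic_map (points X) (points Y) f
   \<and> (\<forall>V. nopen Y V \<longrightarrow>
        \<theta> \<in> ring_iso (ring_on (sections Y V)) (ring_on (sections X (preimage X f V))))"

text \<open>The separated scheme glued from the spectra of the subrings \<open>B \<in> \<B>\<close> of a common field.  Points
  of a separated integral scheme are determined by their local rings in the function field, so
  these local rings serve as the points.\<close>

definition glued_points :: "'a::field set set \<Rightarrow> 'a set set" where
  "glued_points \<B> = {localization B P | B P. B \<in> \<B> \<and> primeideal P (ring_on B)}"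

definition glued_topology :: "'a::field set set \<Rightarrow> 'a set topology" where
  "glued_topology \<B> = topology (\<lambda>V. V \<subseteq> glued_points \<B>
     \<and> (\<forall>B\<in>\<B>. openin (spec B) {P. primeideal P (ring_on B) \<and> localization B P \<in> V}))"

definition glue :: "'a::field set set \<Rightarrow> ('a set, 'a) rspace" where
  "glue \<B> = \<lparr>points = glued_topology \<B>, sections = (\<lambda>V. \<Inter>R\<in>V. R)\<rparr>"

lemma openin_glued_topology:
  "openin (glued_topology \<B>) V \<longleftrightarrow> V \<subseteq> glued_points \<B>
     \<and> (\<forall>B\<in>\<B>. openin (spec B) {P. primeideal P (ring_on B) \<and> localization B P \<in> V})"
proof -
  let ?T = "\<lambda>B V. {P. primeideal P (ring_on B) \<and> localization B P \<in> V}"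
  have inter: "?T B (V \<inter> W) = ?T B V \<inter> ?T B W" for B V W
    by auto
  have union: "?T B (\<Union>\<K>) = \<Union>(?T B ` \<K>)" for B \<K>
    by auto
  have "istopology (\<lambda>V. V \<subseteq> glued_points \<B> \<and> (\<forall>B\<in>\<B>. openin (spec B) (?T B V)))"
    unfolding istopology_def inter union by blast
  then show ?thesis
    unfolding glued_topology_def by (simp add: topology_inverse')
qed

section \<open>Hyperelliptic curves\<close>

definition fract_const :: "'k::field \<Rightarrow> 'k poly fract" where
  "fract_const c = Fract [:c:] 1"

definition fract_var :: "'k::field poly fract" where
  "fract_var = Fract [:0, 1:] 1"

definition projective_line :: "('k::field poly fract set, 'k poly fract) rspace" where
  "projective_line =
     glue {generated_subring (range fract_const \<union> {fract_var}),
           generated_subring (range fract_const \<union> {inverse fract_var})}"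

text \<open>A map of degree 2 is dominant, and its degree is that of the extension of function fields.\<close>

definition hyperelliptic :: "('p, 'a::field) rspace \<Rightarrow> ('k::field \<Rightarrow> 'a) \<Rightarrow> bool" where
  "hyperelliptic X \<iota> \<longleftrightarrow>
     (\<exists>f (\<theta> :: 'k poly fract \<Rightarrow> 'a). dominant_morphism X projective_line f \<theta>
        \<and> (\<forall>c. \<theta> (fract_const c) = \<iota> c)
        \<and> vector_space.dim (\<lambda>b a. \<theta> b * a) (UNIV :: 'a set) = 2)"

section \<open>Coherent sheaves and the dualizing sheaf\<close>

record ('p, 'a, 'm) omodule =
  msections :: "'p set \<Rightarrow> ('a, 'm) module"
  mrestrict :: "'p set \<Rightarrow> 'p set \<Rightarrow> 'm \<Rightarrow> 'm"

definition sheaf_of_modules :: "('p, 'a::field) rspace \<Rightarrow> ('p, 'a, 'm) omodule \<Rightarrow> bool" where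
  "sheaf_of_modules X F \<longleftrightarrow>
     (\<forall>U. nopen X U \<longrightarrow> module (ring_on (sections X U)) (msections F U))
   \<and> (\<forall>U V. nopen X U \<and> nopen X V \<and> V \<subseteq> U \<longrightarrow>
        mrestrict F U V \<in> carrier (msections F U) \<rightarrow> carrier (msections F V)
        \<and> (\<forall>s\<in>carrier (msections F U). \<forall>t\<in>carrier (msections F U).
             mrestrict F U V (s \<oplus>\<^bsub>msections F U\<^esub> t)
               = mrestrict F U V s \<oplus>\<^bsub>msections F V\<^esub> mrestrict F U V t)
        \<and> (\<forall>a\<in>sections X U. \<forall>s\<in>carrier (msections F U).
             mrestrict F U V (a \<odot>\<^bsub>msections F U\<^esub> s) = a \<odot>\<^bsub>msections F V\<^esub> mrestrict F U V s))
   \<and> (\<forall>U. nopen X U \<longrightarrow> (\<forall>s\<in>carrier (msections F U). mrestrict F U U s = s))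
   \<and> (\<forall>U V W. nopen X U \<and> nopen X V \<and> nopen X W \<and> W \<subseteq> V \<and> V \<subseteq> U \<longrightarrow>
        (\<forall>s\<in>carrier (msections F U). mrestrict F V W (mrestrict F U V s) = mrestrict F U W s))
   \<and> (\<forall>\<V>. \<V> \<noteq> {} \<and> (\<forall>V\<in>\<V>. nopen X V) \<longrightarrow>
        (\<forall>\<sigma>. (\<forall>V\<in>\<V>. \<sigma> V \<in> carrier (msections F V))
           \<and> (\<forall>V\<in>\<V>. \<forall>W\<in>\<V>. mrestrict F V (V \<inter> W) (\<sigma> V) = mrestrict F W (V \<inter> W) (\<sigma> W))
           \<longrightarrow> (\<exists>!s. s \<in> carrier (msections F (\<Union>\<V>))
                  \<and> (\<forall>V\<in>\<V>. mrestrict F (\<Union>\<V>) V s = \<sigma> V))))"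

definition coherent :: "('p, 'a::field) rspace \<Rightarrow> ('p, 'a, 'm) omodule \<Rightarrow> bool" where
  "coherent X F \<longleftrightarrow> sheaf_of_modules X F
   \<and> (\<forall>U. affine_open X U \<longrightarrow>
        (\<exists>S. finite S \<and> S \<subseteq> carrier (msections F U)
           \<and> (\<forall>s\<in>carrier (msections F U). \<exists>a\<in>S \<rightarrow> sections X U.
                s = finsum (msections F U) (\<lambda>b. a b \<odot>\<^bsub>msections F U\<^esub> b) S))
        \<and> (\<forall>f\<in>sections X U. f \<noteq> 0 \<longrightarrow>
             (\<forall>s\<in>carrier (msections F (basic_open X U f)). \<exists>n. \<exists>u\<in>carrier (msections F U).
                mrestrict F U (basic_open X U f) u = f ^ n \<odot>\<^bsub>msections F (basic_open X U f)\<^esub> s)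
           \<and> (\<forall>u\<in>carrier (msections F U).
                mrestrict F U (basic_open X U f) u = \<zero>\<^bsub>msections F (basic_open X U f)\<^esub>
                \<longrightarrow> (\<exists>n. f ^ n \<odot>\<^bsub>msections F U\<^esub> u = \<zero>\<^bsub>msections F U\<^esub>))))"

definition sheaf_hom ::
    "('p, 'a::field) rspace \<Rightarrow> ('p, 'a, 'm) omodule \<Rightarrow> ('p, 'a, 'n) omodule
      \<Rightarrow> ('p set \<Rightarrow> 'm \<Rightarrow> 'n) \<Rightarrow> bool" where
  "sheaf_hom X F G \<phi> \<longleftrightarrow>
     (\<forall>U. nopen X U \<longrightarrow>
        \<phi> U \<in> carrier (msections F U) \<rightarrow> carrier (msections G U)
        \<and> (\<forall>s\<in>carrier (msections F U). \<forall>t\<in>carrier (msections F U).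
             \<phi> U (s \<oplus>\<^bsub>msections F U\<^esub> t) = \<phi> U s \<oplus>\<^bsub>msections G U\<^esub> \<phi> U t)
        \<and> (\<forall>a\<in>sections X U. \<forall>s\<in>carrier (msections F U).
             \<phi> U (a \<odot>\<^bsub>msections F U\<^esub> s) = a \<odot>\<^bsub>msections G U\<^esub> \<phi> U s))
   \<and> (\<forall>U V. nopen X U \<and> nopen X V \<and> V \<subseteq> U \<longrightarrow>
        (\<forall>s\<in>carrier (msections F U). \<phi> V (mrestrict F U V s) = mrestrict G U V (\<phi> U s)))"

definition structure_sheaf :: "('p, 'a::field) rspace \<Rightarrow> ('p, 'a, 'a) omodule" where
  "structure_sheaf X =
     \<lparr>msections = (\<lambda>U. \<lparr>carrier = sections X U, monoid.mult = (*), one = 1, zero = 0, add = (+),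
                       module.smult = (*)\<rparr>),
      mrestrict = (\<lambda>U V s. s)\<rparr>"

text \<open>\<open>H\<^sup>1\<close> of a coherent sheaf on a separated scheme, as the Cech cohomology of the covering by all
  affine open sets: one-cocycles \<open>c\<close> modulo coboundaries of zero-cochains \<open>s\<close>.  Only the values of \<open>c\<close> and
  \<open>s\<close> at affine open sets are relevant.\<close>

definition cocycles1 ::
    "('p, 'a::field) rspace \<Rightarrow> ('p, 'a, 'm) omodule \<Rightarrow> ('p set \<Rightarrow> 'p set \<Rightarrow> 'm) set" where
  "cocycles1 X F =
     {c. (\<forall>U V. affine_open X U \<and> affine_open X V \<longrightarrow> c U V \<in> carrier (msections F (U \<inter> V)))
       \<and> (\<forall>U V W. affine_open X U \<and> affine_open X V \<and> affine_open X W \<longrightarrow>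
            mrestrict F (U \<inter> V) (U \<inter> V \<inter> W) (c U V)
              \<oplus>\<^bsub>msections F (U \<inter> V \<inter> W)\<^esub> mrestrict F (V \<inter> W) (U \<inter> V \<inter> W) (c V W)
            = mrestrict F (U \<inter> W) (U \<inter> V \<inter> W) (c U W))}"

definition cochains0 ::
    "('p, 'a::field) rspace \<Rightarrow> ('p, 'a, 'm) omodule \<Rightarrow> ('p set \<Rightarrow> 'm) set" where
  "cochains0 X F = {s. \<forall>U. affine_open X U \<longrightarrow> s U \<in> carrier (msections F U)}"

definition coboundary ::
    "('p, 'a, 'm) omodule \<Rightarrow> ('p set \<Rightarrow> 'm) \<Rightarrow> 'p set \<Rightarrow> 'p set \<Rightarrow> 'm" where
  "coboundary F s U V =
     mrestrict F V (U \<inter> V) (s V) \<ominus>\<^bsub>msections F (U \<inter> V)\<^esub> mrestrict F U (U \<inter> V) (s U)"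

text \<open>The classes of \<open>b\<^sub>0, \<dots>, b\<^sub>n\<^sub>-\<^sub>1\<close> form a basis of \<open>H\<^sup>1\<close> over \<open>k\<close>.\<close>

definition H1_dimension ::
    "('p, 'a::field) rspace \<Rightarrow> ('k \<Rightarrow> 'a) \<Rightarrow> ('p, 'a, 'm) omodule \<Rightarrow> nat \<Rightarrow> bool" where
  "H1_dimension X \<iota> F n \<longleftrightarrow>
     (\<exists>b. (\<forall>i<n. b i \<in> cocycles1 X F)
        \<and> (\<forall>c\<in>cocycles1 X F. \<exists>!l. l \<in> {..<n} \<rightarrow>\<^sub>E UNIV
             \<and> (\<exists>s\<in>cochains0 X F. \<forall>U V. affine_open X U \<and> affine_open X V \<longrightarrow>
                  c U V = finsum (msections F (U \<inter> V))
                            (\<lambda>i. \<iota> (l i) \<odot>\<^bsub>msections F (U \<inter> V)\<^esub> b i U V) {..<n}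
                          \<oplus>\<^bsub>msections F (U \<inter> V)\<^esub> coboundary F s U V)))"

text \<open>\<open>p\<^sub>a = 1 - \<chi>(\<O>) = dim H\<^sup>1(\<O>)\<close>, as \<open>H\<^sup>0(\<O>) = k\<close> for a complete integral curve.\<close>

definition arithmetic_genus :: "('p, 'a::field) rspace \<Rightarrow> ('k \<Rightarrow> 'a) \<Rightarrow> nat \<Rightarrow> bool" where
  "arithmetic_genus X \<iota> g \<longleftrightarrow> H1_dimension X \<iota> (structure_sheaf X) g"

definition H1_functional ::
    "('p, 'a::field) rspace \<Rightarrow> ('k::field \<Rightarrow> 'a) \<Rightarrow> ('p, 'a, 'm) omodule
      \<Rightarrow> (('p set \<Rightarrow> 'p set \<Rightarrow> 'm) \<Rightarrow> 'k) \<Rightarrow> bool" where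
  "H1_functional X \<iota> F r \<longleftrightarrow>
     (\<forall>c\<in>cocycles1 X F. \<forall>s\<in>cochains0 X F.
        (\<forall>U V. affine_open X U \<and> affine_open X V \<longrightarrow> c U V = coboundary F s U V) \<longrightarrow> r c = 0)
   \<and> (\<forall>c\<in>cocycles1 X F. \<forall>d\<in>cocycles1 X F. \<forall>e\<in>cocycles1 X F.
        (\<forall>U V. affine_open X U \<and> affine_open X V \<longrightarrow> e U V = c U V \<oplus>\<^bsub>msections F (U \<inter> V)\<^esub> d U V)
        \<longrightarrow> r e = r c + r d)
   \<and> (\<forall>c\<in>cocycles1 X F. \<forall>d\<in>cocycles1 X F. \<forall>a.
        (\<forall>U V. affine_open X U \<and> affine_open X V \<longrightarrow> d U V = \<iota> a \<odot>\<^bsub>msections F (U \<inter> V)\<^esub> c U V)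
        \<longrightarrow> r d = a * r c)"

text \<open>A dualizing sheaf \<open>\<omega>\<close> with trace \<open>t\<close> on \<open>H\<^sup>1(\<omega>)\<close>: for every coherent sheaf \<open>F\<close> the pairing of
  \<open>Hom(F, \<omega>)\<close> with \<open>H\<^sup>1(F)\<close> induces an isomorphism from \<open>Hom(F, \<omega>)\<close> to the dual of \<open>H\<^sup>1(F)\<close>.

  The sections of \<open>F\<close> are taken in the type \<^typ>\<open>'a\<close> of the function field.  This is no restriction on a
  curve over an (infinite) algebraically closed field: there \<open>F(U)\<close> has at most as many elements
  as the function field, so each coherent sheaf is isomorphic to one of this kind.  The module
  structures on the sets of sections are arbitrary; in particular \<open>F\<close> may have torsion.\<close>

definition dualizing ::
    "('p, 'a::field) rspace \<Rightarrow> ('k::field \<Rightarrow> 'a) \<Rightarrow> ('p, 'a, 'w) omodule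
      \<Rightarrow> (('p set \<Rightarrow> 'p set \<Rightarrow> 'w) \<Rightarrow> 'k) \<Rightarrow> bool" where
  "dualizing X \<iota> \<omega> t \<longleftrightarrow> coherent X \<omega> \<and> H1_functional X \<iota> \<omega> t
   \<and> (\<forall>F :: ('p, 'a, 'a) omodule. coherent X F \<longrightarrow>
        (\<forall>r. H1_functional X \<iota> F r \<longrightarrow>
           (\<exists>\<phi>. sheaf_hom X F \<omega> \<phi>
              \<and> (\<forall>c\<in>cocycles1 X F. t (\<lambda>U V. \<phi> (U \<inter> V) (c U V)) = r c)))
      \<and> (\<forall>\<phi> \<psi>. sheaf_hom X F \<omega> \<phi> \<and> sheaf_hom X F \<omega> \<psi>
           \<and> (\<forall>c\<in>cocycles1 X F.
                t (\<lambda>U V. \<phi> (U \<inter> V) (c U V)) = t (\<lambda>U V. \<psi> (U \<inter> V) (c U V)))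
           \<longrightarrow> (\<forall>U. nopen X U \<longrightarrow> (\<forall>s\<in>carrier (msections F U). \<phi> U s = \<psi> U s))))"

definition global_basis ::
    "('p, 'a::field) rspace \<Rightarrow> ('k \<Rightarrow> 'a) \<Rightarrow> ('p, 'a, 'm) omodule \<Rightarrow> (nat \<Rightarrow> 'm) \<Rightarrow> nat \<Rightarrow> bool" where
  "global_basis X \<iota> F h n \<longleftrightarrow>
     (let M = msections F (topspace (points X)) in
        (\<forall>i<n. h i \<in> carrier M)
      \<and> (\<forall>s\<in>carrier M. \<exists>!l. l \<in> {..<n} \<rightarrow>\<^sub>E UNIV
           \<and> s = finsum M (\<lambda>i. \<iota> (l i) \<odot>\<^bsub>M\<^esub> h i) {..<n}))"

section \<open>Pullbacks modulo torsion and the blowup\<close>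

text \<open>An isomorphism \<open>e\<close> of the generic stalk of \<open>F\<close> with the function field.  The kernel of a
  sheaf on an integral scheme into its generic stalk is its torsion, so sheaves obtained from \<open>F\<close>
  by tensor operations or by pullback along birational maps become, modulo torsion, subsheaves of
  the constant sheaf of rational functions.\<close>

definition generic_trivialization ::
    "('p, 'a::field) rspace \<Rightarrow> ('p, 'a, 'm) omodule \<Rightarrow> ('p set \<Rightarrow> 'm \<Rightarrow> 'a) \<Rightarrow> bool" where
  "generic_trivialization X F e \<longleftrightarrow>
     (\<forall>U. nopen X U \<longrightarrow>
        (\<forall>s\<in>carrier (msections F U). \<forall>t\<in>carrier (msections F U).
           e U (s \<oplus>\<^bsub>msections F U\<^esub> t) = e U s + e U t)
      \<and> (\<forall>a\<in>sections X U. \<forall>s\<in>carrier (msections F U). e U (a \<odot>\<^bsub>msections F U\<^esub> s) = a * e U s)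
      \<and> (\<forall>s\<in>carrier (msections F U).
           e U s = 0 \<longleftrightarrow> (\<exists>V. nopen X V \<and> V \<subseteq> U \<and> mrestrict F U V s = \<zero>\<^bsub>msections F V\<^esub>)))
   \<and> (\<forall>U V. nopen X U \<and> nopen X V \<and> V \<subseteq> U \<longrightarrow>
        (\<forall>s\<in>carrier (msections F U). e V (mrestrict F U V s) = e U s))
   \<and> (\<Union>U\<in>{U. nopen X U}. e U ` carrier (msections F U)) = UNIV"

text \<open>The chart \<open>D\<^sub>+(m) = Spec S\<^sub>(\<^sub>m\<^sub>)\<close> of \<open>Proj S\<close>, where \<open>S\<close> has the graded pieces
  \<open>Sym\<^sup>n M / Torsion = M\<^sup>n\<close>.\<close>

definition proj_chart :: "'a::field set \<Rightarrow> 'a set \<Rightarrow> 'a \<Rightarrow> 'a set" where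
  "proj_chart A M m = {a / m ^ n | a n. a \<in> module_power A M n}"

definition blowup ::
    "('p, 'a::field) rspace \<Rightarrow> ('p, 'a, 'w) omodule \<Rightarrow> ('p set \<Rightarrow> 'w \<Rightarrow> 'a) \<Rightarrow> ('a set, 'a) rspace" where
  "blowup X \<omega> e = glue {proj_chart (sections X U) (e U ` carrier (msections \<omega> U)) m | U m.
     affine_open X U \<and> m \<in> e U ` carrier (msections \<omega> U) \<and> m \<noteq> 0}"

definition normalization :: "('p, 'a::field) rspace \<Rightarrow> ('a set, 'a) rspace" where
  "normalization X = glue {integral_closure (sections X U) | U. affine_open X U}"

text \<open>The image in \<open>X\<close> of the point with local ring \<open>R\<close> of a scheme birational over \<open>X\<close>.\<close>

definition center :: "('p, 'a::field) rspace \<Rightarrow> 'a set \<Rightarrow> 'p" where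
  "center X R = (THE x. x \<in> topspace (points X) \<and> stalk X x \<subseteq> R
                   \<and> stalk X x \<inter> nonunits R = nonunits (stalk X x))"

text \<open>The stalk of \<open>\<O>\<^sub>A\<omega> = \<alpha>\<^sup>*\<omega> / Torsion(\<alpha>\<^sup>*\<omega>)\<close> at the point with local ring \<open>R\<close> of \<open>A\<close>, where
  \<open>\<alpha> : A \<rightarrow> X\<close> is birational.\<close>

definition pullback_stalk ::
    "('p, 'a::field) rspace \<Rightarrow> ('p, 'a, 'w) omodule \<Rightarrow> ('p set \<Rightarrow> 'w \<Rightarrow> 'a) \<Rightarrow> 'a set \<Rightarrow> 'a set" where
  "pullback_stalk X \<omega> e R = set_product R
     (\<Union>U\<in>{U. nopen X U \<and> center X R \<in> U}. e U ` carrier (msections \<omega> U))"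

section \<open>The canonical model and the canonical map\<close>

definition homogeneous_prime :: "nat \<Rightarrow> 'k::field mpoly set \<Rightarrow> bool" where
  "homogeneous_prime n P \<longleftrightarrow> primeideal P (ring_on (polynomials UNIV n))
     \<and> (\<forall>F\<in>P. \<forall>d. homogeneous_component d F \<in> P)"

text \<open>The underlying space of \<open>Proj k[x\<^sub>0, \<dots>, x\<^sub>n\<^sub>-\<^sub>1]\<close>, the projective space of dimension \<open>n - 1\<close>.\<close>

definition projective_space :: "nat \<Rightarrow> 'k::field mpoly set topology" where
  "projective_space n = topology_generated_by
     {{P. homogeneous_prime n P
          \<and> (\<exists>i<n. Poly_Mapping.single (Poly_Mapping.single i 1) 1 \<notin> P) \<and> F \<notin> P} | F.
        F \<in> polynomials UNIV n \<and> (\<exists>d. homogeneous_of_degree d F)}"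

text \<open>The map to projective space given by the global sections \<open>h\<^sub>0, \<dots>, h\<^sub>n\<^sub>-\<^sub>1\<close> of \<open>\<omega>\<close>, regarded as sections
  of \<open>\<O>\<^sub>A\<omega>\<close>, at the point with local ring \<open>R\<close> of \<open>A\<close>.  If \<open>h\<^sub>i\<close> generates the stalk at this point, the
  image is the ideal of the forms \<open>F\<close> for which \<open>F(h)/h\<^sub>i\<^sup>d\<close> vanishes there.  With
  \<open>A = \<close>\<^term>\<open>normalization X\<close> this is the map \<open>\<kappa>\<close>-bar, with \<open>A = \<close>\<^term>\<open>blowup X \<omega> e\<close> it is \<open>\<kappa>\<close>-hat.\<close>

definition canonical_map ::
    "('p, 'a::field) rspace \<Rightarrow> ('k::field \<Rightarrow> 'a) \<Rightarrow> ('p, 'a, 'w) omodule \<Rightarrow> ('p set \<Rightarrow> 'w \<Rightarrow> 'a)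
      \<Rightarrow> (nat \<Rightarrow> 'w) \<Rightarrow> nat \<Rightarrow> 'a set \<Rightarrow> 'k mpoly set" where
  "canonical_map X \<iota> \<omega> e h n R =
     (let v = (\<lambda>i. e (topspace (points X)) (h i)) in
        {F \<in> polynomials UNIV n.
           \<exists>i<n. pullback_stalk X \<omega> e R = {a * v i | a. a \<in> R}
             \<and> (\<forall>d. evaluate \<iota> v (homogeneous_component d F) / v i ^ d \<in> nonunits R)})"

text \<open>The image of the normalization in projective space, with the reduced structure.  Its local
  ring at \<open>P\<close> is the image of the local ring of projective space in the function field.\<close>

definition canonical_model_stalk ::
    "('k::field \<Rightarrow> 'a::field) \<Rightarrow> (nat \<Rightarrow> 'a) \<Rightarrow> nat \<Rightarrow> 'k mpoly set \<Rightarrow> 'a set" where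
  "canonical_model_stalk \<iota> v n P =
     {evaluate \<iota> v F / evaluate \<iota> v G | F G d.
        F \<in> polynomials UNIV n \<and> G \<in> polynomials UNIV n
        \<and> homogeneous_of_degree d F \<and> homogeneous_of_degree d G \<and> G \<notin> P}"

definition canonical_model ::
    "('p, 'a::field) rspace \<Rightarrow> ('k::field \<Rightarrow> 'a) \<Rightarrow> ('p, 'a, 'w) omodule \<Rightarrow> ('p set \<Rightarrow> 'w \<Rightarrow> 'a)
      \<Rightarrow> (nat \<Rightarrow> 'w) \<Rightarrow> nat \<Rightarrow> ('k mpoly set, 'a) rspace" where
  "canonical_model X \<iota> \<omega> e h n =
     \<lparr>points = subtopology (projective_space n)
        (canonical_map X \<iota> \<omega> e h n ` topspace (points (normalization X))),
      sections = (\<lambda>V. \<Inter>P\<in>V. canonical_model_stalk \<iota> (\<lambda>i. e (topspace (points X)) (h i)) n P)\<rparr>"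

end

theory Submission
 imports Defs "HOL-Library.Function_Algebras"
begin

text \<open>
 All rings that occur are subrings of the function field K of the curve.  The trivialization turns the
 dualizing sheaf into a sheaf of fractional ideals, with stalks \<open>M\<^sub>P\<close>, and its global sections into a subspace V of K with basis \<open>v\<^sub>0, \<dots>, v\<^bsub>g-1\<^esub>\<close>.  A point of the blowup
 over P is a local ring R that dominates \<open>O\<^sub>P\<close> and in which some \<open>v\<^sub>i\<close> divides all the \<open>v\<^sub>j\<close>; it is a
 localization of \<open>O\<^sub>P[V/v\<^sub>i]\<close>.  The stalk of the canonical model at the image of R is the localization R' of
 \<open>k[V/v\<^sub>i]\<close> at the center of R.  The heart of the theorem is R = R' (\<open>canonical_local\<close>); given this, the
 canonical map is bijective, continuous and open, and it respects sections because these are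
 intersections of stalks.

 The equality comes from Serre duality, stated for principal parts (duality): if an adele s is not the
 sum of a constant and of an adele in the lattices spanned by a finite set S, then there is a z in K with
 \<open>z S \<subseteq> V\<close> for which the trace of z s does not vanish.  First consequences are that V generates the
 dualizing sheaf (\<open>mst_generated\<close>) and that \<open>O\<^sub>P\<close> is the ring of multipliers of \<open>M\<^sub>P\<close> (\<open>endomorphism_stalk\<close>).
 Let R be a closed point of the blowup over P, and let W be the hyperplane of the w in V with \<open>w/v\<^sub>i\<close> in
 the maximal ideal of R.

 Suppose that a z that maps a hyperplane of V into V must be constant.  Then duality for S = W shows
 that W generates the dualizing sheaf outside of P and that \<open>M\<^sub>P = k v\<^sub>i + O\<^sub>P W\<close>.  Hence \<open>W/v\<^sub>i\<close> generates the maximal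
 ideal of R.  If some z in R were not integral over R', then completeness of C would give a local
 ring over C in which \<open>W/v\<^sub>i\<close> and 1/z are not units; it lies over P because W generates elsewhere, and it contains
 z, a contradiction.  So R is finite over R', with the same residue field and with a maximal ideal
 that is generated by that of R', and Nakayama's lemma gives R = R' (\<open>point_without_pencil\<close>).

 Otherwise a nonconstant x maps a hyperplane of V into V, and then \<open>V = f \<langle>1, x, \<dots>, x\<^bsup>g-1\<^esup>\<rangle>\<close> (\<open>pencil_basis\<close>).
 Duality bounds the growth of the lattices spanned by \<open>1, x, \<dots>, x\<^sup>n\<close> by two dimensions in each step, so that
 K has degree at most two over k(x).  If the degree is one, then R' is a valuation ring and equals R
 (\<open>point_rational\<close>).  If it is two, then the bound is sharp in each step, which forces x or 1/x to be
 regular at every point (\<open>no_drop_regular\<close>); so x is a map of degree two to the line, and the curve is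
 hyperelliptic (\<open>double_cover_hyperelliptic\<close>).

 The commutative algebra rests on one finiteness property, FD: the quotients by nonzero principal ideals
 are finite-dimensional over k.  It passes to all larger subrings of K (\<open>krull_akizuki\<close>).
\<close>

section \<open>Subrings, submodules and prime ideals as sets\<close>

text \<open>Subrings, submodules and prime ideals are predicates on sets, because all rings are subrings of one
 field; \<open>subring_iff_subr\<close> and \<open>primeideal_iff\<close> translate.\<close>

definition subr :: "'a::comm_ring_1 set => bool" where
 "subr B \<longleftrightarrow> 1 : B & (ALL x:B. ALL y:B. x - y : B & x * y : B)"

definition submod :: "'a::comm_ring_1 set => 'a set => bool" where
 "submod B N \<longleftrightarrow> 0 : N & (ALL x:N. ALL y:N. x + y : N) & (ALL b:B. ALL x:N. b * x : N)"

definition prime_of :: "'a::comm_ring_1 set => 'a set => bool" where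
 "prime_of B p \<longleftrightarrow> submod B p & p <= B & 1 ~: p & (ALL a:B. ALL b:B. a * b : p --> a : p | b : p)"

lemma subr_1: "subr B ==> 1 : B"
 and subr_diff: "subr B ==> x : B ==> y : B ==> x - y : B"
 and subr_mult: "subr B ==> x : B ==> y : B ==> x * y : B"
 by (auto simp: subr_def)

lemma subr_0: "subr B ==> 0 : B"
 using subr_diff[of B 1 1] subr_1 by fastforce

lemma subr_uminus: "subr B ==> x : B ==> - x : B"
 using subr_diff[of B 0 x] subr_0 by fastforce

lemma subr_add: "subr B ==> x : B ==> y : B ==> x + y : B"
 using subr_diff[of B x "- y"] subr_uminus[of B y] by simp

lemma subr_power: "subr B ==> x : B ==> x ^ n : B"
 by (induction n) (auto simp: subr_1 subr_mult)

lemma subr_sum: "subr B ==> (!!i. i : I ==> f i : B) ==> sum f I : B"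
 by (induction I rule: infinite_finite_induct) (auto simp: subr_0 subr_add)

lemma subr_prod: "subr B ==> (!!i. i : I ==> f i : B) ==> prod f I : B"
 by (induction I rule: infinite_finite_induct) (auto simp: subr_1 subr_mult)

lemmas subr_closed = subr_0 subr_1 subr_add subr_diff subr_mult subr_uminus subr_power

lemma subr_UNIV [simp]: "subr UNIV"
 by (simp add: subr_def)

lemma submod_0: "submod B N ==> 0 : N"
 and submod_add: "submod B N ==> x : N ==> y : N ==> x + y : N"
 and submod_mult: "submod B N ==> b : B ==> x : N ==> b * x : N"
 by (auto simp: submod_def)

lemma submod_mult': "submod B N ==> b : B ==> x : N ==> x * b : N"
 using submod_mult[of B N b x] by (simp add: mult.commute)

lemma submod_uminus: "submod B N ==> subr B ==> x : N ==> - x : N"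
 using submod_mult[of B N "- 1" x] by (simp add: subr_closed)

lemma submod_diff: "submod B N ==> subr B ==> x : N ==> y : N ==> x - y : N"
 using submod_add[of B N x "- y"] submod_uminus[of B N y] by simp

lemma submod_sum: "submod B N ==> (!!i. i : I ==> f i : N) ==> sum f I : N"
 by (induction I rule: infinite_finite_induct) (auto simp: submod_0 submod_add)

lemma submod_mono: "submod B N ==> A <= B ==> submod A N"
 by (auto simp: submod_def)

lemma submod_self: "subr B ==> submod B B"
 by (auto simp: submod_def subr_closed)

lemma submod_subr: "subr B ==> A <= B ==> submod A B"
 by (auto simp: submod_def subr_closed)

lemma submod_Int: "submod B N ==> submod B M ==> submod B (N Int M)"
 by (auto simp: submod_def)

lemma submod_INT: "(!!i. i : I ==> submod B (N i)) ==> submod B (\<Inter>i\<in>I. N i)"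
 by (auto simp: submod_def)

lemma submod_colon: "subr A ==> submod A N ==> submod A {a : A. a * s : N}"
 unfolding submod_def by (auto simp: distrib_right mult.assoc intro: subr_0 subr_add subr_mult)

lemma submod_divide: "submod B N ==> A <= B ==> submod A {w. w / (m :: 'a :: field) : N}"
 unfolding submod_def by (auto simp: add_divide_distrib simp flip: times_divide_eq_right)

lemma submod_times: "submod B N ==> submod B ((*) a ` N)"
 unfolding submod_def
proof (intro conjI ballI)
 assume N: "0 : N & (ALL x:N. ALL y:N. x + y : N) & (ALL b:B. ALL x:N. b * x : N)"
 thus "0 : (*) a ` N" by (auto intro!: image_eqI[of _ _ 0])
 fix x assume "x : (*) a ` N"
 then obtain u where u: "x = a * u" "u : N" by blast
 show "x + y : (*) a ` N" if "y : (*) a ` N" for y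
  using that u N by (auto simp flip: distrib_left)
 show "b * x : (*) a ` N" if "b : B" for b
  using that u N by (auto simp: mult.left_commute)
qed

lemma submod_plus: "submod B N ==> submod B M ==> submod B {x + y | x y. x : N & y : M}"
 unfolding submod_def
proof (intro conjI ballI; elim conjE)
 assume "0 : N" "0 : M"
 thus "0 : {x + y |x y. x : N & y : M}" by force
next
 fix u v assume *: "ALL x:N. ALL y:N. x + y : N" "ALL x:M. ALL y:M. x + y : M"
  and "u : {x + y |x y. x : N & y : M}" "v : {x + y |x y. x : N & y : M}"
 then obtain a b c d where "u = a + b" "v = c + d" "a : N" "b : M" "c : N" "d : M" by blast
 hence "u + v = (a + c) + (b + d) & a + c : N & b + d : M" using * by simp
 thus "u + v : {x + y |x y. x : N & y : M}" by blast
next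
 fix b x assume "b : B" "x : {x + y |x y. x : N & y : M}"
  and "ALL b:B. ALL x:N. b * x : N" "ALL b:B. ALL x:M. b * x : M"
 thus "b * x : {x + y |x y. x : N & y : M}" by (force simp: distrib_left)
qed

lemma submod_principal: "subr B ==> submod B ((*) a ` B)"
 by (simp add: submod_self submod_times)

lemma prime_ofD:
 assumes "prime_of B p"
 shows "submod B p" "p <= B" "1 ~: p" "!!a b. a : B ==> b : B ==> a * b : p ==> a : p | b : p"
 using assms by (auto simp: prime_of_def)

lemma prime_of_power: "prime_of B p ==> subr B ==> a : B ==> a ^ n : p ==> a : p"
proof (induction n)
 case (Suc n)
 thus ?case using prime_ofD(4)[OF Suc.prems(1), of a "a ^ n"] subr_power[of B a n] by auto
qed (auto dest: prime_ofD)

lemma prime_of_prod: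
 "prime_of B p ==> subr B ==> finite I ==> (!!i. i : I ==> f i : B) ==> prod f I : p ==> EX i:I. f i : p"
proof (induction I rule: infinite_finite_induct)
 case (insert j I)
 hence "f j : p | prod f I : p" by (intro prime_ofD(4)[OF insert.prems(1)] subr_prod) auto
 thus ?case using insert by auto
qed (auto dest: prime_ofD)

lemma prime_of_Int:
 assumes "prime_of B p" "subr A" "A <= B"
 shows "prime_of A (A Int p)"
 using assms unfolding prime_of_def submod_def by (auto simp: subr_closed subset_iff)

lemma prime_of_zero: "subr (B :: 'a::idom set) ==> prime_of B {0}"
 by (auto simp: prime_of_def submod_def subr_closed)

lemma carrier_ring_on: "carrier (ring_on B) = B"
 by (simp add: ring_on_def)

lemma ring_on_cring:
 assumes "subr B" shows "cring (ring_on B)"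
proof (rule cringI)
 show "abelian_group (ring_on B)"
 proof (rule abelian_groupI)
  fix x assume "x : carrier (ring_on B)"
  thus "EX y:carrier (ring_on B). y \<oplus>\<^bsub>ring_on B\<^esub> x = \<zero>\<^bsub>ring_on B\<^esub>"
   by (intro bexI[of _ "- x"]) (auto simp: ring_on_def subr_closed assms)
 qed (auto simp: ring_on_def subr_closed assms ac_simps)
 show "comm_monoid (ring_on B)"
  by (rule comm_monoidI) (auto simp: ring_on_def subr_closed assms ac_simps)
qed (auto simp: ring_on_def algebra_simps)

lemma subring_iff_subr: "subring A (ring_on UNIV) \<longleftrightarrow> subr A"
proof
 interpret R: cring "ring_on UNIV" by (rule ring_on_cring) simp
 have neg: "\<ominus>\<^bsub>ring_on UNIV\<^esub> x = - x" for x :: 'a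
  by (rule R.minus_equality) (auto simp: ring_on_def)
 show "subr A" if "subring A (ring_on UNIV)"
  unfolding subr_def
 proof (intro conjI ballI)
  show "1 : A" using subringE(3)[OF that] by (simp add: ring_on_def)
  fix x y assume "x : A" "y : A"
  thus "x * y : A" using subringE(6)[OF that] by (simp add: ring_on_def)
  have "- y : A" using subringE(5)[OF that `y : A`] by (simp add: neg)
  thus "x - y : A" using subringE(7)[OF that `x : A`, of "- y"] by (simp add: ring_on_def)
 qed
 show "subring A (ring_on UNIV)" if "subr A"
  by (rule R.subringI) (use that in \<open>auto simp: neg subr_closed\<close>, auto simp: ring_on_def subr_closed)
qed

lemma primeideal_iff:
 assumes "subr B" shows "primeideal p (ring_on B) \<longleftrightarrow> prime_of B p"
proof
 interpret R: cring "ring_on B" by (rule ring_on_cring) fact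
 assume "primeideal p (ring_on B)"
 then interpret primeideal p "ring_on B" .
 show "prime_of B p" unfolding prime_of_def submod_def
 proof (intro conjI ballI impI)
  show "0 : p" using additive_subgroup.zero_closed[OF is_additive_subgroup] by (simp add: ring_on_def)
  show pB: "p <= B" using a_subset by (simp add: ring_on_def)
  show "1 ~: p" using one_imp_carrier I_notcarr by (auto simp: ring_on_def)
  fix x y assume "x : p" "y : p"
  thus "x + y : p" using additive_subgroup.a_closed[OF is_additive_subgroup] by (simp add: ring_on_def)
 next
  fix b x assume "b : B" "x : p" thus "b * x : p"
   using I_l_closed[of x b] by (simp add: ring_on_def)
 next
  fix a b assume "a : B" "b : B" "a * b : p" thus "a : p | b : p"
   using I_prime[of a b] by (simp add: ring_on_def)
 qed
next
 interpret R: cring "ring_on B" by (rule ring_on_cring) fact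
 assume p: "prime_of B p"
 note pd = prime_ofD[OF p]
 show "primeideal p (ring_on B)"
 proof (rule primeidealI)
  have neg: "\<ominus>\<^bsub>ring_on B\<^esub> x = - x" if "x : B" for x
   by (rule R.minus_equality) (use that assms in \<open>auto simp: ring_on_def subr_closed\<close>)
  have inv: "inv\<^bsub>add_monoid (ring_on B)\<^esub> x = - x" if "x : B" for x
   using neg[OF that] by (simp add: a_inv_def)
  show "ideal p (ring_on B)"
  proof (rule idealI)
   show "subgroup p (add_monoid (ring_on B))"
   proof (rule subgroup.intro)
    show "p <= carrier (add_monoid (ring_on B))" using pd(2) by (simp add: ring_on_def)
    show "\<one>\<^bsub>add_monoid (ring_on B)\<^esub> : p" using submod_0[OF pd(1)] by (simp add: ring_on_def)
    fix x assume x: "x : p"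
    show "inv\<^bsub>add_monoid (ring_on B)\<^esub> x : p"
     using inv[of x] x pd(2) submod_uminus[OF pd(1) assms] by auto
    fix y assume y: "y : p"
    show "x \<otimes>\<^bsub>add_monoid (ring_on B)\<^esub> y : p"
     using submod_add[OF pd(1) x y] by (simp add: ring_on_def)
   qed
  qed (use pd(1) in \<open>auto simp: ring_on_def submod_mult submod_mult' intro: R.ring_axioms\<close>, rule R.ring_axioms[unfolded ring_on_def])
  show "cring (ring_on B)" by (rule ring_on_cring) fact
  show "carrier (ring_on B) ~= p" using pd(3) assms by (auto simp: ring_on_def subr_closed)
 qed (use pd(4) in \<open>auto simp: ring_on_def\<close>)
qed

abbreviation adjoin :: "'a::comm_ring_1 set => 'a set" where "adjoin \<equiv> generated_subring"

lemma adjoin_subr: "subr (adjoin S)"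
proof -
 interpret R: cring "ring_on UNIV" by (rule ring_on_cring) simp
 show ?thesis using R.generate_ring_is_subring[of S] by (simp add: subring_iff_subr carrier_ring_on)
qed

lemma adjoin_incl: "S <= adjoin S"
 by (auto intro: generate_ring.incl)

lemma adjoin_min: "subr B ==> S <= B ==> adjoin S <= B"
proof -
 assume "subr B" "S <= B"
 interpret R: cring "ring_on UNIV" by (rule ring_on_cring) simp
 show ?thesis using R.generate_ring_min_subring1[of S B] `subr B` `S <= B`
  by (auto simp: subring_iff_subr carrier_ring_on)
qed

lemma adjoin_mono: "S <= T ==> adjoin S <= adjoin T"
 by (meson adjoin_incl adjoin_min adjoin_subr order_trans)

lemma submod_Union_chain:
 assumes "subset.chain X C" "C ~= {}" "!!J. J : X ==> submod B J" shows "submod B (\<Union>C)"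
 unfolding submod_def
proof (intro conjI ballI)
 have CB: "submod B J" if "J : C" for J using assms(1,3) that by (auto simp: subset.chain_def)
 show "0 : \<Union>C" using assms(2) CB by (auto simp: submod_def)
 fix x assume "x : \<Union>C"
 then obtain J where J: "J : C" "x : J" by blast
 show "b * x : \<Union>C" if "b : B" for b using submod_mult[OF CB[OF J(1)] that J(2)] J(1) by blast
 fix y assume "y : \<Union>C"
 then obtain K where K: "K : C" "y : K" by blast
 have "J <= K | K <= J" using assms(1) J(1) K(1) by (auto simp: subset.chain_def)
 then obtain L where "L : C" "x : L" "y : L" using J K by blast
 thus "x + y : \<Union>C" using submod_add[OF CB] by blast
qed

text \<open>An ideal that is maximal among those containing I and no power of f is prime.\<close>

lemma prime_avoiding_powers:
 assumes B: "subr B" and I: "submod B I" "I <= B" and f: "f : B" "!!n. f ^ n ~: I"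
 obtains p where "prime_of B p" "I <= p" "f ~: p"
proof -
 define X where "X = {J. submod B J & I <= J & J <= B & (ALL n. f ^ n ~: J)}"
 have "EX M:X. ALL J:X. M <= J --> J = M"
 proof (rule subset_Zorn_nonempty)
  show "X ~= {}" using I f by (auto simp: X_def)
  fix C assume "C ~= {}" and ch: "subset.chain X C"
  hence CX: "C <= X" by (auto simp: subset.chain_def)
  obtain J0 where "J0 : C" using `C ~= {}` by blast
  have "submod B (\<Union>C)" by (rule submod_Union_chain[OF ch `C ~= {}`]) (auto simp: X_def)
  moreover have "I <= J0" using CX `J0 : C` by (auto simp: X_def)
  ultimately show "\<Union>C \<in> X" using CX `J0 : C` unfolding X_def by blast
 qed
 then obtain p where pX: "p : X" and mx: "!!J. J : X ==> p <= J ==> J = p" by blast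
 hence p: "submod B p" "I <= p" "p <= B" "!!n. f ^ n ~: p" by (auto simp: X_def)
 have big: "EX n x r. f ^ n = x + r * a & x : p & r : B" if "a : B" "a ~: p" for a
 proof -
  let ?J = "{x + y | x y. x : p & y : (*) a ` B}"
  have J: "submod B ?J" using p(1) B by (intro submod_plus submod_principal)
  have sub: "p <= ?J" using subr_0[OF B] by force
  have aJ: "a : ?J" using submod_0[OF p(1)] subr_1[OF B] by force
  have "?J <= B" using p(3) that B by (auto simp: subr_closed subset_iff)
  hence "?J : X" if "ALL n. f ^ n ~: ?J" using J sub p(2) that unfolding X_def by blast
  hence "EX n. f ^ n : ?J" using mx[of ?J] sub aJ that by blast
  thus ?thesis by (force simp: mult.commute)
 qed
 have "prime_of B p" unfolding prime_of_def
 proof (intro conjI ballI impI)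
  show "1 ~: p" using p(4)[of 0] by simp
  fix a b assume ab: "a : B" "b : B" "a * b : p"
  show "a : p | b : p"
  proof (rule ccontr)
   assume "~ ?thesis"
   then obtain n x r m y s where eq: "f ^ n = x + r * a" "f ^ m = y + s * b"
    and mem: "x : p" "r : B" "y : p" "s : B" using big ab by metis
   have "f ^ (n + m) = x * (y + s * b) + (r * a) * y + (r * s) * (a * b)"
    by (simp add: power_add eq algebra_simps)
   moreover have "y + s * b : B" "r * a : B" "r * s : B"
    using mem ab p(3) B by (auto intro!: subr_add subr_mult)
   hence "x * (y + s * b) + (r * a) * y + (r * s) * (a * b) : p"
    using submod_mult'[OF p(1), of "y + s * b" x] submod_mult[OF p(1), of "r * a" y]
     submod_mult[OF p(1), of "r * s" "a * b"] mem ab by (simp add: submod_add[OF p(1)])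
   ultimately have "f ^ (n + m) : p" by (simp only:)
   thus False using p(4) by blast
  qed
 qed (use p in auto)
 thus ?thesis using that p(2) p(4)[of 1] by auto
qed

lemma prime_exists:
 assumes "subr B" "submod B I" "I <= B" "1 ~: I"
 obtains p where "prime_of B p" "I <= p"
proof -
 have "1 ^ n ~: I" for n using assms(4) by simp
 with prime_avoiding_powers[OF assms(1-3) subr_1[OF assms(1)]] show ?thesis using that by metis
qed

section \<open>Spans\<close>

text \<open>The set B of coefficients need not be a ring: Nakayama's lemma uses spans over an ideal.\<close>

inductive_set lspan :: "'a::comm_ring_1 set => 'a set => 'a set" for B S where
 lspan_0: "0 : lspan B S"
| lspan_step: "x : lspan B S ==> b : B ==> s : S ==> b * s + x : lspan B S"

lemma lspan_incl: "subr B ==> S <= lspan B S"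
 using lspan_step[OF lspan_0, of 1 B _ S] subr_1 by auto

lemma lspan_one: "subr B ==> lspan B {1} = B"
proof (intro equalityI subsetI)
 fix x assume "subr B" "x : lspan B {1}"
 from this(2,1) show "x : B" by induction (auto intro: subr_0 subr_add)
next
 fix b assume "subr B" "b : B"
 thus "b : lspan B {1}" using lspan_step[OF lspan_0, of b B 1 "{1}"] by simp
qed

lemma lspan_add: "x : lspan B S ==> y : lspan B S ==> x + y : lspan B S"
 by (induction rule: lspan.induct) (auto simp: add.assoc intro: lspan_step)

lemma lspan_mult:
 assumes "subr B" "x : lspan B S" "b : B" shows "b * x : lspan B S"
 using assms(2)
proof (induction rule: lspan.induct)
 case (lspan_step x c s)
 thus ?case using lspan.lspan_step[of "b * x" B S "b * c" s] assms by (simp add: algebra_simps subr_mult)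
qed (simp add: lspan_0)

lemma lspan_submod: "subr B ==> submod B (lspan B S)"
 by (auto simp: submod_def lspan_0 lspan_add lspan_mult)

lemma lspan_min: "submod B N ==> S <= N ==> lspan B S <= N"
proof
 fix x assume "x : lspan B S" "submod B N" "S <= N"
 thus "x : N" by induction (auto simp: submod_def)
qed

lemma lspan_mono: "A <= B ==> S <= T ==> lspan A S <= lspan B T"
proof
 fix x assume *: "A <= B" "S <= T" and "x : lspan A S"
 from this(3) show "x : lspan B T"
  by (induction rule: lspan.induct) (use * in \<open>auto intro!: lspan_0 lspan_step\<close>)
qed

lemma lspan_empty [simp]: "lspan B {} = {0}"
 by (auto elim: lspan.cases intro: lspan_0)

lemma lspan_insert:
 assumes "submod A B" shows "lspan B (insert s S) = {b * s + x | b x. b : B & x : lspan B S}"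
proof
 have "lspan B S <= lspan B (insert s S)" by (rule lspan_mono) auto
 thus "{b * s + x | b x. b : B & x : lspan B S} <= lspan B (insert s S)"
  by (auto intro!: lspan_step)
 show "lspan B (insert s S) <= {b * s + x | b x. b : B & x : lspan B S}"
 proof
  fix x assume "x : lspan B (insert s S)"
  thus "x : {b * s + x | b x. b : B & x : lspan B S}"
  proof induction
   case lspan_0 thus ?case using submod_0[OF assms] lspan.lspan_0 by force
  next
   case (lspan_step x b u)
   then obtain c y where x: "x = c * s + y" "c : B" "y : lspan B S" by blast
   show ?case
   proof (cases "u = s")
    case True
    hence "b * u + x = (b + c) * s + y" using x by (simp add: algebra_simps)
    moreover have "b + c : B" using submod_add[OF assms] lspan_step x by blast
    ultimately show ?thesis using x by blast
   next
    case False
    hence "b * u + x = c * s + (b * u + y)" using x by (simp add: algebra_simps)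
    moreover have "b * u + y : lspan B S"
     by (rule lspan.lspan_step) (use x lspan_step False in auto)
    ultimately show ?thesis using x by blast
   qed
  qed
 qed
qed

lemma lspan_Un:
 assumes "subr B" shows "lspan B (S Un T) = {x + y | x y. x : lspan B S & y : lspan B T}"
proof
 show "lspan B (S Un T) <= {x + y | x y. x : lspan B S & y : lspan B T}"
 proof (rule lspan_min)
  show "submod B {x + y | x y. x : lspan B S & y : lspan B T}"
   by (intro submod_plus lspan_submod assms)
  show "S Un T <= {x + y |x y. x : lspan B S & y : lspan B T}"
   using lspan_incl[OF assms, of S] lspan_incl[OF assms, of T] lspan_0[of B S] lspan_0[of B T] by force
 qed
 show "{x + y | x y. x : lspan B S & y : lspan B T} <= lspan B (S Un T)"
  using lspan_mono[of B B S "S Un T"] lspan_mono[of B B T "S Un T"] by (auto intro!: lspan_add)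
qed

lemma lspan_lspan:
 assumes "subr A" "subr B" "A <= B" shows "lspan B (lspan A S) = lspan B S"
proof
 show "lspan B (lspan A S) <= lspan B S"
  by (rule lspan_min[OF lspan_submod[OF assms(2)]]) (rule lspan_mono, use assms in auto)
 show "lspan B S <= lspan B (lspan A S)" by (rule lspan_mono) (use lspan_incl[OF assms(1)] in auto)
qed

lemma lspan_times: "lspan B ((*) a ` S) = (*) a ` lspan B S"
proof
 show "lspan B ((*) a ` S) <= (*) a ` lspan B S"
 proof
  fix x assume "x : lspan B ((*) a ` S)"
  thus "x : (*) a ` lspan B S"
  proof induction
   case (lspan_step x b s)
   then obtain t y where "s = a * t" "t : S" "x = a * y" "y : lspan B S" by blast
   have "b * t + y : lspan B S" by (rule lspan.lspan_step) fact+
   moreover have "b * s + x = a * (b * t + y)" by (simp add: `s = _` `x = _` algebra_simps)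
   ultimately show ?case by blast
  qed (auto intro: lspan_0 image_eqI[of _ _ 0])
 qed
 have "a * x : lspan B ((*) a ` S)" if "x : lspan B S" for x
  using that
 proof induction
  case (lspan_step x b s)
  hence "b * (a * s) + a * x : lspan B ((*) a ` S)" by (intro lspan.lspan_step) auto
  thus ?case by (simp add: algebra_simps)
 qed (simp add: lspan_0)
 thus "(*) a ` lspan B S <= lspan B ((*) a ` S)" by blast
qed

lemma lspan_sum: "finite I ==> subr B ==> (!!i. i : I ==> b i : B & s i : S) ==> (\<Sum>i\<in>I. b i * s i) : lspan B S"
 by (rule submod_sum[OF lspan_submod]) (use lspan_incl[of B S] in \<open>auto intro!: lspan_mult\<close>)

lemma lspan_image_finite:
 assumes "subr B" "finite I"
 shows "x : lspan B (s ` I) ==> EX b. (ALL i:I. b i : B) & x = (\<Sum>i\<in>I. b i * s i)"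
proof (induction rule: lspan.induct)
 case lspan_0 thus ?case using subr_0[OF assms(1)] by (intro exI[of _ "%_. 0"]) auto
next
 case (lspan_step x c u)
 then obtain b j where b: "ALL i:I. b i : B" "x = (\<Sum>i\<in>I. b i * s i)" and j: "j : I" "u = s j" by blast
 let ?b = "%i. b i + (if i = j then c else 0)"
 have "(\<Sum>i\<in>I. ?b i * s i) = c * u + x"
  using j assms(2) by (simp add: b distrib_right sum.distrib if_distrib[of "%x. x * _"] cong: if_cong)
 moreover have "ALL i:I. ?b i : B" using b lspan_step assms by (auto simp: subr_closed)
 ultimately show ?case by (intro exI[of _ ?b]) simp
qed

lemma set_product_lspan:
 assumes A: "subr A" and N: "submod A N" shows "set_product N M = lspan A {x * y | x y. x : N & y : M}"
proof (intro equalityI subsetI)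
 let ?S = "{x * y | x y. x : N & y : M}"
 { fix z assume "z : set_product N M"
  then obtain n :: nat and x y where "z = (\<Sum>i<n. x i * y i)" "ALL i<n. x i : N & y i : M" unfolding set_product_def by blast
  moreover have "(\<Sum>i<n. x i * y i) : lspan A ?S" if "ALL i<n. x i : N & y i : M" for n
   using that
  proof (induction n)
   case (Suc n)
   hence "x n * y n : ?S" by blast
   from lspan_add[OF subsetD[OF lspan_incl[OF A] this] Suc.IH] have "x n * y n + (\<Sum>i<n. x i * y i) : lspan A ?S" using Suc.prems by simp
   thus ?case by (simp add: add.commute)
  qed (simp add: lspan_0)
  ultimately show "z : lspan A ?S" by blast }
 fix z assume "z : lspan A ?S"
 thus "z : set_product N M"
 proof induction
  case lspan_0
  show ?case unfolding set_product_def by (intro CollectI exI[of _ 0]) simp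
 next
  case (lspan_step z b s)
  then obtain n :: nat and x y where z: "z = (\<Sum>i<n. x i * y i)" "ALL i<n. x i : N & y i : M" unfolding set_product_def by blast
  obtain p q where s: "s = p * q" "p : N" "q : M" using lspan_step by blast
  have "b * s + z = (\<Sum>i<Suc n. (x(n := b * p)) i * (y(n := q)) i)" unfolding z(1) s(1) by (simp add: ac_simps)
  moreover have "ALL i<Suc n. (x(n := b * p)) i : N & (y(n := q)) i : M"
   using z(2) s submod_mult[OF N lspan_step(2)] by (auto simp: less_Suc_eq)
  ultimately show ?case unfolding set_product_def by blast
 qed
qed

lemma set_product_self:
 assumes "subr B" shows "set_product B S = lspan B S"
 unfolding set_product_lspan[OF assms submod_self[OF assms]]
proof
 show "lspan B {x * y | x y. x : B & y : S} <= lspan B S"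
  by (rule lspan_min[OF lspan_submod[OF assms]]) (use lspan_incl[OF assms] in \<open>auto intro: lspan_mult[OF assms]\<close>)
 show "lspan B S <= lspan B {x * y | x y. x : B & y : S}"
  by (rule lspan_mono[OF order_refl], intro subsetI CollectI, rule exI[of _ 1]) (auto simp: subr_1[OF assms])
qed

section \<open>Localization and local rings\<close>

text \<open>The maximal ideal, if the ring is local.\<close>

abbreviation mm :: "'a::field set => 'a set" where "mm \<equiv> nonunits"

definition loc_ring :: "'a::field set => bool" where
 "loc_ring R \<longleftrightarrow> subr R & (ALL x:mm R. ALL y:mm R. x + y : mm R)"

definition dominated :: "'a::field set => 'a set => bool" where
 "dominated R S \<longleftrightarrow> R <= S & mm R = R Int mm S"

lemma loc_ring_subr: "loc_ring R ==> subr R"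
 by (simp add: loc_ring_def)

lemma nonunits_0: "subr R ==> 0 : mm R"
 by (simp add: nonunits_def subr_closed)

lemma nonunits_1: "subr R ==> 1 ~: mm R"
 by (simp add: nonunits_def subr_closed)

lemma unit_inverse: "x : R ==> x ~: mm R ==> x ~= 0 & inverse x : R"
 by (auto simp: nonunits_def)

lemma nonunits_mult:
 assumes "subr R" "x : mm R" "b : R" shows "b * x : mm R"
proof (rule ccontr)
 assume *: "b * x ~: mm R"
 have "b * x : R" using assms by (auto simp: nonunits_def subr_closed)
 with * have "b * x ~= 0" "inverse (b * x) : R" by (auto simp: nonunits_def)
 hence "b * inverse (b * x) : R" "x ~= 0" using assms by (auto intro: subr_mult)
 moreover have "b * inverse (b * x) = inverse x" using `b * x ~= 0` by (simp add: field_simps)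
 ultimately have "x ~= 0" "inverse x : R" by metis+
 thus False using assms by (auto simp: nonunits_def)
qed

lemma nonunits_prime:
 assumes "loc_ring R" shows "prime_of R (mm R)"
 unfolding prime_of_def submod_def
proof (intro conjI ballI impI)
 have R: "subr R" using assms by (rule loc_ring_subr)
 show "0 : mm R" "1 ~: mm R" using R by (auto simp: nonunits_0 nonunits_1)
 show "mm R <= R" by (auto simp: nonunits_def)
 fix a b assume "a : R" "b : R" "a * b : mm R"
 thus "a : mm R | b : mm R"
  using R unfolding nonunits_def by (auto simp: subr_closed)
next
 fix b x assume "b : R" "x : mm R"
 thus "b * x : mm R" using assms nonunits_mult loc_ring_subr by blast
qed (use assms in \<open>auto simp: loc_ring_def\<close>)

lemmas nonunits_submod = prime_ofD(1)[OF nonunits_prime]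

lemma nonunits_sub: "mm R <= R" by (auto simp: nonunits_def)

lemma one_plus_nonunit:
 assumes "loc_ring R" "x : mm R"
 shows "1 + x : R" "1 + x ~: mm R" "1 - x : R" "1 - x ~: mm R"
proof -
 have R: "subr R" using assms by (simp add: loc_ring_subr)
 show "1 + x : R" "1 - x : R" using assms R nonunits_sub by (auto intro!: subr_closed)
 show "1 + x ~: mm R"
  using submod_diff[OF nonunits_submod[OF assms(1)] R, of "1 + x" x] assms nonunits_1[OF R] by auto
 show "1 - x ~: mm R"
  using submod_add[OF nonunits_submod[OF assms(1)], of "1 - x" x] assms nonunits_1[OF R] by auto
qed

lemma loc_ring_UNIV [simp]: "loc_ring UNIV" "mm UNIV = {0}"
 by (auto simp: loc_ring_def nonunits_def)

lemma nonunits_trivial: "subr R ==> mm R = {0} ==> x : R ==> inverse x : R"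
 by (cases "x = 0") (auto simp: nonunits_def subr_0)

lemma localization_iff: "x : localization B p \<longleftrightarrow> (EX a s. x = a / s & a : B & s : B & s ~: p)"
 by (auto simp: localization_def)

context
 fixes B p :: "'a::field set"
 assumes B: "subr B" and p: "prime_of B p"
begin

lemma loc_den: "s : B ==> s ~: p ==> s ~= 0"
 using submod_0[OF prime_ofD(1)[OF p]] by auto

lemma loc_den_mult: "s : B ==> s ~: p ==> t : B ==> t ~: p ==> s * t ~: p"
 using prime_ofD(4)[OF p] by blast

lemma localization_incl: "B <= localization B p"
 using subr_1[OF B] prime_ofD(3)[OF p] by (force simp: localization_iff)

lemma localization_subr: "subr (localization B p)"
 unfolding subr_def
proof (intro conjI ballI)
 show "1 : localization B p" using localization_incl subr_1[OF B] by blast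
 fix x y assume "x : localization B p" "y : localization B p"
 then obtain a s b t where *: "x = a / s" "y = b / t" "a : B" "s : B" "s ~: p" "b : B" "t : B" "t ~: p"
  by (auto simp: localization_iff)
 hence "x - y = (a * t - b * s) / (s * t)" "x * y = (a * b) / (s * t)"
  using loc_den by (auto simp: field_simps)
 thus "x - y : localization B p" "x * y : localization B p"
  using * loc_den_mult B unfolding localization_iff by (metis subr_diff subr_mult)+
qed

lemma localization_denominator:
 "finite C ==> C <= localization B p ==> EX s:B. s ~: p & (ALL c:C. s * c : B)"
proof (induction C rule: finite_induct)
 case empty
 thus ?case using subr_1[OF B] prime_ofD(3)[OF p] by blast
next
 case (insert c C)
 then obtain s where s: "s : B" "s ~: p" "ALL c:C. s * c : B" by blast
 obtain a t where at: "c = a / t" "a : B" "t : B" "t ~: p" using insert.prems localization_iff[of c B p] by auto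
 have "s * t * c = s * a" using at loc_den by simp
 hence "s * t * c : B" using subr_mult[OF B s(1) at(2)] by (simp only:)
 moreover have "s * t * d : B" if "d : C" for d
  using subr_mult[OF B at(3) s(3)[rule_format, OF that]] by (simp add: ac_simps)
 ultimately show ?case using s at loc_den_mult subr_mult[OF B] by (intro bexI[of _ "s * t"]) auto
qed

lemma localization_nonunits: "mm (localization B p) = {a / s | a s. a : p & s : B & s ~: p}"
proof (intro equalityI subsetI)
 have pB: "p <= B" using prime_ofD[OF p] by blast
 fix x assume x: "x : mm (localization B p)"
 then obtain a s where *: "x = a / s" "a : B" "s : B" "s ~: p" by (auto simp: nonunits_def localization_iff)
 have "a : p"
 proof (rule ccontr)
  assume "a ~: p"
  hence "inverse x : localization B p" "x ~= 0" using * loc_den by (auto simp: localization_iff)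
  thus False using x by (auto simp: nonunits_def)
 qed
 thus "x : {a / s | a s. a : p & s : B & s ~: p}" using * by blast
next
 have pB: "p <= B" using prime_ofD[OF p] by blast
 fix x assume "x : {a / s | a s. a : p & s : B & s ~: p}"
 then obtain a s where *: "x = a / s" "a : p" "s : B" "s ~: p" by blast
 have "x = 0" if inv: "inverse x : localization B p"
 proof (rule ccontr)
  assume "x ~= 0"
  obtain b t where bt: "inverse x = b / t" "b : B" "t : B" "t ~: p" using inv unfolding localization_iff by blast
  have "s * t = b * a" using bt(1) * `x ~= 0` loc_den[OF bt(3,4)] loc_den[OF *(3,4)]
   by (auto simp: field_simps)
  hence "s * t : p" using bt * submod_mult[OF prime_ofD(1)[OF p]] by auto
  thus False using loc_den_mult bt * by blast
 qed
 moreover have "x : localization B p" using * pB unfolding localization_iff by blast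
 ultimately show "x : mm (localization B p)" by (auto simp: nonunits_def)
qed

lemma localization_loc_ring: "loc_ring (localization B p)"
 unfolding loc_ring_def
proof (intro conjI ballI localization_subr)
 fix x y assume "x : mm (localization B p)" "y : mm (localization B p)"
 then obtain a s b t where *: "x = a / s" "y = b / t" "a : p" "s : B" "s ~: p" "b : p" "t : B" "t ~: p"
  by (auto simp: localization_nonunits)
 hence "x + y = (t * a + s * b) / (s * t)" using loc_den by (auto simp: field_simps)
 moreover have "t * a + s * b : p" using * prime_ofD(1)[OF p] by (auto intro!: submod_add submod_mult)
 ultimately show "x + y : mm (localization B p)"
  unfolding localization_nonunits using * loc_den_mult subr_mult[OF B] by blast
qed

lemma localization_contract: "B Int mm (localization B p) = p"
proof (intro equalityI subsetI)
 fix x assume "x : B Int mm (localization B p)"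
 then obtain a s where *: "x = a / s" "a : p" "s : B" "s ~: p" "x : B" unfolding localization_nonunits by auto
 hence "s * x : p" using loc_den by auto
 thus "x : p" using prime_ofD(4)[OF p] * by blast
next
 fix x assume "x : p"
 moreover have "x : B" "x = x / 1" using `x : p` prime_ofD(2)[OF p] by auto
 ultimately show "x : B Int mm (localization B p)"
  unfolding localization_nonunits using prime_ofD(3)[OF p] subr_1[OF B] by blast
qed

end

abbreviation local_at :: "'a::field set => 'a set => 'a set" where
 "local_at B R \<equiv> localization B (B Int mm R)"

lemma center_prime:
 assumes "loc_ring R" "subr B" "B <= R" shows "prime_of B (B Int mm R)"
 using prime_of_Int[OF nonunits_prime] assms by blast

lemma localization_center:
 assumes R: "loc_ring R" and B: "subr B" "B <= R"
 shows "local_at B R <= R" "dominated (local_at B R) R"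
proof -
 let ?p = "B Int mm R"
 have p: "prime_of B ?p" by (rule center_prime) fact+
 have Rs: "subr R" using R by (rule loc_ring_subr)
 have inv: "inverse s : R" if "s : B" "s ~: ?p" for s using that B by (auto simp: nonunits_def)
 show sub: "localization B ?p <= R"
 proof
  fix x assume "x : localization B ?p"
  then obtain a s where x: "x = a / s" "a : B" "s : B" "s ~: ?p" by (auto simp only: localization_iff)
  hence "a * inverse s : R" using inv[OF x(3,4)] B by (intro subr_mult[OF Rs]) auto
  thus "x : R" using x by (simp add: divide_inverse)
 qed
 show "dominated (localization B ?p) R" unfolding dominated_def
 proof (intro conjI sub equalityI subsetI)
  fix x assume x: "x : mm (localization B ?p)"
  then obtain a s where "x = a / s" "a : ?p" "s : B" "s ~: ?p"
   unfolding localization_nonunits[OF B(1) p] by blast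
  hence "x : mm R" using nonunits_mult[OF Rs, of a "inverse s"] inv
   by (auto simp: divide_inverse mult.commute)
  thus "x : localization B ?p Int mm R" using x by (auto simp: nonunits_def)
 next
  fix x assume "x : localization B ?p Int mm R"
  thus "x : mm (localization B ?p)" using sub by (auto simp: nonunits_def)
 qed
qed

lemma localization_min:
 assumes "loc_ring R" "subr B" "dominated R' R" "B <= R'" "loc_ring R'" "B Int mm R = p"
 shows "localization B p <= R'"
proof -
 have "p = B Int mm R'" using assms by (auto simp: dominated_def)
 thus ?thesis using localization_center(1)[OF assms(5,2,4)] by simp
qed

lemma dominated_trans: "dominated R S ==> dominated S T ==> dominated R T"
 by (auto simp: dominated_def)

lemma dominated_refl: "dominated R R"
 by (auto simp: dominated_def nonunits_def)

lemma dominated_sub: "dominated R S ==> R <= S"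
 by (simp add: dominated_def)

lemma dominated_unit: "dominated R S ==> x : R ==> x ~: mm S ==> inverse x : R"
 by (auto simp: dominated_def nonunits_def)

section \<open>Algebras over an algebraically closed field\<close>

locale field_over =
 fixes \<iota> :: "'k::alg_closed_field => 'a::field"
 assumes \<iota>_add: "\<iota> (a + b) = \<iota> a + \<iota> b" and \<iota>_mult: "\<iota> (a * b) = \<iota> a * \<iota> b" and \<iota>_1: "\<iota> 1 = 1"
begin

abbreviation kk :: "'a set" where "kk \<equiv> range \<iota>"

lemma \<iota>_0: "\<iota> 0 = 0"
proof -
 have "\<iota> 0 + 0 = \<iota> 0 + \<iota> 0" using \<iota>_add[of 0 0] by simp
 thus ?thesis by (simp only: add_left_cancel)
qed

lemma \<iota>_uminus: "\<iota> (- a) = - \<iota> a"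
 using \<iota>_add[of a "- a"] by (simp add: \<iota>_0 add_eq_0_iff2)

lemma \<iota>_diff: "\<iota> (a - b) = \<iota> a - \<iota> b"
 using \<iota>_add[of a "- b"] by (simp add: \<iota>_uminus)

lemma \<iota>_inverse: "a ~= 0 ==> \<iota> (inverse a) * \<iota> a = 1"
 by (simp flip: \<iota>_mult add: \<iota>_1)

lemma \<iota>_eq_0 [simp]: "\<iota> a = 0 \<longleftrightarrow> a = 0"
 using \<iota>_inverse[of a] \<iota>_0 by (cases "a = 0") auto

lemma \<iota>_eq [simp]: "\<iota> a = \<iota> b \<longleftrightarrow> a = b"
 using \<iota>_eq_0[of "a - b"] unfolding \<iota>_diff by simp

lemma \<iota>_sum: "\<iota> (sum f I) = (\<Sum>i\<in>I. \<iota> (f i))"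
 by (induction I rule: infinite_finite_induct) (auto simp: \<iota>_0 \<iota>_add)

lemma subr_kk: "subr kk"
 unfolding subr_def by (metis \<iota>_1 \<iota>_diff \<iota>_mult rangeE rangeI)

definition evp :: "'k poly => 'a => 'a" where "evp P x = poly (map_poly \<iota> P) x"

lemma evp_0 [simp]: "evp 0 x = 0" by (simp add: evp_def)

lemma evp_pCons [simp]: "evp (pCons a P) x = \<iota> a + x * evp P x"
 by (cases "a = 0 & P = 0") (auto simp: evp_def map_poly_pCons \<iota>_0)

lemma evp_add [simp]: "evp (P + Q) x = evp P x + evp Q x"
proof (induction P Q rule: poly_induct2)
 case (pCons a p b q) thus ?case by (simp add: \<iota>_add algebra_simps)
qed simp

lemma evp_smult [simp]: "evp (smult a P) x = \<iota> a * evp P x"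
 by (induction P) (auto simp: \<iota>_mult algebra_simps)

lemma evp_mult [simp]: "evp (P * Q) x = evp P x * evp Q x"
 by (induction P) (auto simp: \<iota>_0 algebra_simps)

lemma evp_1 [simp]: "evp 1 x = 1"
 by (simp add: one_pCons \<iota>_1)

lemma evp_monom [simp]: "evp (monom a n) x = \<iota> a * x ^ n"
 by (induction n) (auto simp: monom_Suc \<iota>_0 algebra_simps monom_0)

lemma evp_sum [simp]: "evp (sum f I) x = (\<Sum>i\<in>I. evp (f i) x)"
 by (induction I rule: infinite_finite_induct) auto

lemma evp_mem: "subr B ==> kk <= B ==> x : B ==> evp P x : B"
 by (induction P) (auto intro!: subr_add subr_mult simp: subr_0)

lemma root_mod_prime:
 assumes "subr B" "kk <= B" "prime_of B p" "x : B"
 shows "P ~= 0 ==> evp P x : p ==> EX a. x - \<iota> a : p"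
proof (induction "degree P" arbitrary: P)
 case 0
 then obtain c where P: "P = [:c:]" "c ~= 0" by (metis degree_eq_zeroE pCons_0_0)
 hence "\<iota> (inverse c) * \<iota> c : p" using 0 assms by (auto intro!: submod_mult dest: prime_ofD)
 thus ?case using P prime_ofD(3)[OF assms(3)] by (simp add: \<iota>_inverse)
next
 case (Suc n)
 then obtain a where "poly P a = 0" using alg_closed_imp_poly_has_root[of P] by auto
 then obtain Q where Q: "P = [:-a, 1:] * Q" by (auto simp: poly_eq_0_iff_dvd)
 hence "Q ~= 0" using Suc by auto
 have dQ: "degree P = Suc (degree Q)" unfolding Q by (subst degree_mult_eq) (use `Q ~= 0` in auto)
 have "evp P x = (x - \<iota> a) * evp Q x" unfolding Q evp_mult by (simp add: \<iota>_uminus \<iota>_1)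
 hence "(x - \<iota> a) * evp Q x : p" using Suc by simp
 moreover have "x - \<iota> a : B" "evp Q x : B" using assms evp_mem by (auto intro!: subr_diff)
 ultimately consider "x - \<iota> a : p" | "evp Q x : p" using prime_ofD(4)[OF assms(3)] by blast
 thus ?case using Suc(1)[of Q] Suc(2) dQ `Q ~= 0` by cases auto
qed

lemma root_in_kk: "P ~= 0 ==> evp P x = 0 ==> x : kk"
 using root_mod_prime[of UNIV "{0}" x P] prime_of_zero[of UNIV] by auto

lemma sum_powers_evp: "(\<Sum>i\<in>I. \<iota> (c i) * x ^ i) = evp (\<Sum>i\<in>I. monom (c i) i) x"
 by simp

lemma sum_monom_nz: "finite I ==> i : I ==> c i ~= (0::'k) ==> (\<Sum>i\<in>I. monom (c i) i) ~= 0"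
proof
 assume "finite I" "i : I" "c i ~= 0" "(\<Sum>i\<in>I. monom (c i) i) = 0"
 hence "coeff (\<Sum>i\<in>I. monom (c i) i) i = 0" by simp
 thus False using `finite I` `i : I` `c i ~= 0` by (simp add: coeff_sum)
qed

subsection \<open>Linear dependence modulo a subspace\<close>

text \<open>Dimensions of quotients are counted through dependent families, without quotient
 spaces.\<close>

definition dep :: "'a set => 'i set => ('i => 'a) => bool" where
 "dep I X w \<longleftrightarrow> (EX c. (EX i:X. c i ~= 0) & (\<Sum>i\<in>X. \<iota> (c i) * w i) : I)"

lemma submod_kk_sum: "submod kk I ==> (!!i. i : X ==> w i : I) ==> (\<Sum>i\<in>X. \<iota> (c i) * w i) : I"
 by (rule submod_sum) (auto intro: submod_mult)

lemma dep_mono: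
 assumes "dep I X w" "X <= Y" "finite Y" "I <= J" shows "dep J Y w"
proof -
 obtain c where c: "EX i:X. c i ~= 0" "(\<Sum>i\<in>X. \<iota> (c i) * w i) : I" using assms by (auto simp: dep_def)
 have "(\<Sum>i\<in>Y. \<iota> (if i : X then c i else 0) * w i) = (\<Sum>i\<in>X. \<iota> (c i) * w i)"
  using assms by (intro sum.mono_neutral_cong_right) (auto simp: \<iota>_0)
 thus ?thesis unfolding dep_def using c assms by (intro exI[of _ "%i. if i : X then c i else 0"]) auto
qed

text \<open>The exchange lemma of Steinitz in the quotient by I.\<close>

lemma steinitz:
 assumes I: "submod kk I" and fE: "finite E"
 shows "finite X ==> card E < card X ==> (!!i. i : X ==> EX x:lspan kk E. w i - x : I) ==> dep I X w"
 using fE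
proof (induction E arbitrary: X w rule: finite_induct)
 case empty
 then obtain j where j: "j : X" by (metis card.empty ex_in_conv less_irrefl)
 have "(\<Sum>i\<in>X. \<iota> (if i = j then 1 else 0) * w i) = w j"
  using j empty by (simp add: if_distrib[of \<iota>] if_distrib[of "%x. x * _"] \<iota>_0 \<iota>_1 cong: if_cong)
 moreover have "w j : I" using empty(3)[OF j] by simp
 ultimately show ?case unfolding dep_def using j by (intro exI[of _ "%i. if i = j then 1 else 0"]) auto
next
 case (insert e E)
 have "ALL i:X. EX a y. y : lspan kk E & w i - (\<iota> a * e + y) : I"
  using insert.prems(3) unfolding lspan_insert[OF submod_self[OF subr_kk]] by blast
 then obtain a y where ay: "!!i. i : X ==> y i : lspan kk E & w i - (\<iota> (a i) * e + y i) : I" by metis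
 show ?case
 proof (cases "EX j:X. a j ~= 0")
  case False
  have "dep I X w"
  proof (rule insert.IH)
   show "card E < card X" using insert by simp
   show "EX x:lspan kk E. w i - x : I" if "i : X" for i
    using ay[OF that] False that by (auto simp: \<iota>_0)
  qed fact
  thus ?thesis .
 next
  case True
  then obtain j where j: "j : X" "a j ~= 0" by blast
  define v where "v i = w i - \<iota> (a i / a j) * w j" for i
  have "dep I (X - {j}) v"
  proof (rule insert.IH)
   show "finite (X - {j})" using insert by simp
   show "card E < card (X - {j})" using insert j by simp
   fix i assume i: "i : X - {j}"
   let ?r = "\<iota> (a i / a j)"
   have r: "?r * \<iota> (a j) = \<iota> (a i)" using j by (simp flip: \<iota>_mult)
   have "v i - (y i - ?r * y j) = (w i - (\<iota> (a i) * e + y i)) - ?r * (w j - (\<iota> (a j) * e + y j))"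
    unfolding v_def r[symmetric] by (simp add: algebra_simps)
   moreover have "\<dots> : I" using ay[of i] ay[of j] i j
    by (intro submod_diff[OF I subr_kk, of "w i - (\<iota> (a i) * e + y i)"] submod_mult[OF I]) blast+
   moreover have "y i - ?r * y j : lspan kk E"
    using ay i j lspan_submod[OF subr_kk] by (intro submod_diff[OF _ subr_kk] submod_mult) auto
   ultimately show "EX x:lspan kk E. v i - x : I" by metis
  qed
  then obtain c where c: "EX i:X-{j}. c i ~= 0" "(\<Sum>i\<in>X-{j}. \<iota> (c i) * v i) : I" by (auto simp: dep_def)
  define d where "d i = (if i = j then - (\<Sum>l\<in>X-{j}. c l * (a l / a j)) else c i)" for i
  have "(\<Sum>i\<in>X. \<iota> (d i) * w i) = \<iota> (d j) * w j + (\<Sum>i\<in>X-{j}. \<iota> (c i) * w i)"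
   using insert j by (subst sum.remove[of _ j]) (auto simp: d_def)
  also have "\<dots> = (\<Sum>i\<in>X-{j}. \<iota> (c i) * v i)"
   by (simp add: d_def v_def \<iota>_uminus \<iota>_sum right_diff_distrib sum_subtractf sum_distrib_right flip: \<iota>_mult mult.assoc)
  finally show ?thesis unfolding dep_def using c by (intro exI[of _ d]) (auto simp: d_def)
 qed
qed

text \<open>The quotient of A by I has dimension less than n.\<close>

definition fcn :: "nat => 'a set => 'a set => bool" where
 "fcn n A I \<longleftrightarrow> (ALL w. (ALL i<n. w i : A) --> dep I {..<n} w)"

definition fc :: "'a set => 'a set => bool" where "fc A I \<longleftrightarrow> (EX n. fcn n A I)"

lemma fcnD: "fcn n A I ==> (!!i. i < n ==> w i : A) ==> dep I {..<n} w"
 by (simp add: fcn_def)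

lemma fcn_family:
 assumes "fcn n A I" "finite X" "card X >= n" "!!i. i : X ==> w i : A"
 shows "dep I X w"
proof -
 obtain Y where Y: "Y <= X" "card Y = n" "finite Y" using obtain_subset_with_card_n[OF assms(3)] by metis
 obtain f where f: "bij_betw f {..<n} Y" using ex_bij_betw_nat_finite[OF Y(3)] Y(2) atLeast0LessThan by metis
 have "dep I {..<n} (w \<circ> f)" by (rule fcnD[OF assms(1)]) (use assms(4) Y f in \<open>auto simp: bij_betw_def\<close>)
 then obtain c where c: "EX i<n. c i ~= 0" "(\<Sum>i<n. \<iota> (c i) * w (f i)) : I" by (auto simp: dep_def)
 define d where "d y = c (the_inv_into {..<n} f y)" for y
 have df: "d (f i) = c i" if "i < n" for i using that f by (simp add: d_def the_inv_into_f_f bij_betw_def)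
 have "(\<Sum>y\<in>Y. \<iota> (d y) * w y) = (\<Sum>i<n. \<iota> (d (f i)) * w (f i))"
  by (rule sum.reindex_bij_betw[OF f, symmetric])
 also have "\<dots> = (\<Sum>i<n. \<iota> (c i) * w (f i))" using df by simp
 finally have "dep I Y w" unfolding dep_def using c df f
  by (intro exI[of _ d]) (auto simp: bij_betw_def)
 thus ?thesis using dep_mono Y assms(2) by blast
qed

lemma fcnI_span:
 assumes "submod kk I" "finite E" "card E < n" "!!a. a : A ==> EX x:lspan kk E. a - x : I"
 shows "fcn n A I"
 unfolding fcn_def using assms by (auto intro!: steinitz[OF assms(1,2)])

lemma fcI_span:
 assumes "submod kk I" "finite E" "!!a. a : A ==> EX x:lspan kk E. a - x : I"
 shows "fc A I"
 unfolding fc_def using fcnI_span[OF assms(1,2) _ assms(3), of "Suc (card E)"] by auto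

text \<open>A maximal independent family spans.\<close>

lemma fcn_basis:
 assumes "submod kk I" "fcn n A I"
 obtains m and w :: "nat => 'a" where "m < n" "ALL i<m. w i : A" "~ dep I {..<m} w"
  "!!a. a : A ==> EX x:lspan kk (w ` {..<m}). a - x : I"
proof -
 define P where "P m \<longleftrightarrow> (EX w::nat=>'a. (ALL i<m. w i : A) & ~ dep I {..<m} w)" for m
 have P0: "P 0" by (auto simp: P_def dep_def)
 have bd: "m < n" if "P m" for m
 proof (rule ccontr)
  assume "~ m < n"
  thus False using that fcn_family[OF assms(2), of "{..<m}"] by (auto simp: P_def)
 qed
 define m where "m = (GREATEST m. P m)"
 have Pm: "P m" unfolding m_def by (rule GreatestI_nat[where P = P and k = 0 and b = n]) (use bd P0 in force)+
 have mx: "l <= m" if "P l" for l unfolding m_def by (rule Greatest_le_nat[where P = P and k = l and b = n]) (use bd that in force)+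
 obtain w :: "nat => 'a" where w: "ALL i<m. w i : A" "~ dep I {..<m} w" using Pm by (auto simp: P_def)
 have "EX x:lspan kk (w ` {..<m}). a - x : I" if a: "a : A" for a
 proof -
  have "~ P (Suc m)" using mx[of "Suc m"] by auto
  moreover have "ALL i<Suc m. (w(m := a)) i : A" using w a by (auto simp: less_Suc_eq)
  ultimately have "dep I {..<Suc m} (w(m := a))" unfolding P_def by blast
  then obtain c where c: "EX i<Suc m. c i ~= 0" "(\<Sum>i<Suc m. \<iota> (c i) * (w(m := a)) i) : I" by (auto simp: dep_def)
  have s: "(\<Sum>i<m. \<iota> (c i) * w i) + \<iota> (c m) * a : I" using c(2) by simp
  have cm: "c m ~= 0"
  proof
   assume "c m = 0"
   hence "dep I {..<m} w" using c s unfolding dep_def by (intro exI[of _ c]) (auto simp: \<iota>_0 less_Suc_eq)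
   thus False using w by simp
  qed
  define x where "x = (\<Sum>i<m. \<iota> (- c i / c m) * w i)"
  have e: "\<iota> (- c i / c m) = - (\<iota> (inverse (c m)) * \<iota> (c i))" for i
   by (simp add: divide_inverse mult.commute flip: \<iota>_mult \<iota>_uminus)
  have "a - x = \<iota> (inverse (c m)) * ((\<Sum>i<m. \<iota> (c i) * w i) + \<iota> (c m) * a)"
   using \<iota>_inverse[OF cm] unfolding x_def e
   by (simp add: sum_negf sum_distrib_left distrib_left mult.assoc flip: mult.assoc[of _ "\<iota> (c m)"])
  hence "a - x : I" using submod_mult[OF assms(1) _ s] by simp
  moreover have "x : lspan kk (w ` {..<m})" unfolding x_def by (rule lspan_sum) (auto simp: subr_kk)
  ultimately show ?thesis by blast
 qed
 thus ?thesis using that bd[OF Pm] w by blast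
qed

lemma fc_span:
 assumes "submod kk I" "fc A I"
 obtains E where "finite E" "E <= A" "!!a. a : A ==> EX x:lspan kk E. a - x : I"
proof -
 obtain n where "fcn n A I" using assms by (auto simp: fc_def)
 from fcn_basis[OF assms(1) this] obtain m and w :: "nat => 'a" where
  "ALL i<m. w i : A" "!!a. a : A ==> EX x:lspan kk (w ` {..<m}). a - x : I" by metis
 thus ?thesis by (intro that[of "w ` {..<m}"]) auto
qed

lemma fc_mono: "fc A I ==> A' <= A ==> I <= I' ==> fc A' I'"
 unfolding fc_def fcn_def using dep_mono[of I "{..<_}" _ "{..<_}" I'] by (meson finite_lessThan order_refl subset_iff)

text \<open>Dimensions add along \<open>A \<supseteq> A \<inter> J \<supseteq> I\<close>; the successors are there because fcn bounds strictly.\<close>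

lemma fcn_trans:
 assumes A: "submod kk A" and J: "submod kk J" and I: "submod kk I" and f: "fcn (Suc a) A J" "fcn (Suc b) (A Int J) I"
 shows "fcn (Suc (a + b)) A I"
proof -
 obtain m and w :: "nat => 'a" where w: "m < Suc a" "ALL i<m. w i : A" "!!x. x : A ==> EX y:lspan kk (w ` {..<m}). x - y : J"
  by (rule fcn_basis[OF J f(1)]) blast
 obtain l and u :: "nat => 'a" where u: "l < Suc b" "!!x. x : A Int J ==> EX y:lspan kk (u ` {..<l}). x - y : I"
  by (rule fcn_basis[OF I f(2)]) blast
 show ?thesis
 proof (rule fcnI_span[OF I])
  show "finite (w ` {..<m} Un u ` {..<l})" by simp
  have "card (w ` {..<m}) <= m" "card (u ` {..<l}) <= l" using card_image_le[of "{..<_::nat}"] by (metis card_lessThan finite_lessThan)+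
  thus "card (w ` {..<m} Un u ` {..<l}) < Suc (a + b)" using card_Un_le[of "w ` {..<m}" "u ` {..<l}"] w(1) u(1) by linarith
  fix x assume x: "x : A"
  obtain y where y: "y : lspan kk (w ` {..<m})" "x - y : J" using w(3)[OF x] by blast
  have "w ` {..<m} <= A" using w(2) by auto
  hence "x - y : A" using lspan_min[OF A] y(1) submod_diff[OF A subr_kk x] by blast
  then obtain z where "z : lspan kk (u ` {..<l})" "x - y - z : I" using u(2) y(2) by blast
  thus "EX z:lspan kk (w ` {..<m} Un u ` {..<l}). x - z : I"
   using y(1) unfolding lspan_Un[OF subr_kk] by (auto simp: diff_diff_eq intro!: bexI[of _ "y + z"])
 qed
qed

lemma fc_trans:
 assumes "submod kk A" "submod kk J" "submod kk I" "fc A J" "fc (A Int J) I" shows "fc A I"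
proof -
 have "fcn n A' I' ==> fcn (Suc n) A' I'" for n A' I'
  unfolding fcn_def using dep_mono[of I' "{..<n}" _ "{..<Suc n}" I'] by auto
 thus ?thesis using fcn_trans[OF assms(1-3)] assms(4,5) unfolding fc_def by blast
qed

lemma fc_Int:
 assumes "submod kk A" "submod kk I" "submod kk J" "fc A I" "fc A J" shows "fc A (I Int J)"
proof (rule fc_trans[OF assms(1,2)])
 show "submod kk (I Int J)" using assms by (simp add: submod_Int)
 have "fc (A Int I) J" using fc_mono[OF assms(5)] by blast
 then obtain n where n: "fcn n (A Int I) J" by (auto simp: fc_def)
 have "fcn n (A Int I) (I Int J)" unfolding fcn_def
 proof (intro allI impI)
  fix w assume w: "ALL i<n. w i : A Int I"
  then obtain c where c: "EX i<n. c i ~= 0" "(\<Sum>i<n. \<iota> (c i) * w i) : J" using n unfolding fcn_def dep_def by blast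
  have "(\<Sum>i<n. \<iota> (c i) * w i) : I" using w by (intro submod_kk_sum assms) auto
  thus "dep (I Int J) {..<n} w" using c unfolding dep_def by (intro exI[of _ c]) auto
 qed
 thus "fc (A Int I) (I Int J)" by (auto simp: fc_def)
qed (use assms in auto)

text \<open>In a dependence relation the term of lowest index can be isolated.\<close>

lemma dep_lowest:
 fixes n :: nat
 assumes "submod kk I" "dep I {..<n} w"
 obtains m c where "m < n" "w m + (\<Sum>i\<in>{m<..<n}. \<iota> (c i) * w i) : I"
proof -
 obtain c where c: "EX i<n. c i ~= 0" "(\<Sum>i<n. \<iota> (c i) * w i) : I" using assms(2) by (auto simp: dep_def)
 define m where "m = (LEAST i. i < n & c i ~= 0)"
 have m: "m < n" "c m ~= 0" using LeastI_ex[of "%i. i < n & c i ~= 0"] c(1) by (auto simp: m_def)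
 have least: "c i = 0" if "i < m" for i using not_less_Least[of i "%i. i < n & c i ~= 0"] that m(1) by (auto simp: m_def)
 have "(\<Sum>i<n. \<iota> (c i) * w i) = (\<Sum>i\<in>insert m {m<..<n}. \<iota> (c i) * w i)"
  using m least by (intro sum.mono_neutral_right) (auto simp: \<iota>_0 not_le)
 also have "\<dots> = \<iota> (c m) * w m + (\<Sum>i\<in>{m<..<n}. \<iota> (c i) * w i)" by simp
 finally have "\<iota> (inverse (c m)) * (\<iota> (c m) * w m + (\<Sum>i\<in>{m<..<n}. \<iota> (c i) * w i)) : I"
  using submod_mult[OF assms(1)] c by simp
 moreover have "\<iota> (inverse (c m)) * (\<iota> (c m) * w m + (\<Sum>i\<in>{m<..<n}. \<iota> (c i) * w i))
  = w m + (\<Sum>i\<in>{m<..<n}. \<iota> (inverse (c m) * c i) * w i)"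
  using \<iota>_inverse[OF m(2)] by (simp add: distrib_left sum_distrib_left \<iota>_mult mult.assoc flip: mult.assoc[of _ "\<iota> (c m)"])
 ultimately show ?thesis using that[of m "%i. inverse (c m) * c i"] m by simp
qed

section \<open>Rings with finite-dimensional quotients\<close>

text \<open>For a finitely generated domain over k this says that the dimension is at most one.  It is
 inherited by all larger rings with the same field of fractions, such as local rings and integral closures.\<close>

definition FD :: "'a set => bool" where
 "FD B \<longleftrightarrow> subr B & kk <= B & (ALL b:B. b ~= 0 --> fc B ((*) b ` B))"

lemma FD_subr: "FD B ==> subr B" and FD_kk: "FD B ==> kk <= B"
 by (auto simp: FD_def)

lemma FD_submod_kk: "FD B ==> submod B I ==> submod kk I"
 using submod_mono FD_kk by blast

lemma FD_ideal:
 assumes "FD B" "submod B I" "b : I" "b : B" "b ~= 0" shows "fc B I"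
proof -
 have "fc B ((*) b ` B)" using assms by (auto simp: FD_def)
 moreover have "(*) b ` B <= I" using assms submod_mult'[OF assms(2)] by blast
 ultimately show ?thesis using fc_mono by blast
qed

lemma dep_powers:
 assumes "subr B" "kk <= B" "submod B I" "fc B I" "f : B"
 obtains P where "P ~= 0" "evp P f : I"
proof -
 obtain n where "fcn n B I" using assms by (auto simp: fc_def)
 hence "dep I {..<n} (%i. f ^ i)" using assms by (auto simp: fcn_def intro: subr_power)
 then obtain c where c: "EX i<n. c i ~= 0" "(\<Sum>i<n. \<iota> (c i) * f ^ i) : I" by (auto simp: dep_def)
 thus ?thesis using sum_monom_nz[of "{..<n}" _ c] unfolding sum_powers_evp by (auto intro!: that)
qed

text \<open>A dependence relation between powers of the element, normalized at its term of lowest degree.\<close>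

lemma fitting:
 assumes "subr B" "kk <= B" "submod B I" "fc B I" "f : B"
 obtains m g where "g : B" "f ^ m * (1 + f * g) : I"
proof -
 have I: "submod kk I" using assms submod_mono by blast
 obtain n where "fcn n B I" using assms by (auto simp: fc_def)
 hence "dep I {..<n} (%i. f ^ i)" using assms by (auto simp: fcn_def intro: subr_power)
 from dep_lowest[OF I this] obtain m c where mc: "m < n" "f ^ m + (\<Sum>i\<in>{m<..<n}. \<iota> (c i) * f ^ i) : I" by metis
 let ?g = "\<Sum>i\<in>{m<..<n}. \<iota> (c i) * f ^ (i - Suc m)"
 have "f ^ m * (1 + f * ?g) = f ^ m + (\<Sum>i\<in>{m<..<n}. \<iota> (c i) * (f ^ Suc m * f ^ (i - Suc m)))"
  by (simp add: distrib_left sum_distrib_left algebra_simps)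
 also have "\<dots> = f ^ m + (\<Sum>i\<in>{m<..<n}. \<iota> (c i) * f ^ i)"
  by (intro arg_cong2[of _ _ _ _ "(+)"] sum.cong refl) (simp flip: power_add power_Suc)
 finally show ?thesis using mc assms by (intro that[of ?g m]) (auto intro!: subr_sum subr_mult subr_power)
qed

text \<open>The maximal ideal is nilpotent modulo I: the partial products of the factors are dependent modulo I,
 and in a relation the terms after the first one only change it by a unit.\<close>

lemma prod_nonunits_mem:
 assumes "loc_ring R" "FD R" "submod R I" "b : I" "b : R" "b ~= 0"
 shows "EX N::nat. ALL f. (ALL i<N. f i : mm R) --> (\<Prod>i<N. f i) : I"
proof -
 have R: "subr R" using assms FD_subr by blast
 obtain n where n: "fcn n R I" using FD_ideal[OF assms(2-6)] by (auto simp: fc_def)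
 have main: "(\<Prod>i<n. f i) : I" if f: "ALL i<n. f i : mm R" for f
 proof -
  have fR: "f i : R" if "i < n" for i using that f nonunits_sub by blast
  let ?w = "%j. \<Prod>i<j. f i"
  have "ALL j<n. ?w j : R" using fR R by (auto intro!: subr_prod)
  hence "dep I {..<n} ?w" using n by (auto simp: fcn_def)
  from dep_lowest[OF FD_submod_kk[OF assms(2,3)] this] obtain m c
   where m: "m < n" "?w m + (\<Sum>i\<in>{m<..<n}. \<iota> (c i) * ?w i) : I" by metis
  let ?g = "\<Sum>i\<in>{m<..<n}. \<iota> (c i) * (\<Prod>l\<in>{Suc m..<i}. f l)"
  have split: "?w i = ?w m * (f m * (\<Prod>l\<in>{Suc m..<i}. f l))" if "m < i" for i
  proof -
   have "{..<i} = {..<m} Un insert m {Suc m..<i}" using that by auto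
   hence "?w i = prod f ({..<m} Un insert m {Suc m..<i})" by (rule arg_cong)
   also have "\<dots> = ?w m * prod f (insert m {Suc m..<i})" by (rule prod.union_disjoint) auto
   finally show ?thesis by simp
  qed
  have "(\<Sum>i\<in>{m<..<n}. \<iota> (c i) * ?w i) = ?w m * (f m * ?g)"
   unfolding sum_distrib_left by (intro sum.cong refl) (subst split, auto)
  hence "?w m * (1 + f m * ?g) : I" using m by (simp add: distrib_left)
  moreover have "?g : R" using R fR FD_kk[OF assms(2)] by (auto intro!: subr_sum subr_mult subr_prod)
  hence "f m * ?g : mm R" using nonunits_mult[OF R, of "f m" ?g] f m by (simp add: mult.commute)
  from one_plus_nonunit[OF assms(1) this] have "1 + f m * ?g ~= 0" "inverse (1 + f m * ?g) : R"
   using unit_inverse by blast+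
  ultimately have wm: "?w m : I"
   using submod_mult'[OF assms(3), of "inverse (1 + f m * ?g)" "?w m * (1 + f m * ?g)"] by (simp add: mult.assoc)
  have "{..<n} = {..<m} Un {m..<n}" using m by auto
  hence "(\<Prod>i<n. f i) = prod f ({..<m} Un {m..<n})" by (rule arg_cong)
  also have "\<dots> = ?w m * (\<Prod>i\<in>{m..<n}. f i)" by (rule prod.union_disjoint) auto
  finally have "(\<Prod>i<n. f i) = ?w m * (\<Prod>i\<in>{m..<n}. f i)" .
  moreover have "(\<Prod>i\<in>{m..<n}. f i) : R" using fR by (intro subr_prod[OF R]) auto
  ultimately show ?thesis using submod_mult'[OF assms(3) _ wm] by (simp only:)
 qed
 show ?thesis
 proof (intro exI[of _ n] allI impI)
  show "(\<Prod>i<n. f i) : I" if "ALL i<n. f i : mm R" for f by (rule main[OF that])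
 qed
qed

lemma FD_residue:
 assumes "FD B" "prime_of B p" "p ~= {0}" "x : B" shows "EX a. x - \<iota> a : p"
proof -
 obtain b where b: "b : p" "b ~= 0" using assms(3) submod_0[OF prime_ofD(1)[OF assms(2)]] by blast
 have "fc B p" using FD_ideal[OF assms(1) prime_ofD(1)[OF assms(2)] b(1)] b prime_ofD(2)[OF assms(2)] by blast
 then obtain P where "P ~= 0" "evp P x : p"
  using dep_powers[OF FD_subr[OF assms(1)] FD_kk[OF assms(1)] prime_ofD(1)[OF assms(2)] _ assms(4)] by blast
 thus ?thesis using root_mod_prime[OF FD_subr[OF assms(1)] FD_kk[OF assms(1)] assms(2,4)] by blast
qed

lemma residue_maximal:
 assumes "subr B" "kk <= B" "prime_of B p" "!!x. x : B ==> EX a. x - \<iota> a : p"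
  and "submod B q" "q <= B" "1 ~: q" "p <= q"
 shows "q = p"
proof (rule ccontr)
 assume "q ~= p"
 then obtain x where x: "x : q" "x ~: p" using assms by blast
 then obtain a where a: "x - \<iota> a : p" using assms by blast
 hence "a ~= 0" using x by (auto simp: \<iota>_0)
 have "x - (x - \<iota> a) : q" using submod_diff[OF assms(5,1), of x "x - \<iota> a"] a x assms(8) by blast
 hence "\<iota> (inverse a) * \<iota> a : q" using assms(2) by (intro submod_mult[OF assms(5)]) auto
 thus False using \<iota>_inverse[OF `a ~= 0`] assms by simp
qed

lemma FD_maximal:
 assumes "FD B" "prime_of B p" "p ~= {0}" "prime_of B q" "p <= q" shows "q = p"
 using residue_maximal[OF FD_subr[OF assms(1)] FD_kk[OF assms(1)] assms(2) FD_residue[OF assms(1-3)]]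
  prime_ofD[OF assms(4)] assms(5) by blast

text \<open>Distinct primes over b are separated by elements that are independent modulo b.\<close>

lemma FD_finite_primes:
 assumes "FD B" "b : B" "b ~= 0" shows "finite {p. prime_of B p & b : p}"
proof (rule ccontr)
 let ?S = "{p. prime_of B p & b : p}"
 assume "infinite ?S"
 have B: "subr B" and kB: "kk <= B" using FD_subr FD_kk assms by auto
 obtain n where n: "fcn n B ((*) b ` B)" using assms by (auto simp: FD_def fc_def)
 obtain T where T: "T <= ?S" "finite T" "card T = n" using infinite_arbitrarily_large[OF `infinite ?S`] by blast
 have Tp: "prime_of B p" "b : p" if "p : T" for p using T that by auto
 have "EX x. x : q & x : B & x ~: p" if "p : T" "q : T" "p ~= q" for p q
 proof -
  have "q ~= {0}" using Tp[OF that(2)] assms by auto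
  hence "~ q <= p" using FD_maximal[OF assms(1), of q p] Tp that by blast
  thus ?thesis using prime_ofD(2)[OF Tp(1)[OF that(2)]] by blast
 qed
 then obtain x where x: "!!p q. p : T ==> q : T ==> p ~= q ==> x p q : q & x p q : B & x p q ~: p" by metis
 (* Each e p lies in all primes of T except p. *)
 define e where "e p = (\<Prod>q\<in>T-{p}. x p q)" for p
 have eB: "e p : B" if "p : T" for p unfolding e_def using x that B by (auto intro!: subr_prod)
 have enp: "e p ~: p" if "p : T" for p
  using prime_of_prod[OF Tp(1)[OF that] B, of "T-{p}" "x p"] x that T unfolding e_def by auto
 have eq: "e p : q" if "p : T" "q : T" "p ~= q" for p q
 proof -
  have "e p = x p q * (\<Prod>q\<in>T-{p}-{q}. x p q)" unfolding e_def using that T by (subst prod.remove[of _ q]) auto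
  moreover have "(\<Prod>q\<in>T-{p}-{q}. x p q) : B" using x that B by (auto intro!: subr_prod)
  ultimately show ?thesis using x[OF that] submod_mult'[OF prime_ofD(1)[OF Tp(1)[OF that(2)]]] by metis
 qed
 have "dep ((*) b ` B) T e" using fcn_family[OF n T(2)] T eB by auto
 then obtain c where c: "EX p:T. c p ~= 0" "(\<Sum>p\<in>T. \<iota> (c p) * e p) : (*) b ` B" by (auto simp: dep_def)
 then obtain p where p: "p : T" "c p ~= 0" by blast
 note sp = prime_ofD(1)[OF Tp(1)[OF p(1)]]
 have "(\<Sum>p\<in>T. \<iota> (c p) * e p) : p" using c(2) submod_mult'[OF sp] Tp[OF p(1)] by auto
 moreover have "(\<Sum>p\<in>T. \<iota> (c p) * e p) = \<iota> (c p) * e p + (\<Sum>q\<in>T-{p}. \<iota> (c q) * e q)"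
  using p T by (simp add: sum.remove)
 moreover have "(\<Sum>q\<in>T-{p}. \<iota> (c q) * e q) : p" using eq[OF _ p(1)] kB by (intro submod_sum[OF sp] submod_mult[OF sp]) auto
 ultimately have "\<iota> (c p) * e p : p" using submod_diff[OF sp B] by fastforce
 hence "\<iota> (inverse (c p)) * (\<iota> (c p) * e p) : p" using submod_mult[OF sp] kB by blast
 thus False using enp[OF p(1)] \<iota>_inverse[OF p(2)] by (simp flip: mult.assoc)
qed

end

definition fractions :: "'a::field set => bool" where
 "fractions A \<longleftrightarrow> (ALL z. EX a b. a : A & b : A & b ~= 0 & z = a / b)"

lemma fractions_mono: "fractions A ==> A <= B ==> fractions B"
 unfolding fractions_def by blast

lemma fractions_nonunits_zero: assumes "subr R" "fractions R" "mm R = {0}" shows "z : R"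
proof -
 obtain a b where "a : R" "b : R" "z = a / b" using assms(2) unfolding fractions_def by metis
 thus ?thesis using nonunits_trivial[OF assms(1,3)] subr_mult[OF assms(1)] by (simp add: divide_inverse)
qed

lemma common_denominator:
 assumes "subr A" "fractions A" "finite S"
 obtains d where "d : A" "d ~= 0" "!!s. s : S ==> d * s : A"
proof -
 have "EX d:A. d ~= 0 & (ALL s:S. d * s : A)" using assms(3)
 proof induction
  case empty thus ?case using subr_1[OF assms(1)] by (auto intro!: bexI[of _ 1])
 next
  case (insert s S)
  then obtain d where d: "d : A" "d ~= 0" "ALL s:S. d * s : A" by blast
  obtain a b where ab: "a : A" "b : A" "b ~= 0" "s = a / b" using assms(2) unfolding fractions_def by metis
  have "d * b * t : A" if "t : insert s S" for t
  proof (cases "t = s")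
   case True
   hence "d * b * t = d * a" using ab(3) unfolding True ab(4) by simp
   thus ?thesis using subr_mult[OF assms(1) d(1) ab(1)] by (simp only:)
  next
   case False
   hence "b * (d * t) : A" using that d ab subr_mult[OF assms(1)] by blast
   thus ?thesis by (simp add: ac_simps)
  qed
  thus ?case using d ab subr_mult[OF assms(1)] by (intro bexI[of _ "d * b"]) auto
 qed
 thus ?thesis using that by blast
qed

lemma lspan_denominator:
 assumes "subr A" "!!s. s : S ==> d * s : A" "x : lspan A S" shows "d * x : A"
 using assms(3)
proof induction
 case (lspan_step x b s)
 have "d * (b * s + x) = b * (d * s) + d * x" by (simp add: algebra_simps)
 moreover have "b * (d * s) : A" using lspan_step assms subr_mult by blast
 ultimately show ?case using lspan_step subr_add[OF assms(1)] by simp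
qed (simp add: subr_0[OF assms(1)])

context field_over
begin

text \<open>The step of Krull and Akizuki: J/aJ is no larger than A/aA.  Count A/aJ through A/aA and aA/aJ, and through
 A/J and J/aJ; multiplication by \<open>a\<close> identifies A/J with aA/aJ.\<close>

lemma fcn_ideal_quotient:
 assumes A: "FD A" and a: "a : A" "a ~= 0" and n: "fcn n A ((*) a ` A)"
  and J: "submod A J" "J <= A" "j : J" "j ~= 0"
 shows "fcn n J ((*) a ` J)"
 unfolding fcn_def
proof (intro allI impI)
 fix w assume w: "ALL i<n. w i : J"
 have As: "subr A" using FD_subr A by auto
 have kJ: "submod kk J" using FD_submod_kk[OF A J(1)] .
 have kaA: "submod kk ((*) a ` A)" using FD_submod_kk[OF A submod_principal[OF As]] .
 have kaJ: "submod kk ((*) a ` J)" using submod_times[OF kJ] .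
 obtain m :: nat and e :: "nat => 'a" where e: "m < n" "ALL i<m. e i : A"
  "!!x. x : A ==> EX y:lspan kk (e ` {..<m}). x - y : (*) a ` A" using fcn_basis[OF kaA n] by metis
 obtain l where "fcn l A J" using FD_ideal[OF A J(1,3)] J by (auto simp: fc_def)
 from fcn_basis[OF kJ this] obtain q :: nat and u :: "nat => 'a" where u: "ALL i<q. u i : A" "~ dep J {..<q} u"
  "!!x. x : A ==> EX y:lspan kk (u ` {..<q}). x - y : J" by metis
 define v where "v i = (if i < n then w i else u (i - n))" for i
 (* The family v consists of w and of lifts u of a basis of A/J; the basis e of A/aA and a u span A/aJ. *)
 have "dep ((*) a ` J) {..<n+q} v"
 proof (rule steinitz[OF kaJ, of "e ` {..<m} Un (*) a ` (u ` {..<q})"])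
  show "card (e ` {..<m} Un (*) a ` (u ` {..<q})) < card {..<n+q}"
  proof -
   have "card (e ` {..<m} Un (*) a ` (u ` {..<q})) <= card (e ` {..<m}) + card ((*) a ` (u ` {..<q}))"
    by (rule card_Un_le)
   also have "\<dots> <= m + q" using card_image_le[of "{..<m}" e] card_image_le[of "{..<q}" "%i. a * u i"]
    by (simp add: image_image)
   finally show ?thesis using e by simp
  qed
  fix i assume i: "i : {..<n+q}"
  have "v i : A" using i w u J by (auto simp: v_def)
  then obtain x b where x: "x : lspan kk (e ` {..<m})" "v i - x = a * b" "b : A" using e(3) by blast
  obtain y where y: "y : lspan kk (u ` {..<q})" "b - y : J" using u(3)[OF x(3)] by blast
  have "v i - (x + a * y) = a * (b - y)" using x(2) by (simp add: algebra_simps)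
  hence "v i - (x + a * y) : (*) a ` J" using y(2) by blast
  moreover have "x + a * y : lspan kk (e ` {..<m} Un (*) a ` (u ` {..<q}))"
   unfolding lspan_Un[OF subr_kk] lspan_times using x y by blast
  ultimately show "EX x:lspan kk (e ` {..<m} Un (*) a ` (u ` {..<q})). v i - x : (*) a ` J" by blast
 qed auto
 then obtain c where c: "EX i<n+q. c i ~= 0" "(\<Sum>i<n+q. \<iota> (c i) * v i) : (*) a ` J" by (auto simp: dep_def)
 have split: "(\<Sum>i<n+q. \<iota> (c i) * v i) = (\<Sum>i<n. \<iota> (c i) * w i) + (\<Sum>i<q. \<iota> (c (n + i)) * u i)"
 proof -
  have "(\<Sum>i<n+q. \<iota> (c i) * v i) = (\<Sum>i<n. \<iota> (c i) * v i) + (\<Sum>i<q. \<iota> (c (n + i)) * v (n + i))"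
   by (induction q) (simp_all add: add.assoc)
  thus ?thesis by (simp add: v_def)
 qed
 have wJ: "(\<Sum>i<n. \<iota> (c i) * w i) : J" using w by (intro submod_kk_sum[OF kJ]) auto
 have "(*) a ` J <= J" using submod_mult[OF J(1) a(1)] by blast
 hence "(\<Sum>i<n+q. \<iota> (c i) * v i) : J" using c(2) by blast
 from submod_diff[OF kJ subr_kk this wJ] have "(\<Sum>i<q. \<iota> (c (n + i)) * u i) : J" unfolding split by simp
 hence cz: "ALL i<q. c (n + i) = 0" using u(2) unfolding dep_def
  by (auto dest!: spec[of _ "%i. c (n + i)"])
 hence "(\<Sum>i<n. \<iota> (c i) * w i) : (*) a ` J" using c(2) unfolding split by (simp add: \<iota>_0)
 moreover have "EX i<n. c i ~= 0"
 proof -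
  obtain i where i: "i < n + q" "c i ~= 0" using c by blast
  hence "i < n" using cz by (metis add_diff_inverse_nat nat_add_left_cancel_less)
  thus ?thesis using i by blast
 qed
 ultimately show "dep ((*) a ` J) {..<n} w" unfolding dep_def by (intro exI[of _ c]) auto
qed

text \<open>A family in B has a common denominator d, so that it lies in a finite A-module, which d makes an ideal of A.\<close>

theorem krull_akizuki:
 assumes A: "FD A" "fractions A" and B: "subr B" "A <= B" shows "FD B"
 unfolding FD_def
proof (intro conjI ballI impI)
 have As: "subr A" using FD_subr A by auto
 show "subr B" "kk <= B" using B FD_kk[OF A(1)] by auto
 fix b assume b: "b : B" "b ~= 0"
 obtain a s where as: "a : A" "s : A" "s ~= 0" "b = a / s" using A(2) unfolding fractions_def by metis
 hence a: "a = b * s" "a ~= 0" using b by auto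
 obtain n where n: "fcn n A ((*) a ` A)" using A(1) as(1) a(2) by (auto simp: FD_def fc_def)
 have "fcn n B ((*) b ` B)" unfolding fcn_def
 proof (intro allI impI)
  fix w :: "nat => 'a" assume w: "ALL i<n. w i : B"
  obtain d where d: "d : A" "d ~= 0" "!!s. s : w ` {..<n} ==> d * s : A"
   using common_denominator[OF As A(2), of "w ` {..<n}"] by auto
  let ?S = "insert 1 (w ` {..<n})"
  let ?J = "(*) d ` lspan A ?S"
  have dS: "!!s. s : ?S ==> d * s : A" using d by auto
  have "fcn n ?J ((*) a ` ?J)"
  proof (rule fcn_ideal_quotient[OF A(1) as(1) a(2) n, of _ d])
   show "submod A ?J" by (intro submod_times lspan_submod As)
   show "?J <= A" using lspan_denominator[OF As dS] by blast
   show "d : ?J" using lspan_incl[OF As, of ?S] by force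
  qed (use d in auto)
  moreover have "ALL i<n. d * w i : ?J" using lspan_incl[OF As, of ?S] by auto
  ultimately have "dep ((*) a ` ?J) {..<n} (%i. d * w i)" by (intro fcnD) auto
  then obtain c where c: "EX i<n. c i ~= 0" "(\<Sum>i<n. \<iota> (c i) * (d * w i)) : (*) a ` ?J" by (auto simp: dep_def)
  then obtain y where y: "y : lspan A ?S" "(\<Sum>i<n. \<iota> (c i) * (d * w i)) = a * (d * y)" by blast
  have "(\<Sum>i<n. \<iota> (c i) * (d * w i)) = d * (\<Sum>i<n. \<iota> (c i) * w i)" by (simp add: sum_distrib_left algebra_simps)
  hence "(\<Sum>i<n. \<iota> (c i) * w i) = b * (s * y)" using y(2) d a by (simp add: algebra_simps)
  moreover have "s * y : B"
  proof -
   have "lspan A ?S <= B" by (rule lspan_min[OF submod_subr]) (use B w subr_1 in auto)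
   thus ?thesis using y as B subr_mult by blast
  qed
  ultimately have "(\<Sum>i<n. \<iota> (c i) * w i) : (*) b ` B" by blast
  thus "dep ((*) b ` B) {..<n} w" unfolding dep_def using c(1) by (intro exI[of _ c]) auto
 qed
 thus "fc B ((*) b ` B)" by (auto simp: fc_def)
qed

end

section \<open>Finitely generated algebras\<close>

lemma submod_step: "submod B W ==> b : B ==> u : W ==> v : W ==> b * u + v : W"
 by (simp add: submod_add submod_mult)

lemma adjoin_in_module:
 assumes "submod F W" "1 : W" "!!s w. s : S ==> w : W ==> s * w : W" "0 : W"
  and neg: "!!w. w : W ==> - w : W"
 shows "adjoin (F Un S) <= W"
proof -
 let ?T = "{x. ALL w:W. x * w : W}"
 have "subr ?T" unfolding subr_def
 proof (intro conjI ballI)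
  fix x y assume xy: "x : ?T" "y : ?T"
  show "x * y : ?T" using xy by (simp add: mult.assoc)
  show "x - y : ?T"
  proof (intro CollectI ballI)
   fix w assume "w : W"
   hence "x * w + - (y * w) : W" using xy assms(1) neg by (intro submod_add[OF assms(1)]) auto
   thus "(x - y) * w : W" by (simp add: algebra_simps)
  qed
 qed simp
 moreover have "F Un S <= ?T" using assms by (auto intro: submod_mult)
 ultimately have "adjoin (F Un S) <= ?T" by (rule adjoin_min)
 thus ?thesis using assms(2) by force
qed

definition poly_over :: "'a::comm_ring_1 set => 'a poly set" where
 "poly_over F = {P. ALL i. coeff P i : F}"

lemma poly_over_subr: "subr F ==> subr (poly_over F)"
proof -
 assume F: "subr F"
 have "coeff (1 :: 'a poly) i : F" for i
  using F by (cases i) (auto simp: one_pCons coeff_pCons subr_0 subr_1)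
 moreover have "coeff (P * Q) i : F" if "P : poly_over F" "Q : poly_over F" for P Q i
  using that F unfolding coeff_mult poly_over_def by (intro subr_sum subr_mult) auto
 moreover have "coeff (P - Q) i : F" if "P : poly_over F" "Q : poly_over F" for P Q i
  using that F by (simp add: poly_over_def subr_diff)
 ultimately show "subr (poly_over F)" unfolding subr_def by (simp add: poly_over_def)
qed

lemma poly_over_monom: "a : F ==> subr F ==> monom a n : poly_over F"
 by (auto simp: poly_over_def subr_0)

lemma poly_over_pCons: "a : F ==> P : poly_over F ==> pCons a P : poly_over F"
 by (auto simp: poly_over_def coeff_pCons split: nat.splits)

lemma poly_over_const: "subr F ==> a : F ==> [:a:] : poly_over F"
 by (auto simp: poly_over_def coeff_pCons subr_0 split: nat.splits)

lemma poly_over_eval: "subr B ==> F <= B ==> P : poly_over F ==> x : B ==> poly P x : B"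
 unfolding poly_altdef poly_over_def by (intro subr_sum subr_mult subr_power) auto

lemma adjoin_single:
 fixes x :: "'a::comm_ring_1"
 assumes "subr F" shows "adjoin (F Un {x}) = (%P. poly P x) ` poly_over F"
proof
 show "adjoin (F Un {x}) <= (%P. poly P x) ` poly_over F"
 proof (rule adjoin_min)
  have "a - b : (%P. poly P x) ` poly_over F & a * b : (%P. poly P x) ` poly_over F"
   if ab: "a : (%P. poly P x) ` poly_over F" "b : (%P. poly P x) ` poly_over F" for a b
  proof -
   obtain P Q where PQ: "a = poly P x" "b = poly Q x" "P : poly_over F" "Q : poly_over F" using ab by blast
   hence "a - b = poly (P - Q) x" "a * b = poly (P * Q) x" "P - Q : poly_over F" "P * Q : poly_over F"
    using poly_over_subr[OF assms] by (auto intro: subr_diff subr_mult)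
   thus ?thesis by blast
  qed
  moreover have "1 : (%P. poly P x) ` poly_over F"
   using subr_1[OF poly_over_subr[OF assms]] by (intro image_eqI[of _ _ 1]) auto
  ultimately show "subr ((%P. poly P x) ` poly_over F)" unfolding subr_def by blast
  have "x : (%P. poly P x) ` poly_over F"
   by (rule image_eqI[of _ _ "[:0, 1:]"]) (auto intro!: poly_over_pCons poly_over_const simp: assms subr_0 subr_1)
  moreover have "f : (%P. poly P x) ` poly_over F" if "f : F" for f
   using that by (intro image_eqI[of _ _ "[:f:]"]) (auto intro!: poly_over_const simp: assms)
  ultimately show "F Un {x} <= (%P. poly P x) ` poly_over F" by blast
 qed
 show "(%P. poly P x) ` poly_over F <= adjoin (F Un {x})"
 proof
  fix y assume "y : (%P. poly P x) ` poly_over F"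
  then obtain P where "y = poly P x" "P : poly_over F" by blast
  thus "y : adjoin (F Un {x})"
   using poly_over_eval[OF adjoin_subr[of "F Un {x}"], of F P x] adjoin_incl[of "F Un {x}"] by auto
 qed
qed

context field_over
begin

lemma poly_over_evp: "map_poly \<iota> P : poly_over kk"
 by (auto simp: poly_over_def coeff_map_poly \<iota>_0)

text \<open>The generators are the differences between the products s e of a generator of A and a basis element of the quotient,
 and the representatives of these products.\<close>

lemma finite_codimension_fg:
 assumes S: "finite S" and A: "A = adjoin (kk Un S)"
  and J: "submod A J" "J <= A" "fc A J"
 obtains G where "finite G" "G <= J" "J = lspan A G"
proof -
 have As: "subr A" unfolding A by (rule adjoin_subr)
 have kA: "kk <= A" and SA: "S <= A" using adjoin_incl[of "kk Un S"] A by auto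
 have kJ: "submod kk J" using submod_mono[OF J(1) kA] .
 obtain n where "fcn n A J" using J by (auto simp: fc_def)
 from fcn_basis[OF kJ this] obtain m and w :: "nat => 'a" where w: "ALL i<m. w i : A" "~ dep J {..<m} w"
  "!!a. a : A ==> EX x:lspan kk (w ` {..<m}). a - x : J" by metis
 let ?E = "w ` {..<m}"
 obtain pr where pr: "!!a. a : A ==> pr a : lspan kk ?E & a - pr a : J" using w(3) by metis
 define T where "T = insert 1 ((%(s, e). s * e) ` (S \<times> ?E))"
 have TA: "T <= A" unfolding T_def using SA w As by (auto intro: subr_1 subr_mult)
 define G where "G = (%t. t - pr t) ` T"
 have finG: "finite G" using S by (auto simp: G_def T_def)
 have GJ: "G <= J" using pr TA by (auto simp: G_def)
 define W where "W = {x + y | x y. x : lspan kk ?E & y : lspan A G}"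
 have Wm: "submod kk W" unfolding W_def
  by (intro submod_plus lspan_submod subr_kk submod_mono[OF lspan_submod[OF As] kA])
 have GW: "lspan A G <= W" using lspan_0[of kk ?E] by (force simp: W_def)
 have TW: "T <= W"
 proof
  fix t assume t: "t : T"
  hence "t - pr t : lspan A G" using lspan_incl[OF As, of G] by (auto simp: G_def)
  moreover have "t = pr t + (t - pr t)" by simp
  ultimately show "t : W" unfolding W_def using pr t TA by blast
 qed
 have AW: "A <= W" unfolding A
 proof (rule adjoin_in_module[OF Wm])
  show "1 : W" using TW by (auto simp: T_def)
  show "s * x : W" if sx: "s : S" "x : W" for s x
  proof -
   obtain u v where uv: "x = u + v" "u : lspan kk ?E" "v : lspan A G" using sx unfolding W_def by blast
   have "s * u : W" using uv(2)
   proof induction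
    case (lspan_step x b e)
    hence "s * e : W" using TW sx(1) by (force simp: T_def)
    hence "b * (s * e) + s * x : W" using lspan_step by (intro submod_step[OF Wm])
    thus ?case by (simp add: algebra_simps)
   qed (simp add: submod_0[OF Wm])
   moreover have "s * v : W" using GW lspan_mult[OF As uv(3)] sx SA by blast
   ultimately show ?thesis unfolding uv distrib_left by (rule submod_add[OF Wm])
  qed
 qed (auto intro: submod_0[OF Wm] submod_uminus[OF Wm subr_kk])
 have lG: "lspan A G <= J" by (rule lspan_min[OF J(1) GJ])
 have "J <= lspan A G"
 proof
  fix j assume j: "j : J"
  then obtain u v where uv: "j = u + v" "u : lspan kk ?E" "v : lspan A G" using AW J by (auto simp: W_def)
  have "j - v : J" using submod_diff[OF kJ subr_kk j] lG uv by blast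
  hence uJ: "u : J" using uv(1) by simp
  obtain b where b: "ALL i:{..<m}. b i : kk" "u = (\<Sum>i<m. b i * w i)"
   using lspan_image_finite[OF subr_kk _ uv(2)] by auto
  hence "ALL i:{..<m}. EX c. b i = \<iota> c" by auto
  then obtain c where c: "!!i. i < m ==> b i = \<iota> (c i)" by (metis lessThan_iff)
  hence u: "u = (\<Sum>i<m. \<iota> (c i) * w i)" using b by auto
  hence "ALL i<m. c i = 0" using w(2) uJ by (auto simp: dep_def)
  hence "u = 0" using u by (simp add: \<iota>_0)
  thus "j : lspan A G" using uv by simp
 qed
 thus ?thesis using that finG GJ lG by blast
qed

text \<open>In a finitely generated algebra an ideal that is maximal among the nonzero ideals of infinite
 codimension would be prime, hence of codimension one.\<close>

theorem FD_finitely_generated: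
 assumes S: "finite S" and A: "A = adjoin (kk Un S)"
  and res: "!!p x. prime_of A p ==> p ~= {0} ==> x : A ==> EX a. x - \<iota> a : p"
 shows "FD A"
proof -
 have As: "subr A" unfolding A by (rule adjoin_subr)
 have kA: "kk <= A" using adjoin_incl[of "kk Un S"] A by auto
 have kI: "submod kk I" if "submod A I" for I using submod_mono[OF that kA] .
 have "fc A ((*) b ` A)" if b: "b : A" "b ~= 0" for b
 proof (rule ccontr)
  assume nfc: "~ fc A ((*) b ` A)"
  define X where "X = {J. submod A J & J <= A & b : J & ~ fc A J}"
  have "EX M:X. ALL J:X. M <= J --> J = M"
  proof (rule subset_Zorn_nonempty)
   have "(*) b ` A : X" unfolding X_def using b nfc submod_principal[OF As] As
    by (auto intro: subr_mult intro!: image_eqI[of _ _ 1] simp: subr_1)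
   thus "X ~= {}" by blast
   fix C assume "C ~= {}" and ch: "subset.chain X C"
   hence CX: "C <= X" and tot: "!!J K. J : C ==> K : C ==> J <= K | K <= J"
    by (auto simp: subset.chain_def)
   obtain J0 where J0: "J0 : C" using `C ~= {}` by blast
   have Cm: "submod A J" if "J : C" for J using CX that by (auto simp: X_def)
   have sub: "submod A (\<Union>C)" by (rule submod_Union_chain[OF ch `C ~= {}`]) (auto simp: X_def)
   have "~ fc A (\<Union>C)"
   proof
    assume "fc A (\<Union>C)"
    moreover have CA: "\<Union>C <= A" using CX by (auto simp: X_def)
    ultimately obtain G where G: "finite G" "G <= \<Union>C" "\<Union>C = lspan A G"
     using finite_codimension_fg[OF S A sub] by blast
    have "EX J:C. G <= J" using G(1,2)
    proof induction
     case empty thus ?case using J0 by blast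
    next
     case (insert g G)
     then obtain J K where "J : C" "G <= J" "K : C" "g : K" by blast
     thus ?case using tot[of J K] by blast
    qed
    then obtain J where J: "J : C" "G <= J" by blast
    hence "\<Union>C <= J" using G(3) lspan_min[OF Cm[OF J(1)] J(2)] by simp
    hence "J = \<Union>C" using J by blast
    thus False using `fc A (\<Union>C)` J CX by (auto simp: X_def)
   qed
   moreover have "b : \<Union>C" "\<Union>C <= A" using CX J0 by (auto simp: X_def)
   ultimately show "\<Union>C \<in> X" using sub unfolding X_def by blast
  qed
  then obtain p where pX: "p : X" and mx: "!!J. J : X ==> p <= J ==> J = p" by blast
  hence p: "submod A p" "p <= A" "b : p" "~ fc A p" by (auto simp: X_def)
  have big: "fc A J" if "submod A J" "J <= A" "p <= J" "x : J" "x ~: p" for J x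
   using mx[of J] that p(3) unfolding X_def by blast
  have prime: "prime_of A p" unfolding prime_of_def
  proof (intro conjI ballI impI p(1,2))
   have "fc A A" by (rule fcI_span[of _ "{}"]) (auto intro: kI submod_self As)
   thus "1 ~: p" using fc_mono[of A A A p] p(1,4) submod_mult'[OF p(1), of _ 1] by (auto simp: subset_iff)
   fix x y assume xy: "x : A" "y : A" "x * y : p"
   show "x : p | y : p"
   proof (rule ccontr)
    assume n: "~ ?thesis"
    let ?J = "{u + v | u v. u : p & v : (*) y ` A}" and ?Q = "{z : A. z * y : p}"
    have Jm: "submod A ?J" using p(1) As by (intro submod_plus submod_principal)
    have pJ: "p <= ?J" using subr_0[OF As] by force
    have yJ: "y : ?J" using submod_0[OF p(1)] subr_1[OF As] by force
    have JA: "?J <= A" using p xy As by (auto intro!: subr_add subr_mult)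
    have fJ: "fc A ?J" by (rule big[OF Jm JA pJ yJ]) (use n in blast)
    have Qm: "submod A ?Q" by (rule submod_colon[OF As p(1)])
    have pQ: "p <= ?Q" using p(2) submod_mult'[OF p(1) xy(2)] by blast
    have fQ: "fc A ?Q" by (rule big[OF Qm _ pQ, of x]) (use n xy in auto)
    obtain E where E: "finite E" "!!a. a : A ==> EX u:lspan kk E. a - u : ?Q"
     using fc_span[OF kI[OF Qm] fQ] by metis
    have "fc (A Int ?J) p"
    proof (rule fcI_span[OF kI[OF p(1)]])
     show "finite ((*) y ` E)" using E by simp
     fix a assume "a : A Int ?J"
     then obtain u v where uv: "a = u + y * v" "u : p" "v : A" by blast
     obtain e where e: "e : lspan kk E" "v - e : ?Q" using E(2)[OF uv(3)] by blast
     have "a - y * e = u + (v - e) * y" using uv by (simp add: algebra_simps)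
     hence "a - y * e : p" using submod_add[OF p(1) uv(2)] e by simp
     thus "EX x:lspan kk ((*) y ` E). a - x : p" unfolding lspan_times using e by blast
    qed
    hence "fc A p" by (intro fc_trans[OF kI[OF submod_self[OF As]] kI[OF Jm] kI[OF p(1)] fJ])
    thus False using p by blast
   qed
  qed
  have "p ~= {0}" using p b by blast
  hence "EX a. x - \<iota> a : p" if "x : A" for x
   using res[OF prime] that by blast
  hence "fc A p"
   by (intro fcI_span[OF kI[OF p(1)], of "{1}"]) (use lspan_mult[OF subr_kk] lspan_incl[OF subr_kk, of "{1}"] in force)+
  thus False using p by blast
 qed
 thus ?thesis using As kA by (auto simp: FD_def)
qed

end

lemma dominated_valuation:
 assumes "dominated R S" "subr R" "!!z. z : R | inverse z : R" shows "S = R"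
proof (intro equalityI subsetI)
 fix z assume z: "z : S"
 show "z : R"
 proof (rule ccontr)
  assume n: "z ~: R"
  hence "z ~= 0" using subr_0[OF assms(2)] by blast
  hence "inverse z ~: mm S" using z by (auto simp: nonunits_def)
  thus False using dominated_unit[OF assms(1)] assms(3)[of z] n by fastforce
 qed
qed (use dominated_sub[OF assms(1)] in blast)

section \<open>Approximation\<close>

definition nloc :: "'a::field set => 'a set => 'a set => 'a set" where
 "nloc A N p = {y. EX t:A. t ~: p & t * y : N}"

lemma nloc_submod:
 assumes "subr A" "prime_of A p" "submod A N" shows "submod A (nloc A N p)"
 unfolding submod_def
proof (intro conjI ballI)
 show "0 : nloc A N p" unfolding nloc_def using subr_1[OF assms(1)] prime_ofD(3)[OF assms(2)] submod_0[OF assms(3)]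
  by (auto intro!: bexI[of _ 1])
 fix x y assume "x : nloc A N p" "y : nloc A N p"
 then obtain s t where *: "s : A" "s ~: p" "s * x : N" "t : A" "t ~: p" "t * y : N" by (auto simp: nloc_def)
 have "s * t * (x + y) = t * (s * x) + s * (t * y)" by (simp add: algebra_simps)
 hence "s * t * (x + y) : N" using * assms(3) by (simp add: submod_add submod_mult)
 thus "x + y : nloc A N p" unfolding nloc_def using * loc_den_mult[OF assms(1,2)] subr_mult[OF assms(1)] by blast
next
 fix b x assume "b : A" "x : nloc A N p"
 then obtain s where *: "s : A" "s ~: p" "s * x : N" by (auto simp: nloc_def)
 have "s * (b * x) : N" using submod_mult[OF assms(3) `b : A` *(3)] by (simp only: mult.left_commute)
 thus "b * x : nloc A N p" unfolding nloc_def using * by blast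
qed

lemma nloc_eq_lspan:
 assumes "subr A" "prime_of A p" "submod A N" shows "nloc A N p = lspan (localization A p) N"
proof
 note Ls = localization_subr[OF assms(1,2)]
 show "nloc A N p <= lspan (localization A p) N"
 proof
  fix y assume "y : nloc A N p"
  then obtain t where t: "t : A" "t ~: p" "t * y : N" by (auto simp: nloc_def)
  have "1 / t : localization A p" unfolding localization_iff using t subr_1[OF assms(1)] by blast
  hence "(1 / t) * (t * y) : lspan (localization A p) N"
   using lspan_mult[OF Ls] lspan_incl[OF Ls, of N] t by blast
  thus "y : lspan (localization A p) N" using loc_den[OF assms(1,2)] t by simp
 qed
 have "submod (localization A p) (nloc A N p)"
  unfolding submod_def
 proof (intro conjI ballI)
  fix b x assume "b : localization A p" "x : nloc A N p"
  then obtain a s where as: "b = a / s" "a : A" "s : A" "s ~: p" unfolding localization_iff by blast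
  obtain t where t: "t : A" "t ~: p" "t * x : N" using `x : nloc A N p` by (auto simp: nloc_def)
  have "s * t * (b * x) = a * (t * x)" using as loc_den[OF assms(1,2)] by (simp add: field_simps)
  hence "s * t * (b * x) : N" using submod_mult[OF assms(3) as(2) t(3)] by (simp only:)
  thus "b * x : nloc A N p" unfolding nloc_def
   using as t loc_den_mult[OF assms(1,2)] subr_mult[OF assms(1)] by blast
 qed (use nloc_submod[OF assms] in \<open>auto simp: submod_def\<close>)
 moreover have "N <= nloc A N p"
  unfolding nloc_def using subr_1[OF assms(1)] prime_ofD(3)[OF assms(2)] by (auto intro!: bexI[of _ 1])
 ultimately show "lspan (localization A p) N <= nloc A N p" by (rule lspan_min)
qed

text \<open>The ideal of denominators of y is contained in no prime ideal that avoids f, so it contains a power of f.\<close>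

lemma local_global_module:
 assumes "subr A" "submod A N" "f : A" "!!p. prime_of A p ==> f ~: p ==> y : nloc A N p"
 shows "EX n. f ^ n * y : N"
proof (rule ccontr)
 assume *: "\<nexists>n. f ^ n * y : N"
 let ?I = "{a : A. a * y : N}"
 have "submod A ?I" by (rule submod_colon[OF assms(1,2)])
 then obtain p where p: "prime_of A p" "?I <= p" "f ~: p"
  using prime_avoiding_powers[OF assms(1) _ _ assms(3), of ?I] * by auto
 thus False using assms(4)[OF p(1,3)] by (auto simp: nloc_def)
qed

context field_over
begin

text \<open>The element is a power of a product c of elements of the other primes that contain I: by Fitting's lemma such a
 power can be multiplied by further powers of c without loss, modulo I.\<close>

lemma isolate_prime:
 assumes A: "FD A" and I: "submod A I" "I <= A" "i : I" "i ~= 0" and p: "prime_of A p"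
 obtains b where "b : A" "b ~: p" "!!f. f : p ==> EX n. f ^ n * b : I"
proof (cases "p = {0}")
 case True
 have "0 ^ 1 * 1 : I" using submod_0[OF I(1)] by simp
 thus ?thesis using that[of 1] True prime_ofD(3)[OF p] subr_1[OF FD_subr[OF A]] by blast
next
 case False
 have As: "subr A" using FD_subr[OF A] .
 define T where "T = {q. prime_of A q & I <= q & q ~= p}"
 have fT: "finite T" by (rule finite_subset[OF _ FD_finite_primes[OF A, of i]]) (use I in \<open>auto simp: T_def\<close>)
 have "EX x. x : q & x ~: p" if "q : T" for q
 proof -
  have "q ~= {0}" using that I by (auto simp: T_def)
  thus ?thesis using FD_maximal[OF A, of q p] p that by (auto simp: T_def)
 qed
 then obtain x where x: "!!q. q : T ==> x q : q & x q ~: p" by metis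
 have xA: "x q : A" if "q : T" for q using x[OF that] that prime_ofD(2)[of A q] by (auto simp: T_def)
 define c where "c = prod x T"
 have cA: "c : A" unfolding c_def using xA by (intro subr_prod As)
 have cp: "c ~: p"
 proof
  assume "c : p"
  hence "EX q:T. x q : p" unfolding c_def by (intro prime_of_prod[OF p As fT] xA)
  thus False using x by blast
 qed
 have cq: "c : q" if "q : T" for q
 proof -
  have "c = prod x (T - {q}) * x q" unfolding c_def using fT that by (simp add: prod.remove mult.commute)
  moreover have "prod x (T - {q}) : A" using xA by (intro subr_prod As) auto
  ultimately show ?thesis using that x submod_mult[OF prime_ofD(1)[of A q]] by (simp add: T_def)
 qed
 have fcI: "fc A I" using FD_ideal[OF A I(1,3)] I by blast
 obtain m g where mg: "g : A" "c ^ m * (1 + c * g) : I"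
  using fitting[OF As FD_kk[OF A] I(1) fcI cA] by blast
 have iter: "c ^ m - (- g) ^ j * c ^ (m + j) : I" for j
 proof (induction j)
  case 0 thus ?case by (simp add: submod_0[OF I(1)])
 next
  case (Suc j)
  have "c ^ m - (- g) ^ Suc j * c ^ (m + Suc j)
   = (c ^ m - (- g) ^ j * c ^ (m + j)) + ((- g) ^ j * c ^ j) * (c ^ m * (1 + c * g))"
   by (simp add: algebra_simps power_add)
  moreover have "(- g) ^ j * c ^ j : A" using mg cA As by (intro subr_mult subr_power subr_uminus)
  ultimately show ?case using submod_add[OF I(1) Suc submod_mult[OF I(1) _ mg(2)]] by (simp only:)
 qed
 show ?thesis
 proof (rule that[of "c ^ m"])
  show "c ^ m : A" using cA As by (rule subr_power[rotated])
  show "c ^ m ~: p" using prime_of_power[OF p As cA] cp by blast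
  fix f assume f: "f : p"
  hence fA: "f : A" using prime_ofD(2)[OF p] by blast
  have "EX n. (f * c) ^ n : I"
  proof (rule ccontr)
   assume "\<nexists>n. (f * c) ^ n : I"
   then obtain q where q: "prime_of A q" "I <= q" "f * c ~: q"
    using prime_avoiding_powers[OF As I(1,2), of "f * c"] subr_mult[OF As fA cA] by blast
   have "q ~= p" using q(3) submod_mult'[OF prime_ofD(1)[OF p] cA f] by blast
   hence "c : q" using cq q by (auto simp: T_def)
   thus False using q submod_mult[OF prime_ofD(1)[OF q(1)] fA] by blast
  qed
  then obtain n where n: "(f * c) ^ n : I" by blast
  have "f ^ n * c ^ m = f ^ n * (c ^ m - (- g) ^ n * c ^ (m + n)) + ((- g) ^ n * c ^ m) * (f * c) ^ n"
   by (simp add: algebra_simps power_add power_mult_distrib)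
  moreover have "f ^ n : A" "(- g) ^ n * c ^ m : A" using fA mg cA As by (auto intro!: subr_mult subr_power subr_uminus)
  ultimately have "f ^ n * c ^ m : I"
   using submod_add[OF I(1) submod_mult[OF I(1) _ iter[of n]] submod_mult[OF I(1) _ n]] by (simp only:)
  thus "EX n. f ^ n * c ^ m : I" by blast
 qed
qed

lemma submod_denominator:
 assumes "subr A" "fractions A" "submod A N" "n : N" "n ~= 0"
 obtains t where "t : A" "t ~= 0" "t * y : N"
proof -
 obtain a b where ab: "a : A" "b : A" "b ~= 0" "y / n = a / b" using assms(2) unfolding fractions_def by metis
 have "b * y = a * n" using ab assms(5) by (simp add: field_simps)
 thus ?thesis using that[of b] ab submod_mult[OF assms(3) ab(1) assms(4)] by simp
qed

lemma nloc_zero: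
 assumes "subr A" "fractions A" "submod A N" "n : N" "n ~= 0" shows "nloc A N {0} = UNIV"
 using submod_denominator[OF assms] unfolding nloc_def by (metis (mono_tags, lifting) UNIV_eq_I mem_Collect_eq singletonD)

text \<open>The case of one principal part.  With b as above, scaled to c with 1 - c in p, the element
 \<open>(1 - (1 - c)\<^sup>n) s\<close> is congruent to s at p, and it is a multiple of c s, which lies in the localizations at all other primes.\<close>

lemma approximation1:
 assumes A: "FD A" "fractions A" and N: "submod A N" "n : N" "n ~= 0" and p: "prime_of A p"
 obtains z where "z - s : nloc A N p" "!!q. prime_of A q ==> q ~= p ==> z : nloc A N q"
proof (cases "p = {0}")
 case True
 have "0 : nloc A N q" if "prime_of A q" for q using submod_0[OF nloc_submod[OF FD_subr[OF A(1)] that N(1)]] .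
 thus ?thesis using that[of 0] nloc_zero[OF FD_subr[OF A(1)] A(2) N] True by auto
next
 case False
 have As: "subr A" using FD_subr[OF A(1)] .
 let ?I = "{b : A. b * s : N}"
 have Im: "submod A ?I" by (rule submod_colon[OF As N(1)])
 obtain t where t: "t : A" "t ~= 0" "t * s : N" using submod_denominator[OF As A(2) N] by blast
 obtain b where b: "b : A" "b ~: p" "!!f. f : p ==> EX n. f ^ n * b : ?I"
  using isolate_prime[OF A(1) Im _ _ t(2) p] t by blast
 obtain a where a: "b - \<iota> a : p" using FD_residue[OF A(1) p False b(1)] by blast
 note sp = prime_ofD(1)[OF p]
 have a0: "a ~= 0" using a b(2) by (auto simp: \<iota>_0)
 define c where "c = \<iota> (inverse a) * b"
 have kA: "\<iota> x : A" for x using FD_kk[OF A(1)] by blast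
 have cA: "c : A" using b kA As by (auto simp: c_def intro: subr_mult)
 have "1 - c = - \<iota> (inverse a) * (b - \<iota> a)" using \<iota>_inverse[OF a0] by (simp add: c_def algebra_simps)
 hence q0: "1 - c : p" using submod_mult[OF sp subr_uminus[OF As kA] a] by simp
 then obtain n where n: "(1 - c) ^ n * b : ?I" using b(3) by blast
 have dp: "(1 - c) ^ n * s : nloc A N p" unfolding nloc_def using n b by (auto simp: ac_simps intro!: bexI[of _ b])
 define z where "z = (1 - (1 - c) ^ n) * s"
 have "z = (\<Sum>i<n. (1 - c) ^ i) * \<iota> (inverse a) * (b * s)"
  unfolding z_def one_diff_power_eq by (simp add: c_def ac_simps)
 moreover have coef: "(\<Sum>i<n. (1 - c) ^ i) * \<iota> (inverse a) : A"
  using As cA kA by (intro subr_mult subr_sum subr_power subr_diff) (auto simp: subr_1)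
 ultimately have zb: "z = ((\<Sum>i<n. (1 - c) ^ i) * \<iota> (inverse a)) * (b * s)" by (simp add: ac_simps)
 show ?thesis
 proof (rule that[of z])
  have "z - s = (- 1) * ((1 - c) ^ n * s)" by (simp add: z_def algebra_simps)
  thus "z - s : nloc A N p" using submod_uminus[OF nloc_submod[OF As p N(1)] As dp] by simp
  fix q assume q: "prime_of A q" "q ~= p"
  hence "~ p <= q" using FD_maximal[OF A(1) p False q(1)] by blast
  then obtain f where f: "f : p" "f ~: q" by blast
  hence fA: "f : A" using prime_ofD(2)[OF p] by blast
  obtain m where m: "f ^ m * b : ?I" using b(3)[OF f(1)] by blast
  have "f ^ m : A" "f ^ m ~: q" using subr_power[OF As fA] prime_of_power[OF q(1) As fA] f by blast+
  hence "b * s : nloc A N q" unfolding nloc_def using m by (auto simp: mult.assoc)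
  thus "z : nloc A N q" unfolding zb using submod_mult[OF nloc_submod[OF As q(1) N(1)] coef] by blast
 qed
qed

text \<open>Finitely many principal parts are the principal parts of one element: the first cohomology of
 an affine curve vanishes.\<close>

theorem approximation:
 assumes A: "FD A" "fractions A" and N: "submod A N" "n : N" "n ~= 0"
  and "finite T" "!!p. p : T ==> prime_of A p"
 shows "EX z. ALL p. prime_of A p --> z - (if p : T then s p else 0) : nloc A N p"
 using assms(6,7)
proof (induction T rule: finite_induct)
 case empty
 thus ?case using submod_0[OF nloc_submod[OF FD_subr[OF A(1)] _ N(1)]] by (intro exI[of _ 0]) auto
next
 case (insert p T)
 then obtain z where z: "!!q. prime_of A q ==> z - (if q : T then s q else 0) : nloc A N q" by auto
 have p: "prime_of A p" using insert by auto
 obtain y where y: "y - s p : nloc A N p" "!!q. prime_of A q ==> q ~= p ==> y : nloc A N q"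
  using approximation1[OF A N p] by metis
 have "(z + y) - (if q : insert p T then s q else 0) : nloc A N q" if q: "prime_of A q" for q
 proof -
  note add = submod_add[OF nloc_submod[OF FD_subr[OF A(1)] q N(1)]]
  show ?thesis
  proof (cases "q = p")
   case True
   have "z + (y - s p) : nloc A N p" using add[of z "y - s p"] z[OF p] y insert(2) True by auto
   thus ?thesis using True by (simp add: algebra_simps)
  next
   case False
   have "(z - (if q : T then s q else 0)) + y : nloc A N q" using add z[OF q] y(2)[OF q False] by blast
   thus ?thesis using False by (simp add: algebra_simps)
  qed
 qed
 thus ?case by blast
qed

end

section \<open>Integral closure and valuation rings\<close>

lemma first_change: "Q 0 ==> ~ Q N ==> EX n::nat. Q n & ~ Q (Suc n)"
 by (induction N) auto

abbreviation icl :: "'a::field set => 'a set" where "icl \<equiv> integral_closure"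

definition integral_over :: "'a::comm_ring_1 set => 'a => bool" where
 "integral_over A z \<longleftrightarrow> (EX P:poly_over A. lead_coeff P = 1 & poly P z = 0)"

lemma integral_closure_iff: "z : icl A \<longleftrightarrow> integral_over A z"
 unfolding integral_closure_def integral_over_def poly_over_def by auto

lemma integral_over_mono: "integral_over A z ==> A <= B ==> integral_over B z"
 unfolding integral_over_def poly_over_def by blast

lemma integral_self: "subr A ==> z : A ==> integral_over A z"
 unfolding integral_over_def
 by (rule bexI[of _ "[:-z, 1:]"]) (auto intro!: poly_over_pCons poly_over_const simp: subr_1 subr_uminus)

lemma integral_power_span:
 fixes z :: "'a::field"
 assumes B: "subr B" and z: "integral_over B z"
 shows "EX d>0. adjoin (B Un {z}) <= lspan B ((%i. z ^ i) ` {..<d})"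
proof -
 obtain P where P: "P : poly_over B" "lead_coeff P = 1" "poly P z = 0" using z by (auto simp: integral_over_def)
 define d where "d = degree P"
 have d0: "d > 0"
 proof (rule ccontr)
  assume "~ d > 0"
  then obtain c where "P = [:c:]" by (metis d_def degree_eq_zeroE neq0_conv)
  thus False using P by auto
 qed
 let ?W = "lspan B ((%i. z ^ i) ` {..<d})"
 note Wm = lspan_submod[OF B, of "(%i. z ^ i) ` {..<d}"]
 have pw: "z ^ i : ?W" if "i < d" for i using lspan_incl[OF B, of "(%i. z ^ i) ` {..<d}"] that by auto
 have zd: "z ^ d : ?W"
 proof -
  have "0 = (\<Sum>i<d. coeff P i * z ^ i) + z ^ d"
   using P by (simp add: poly_altdef d_def flip: lessThan_Suc_atMost)
  hence "z ^ d = (\<Sum>i<d. - coeff P i * z ^ i)" by (simp add: sum_negf eq_neg_iff_add_eq_0 add.commute)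
  moreover have "(\<Sum>i<d. - coeff P i * z ^ i) : ?W"
   using P B pw by (intro submod_sum[OF Wm] submod_mult[OF Wm]) (auto simp: poly_over_def intro!: subr_uminus)
  ultimately show ?thesis by simp
 qed
 have "z * w : ?W" if "w : ?W" for w using that
 proof induction
  case (lspan_step x b s)
  then obtain i where i: "s = z ^ i" "i < d" by auto
  have "z * s : ?W" using i pw[of "Suc i"] zd by (cases "Suc i < d") (auto simp: not_less_eq less_Suc_eq)
  hence "b * (z * s) + z * x : ?W" using lspan_step by (intro submod_step[OF Wm])
  thus ?case by (simp add: algebra_simps)
 qed (simp add: lspan_0)
 hence "adjoin (B Un {z}) <= ?W"
  using pw[OF d0] by (intro adjoin_in_module[OF Wm]) (auto intro: lspan_0 submod_uminus[OF Wm B])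
 thus ?thesis using d0 by blast
qed

lemma lspan_products:
 assumes A: "subr A" and b: "b : lspan A T" and c: "c : P" shows "b * c : lspan A {x * y | x y. x : T & y : P}"
 using b
proof induction
 case (lspan_step x a s)
 have "a * (s * c) + x * c : lspan A {x * y | x y. x : T & y : P}"
  by (rule submod_step[OF lspan_submod[OF A] lspan_step(2) subsetD[OF lspan_incl[OF A]] lspan_step(4)]) (use lspan_step c in auto)
 thus ?case by (simp add: algebra_simps)
qed (simp add: lspan.lspan_0)

lemma integral_finite_step:
 fixes A :: "'a::field set"
 assumes A: "subr A" and T: "finite T" "B <= lspan A T" and B: "subr B" and s: "integral_over B s"
 shows "EX Q. finite Q & adjoin (B Un {s}) <= lspan A Q & (ALL q:Q. EX t:T. EX i. q = t * s ^ i)"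
proof -
 obtain d where d: "adjoin (B Un {s}) <= lspan B ((%i. s ^ i) ` {..<d})" using integral_power_span[OF B s] by blast
 let ?P = "(%i. s ^ i) ` {..<d}" let ?Q = "{x * y | x y. x : T & y : ?P}"
 have "lspan B ?P <= lspan A ?Q"
 proof
  fix z assume "z : lspan B ?P"
  thus "z : lspan A ?Q"
  proof induction
   case (lspan_step x b p)
   thus ?case using T(2) lspan_products[OF A, of b T p ?P] lspan_add by blast
  qed (rule lspan.lspan_0)
 qed
 moreover have "finite ?Q" by (rule finite_image_set2) (use T(1) in auto)
 ultimately show ?thesis using d by (intro exI[of _ ?Q]) blast
qed

lemma integral_finite:
 fixes A :: "'a::field set"
 assumes A: "subr A" and "finite S" "!!s. s : S ==> integral_over A s"
 shows "EX T. finite T & T <= adjoin (A Un S) & adjoin (A Un S) <= lspan A T"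
 using assms(2,3)
proof (induction S rule: finite_induct)
 case empty
 have "adjoin A <= lspan A {1}" unfolding lspan_one[OF A] by (rule adjoin_min[OF A order.refl])
 thus ?case using subr_1[OF adjoin_subr] by (intro exI[of _ "{1}"]) auto
next
 case (insert s S)
 let ?B = "adjoin (A Un S)" and ?C = "adjoin (A Un insert s S)"
 obtain T where T: "finite T" "T <= ?B" "?B <= lspan A T" using insert by auto
 have "A <= ?B" using adjoin_incl by blast
 hence "integral_over ?B s" using integral_over_mono[of A s] insert by auto
 from integral_finite_step[OF A T(1,3) adjoin_subr this] obtain Q where
  Q: "finite Q" "adjoin (?B Un {s}) <= lspan A Q" "ALL q:Q. EX t:T. EX i. q = t * s ^ i" by blast
 have "?C <= adjoin (?B Un {s})"
  by (rule adjoin_mono) (use adjoin_incl[of "A Un S"] in auto)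
 moreover have "Q <= ?C"
 proof -
  have "?B <= ?C" "s : ?C" using adjoin_mono[of "A Un S" "A Un insert s S"] adjoin_incl[of "A Un insert s S"] by auto
  note C = adjoin_subr[of "A Un insert s S"]
  show ?thesis
  proof
   fix q assume "q : Q"
   then obtain t i where "t : T" "q = t * s ^ i" using Q(3) by blast
   thus "q : ?C" using subr_mult[OF C _ subr_power[OF C `s : ?C`]] `?B <= ?C` T(2) by blast
  qed
 qed
 ultimately show ?case using Q(1,2) by (meson dual_order.trans)
qed

lemma integral_bounded:
 fixes A :: "'a::field set"
 assumes A: "subr A" "fractions A" and S: "finite S" "!!s. s : S ==> integral_over A s" and z: "integral_over (adjoin (A Un S)) z"
 shows "EX d:A. d ~= 0 & (ALL b:adjoin (adjoin (A Un S) Un {z}). d * b : A)"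
proof -
 obtain T where T: "finite T" "adjoin (A Un S) <= lspan A T" using integral_finite[OF A(1) S] by blast
 obtain Q where Q: "finite Q" "adjoin (adjoin (A Un S) Un {z}) <= lspan A Q"
  using integral_finite_step[OF A(1) T adjoin_subr z] by blast
 obtain d where d: "d : A" "d ~= 0" "!!s. s : Q ==> d * s : A" by (rule common_denominator[OF A Q(1)]) blast
 show ?thesis using d(1,2) lspan_denominator[OF A(1) d(3)] Q(2) by blast
qed

lemma integral_inverse:
 fixes u :: "'a::field"
 assumes u: "integral_over A u" "u ~= 0" and C: "subr C" "A <= C" "inverse u : C" shows "u : C"
proof -
 obtain P where P: "P : poly_over A" "lead_coeff P = 1" "poly P u = 0" using u by (auto simp: integral_over_def)
 define d where "d = degree P"
 have d0: "d > 0"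
 proof (rule ccontr)
  assume "~ d > 0"
  then obtain c where "P = [:c:]" by (metis d_def degree_eq_zeroE neq0_conv)
  thus False using P by auto
 qed
 have "0 = (\<Sum>i<d. coeff P i * u ^ i) + u ^ d" using P by (simp add: poly_altdef d_def flip: lessThan_Suc_atMost)
 hence "u ^ d = - (\<Sum>i<d. coeff P i * u ^ i)" by (simp add: eq_neg_iff_add_eq_0 add.commute)
 hence "u ^ d * inverse u ^ (d - 1) = (\<Sum>i<d. - coeff P i * (u ^ i * inverse u ^ (d - 1)))"
  by (simp add: sum_distrib_right sum_negf mult.assoc)
 also have "u ^ i * inverse u ^ (d - 1) = inverse u ^ (d - 1 - i)" if "i < d" for i
  using that u(2) power_add[of "inverse u" i "d - 1 - i"] by (simp add: field_simps flip: power_mult_distrib)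
 hence "(\<Sum>i<d. - coeff P i * (u ^ i * inverse u ^ (d - 1))) = (\<Sum>i<d. - coeff P i * inverse u ^ (d - 1 - i))" by simp
 also have "u ^ d * inverse u ^ (d - 1) = u" using d0 u(2) by (cases d) (simp_all flip: power_mult_distrib)
 finally have "u = (\<Sum>i<d. - coeff P i * inverse u ^ (d - 1 - i))" .
 moreover have "\<dots> : C" using P(1) C by (intro subr_sum[OF C(1)] subr_mult[OF C(1)] subr_uminus[OF C(1)] subr_power[OF C(1)]) (auto simp: poly_over_def)
 ultimately show ?thesis by simp
qed

context field_over
begin

text \<open>An element all of whose powers have a common denominator satisfies a monic equation whose
 coefficients are constants apart from the last one.\<close>

lemma almost_integral_relation:
 assumes A: "FD A" and c: "c : A" "c ~= 0" "!!n. c * z ^ n : A"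
 obtains a P where "a : A" "lead_coeff P = 1" "degree P > 0" "evp P z = a"
proof -
 have As: "subr A" using FD_subr[OF A] .
 obtain n where n: "fcn n A ((*) c ` A)" using A c by (auto simp: FD_def fc_def)
 (* The exponents start at 1, so that the relation is not a constant. *)
 have "dep ((*) c ` A) {..<n} (%i. c * z ^ Suc i)" by (rule fcnD[OF n c(3)])
 then obtain e i where e: "(\<Sum>i<n. \<iota> (e i) * (c * z ^ Suc i)) : (*) c ` A" "i < n" "e i ~= 0"
  by (auto simp: dep_def)
 then obtain a where a: "(\<Sum>i<n. \<iota> (e i) * (c * z ^ Suc i)) = c * a" "a : A" by blast
 have "(\<Sum>i<n. \<iota> (e i) * (c * z ^ Suc i)) = c * (\<Sum>i<n. \<iota> (e i) * z ^ Suc i)"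
  unfolding sum_distrib_left by (intro sum.cong) (simp_all add: ac_simps)
 hence s: "(\<Sum>i<n. \<iota> (e i) * z ^ Suc i) = a" using a c by simp
 define Q where "Q = (\<Sum>i<n. monom (e i) (Suc i))"
 have "coeff Q (Suc i) = (\<Sum>j<n. if j = i then e j else 0)" unfolding Q_def coeff_sum by (intro sum.cong) auto
 also have "\<dots> = e i" using e by simp
 finally have Qi: "coeff Q (Suc i) ~= 0" using e by simp
 hence Q: "Q ~= 0" "degree Q > 0" using le_degree[OF Qi] by auto
 let ?l = "inverse (lead_coeff Q)"
 show ?thesis
 proof (rule that[of "\<iota> ?l * a" "smult ?l Q"])
  show "\<iota> ?l * a : A" using a FD_kk[OF A] by (intro subr_mult[OF As]) auto
  show "evp (smult ?l Q) z = \<iota> ?l * a" using s by (simp add: Q_def)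
 qed (use Q in auto)
qed

lemma relation_integral:
 assumes "subr A" "kk <= A" "a : A" "lead_coeff P = 1" "degree P > 0" "evp P z = a"
 shows "integral_over A z"
 unfolding integral_over_def
proof (rule bexI[of _ "map_poly \<iota> P - [:a:]"])
 have dm: "degree (map_poly \<iota> P) = degree P" by (rule degree_map_poly) (auto simp: \<iota>_0)
 show "map_poly \<iota> P - [:a:] : poly_over A"
  using poly_over_evp[of P] assms by (intro subr_diff[OF poly_over_subr] poly_over_const) (auto simp: poly_over_def)
 have "degree (map_poly \<iota> P - [:a:]) = degree P"
  using degree_add_eq_left[of "- [:a:]" "map_poly \<iota> P"] dm assms(5) by (simp only: diff_conv_add_uminus) simp
 thus "lead_coeff (map_poly \<iota> P - [:a:]) = 1 & poly (map_poly \<iota> P - [:a:]) z = 0"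
  using assms by (auto simp: coeff_map_poly \<iota>_0 \<iota>_1 evp_def[symmetric] coeff_pCons split: nat.splits)
qed

lemma integral_iff_almost:
 assumes A: "FD A" "fractions A"
 shows "integral_over A z \<longleftrightarrow> (EX c:A. c ~= 0 & (ALL n. c * z ^ n : A))"
proof
 have As: "subr A" using FD_subr[OF A(1)] .
 assume "integral_over A z"
 from integral_over_mono[OF this] have "integral_over (adjoin (A Un {})) z" using adjoin_incl[of "A Un {}"] by simp
 from integral_bounded[OF As A(2) finite.emptyI _ this] obtain d where
  d: "d : A" "d ~= 0" "ALL b:adjoin (adjoin (A Un {}) Un {z}). d * b : A" by auto
 have "z ^ n : adjoin (adjoin (A Un {}) Un {z})" for n
  using adjoin_incl[of "adjoin (A Un {}) Un {z}"] by (intro subr_power adjoin_subr) auto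
 thus "EX c:A. c ~= 0 & (ALL n. c * z ^ n : A)" using d by blast
next
 assume "EX c:A. c ~= 0 & (ALL n. c * z ^ n : A)"
 then obtain c where "c : A" "c ~= 0" "!!n. c * z ^ n : A" by blast
 from almost_integral_relation[OF A(1) this] show "integral_over A z"
  using relation_integral[OF FD_subr[OF A(1)] FD_kk[OF A(1)]] by metis
qed

lemma integral_closure_props:
 assumes A: "FD A" "fractions A"
 shows "subr (icl A)" "A <= icl A" "FD (icl A)"
  "!!z. integral_over (icl A) z ==> z : icl A"
proof -
 have As: "subr A" using FD_subr[OF A(1)] .
 show sub: "A <= icl A" using integral_self[OF As] by (auto simp: integral_closure_iff)
 have mem: "z : icl A" if S: "finite S" "S <= icl A" "integral_over (adjoin (A Un S)) z" for S z
 proof -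
  let ?C = "adjoin (adjoin (A Un S) Un {z})"
  obtain d where d: "d : A" "d ~= 0" "ALL b:?C. d * b : A"
   using integral_bounded[OF As A(2) S(1) _ S(3)] S(2) integral_closure_iff by blast
  have "z ^ n : ?C" for n
   using adjoin_incl[of "adjoin (A Un S) Un {z}"] by (intro subr_power adjoin_subr) auto
  thus ?thesis unfolding integral_closure_iff integral_iff_almost[OF A] using d by blast
 qed
 show sr: "subr (icl A)" unfolding subr_def
 proof (intro conjI ballI)
  show "1 : icl A" using sub subr_1[OF As] by blast
  fix x y assume xy: "x : icl A" "y : icl A"
  have in_gen: "x : adjoin (A Un {x, y})" "y : adjoin (A Un {x, y})"
   using adjoin_incl[of "A Un {x, y}"] by auto
  note g = adjoin_subr[of "A Un {x, y}"]
  show "x - y : icl A" "x * y : icl A"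
   using mem[of "{x, y}"] xy integral_self[OF g] subr_diff[OF g in_gen] subr_mult[OF g in_gen] by auto
 qed
 show "FD (icl A)" by (rule krull_akizuki[OF A sr sub])
 fix z assume "integral_over (icl A) z"
 then obtain P where P: "P : poly_over (icl A)" "lead_coeff P = 1" "poly P z = 0" by (auto simp: integral_over_def)
 let ?S = "coeff P ` {..degree P}"
 have "coeff P i : adjoin (A Un ?S)" for i
  using adjoin_incl[of "A Un ?S"] subr_0[OF adjoin_subr] by (cases "i <= degree P") (auto simp: coeff_eq_0)
 hence "integral_over (adjoin (A Un ?S)) z" unfolding integral_over_def poly_over_def using P by auto
 thus "z : icl A" by (intro mem[of ?S]) (use P(1) in \<open>auto simp: poly_over_def\<close>)
qed

text \<open>Almost integrality passes to localizations: by approximation z can be replaced by an element y that is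
 regular at all other primes, and y is almost integral over the integral closure itself.\<close>

lemma localized_closure_almost:
 assumes A: "FD A" "fractions A" and P: "prime_of (icl A) P"
  and a: "a : localization (icl A) P" "a ~= 0" "!!n. a * z ^ n : localization (icl A) P"
 shows "z : localization (icl A) P"
proof -
 let ?B = "icl A"
 note B = integral_closure_props[OF A]
 have fB: "fractions ?B" by (rule fractions_mono[OF A(2) B(2)])
 have loc: "nloc ?B ?B q = localization ?B q" if "prime_of ?B q" for q
  using nloc_eq_lspan[OF B(1) that submod_self[OF B(1)]] lspan_lspan[OF B(1) localization_subr[OF B(1) that] localization_incl[OF B(1) that], of "{1}"]
  by (simp add: lspan_one[OF B(1)] lspan_one[OF localization_subr[OF B(1) that]])
 note L = localization_subr[OF B(1) P]
 obtain c s where c: "a = c / s" "c : ?B" "s : ?B" "s ~: P" using a(1) unfolding localization_iff by blast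
 have c0: "c ~= 0" using c a(2) by auto
 have cz: "c * z ^ n : localization ?B P" for n
  using subr_mult[OF L subsetD[OF localization_incl[OF B(1) P] c(3)] a(3)[of n]] a(2) unfolding c(1) by (cases "s = 0") auto
 obtain y where y: "y - z : localization ?B P" "!!q. prime_of ?B q ==> q ~= P ==> y : localization ?B q"
  using approximation1[OF B(3) fB submod_self[OF B(1)] subr_1[OF B(1)] one_neq_zero P, of z] loc P by metis
 (* At P the powers of y = z + (y - z) are controlled by those of z. *)
 have "c * z ^ m * y ^ n : localization ?B P" for m n
 proof (induction n arbitrary: m)
  case (Suc n)
  have "c * z ^ m * y ^ Suc n = (y - z) * (c * z ^ m * y ^ n) + c * z ^ Suc m * y ^ n" by (simp add: algebra_simps)
  thus ?case using subr_add[OF L subr_mult[OF L y(1) Suc[of m]] Suc[of "Suc m"]] by (simp only:)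
 qed (use cz in simp)
 from this[of 0] have cy: "c * y ^ n : localization ?B q" if q: "prime_of ?B q" for n q
  using subr_mult[OF localization_subr[OF B(1) q] subsetD[OF localization_incl[OF B(1) q] c(2)] subr_power[OF localization_subr[OF B(1) q] y(2)[OF q]]]
  by (cases "q = P") auto
 have "c * y ^ n : ?B" for n
  using local_global_module[OF B(1) submod_self[OF B(1)] subr_1[OF B(1)], of "c * y ^ n"] cy loc by auto
 hence "y : ?B" using B(4) integral_iff_almost[OF B(3) fB] c(2) c0 by blast
 thus ?thesis using subr_diff[OF L _ y(1), of y] localization_incl[OF B(1) P] by auto
qed

text \<open>A longest product of nonunits outside of a R is annihilated by the maximal ideal modulo a R; divided by \<open>a\<close> it
 is the required element.\<close>

lemma socle_element:
 assumes R: "loc_ring R" "FD R" and m: "mm R ~= {0}"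
 obtains z where "z ~: R" "!!h. h : mm R ==> z * h : R"
proof -
 have Rs: "subr R" using R by (simp add: loc_ring_def)
 have sm: "submod R (mm R)" by (rule nonunits_submod[OF R(1)])
 obtain a where a: "a : mm R" "a ~= 0" using m nonunits_0[OF Rs] by blast
 have aR: "a : R" using a nonunits_sub by blast
 define Q where "Q n \<longleftrightarrow> (ALL f::nat=>'a. (ALL i<n. f i : mm R) --> (\<Prod>i<n. f i) : (*) a ` R)" for n
 have "a : (*) a ` R" using subr_1[OF Rs] by force
 from prod_nonunits_mem[OF R submod_principal[OF Rs] this aR a(2)] obtain N where "Q N" unfolding Q_def by blast
 moreover have "~ Q 0"
 proof
  assume "Q 0"
  hence "1 : mm R" using submod_mult'[OF sm _ a(1)] unfolding Q_def by fastforce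
  thus False using nonunits_1[OF Rs] by simp
 qed
 ultimately obtain n where n: "~ Q n" "Q (Suc n)" using first_change[of "%n. ~ Q n"] by blast
 then obtain f :: "nat => 'a" where f: "ALL i<n. f i : mm R" "(\<Prod>i<n. f i) ~: (*) a ` R" by (auto simp: Q_def)
 show ?thesis
 proof (rule that[of "(\<Prod>i<n. f i) / a"])
  show "(\<Prod>i<n. f i) / a ~: R"
  proof
   assume "(\<Prod>i<n. f i) / a : R"
   hence "a * ((\<Prod>i<n. f i) / a) : (*) a ` R" by (rule imageI)
   thus False using f(2) a(2) by simp
  qed
  fix h assume "h : mm R"
  hence "ALL i<Suc n. (f(n := h)) i : mm R" using f by (auto simp: less_Suc_eq)
  hence "(\<Prod>i<Suc n. (f(n := h)) i) : (*) a ` R" using n(2) unfolding Q_def by blast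
  then obtain r where "(\<Prod>i<n. f i) * h = a * r" "r : R" by auto
  thus "(\<Prod>i<n. f i) / a * h : R" using a(2) by simp
 qed
qed

text \<open>Let z be outside of R with \<open>z m <= R\<close>, where m is the maximal ideal.  If \<open>a z\<^sup>n\<close> and \<open>b z\<^sup>n\<close> were in
 m for all n, then z would be almost integral; so one of them is a unit for some n for which both
 are in R.\<close>

lemma almost_closed_valuation:
 assumes R: "loc_ring R" "FD R" "fractions R"
  and closed: "!!a z. a : R ==> a ~= 0 ==> (!!n. a * z ^ n : R) ==> z : R" and y: "y ~= 0"
 shows "y : R | inverse y : R"
proof (cases "mm R = {0}")
 case False
 note Rs = loc_ring_subr[OF R(1)]
 obtain z where z: "z ~: R" "!!h. h : mm R ==> z * h : R" using socle_element[OF R(1,2) False] by blast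
 obtain a b where ab: "a : R" "b : R" "b ~= 0" "y = a / b" using R(3) unfolding fractions_def by metis
 have a0: "a ~= 0" using ab y by auto
 show ?thesis
 proof (cases "EX p. a * p : R & b * p : R & (a * p ~: mm R | b * p ~: mm R)")
  case True
  then obtain p where p: "a * p : R" "b * p : R" "a * p ~: mm R | b * p ~: mm R" by blast
  show ?thesis
  proof (cases "a * p : mm R")
   case True
   hence "b * p ~= 0 & inverse (b * p) : R" using p unit_inverse by blast
   hence "a * p * inverse (b * p) : R" "a * p * inverse (b * p) = y" using subr_mult[OF Rs p(1)] ab(4) by (auto simp: divide_inverse)
   thus ?thesis by simp
  next
   case False
   hence "a * p ~= 0 & inverse (a * p) : R" using p unit_inverse by blast
   hence "b * p * inverse (a * p) : R" "b * p * inverse (a * p) = inverse y" using subr_mult[OF Rs p(2)] ab(4) by (auto simp: divide_inverse)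
   thus ?thesis by simp
  qed
 next
  case False
  have "a * z ^ n : R & b * z ^ n : R" for n
  proof (induction n)
   case (Suc n)
   hence "z * (a * z ^ n) : R" "z * (b * z ^ n) : R" using False z(2) by blast+
   thus ?case by (simp add: ac_simps)
  qed (use ab in simp)
  thus ?thesis using closed[OF ab(1) a0] z(1) by blast
 qed
qed (use fractions_nonunits_zero[OF loc_ring_subr[OF R(1)] R(3)] in blast)

lemma localized_closure_valuation:
 assumes A: "FD A" "fractions A" and P: "prime_of (icl A) P" and z: "z ~= 0"
 shows "z : localization (icl A) P | inverse z : localization (icl A) P"
proof -
 note B = integral_closure_props[OF A]
 note L = localization_subr[OF B(1) P] localization_incl[OF B(1) P] and fB = fractions_mono[OF A(2) B(2)]
 show ?thesis
  by (rule almost_closed_valuation[OF localization_loc_ring[OF B(1) P] krull_akizuki[OF B(3) fB L] fractions_mono[OF fB L(2)]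
   localized_closure_almost[OF A P] z])
qed

text \<open>A prime of the integral closure of R over the maximal ideal gives a local ring that dominates R and also dominates a
 localization of the integral closure of A.  The latter is a valuation ring, so that both agree.\<close>

lemma lying_over:
 assumes A: "FD A" "fractions A" and R: "loc_ring R" "A <= R"
 obtains P where "prime_of (icl A) P" "dominated R (localization (icl A) P)"
proof -
 let ?B = "icl A" and ?D = "icl R"
 note Rs = loc_ring_subr[OF R(1)]
 note B = integral_closure_props[OF A]
 have FR: "FD R" and fR: "fractions R" using krull_akizuki[OF A Rs R(2)] fractions_mono[OF A(2) R(2)] by auto
 note D = integral_closure_props[OF FR fR]
 have BD: "?B <= ?D" using integral_over_mono[OF _ R(2)] by (auto simp: integral_closure_iff)
 show ?thesis
 proof (cases "mm R = {0}")
  case True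
  hence "R = UNIV" using fractions_nonunits_zero[OF Rs fR] by blast
  moreover have "localization ?B {0} = UNIV" using nloc_zero[OF B(1) fractions_mono[OF A(2) B(2)] submod_self[OF B(1)] subr_1[OF B(1)]]
    nloc_eq_lspan[OF B(1) prime_of_zero[OF B(1)] submod_self[OF B(1)]]
    lspan_min[OF submod_self[OF localization_subr[OF B(1) prime_of_zero[OF B(1)]]] localization_incl[OF B(1) prime_of_zero[OF B(1)]]] by auto
  ultimately show ?thesis using that[OF prime_of_zero[OF B(1)]] dominated_refl[of UNIV] by simp
 next
  case False
  then obtain \<pi> where \<pi>: "\<pi> : mm R" "\<pi> ~= 0" using nonunits_0[OF Rs] by blast
  have \<pi>R: "\<pi> : R" using \<pi> nonunits_sub by blast
  have "inverse \<pi> ~: ?D" using integral_inverse[of R "inverse \<pi>" R] Rs \<pi> \<pi>R unfolding integral_closure_iff by (auto simp: nonunits_def)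
  hence "1 ~: (*) \<pi> ` ?D" using inverse_unique[of \<pi>] by (metis imageE)
  moreover have "(*) \<pi> ` ?D <= ?D" using subr_mult[OF D(1)] D(2) \<pi>R by blast
  ultimately obtain q where q: "prime_of ?D q" "(*) \<pi> ` ?D <= q" using prime_exists[OF D(1) submod_principal[OF D(1)]] by blast
  let ?L = "localization ?D q"
  have L: "loc_ring ?L" "?D <= ?L" using localization_loc_ring[OF D(1) q(1)] localization_incl[OF D(1) q(1)] by auto
  have RL: "R <= ?L" and BL: "?B <= ?L" using D(2) BD L(2) by auto
  have "\<pi> : q" using q(2) subr_1[OF D(1)] by force
  hence "\<pi> : R Int mm ?L" using localization_contract[OF D(1) q(1)] \<pi>R by blast
  hence "mm R = R Int mm ?L"
   using FD_maximal[OF FR center_prime[OF L(1) Rs RL] _ nonunits_prime[OF R(1)]] \<pi>(2) RL by (auto simp: nonunits_def)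
  hence RD: "dominated R ?L" using RL by (simp add: dominated_def)
  let ?P = "?B Int mm ?L" let ?S = "localization ?B ?P"
  have P: "prime_of ?B ?P" by (rule center_prime[OF L(1) B(1) BL])
  note dom = localization_center(2)[OF L(1) B(1) BL]
  have "?L = ?S"
  proof (rule dominated_valuation[OF dom localization_subr[OF B(1) P]])
   show "z : ?S | inverse z : ?S" for z
    using localized_closure_valuation[OF A P, of z] subr_0[OF localization_subr[OF B(1) P]] by (cases "z = 0") auto
  qed
  thus ?thesis using that[OF P] RD by simp
 qed
qed

end

section \<open>Integral schemes through their local rings\<close>

definition point_prime :: "('p, 'a::field) rspace => 'p set => 'p => 'a set" where
 "point_prime X U x = sections X U Int mm (stalk X x)"

lemma topspace_spec: "subr A ==> topspace (spec A) = {p. prime_of A p}"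
 unfolding spec_def topology_generated_by_topspace using prime_ofD(3)[of A] subr_1[of A]
 by (auto simp: primeideal_iff)

lemma spec_basis:
 assumes A: "subr (A :: 'c::comm_ring_1 set)" and W: "openin (spec A) W" "p : W"
 shows "EX f:A. f ~: p & (ALL q. prime_of A q & f ~: q --> q : W)"
proof -
 let ?G = "{{p. primeideal p (ring_on A) & f ~: p} | f. f : A}"
 have tp: "prime_of A p"
  using W openin_subset[OF W(1)] unfolding spec_def topology_generated_by_topspace by (auto simp: primeideal_iff[OF A])
 have "generate_topology_on ?G W" using W(1) unfolding spec_def by (simp add: openin_topology_generated_by_iff)
 hence "p : W ==> EX f:A. f ~: p & (ALL q. prime_of A q & f ~: q --> q : W)" for p
 proof (induction arbitrary: p)
  case (Int a b)
  then obtain f g where fg: "f : A" "f ~: p" "ALL q. prime_of A q & f ~: q --> q : a"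
   "g : A" "g ~: p" "ALL q. prime_of A q & g ~: q --> q : b" by blast
  have "openin (spec A) a" unfolding spec_def openin_topology_generated_by_iff by (rule Int)
  hence "p : topspace (spec A)" using openin_subset[of "spec A" a] Int.prems by blast
  hence pA: "prime_of A p" unfolding spec_def topology_generated_by_topspace by (auto simp: primeideal_iff[OF A])
  have "f * g : A" "f * g ~: p" using fg subr_mult[OF A] prime_ofD(4)[OF pA] by blast+
  moreover have "f ~: q & g ~: q" if "prime_of A q" "f * g ~: q" for q
   using that fg submod_mult[OF prime_ofD(1)[OF that(1)]] submod_mult'[OF prime_ofD(1)[OF that(1)]] by blast
  ultimately show ?case using fg by (intro bexI[of _ "f * g"]) auto
 next
  case (UN K)
  then obtain k where k: "k : K" "p : k" by blast
  thus ?case using UN(2)[OF k] by blast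
 next
  case (Basis s)
  thus ?case by (auto simp: primeideal_iff[OF A])
 qed auto
 thus ?thesis using W(2) by blast
qed

lemma openin_spec_basic: "f : A ==> subr A ==> openin (spec A) {p. prime_of A p & f ~: p}"
 unfolding spec_def by (rule topology_generated_by_Basis) (auto simp: primeideal_iff)

locale scheme =
 fixes X :: "('p, 'a::field) rspace"
 assumes integral: "integral_scheme X"
begin

abbreviation "pts \<equiv> topspace (points X)"
abbreviation "\<O> \<equiv> sections X"
abbreviation "stk \<equiv> stalk X"
abbreviation "pp \<equiv> point_prime X"
abbreviation "nop \<equiv> nopen X"
abbreviation "bas \<equiv> basic_open X"
abbreviation "aff \<equiv> affine_open X"

lemma nopen_Int: "nop U ==> nop V ==> nop (U Int V)"
 using integral by (auto simp: integral_scheme_def nopen_def)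

lemma nopen_sub: "nop U ==> U <= pts"
 by (auto simp: nopen_def openin_subset)

lemma nopen_Union: "\<V> ~= {} ==> (!!V. V : \<V> ==> nop V) ==> nop (\<Union>\<V>)"
 by (auto simp: nopen_def)

lemma sections_subr: "nop U ==> subr (\<O> U)"
 using integral by (simp add: integral_scheme_def subring_iff_subr)

lemma sections_Union: "\<V> ~= {} ==> (!!V. V : \<V> ==> nop V) ==> \<O> (\<Union>\<V>) = (\<Inter>V\<in>\<V>. \<O> V)"
proof -
 assume "\<V> ~= {}" "!!V. V : \<V> ==> nop V"
 moreover have "ALL \<V>. \<V> ~= {} & (ALL V:\<V>. nop V) --> \<O> (\<Union>\<V>) = (\<Inter>V\<in>\<V>. \<O> V)"
  using integral unfolding integral_scheme_def by (elim conjE)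
 ultimately show ?thesis by simp
qed

lemma sections_mono: "nop U ==> nop V ==> V <= U ==> \<O> U <= \<O> V"
proof -
 assume "nop U" "nop V" "V <= U"
 moreover from this have "\<Union>{U, V} = U" by auto
 ultimately have "\<O> U = \<O> U Int \<O> V" using sections_Union[of "{U, V}"] by auto
 thus ?thesis by blast
qed

lemma affine_nopen: "aff U ==> nop U"
 by (simp add: affine_open_def)

lemma affine_cover: "x : pts ==> EX U. aff U & x : U"
 using integral by (simp add: integral_scheme_def)

lemma stalk_iff: "z : stk x \<longleftrightarrow> (EX U. openin (points X) U & x : U & z : \<O> U)"
 unfolding stalk_def by auto

lemma stalk_nopen: "nop U ==> x : U ==> \<O> U <= stk x"
 by (auto simp: stalk_iff nopen_def)

lemma stalk_affine: "aff U ==> x : U ==> \<O> U <= stk x"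
 by (rule stalk_nopen[OF affine_nopen])

lemma affine_sub: "aff U ==> U <= pts"
 by (rule nopen_sub[OF affine_nopen])

lemma sections_eq_stalks: "nop W ==> \<O> W = (\<Inter>x\<in>W. stk x)"
proof (intro equalityI subsetI)
 assume W: "nop W"
 show "z : (\<Inter>x\<in>W. stk x)" if "z : \<O> W" for z using that stalk_nopen[OF W] by blast
 fix z assume z: "z : (\<Inter>x\<in>W. stk x)"
 have "EX V. nop V & V <= W & x : V & z : \<O> V" if x: "x : W" for x
 proof -
  obtain U where U: "openin (points X) U" "x : U" "z : \<O> U" using z x by (auto simp: stalk_iff)
  hence nU: "nop U" by (auto simp: nopen_def)
  have "\<O> U <= \<O> (U Int W)" by (rule sections_mono[OF nU nopen_Int[OF nU W]]) auto
  thus ?thesis using nopen_Int[OF nU W] U x by blast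
 qed
 then obtain V where V: "!!x. x : W ==> nop (V x) & V x <= W & x : V x & z : \<O> (V x)" by metis
 have "\<O> (\<Union>(V ` W)) = (\<Inter>U\<in>V ` W. \<O> U)" using W V by (intro sections_Union) (auto simp: nopen_def)
 moreover have "\<Union>(V ` W) = W" using V by blast
 ultimately show "z : \<O> W" using V by auto
qed

context
 fixes U assumes U: "aff U"
begin

lemma affine_homeo: "homeomorphic_map (subtopology (points X) U) (spec (\<O> U)) (pp U)"
 using U unfolding affine_open_def point_prime_def by blast

lemma affine_subr: "subr (\<O> U)"
 by (rule sections_subr[OF affine_nopen[OF U]])

lemma affine_topspace: "topspace (subtopology (points X) U) = U"
 using nopen_sub[OF affine_nopen[OF U]] by auto

lemma pp_prime: "x : U ==> prime_of (\<O> U) (pp U x)"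
 using homeomorphic_imp_surjective_map[OF affine_homeo] unfolding affine_topspace topspace_spec[OF affine_subr] by auto

lemma pp_inj: "x : U ==> y : U ==> pp U x = pp U y ==> x = y"
 using homeomorphic_imp_injective_map[OF affine_homeo] unfolding affine_topspace by (auto dest: inj_onD)

lemma pp_surj: "prime_of (\<O> U) p ==> EX x:U. pp U x = p"
 using homeomorphic_imp_surjective_map[OF affine_homeo] unfolding affine_topspace topspace_spec[OF affine_subr]
 by (metis imageE mem_Collect_eq)

lemma basic_open_eq: "f : \<O> U ==> bas U f = {x : U. f ~: pp U x}"
 by (auto simp: basic_open_def point_prime_def)

lemma basic_open_openin: assumes f: "f : \<O> U" shows "openin (points X) (bas U f)"
proof -
 have "openin (subtopology (points X) U) {x : topspace (subtopology (points X) U). pp U x : {p. prime_of (\<O> U) p & f ~: p}}"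
  by (rule openin_continuous_map_preimage[OF homeomorphic_imp_continuous_map[OF affine_homeo] openin_spec_basic[OF f affine_subr]])
 also have "{x : topspace (subtopology (points X) U). pp U x : {p. prime_of (\<O> U) p & f ~: p}} = bas U f"
  unfolding affine_topspace basic_open_eq[OF f] using pp_prime by auto
 finally show ?thesis
  using openin_open_subtopology affine_nopen[OF U] unfolding nopen_def by blast
qed

lemma basic_open_nopen: assumes f: "f : \<O> U" "f ~= 0" shows "nop (bas U f)"
proof -
 obtain x where "x : U" "pp U x = {0}" using pp_surj[OF prime_of_zero[OF affine_subr]] by blast
 hence "x : bas U f" using f by (simp add: basic_open_eq)
 thus ?thesis using basic_open_openin[OF f(1)] by (auto simp: nopen_def)
qed

lemma basic_open_sections: "f : \<O> U ==> f ~= 0 ==> \<O> (bas U f) = {a / f ^ n | a n. a : \<O> U}"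
 using U by (simp add: affine_open_def)

lemma basic_open_basis:
 assumes W: "openin (points X) W" "x : W" "x : U"
 obtains f where "f : \<O> U" "f ~: pp U x" "f ~= 0" "x : bas U f" "bas U f <= W"
proof -
 let ?S = "subtopology (points X) U"
 have "openin ?S (W Int U)" using W by (auto simp: openin_subtopology)
 hence o: "openin (spec (\<O> U)) (pp U ` (W Int U))"
  using homeomorphic_imp_open_map[OF affine_homeo] by (simp add: open_map_def)
 have "pp U x : pp U ` (W Int U)" using W by blast
 from spec_basis[OF affine_subr o this] obtain f where f: "f : \<O> U" "f ~: pp U x"
  "!!q. prime_of (\<O> U) q ==> f ~: q ==> q : pp U ` (W Int U)" by blast
 have "f ~= 0" using f(2) submod_0[OF prime_ofD(1)[OF pp_prime[OF W(3)]]] by auto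
 moreover have "bas U f <= W"
 proof
  fix y assume "y : bas U f"
  hence y: "y : U" "f ~: pp U y" using basic_open_eq[OF f(1)] by auto
  then obtain z where "z : W Int U" "pp U y = pp U z" using f(3)[OF pp_prime[OF y(1)]] by blast
  thus "y : W" using pp_inj[of y z] y by auto
 qed
 moreover have "x : bas U f" using f W basic_open_eq by blast
 ultimately show ?thesis using that f by blast
qed

lemma stalk_eq_localization: assumes x: "x : U" shows "stk x = localization (\<O> U) (pp U x)"
proof (intro equalityI subsetI)
 fix z assume "z : stk x"
 then obtain W where W: "openin (points X) W" "x : W" "z : \<O> W" by (auto simp: stalk_iff)
 obtain f where f: "f : \<O> U" "f ~: pp U x" "f ~= 0" "x : bas U f" "bas U f <= W"
  using basic_open_basis[OF W(1,2) x] by blast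
 have "\<O> W <= \<O> (bas U f)"
  by (rule sections_mono) (use W f basic_open_nopen in \<open>auto simp: nopen_def\<close>)
 then obtain a n where "z = a / f ^ n" "a : \<O> U" using W basic_open_sections[OF f(1,3)] by blast
 moreover have "f ^ n : \<O> U" "f ^ n ~: pp U x"
  using subr_power[OF affine_subr f(1)] prime_of_power[OF pp_prime[OF x] affine_subr f(1)] f(2) by blast+
 ultimately show "z : localization (\<O> U) (pp U x)" unfolding localization_iff by blast
next
 fix z assume "z : localization (\<O> U) (pp U x)"
 then obtain a s where as: "z = a / s" "a : \<O> U" "s : \<O> U" "s ~: pp U x" unfolding localization_iff by blast
 have "s ~= 0" using loc_den[OF affine_subr pp_prime[OF x]] as by blast
 hence "z : \<O> (bas U s)" using as basic_open_sections[OF as(3)] by (auto intro!: exI[of _ a] exI[of _ "1::nat"])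
 moreover have "x : bas U s" using as x basic_open_eq by blast
 ultimately show "z : stk x" using basic_open_openin[OF as(3)] unfolding stalk_iff by blast
qed

lemma affine_fractions: "fractions (\<O> U)"
 unfolding fractions_def
proof
 fix z
 have "z : (\<Union>V\<in>{V. nop V}. \<O> V)" using integral by (simp add: integral_scheme_def)
 then obtain V where V: "nop V" "z : \<O> V" by blast
 obtain x where x: "x : U" "x : V" using nopen_Int[OF V(1) affine_nopen[OF U]] by (auto simp: nopen_def)
 hence "z : stk x" using V stalk_nopen by blast
 then obtain a s where "z = a / s" "a : \<O> U" "s : \<O> U" "s ~: pp U x"
  unfolding stalk_eq_localization[OF x(1)] localization_iff by blast
 thus "EX a b. a : \<O> U & b : \<O> U & b ~= 0 & z = a / b" using loc_den[OF affine_subr pp_prime[OF x(1)]] by blast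
qed

end

lemma stalk_loc_ring: "x : pts ==> loc_ring (stk x)"
 using affine_cover[of x] stalk_eq_localization localization_loc_ring affine_subr pp_prime by metis

lemma stalk_subr: "x : pts ==> subr (stk x)"
 using stalk_loc_ring loc_ring_subr by blast

lemma stalk_fractions: "x : pts ==> fractions (stk x)"
 using affine_cover[of x] fractions_mono[OF affine_fractions stalk_nopen[OF affine_nopen]] by metis

lemma generic_point:
 assumes "aff U" shows "EX x:U. stk x = UNIV"
proof -
 obtain x where x: "x : U" "pp U x = {0}" using pp_surj[OF assms prime_of_zero[OF affine_subr[OF assms]]] by blast
 have "localization (\<O> U) {0} = UNIV"
 proof (rule UNIV_eq_I[symmetric])
  fix z
  obtain a b where "a : \<O> U" "b : \<O> U" "b ~= 0" "z = a / b"
   using affine_fractions[OF assms] unfolding fractions_def by metis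
  thus "z : localization (\<O> U) {0}" unfolding localization_iff by auto
 qed
 thus ?thesis using x stalk_eq_localization[OF assms x(1)] by metis
qed

end

section \<open>Complete integral curves\<close>

locale complete_curve =
 fixes X :: "('p, 'a::field) rspace" and \<iota> :: "'k::alg_closed_field => 'a"
 assumes curve: "complete_integral_curve X \<iota>"
begin

sublocale scheme X
 using curve by unfold_locales (simp add: complete_integral_curve_def)

lemma \<iota>_hom: "\<iota> : ring_hom (ring_on UNIV) (ring_on (\<O> pts))"
 using curve by (simp add: complete_integral_curve_def over_field_def)

sublocale field_over \<iota>
 using \<iota>_hom by unfold_locales (auto simp: ring_hom_def ring_on_def)

lemma nopen_pts: "nop pts"
 using integral by (simp add: nopen_def integral_scheme_def)

lemma kk_sections: "nop U ==> kk <= \<O> U"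
 using \<iota>_hom sections_mono[OF nopen_pts, of U] nopen_sub[of U] by (auto simp: ring_hom_def ring_on_def)

lemma sep: "aff U ==> aff V ==> aff (U Int V)"
 "aff U ==> aff V ==> \<O> (U Int V) = adjoin (\<O> U Un \<O> V)"
 using curve by (auto simp: complete_integral_curve_def separated_def)

lemma finite_cover:
 obtains \<U> where "finite \<U>" "\<Union>\<U> = pts" "!!U. U : \<U> ==> aff U"
  "!!U. U : \<U> ==> EX S. finite S & \<O> U = adjoin (kk Un S)"
proof -
 have "finite_type X \<iota>" using curve by (simp add: complete_integral_curve_def)
 then obtain \<U> where "finite \<U>" "\<Union>\<U> = pts" "ALL U:\<U>. aff U & (EX S. finite S & \<O> U = adjoin (kk Un S))"
  unfolding finite_type_def by (elim exE conjE)
 thus ?thesis by (intro that) auto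
qed

text \<open>A chain of three prime ideals would give a chain of three irreducible closed sets.\<close>

lemma primes_maximal:
 assumes U: "aff U" and p: "prime_of (\<O> U) p" "p ~= {0}" and q: "prime_of (\<O> U) q" "p <= q"
 shows "q = p"
proof (rule ccontr)
 assume "q ~= p"
 note Us = affine_subr[OF U]
 obtain x0 x1 x2 where x: "x0 : U" "pp U x0 = {0}" "x1 : U" "pp U x1 = p" "x2 : U" "pp U x2 = q"
  using pp_surj[OF U prime_of_zero[OF Us]] pp_surj[OF U p(1)] pp_surj[OF U q(1)] by metis
 let ?Z = "%x. points X closure_of {x}"
 have UX: "U <= pts" using nopen_sub[OF affine_nopen[OF U]] .
 have spec: "y : ?Z z \<longleftrightarrow> pp U z <= pp U y" if yz: "y : U" "z : U" for y z
 proof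
  assume y: "y : ?Z z"
  show "pp U z <= pp U y"
  proof
   fix f assume f: "f : pp U z"
   hence fO: "f : \<O> U" by (simp add: point_prime_def)
   show "f : pp U y"
   proof (rule ccontr)
    assume "f ~: pp U y"
    hence "y : bas U f" using yz basic_open_eq[OF U fO] by blast
    hence "z : bas U f" using y basic_open_openin[OF U fO] by (auto simp: in_closure_of)
    thus False using f basic_open_eq[OF U fO] by blast
   qed
  qed
 next
  assume sub: "pp U z <= pp U y"
  have "z : W" if W: "openin (points X) W" "y : W" for W
  proof -
   obtain f where f: "f : \<O> U" "f ~: pp U y" "bas U f <= W" using basic_open_basis[OF U W yz(1)] by blast
   hence "z : bas U f" using sub yz basic_open_eq[OF U f(1)] by blast
   thus ?thesis using f by blast
  qed
  thus "y : ?Z z" using UX yz by (auto simp: in_closure_of)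
 qed
 have irr: "irreducible_closed (points X) (?Z x)" if "x : pts" for x
  unfolding irreducible_closed_def
 proof (intro conjI allI impI)
  show "closedin (points X) (?Z x)" by simp
  have xZ: "x : ?Z x" using that by (simp add: in_closure_of)
  thus "?Z x ~= {}" by blast
  fix A B assume AB: "closedin (points X) A & closedin (points X) B & ?Z x <= A Un B"
  hence "x : A | x : B" using xZ by blast
  thus "?Z x <= A | ?Z x <= B" using AB closure_of_minimal[of "{x}"] by blast
 qed
 have sub: "?Z y <= ?Z z" if "y : ?Z z" for y z
  by (rule closure_of_minimal) (use that in auto)
 have "?Z x2 \<subset> ?Z x1"
 proof
  show "?Z x2 <= ?Z x1" using spec[of x2 x1] x q by (intro sub) simp
  have "x1 ~: ?Z x2" "x1 : ?Z x1" using spec[of x1 x2] spec[of x1 x1] x q `q ~= p` by auto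
  thus "?Z x2 ~= ?Z x1" by blast
 qed
 moreover have "?Z x1 \<subset> ?Z x0"
 proof
  have "0 : p" using submod_0[OF prime_ofD(1)[OF p(1)]] .
  thus "?Z x1 <= ?Z x0" using spec[of x1 x0] x by (intro sub) simp
  have "x0 ~: ?Z x1" "x0 : ?Z x0" using spec[of x0 x1] spec[of x0 x0] x p `0 : p` by auto
  thus "?Z x1 ~= ?Z x0" by blast
 qed
 ultimately have "irreducible_chain (points X) (Suc 1)"
  unfolding irreducible_chain_def using irr x UX
  by (intro exI[of _ "%i. if i = 0 then ?Z x2 else if i = 1 then ?Z x1 else ?Z x0"]) (auto simp: less_Suc_eq)
 thus False using curve by (simp add: complete_integral_curve_def has_dimension_def)
qed

end

section \<open>Polynomials in several variables\<close>

abbreviation lk :: "('b \<Rightarrow>\<^sub>0 'c::zero) => 'b => 'c" where "lk \<equiv> Poly_Mapping.lookup"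
abbreviation supp :: "('b \<Rightarrow>\<^sub>0 'c::zero) => 'b set" where "supp \<equiv> Poly_Mapping.keys"
abbreviation mon :: "'b => 'c::zero => 'b \<Rightarrow>\<^sub>0 'c" where "mon \<equiv> Poly_Mapping.single"

abbreviation homog :: "nat => 'c::zero mpoly => bool" where "homog \<equiv> homogeneous_of_degree"

abbreviation hcomp :: "nat => 'c::comm_ring_1 mpoly => 'c mpoly" where "hcomp \<equiv> homogeneous_component"

definition monom_value :: "(nat => 'a::comm_ring_1) => (nat \<Rightarrow>\<^sub>0 nat) => 'a" where
 "monom_value v m = (\<Prod>i\<in>supp m. v i ^ lk m i)"

lemma monom_value_superset:
 "finite I ==> supp m <= I ==> monom_value v m = (\<Prod>i\<in>I. v i ^ lk m i)"
 unfolding monom_value_def by (rule prod.mono_neutral_left) (auto simp: in_keys_iff)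

lemma monom_value_add: "monom_value v (m + n) = monom_value v m * monom_value v n"
proof -
 let ?I = "supp m Un supp n"
 have "monom_value v (m + n) = (\<Prod>i\<in>?I. v i ^ lk (m + n) i)"
  by (rule monom_value_superset) (use Poly_Mapping.keys_add[of m n] in auto)
 also have "\<dots> = (\<Prod>i\<in>?I. v i ^ lk m i) * (\<Prod>i\<in>?I. v i ^ lk n i)"
  by (simp add: lookup_add power_add prod.distrib)
 also have "\<dots> = monom_value v m * monom_value v n"
  using monom_value_superset[of ?I m v] monom_value_superset[of ?I n v] by simp
 finally show ?thesis .
qed

lemma monom_value_0 [simp]: "monom_value v 0 = 1"
 by (simp add: monom_value_def)

lemma monom_value_single: "monom_value v (mon i k) = v i ^ k"
 by (cases "k = 0") (auto simp: monom_value_def)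

lemma evaluate_alt: "evaluate \<phi> v F = (\<Sum>m\<in>supp F. \<phi> (lk F m) * monom_value v m)"
 by (simp add: evaluate_def monom_value_def)

lemma mpoly_sum_single: "F = (\<Sum>m\<in>supp F. mon m (lk F m))"
proof (rule poly_mapping_eqI)
 fix k
 have "lk (\<Sum>m\<in>supp F. mon m (lk F m)) k = (\<Sum>m\<in>supp F. if m = k then lk F m else 0)"
  unfolding lookup_sum by (intro sum.cong) (auto simp: lookup_single when_def)
 also have "\<dots> = lk F k" by (auto simp: in_keys_iff)
 finally show "lk F k = lk (\<Sum>m\<in>supp F. mon m (lk F m)) k" by simp
qed

locale hom =
 fixes \<phi> :: "'c::comm_ring_1 => 'a::comm_ring_1"
 assumes hom_add: "\<phi> (a + b) = \<phi> a + \<phi> b" and hom_mult: "\<phi> (a * b) = \<phi> a * \<phi> b" and hom_1: "\<phi> 1 = 1"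
begin

lemma hom_0: "\<phi> 0 = 0"
proof -
 have "\<phi> 0 + 0 = \<phi> 0 + \<phi> 0" using hom_add[of 0 0] by simp
 thus ?thesis by (simp only: add_left_cancel)
qed

lemma evaluate_superset:
 "finite M ==> supp F <= M ==> evaluate \<phi> v F = (\<Sum>m\<in>M. \<phi> (lk F m) * monom_value v m)"
 unfolding evaluate_alt by (rule sum.mono_neutral_left) (auto simp: in_keys_iff hom_0)

lemma evaluate_add: "evaluate \<phi> v (F + G) = evaluate \<phi> v F + evaluate \<phi> v G"
proof -
 let ?M = "supp F Un supp G"
 have "evaluate \<phi> v (F + G) = (\<Sum>m\<in>?M. \<phi> (lk (F + G) m) * monom_value v m)"
  by (rule evaluate_superset) (use Poly_Mapping.keys_add[of F G] in auto)
 also have "\<dots> = (\<Sum>m\<in>?M. \<phi> (lk F m) * monom_value v m) + (\<Sum>m\<in>?M. \<phi> (lk G m) * monom_value v m)"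
  by (simp add: lookup_add hom_add distrib_right sum.distrib)
 also have "\<dots> = evaluate \<phi> v F + evaluate \<phi> v G"
  using evaluate_superset[of ?M F v] evaluate_superset[of ?M G v] by simp
 finally show ?thesis .
qed

lemma evaluate_0 [simp]: "evaluate \<phi> v 0 = 0"
 by (simp add: evaluate_def)

lemma evaluate_sum: "evaluate \<phi> v (sum f I) = (\<Sum>i\<in>I. evaluate \<phi> v (f i))"
 by (induction I rule: infinite_finite_induct) (auto simp: evaluate_add)

lemma evaluate_single: "evaluate \<phi> v (mon m c) = \<phi> c * monom_value v m"
 by (cases "c = 0") (auto simp: evaluate_alt hom_0)

lemma evaluate_mult: "evaluate \<phi> v (F * G) = evaluate \<phi> v F * evaluate \<phi> v G"
proof -
 let ?S = "%F. \<Sum>m\<in>supp F. mon m (lk F m)"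
 have "evaluate \<phi> v (F * G) = evaluate \<phi> v (?S F * ?S G)" by (simp flip: mpoly_sum_single)
 also have "\<dots> = (\<Sum>m\<in>supp F. \<Sum>n\<in>supp G. evaluate \<phi> v (mon m (lk F m)) * evaluate \<phi> v (mon n (lk G n)))"
  unfolding sum_product evaluate_sum mult_single evaluate_single
  by (simp add: hom_mult monom_value_add ac_simps)
 also have "\<dots> = evaluate \<phi> v (?S F) * evaluate \<phi> v (?S G)" unfolding evaluate_sum sum_product ..
 finally show ?thesis by (simp flip: mpoly_sum_single)
qed

lemma evaluate_1: "evaluate \<phi> v 1 = 1"
 using evaluate_single[of v 0 1] by (simp add: hom_1)

lemma evaluate_uminus: "evaluate \<phi> v (- F) = - evaluate \<phi> v F"
 using evaluate_add[of v F "- F"] by (simp add: eq_neg_iff_add_eq_0 add.commute)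

lemma evaluate_diff: "evaluate \<phi> v (F - G) = evaluate \<phi> v F - evaluate \<phi> v G"
 using evaluate_add[of v F "- G"] by (simp add: evaluate_uminus)

end

lemma hom_id: "hom (%x. x)" by unfold_locales auto

lemma (in field_over) hom_iota: "hom \<iota>" by unfold_locales (auto simp: \<iota>_add \<iota>_mult \<iota>_1)

lemma polynomials_single: "c : A ==> 0 : A ==> supp m <= {..<n} ==> mon m c : polynomials A n"
 by (auto simp: polynomials_def lookup_single when_def)

lemma polynomials_add: "subr A ==> F : polynomials A n ==> G : polynomials A n ==> F + G : polynomials A n"
proof -
 assume "subr A" "F : polynomials A n" "G : polynomials A n"
 moreover have "lk F m ~= 0 | lk G m ~= 0" if "lk (F + G) m ~= 0" for m using that by (auto simp: lookup_add)
 ultimately show ?thesis unfolding polynomials_def mem_Collect_eq by (metis lookup_add subr_add)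
qed

lemma polynomials_diff: "subr A ==> F : polynomials A n ==> G : polynomials A n ==> F - G : polynomials A n"
proof -
 assume "subr A" "F : polynomials A n" "G : polynomials A n"
 moreover have "lk F m ~= 0 | lk G m ~= 0" if "lk (F - G) m ~= 0" for m using that by (auto simp: lookup_minus)
 ultimately show ?thesis unfolding polynomials_def mem_Collect_eq by (metis lookup_minus subr_diff)
qed

lemma polynomials_sum: "subr A ==> (!!i. i : I ==> f i : polynomials A n) ==> sum f I : polynomials A n"
proof (induction I rule: infinite_finite_induct)
 case (insert x I)
 thus ?case by (simp add: polynomials_add)
qed (auto simp: polynomials_def subr_0)

lemma polynomials_const: "c : A ==> 0 : A ==> mon 0 c : polynomials A n"
 by (rule polynomials_single) auto

lemma polynomials_1: "subr A ==> 1 : polynomials A n"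
 using polynomials_const[of 1 A n] by (simp add: subr_0 subr_1)

lemma polynomials_mult:
 assumes A: "subr A" and F: "F : polynomials A n" and G: "G : polynomials A n" shows "F * G : polynomials A n"
proof -
 have "(\<Sum>m\<in>supp F. mon m (lk F m)) * (\<Sum>m\<in>supp G. mon m (lk G m)) : polynomials A n"
  unfolding sum_product mult_single
 proof (intro polynomials_sum A polynomials_single)
  fix m l assume ml: "m : supp F" "l : supp G"
  show "lk F m * lk G l : A" "0 : A" using F G A by (auto simp: polynomials_def intro: subr_mult subr_0)
  have "supp m <= {..<n}" "supp l <= {..<n}"
   using ml F G unfolding polynomials_def in_keys_iff by blast+
  thus "supp (m + l) <= {..<n}" using Poly_Mapping.keys_add[of m l] by blast
 qed
 thus ?thesis by (simp flip: mpoly_sum_single)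
qed

lemma polynomials_subr: "subr A ==> subr (polynomials A n)"
 unfolding subr_def[of "polynomials A n"] by (auto intro: polynomials_1 polynomials_diff polynomials_mult)

lemma polynomials_mono: "A <= B ==> polynomials A n <= polynomials B n"
 by (auto simp: polynomials_def)

lemma (in hom) evaluate_mem:
 assumes "subr B" "!!c. c : A ==> \<phi> c : B" "!!i. i < n ==> v i : B" "F : polynomials A n"
 shows "evaluate \<phi> v F : B"
 unfolding evaluate_alt monom_value_def
proof (intro subr_sum subr_mult subr_prod subr_power assms(1))
 fix m i assume "m : supp F"
 hence "lk F m : A & supp m <= {..<n}" using assms(4) by (auto simp: polynomials_def in_keys_iff)
 thus "\<phi> (lk F m) : B" "i : supp m ==> v i : B" using assms by auto
qed

lemma (in hom) adjoin_eq_evaluate: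
 assumes A: "subr A"
 shows "adjoin (\<phi> ` A Un v ` {..<n}) = evaluate \<phi> v ` polynomials A n"
proof
 let ?E = "evaluate \<phi> v ` polynomials A n"
 show "adjoin (\<phi> ` A Un v ` {..<n}) <= ?E"
 proof (rule adjoin_min)
  have "a - b : ?E & a * b : ?E" if ab: "a : ?E" "b : ?E" for a b
  proof -
   obtain F G where FG: "a = evaluate \<phi> v F" "b = evaluate \<phi> v G" "F : polynomials A n" "G : polynomials A n"
    using ab by blast
   hence "a - b = evaluate \<phi> v (F - G)" "a * b = evaluate \<phi> v (F * G)" by (auto simp: evaluate_diff evaluate_mult)
   thus ?thesis using FG polynomials_diff[OF A] polynomials_mult[OF A] by blast
  qed
  moreover have "1 : ?E" using polynomials_1[OF A] evaluate_1 by (metis imageI)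
  ultimately show "subr ?E" unfolding subr_def by blast
  have "\<phi> c : ?E" if "c : A" for c
   using polynomials_const[OF that subr_0[OF A]] by (rule image_eqI[rotated]) (simp add: evaluate_single)
  moreover have "v i : ?E" if "i < n" for i
   using that subr_0[OF A] subr_1[OF A]
   by (intro image_eqI[of _ _ "mon (mon i 1) 1"] polynomials_single) (auto simp: evaluate_single hom_1 monom_value_single)
  ultimately show "\<phi> ` A Un v ` {..<n} <= ?E" by blast
 qed
 show "?E <= adjoin (\<phi> ` A Un v ` {..<n})"
 proof
  fix z assume "z : ?E"
  then obtain F where F: "z = evaluate \<phi> v F" "F : polynomials A n" by blast
  show "z : adjoin (\<phi> ` A Un v ` {..<n})" unfolding F(1)
   by (rule evaluate_mem[OF adjoin_subr _ _ F(2)]) (use adjoin_incl[of "\<phi> ` A Un v ` {..<n}"] in auto)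
 qed
qed

lemma (in hom) evaluate_prime:
 assumes A: "subr A" and B: "subr B" "\<phi> ` A <= B" "v ` {..<n} <= B" and q: "prime_of B q"
 shows "prime_of (polynomials A n) {F : polynomials A n. evaluate \<phi> v F : q}"
proof -
 have mem: "evaluate \<phi> v F : B" if "F : polynomials A n" for F
  by (rule evaluate_mem[OF B(1) _ _ that]) (use B in auto)
 note P = polynomials_subr[OF A, of n]
 note sq = prime_ofD(1)[OF q]
 show ?thesis unfolding prime_of_def submod_def
  using mem P submod_0[OF sq] submod_add[OF sq] submod_mult[OF sq] prime_ofD(3,4)[OF q]
  by (auto simp: evaluate_add evaluate_mult evaluate_1 intro: subr_0 subr_add subr_mult)
qed

section \<open>Completeness\<close>

context complete_curve
begin

text \<open>The points of \<open>X \<times> A\<^sup>n\<close>; aso is the space that they form.\<close>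

abbreviation "asp \<equiv> affine_space_points X"
abbreviation "aso \<equiv> affine_space_over X"

lemma affine_space_over_topspace: "topspace (aso n) = asp n"
proof -
 have "(x, P) : topspace (aso n)" if xP: "(x, P) : asp n" for x P
 proof -
  have x: "x : pts" using xP by (simp add: affine_space_points_def)
  obtain U where U: "aff U" "x : U" using affine_cover[OF x] by blast
  have "1 ~: P"
   using xP prime_ofD(3)[of "polynomials (stk x) n" P] primeideal_iff[OF polynomials_subr[OF stalk_subr[OF x]]]
   by (auto simp: affine_space_points_def)
  moreover have "1 : polynomials (\<O> U) n" using polynomials_1[OF affine_subr[OF U(1)]] .
  ultimately have "(x, P) : {(x, P). (x, P) : asp n & x : U & 1 ~: P}"
   "{(x, P). (x, P) : asp n & x : U & 1 ~: P} :
    {{(x, P). (x, P) : asp n & x : U & F ~: P} | U F. aff U & F : polynomials (\<O> U) n}"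
   using xP U by blast+
  thus ?thesis unfolding affine_space_over_def topology_generated_by_topspace by (rule UnionI[rotated])
 qed
 moreover have "topspace (aso n) <= asp n"
  unfolding affine_space_over_def topology_generated_by_topspace by auto
 ultimately show ?thesis by auto
qed

lemma affine_space_pointsD:
 assumes "(x, P) : asp n"
 shows "x : pts" "prime_of (polynomials (stk x) n) P" "!!c. c : stk x ==> mon 0 c : P \<longleftrightarrow> c : mm (stk x)"
proof -
 show x: "x : pts" using assms by (simp add: affine_space_points_def)
 show "prime_of (polynomials (stk x) n) P"
  using assms primeideal_iff[OF polynomials_subr[OF stalk_subr[OF x]]] by (simp add: affine_space_points_def)
 have "{c : stk x. mon 0 c : P} = mm (stk x)" using assms by (simp add: affine_space_points_def)
 thus "!!c. c : stk x ==> mon 0 c : P \<longleftrightarrow> c : mm (stk x)" by blast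
qed

lemma clear_denominators:
 assumes U: "aff U" "x : U" and F: "F : polynomials (stk x) n"
 obtains s where "s : \<O> U" "s ~: pp U x" "mon 0 s * F : polynomials (\<O> U) n"
proof -
 have "lk F ` supp F <= localization (\<O> U) (pp U x)"
  using F stalk_eq_localization[OF U] by (auto simp: polynomials_def)
 from localization_denominator[OF affine_subr[OF U(1)] pp_prime[OF U] _ this] obtain s where
  s: "s : \<O> U" "s ~: pp U x" "ALL c:lk F ` supp F. s * c : \<O> U" by auto
 have lkG: "lk (mon 0 s * F) m = s * lk F m" for m by (simp flip: mult_map_scale_conv_mult add: Poly_Mapping.map.rep_eq when_def)
 have "mon 0 s * F : polynomials (\<O> U) n" unfolding polynomials_def
 proof (intro CollectI allI conjI impI)
  fix m
  show "lk (mon 0 s * F) m : \<O> U" using s(3) subr_0[OF affine_subr[OF U(1)]] unfolding lkG by (cases "m : supp F") (auto simp: in_keys_iff)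
  show "supp m <= {..<n}" if "lk (mon 0 s * F) m ~= 0" using that F unfolding lkG by (auto simp: polynomials_def)
 qed
 thus ?thesis using that s by blast
qed

text \<open>The residue field of a closed point is k: the point of \<open>X \<times> A\<^sup>1\<close> at which the coordinate takes the
 value f is closed, hence so is its image in the affine line; the generic point is not closed.\<close>

lemma closed_point_affine_line:
 assumes U: "aff U" "x : U" and nz: "pp U x ~= {0}" and f: "f : \<O> U"
 defines "P \<equiv> {F : polynomials (stk x) 1. evaluate (%c. c) (%_. f) F : mm (stk x)}"
 shows "(x, P) : asp 1" "closedin (aso 1) {(x, P)}"
proof -
 interpret h: hom "%c::'a. c" by (rule hom_id)
 let ?ev = "evaluate (%c::'a. c) (%_. f)"
 have xp: "x : pts" using affine_sub[OF U(1)] U(2) by blast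
 note S = stalk_subr[OF xp] and m = nonunits_prime[OF stalk_loc_ring[OF xp]]
 have fx: "f : stk x" using stalk_affine[OF U(1) U(2)] f by blast
 have Pp: "prime_of (polynomials (stk x) 1) P" unfolding P_def
  by (rule h.evaluate_prime[OF S S _ _ m]) (use fx in auto)
 have cP: "mon 0 c : P \<longleftrightarrow> c : mm (stk x)" if "c : stk x" for c
  unfolding P_def using polynomials_const[OF that subr_0[OF S]] by (simp add: h.evaluate_single)
 have xP: "(x, P) : asp 1"
  unfolding affine_space_points_def using xp Pp cP nonunits_sub[of "stk x"] primeideal_iff[OF polynomials_subr[OF S]] by blast
 thus "(x, P) : asp 1" .
 have "EX W. openin (aso 1) W & (y, Q) : W & W <= asp 1 - {(x, P)}"
  if yQ: "(y, Q) : asp 1" "(y, Q) ~= (x, P)" for y Q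
 proof -
  note Q = affine_space_pointsD[OF yQ(1)]
  have "EX V F. aff V & y : V & F : polynomials (\<O> V) 1 & F ~: Q & (x : V --> F : P)"
  proof (cases "y = x")
   case True
   have "~ P <= Q"
   proof
    assume PQ: "P <= Q"
    have "Q <= P"
    proof
     fix G assume G: "G : Q"
     hence Gp: "G : polynomials (stk x) 1" using prime_ofD(2)[OF Q(2)] True by blast
     have u: "?ev G : stk x" by (rule h.evaluate_mem[OF S _ _ Gp]) (use fx in auto)
     note c = polynomials_const[OF u subr_0[OF S]]
     have "G - mon 0 (?ev G) : P" unfolding P_def
      using polynomials_diff[OF S Gp c] nonunits_0[OF S] by (simp add: h.evaluate_diff h.evaluate_single)
     hence "G - (G - mon 0 (?ev G)) : Q"
      using submod_diff[OF prime_ofD(1)[OF Q(2)] polynomials_subr[OF stalk_subr[OF Q(1)]] G] PQ by blast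
     hence "?ev G : mm (stk x)" using Q(3)[of "?ev G"] u True by simp
     thus "G : P" using Gp by (simp add: P_def)
    qed
    thus False using PQ yQ(2) True by auto
   qed
   then obtain F where F: "F : P" "F ~: Q" by blast
   hence Fp: "F : polynomials (stk x) 1" by (simp add: P_def)
   obtain s where s: "s : \<O> U" "s ~: pp U x" "mon 0 s * F : polynomials (\<O> U) 1" by (rule clear_denominators[OF U Fp])
   have sx: "s : stk x" using stalk_affine[OF U(1) U(2)] s by blast
   note c = polynomials_const[OF sx subr_0[OF S]]
   have "mon 0 s ~: Q" using Q(3)[of s] sx s(1,2) True by (auto simp: point_prime_def)
   hence "mon 0 s * F ~: Q" using prime_ofD(4)[OF Q(2)] c Fp F(2) True by blast
   moreover have "mon 0 s * F : P" by (rule submod_mult[OF prime_ofD(1)[OF Pp] c F(1)])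
   ultimately show ?thesis using U s(3) True by blast
  next
   case False
   obtain V where V: "aff V" "y : V" using affine_cover Q(1) by blast
   have "EX g:\<O> V. g ~: pp V y & (x : V --> g : pp V x)"
   proof (cases "x : V")
    case True
    have "pp V x ~= {0}"
    proof
     assume "pp V x = {0}"
     hence "mm (stk x) = {0}" using stalk_eq_localization[OF V(1) True] localization_nonunits[OF affine_subr[OF V(1)] pp_prime[OF V(1) True]] subr_1[OF affine_subr[OF V(1)]] by auto
     thus False using nz submod_0[OF prime_ofD(1)[OF pp_prime[OF U]]] by (auto simp: point_prime_def)
    qed
    hence "~ pp V x <= pp V y" using primes_maximal[OF V(1) pp_prime[OF V(1) True] _ pp_prime[OF V]] pp_inj[OF V(1,2) True] False by blast
    thus ?thesis by (auto simp: point_prime_def)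
   qed (use subr_1[OF affine_subr[OF V(1)]] prime_ofD(3)[OF pp_prime[OF V]] in blast)
   then obtain g where g: "g : \<O> V" "g ~: pp V y" "x : V ==> g : pp V x" by blast
   have gs: "g : stk z" if "z : V" for z using stalk_affine[OF V(1) that] g(1) by blast
   have "mon 0 g ~: Q" using Q(3)[OF gs[OF V(2)]] g(1,2) by (auto simp: point_prime_def)
   moreover have "mon 0 g : P" if "x : V" using cP[OF gs[OF that]] g(3)[OF that] by (simp add: point_prime_def)
   ultimately show ?thesis using V polynomials_const[OF g(1) subr_0[OF affine_subr[OF V(1)]]] by blast
  qed
  then obtain V F where V: "aff V" "y : V" "F : polynomials (\<O> V) 1" "F ~: Q" "x : V --> F : P" by blast
  let ?W = "{(x, P). (x, P) : asp 1 & x : V & F ~: P}"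
  have "openin (aso 1) ?W" unfolding affine_space_over_def
   by (rule topology_generated_by_Basis) (use V in blast)
  thus ?thesis using V yQ(1) by (intro exI[of _ ?W]) auto
 qed
 hence "openin (aso 1) (asp 1 - {(x, P)})" by (subst openin_subopen) auto
 thus "closedin (aso 1) {(x, P)}" unfolding closedin_def affine_space_over_topspace using xP by blast
qed

lemma residue_field:
 assumes U: "aff U" and p: "prime_of (\<O> U) p" "p ~= {0}" and f: "f : \<O> U"
 shows "EX a. f - \<iota> a : p"
proof -
 interpret h: hom "%c::'a. c" by (rule hom_id)
 obtain x where x: "x : U" "pp U x = p" using pp_surj[OF U p(1)] by blast
 let ?ev = "evaluate (%c::'a. c) (%_. f)" and ?kt = "polynomials kk 1"
 define P where "P = {F : polynomials (stk x) 1. ?ev F : mm (stk x)}"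
 have xp: "x : pts" and kO: "kk <= \<O> U" and Ox: "\<O> U <= stk x"
  using affine_sub[OF U] x(1) kk_sections[OF affine_nopen[OF U]] stalk_affine[OF U x(1)] by auto
 note kt = polynomials_subr[OF subr_kk, of 1]
 have "closed_map (aso 1) (spec ?kt) (%(x, P). P Int ?kt)"
  using curve by (simp add: complete_integral_curve_def universally_closed_def)
 hence cl: "closedin (spec ?kt) {P Int ?kt}"
  using closed_point_affine_line(2)[OF U x(1) _ f] p(2) x(2) unfolding closed_map_def P_def by fastforce
 have "EX F:?kt. F ~= 0 & F : P"
 proof (rule ccontr)
  assume "~ ?thesis"
  hence P0: "P Int ?kt = {0}" using subr_0[OF kt] submod_0[OF nonunits_submod[OF stalk_loc_ring[OF xp]]] subr_0[OF polynomials_subr[OF stalk_subr[OF xp]]]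
   by (auto simp: P_def)
  define q where "q = {F : ?kt. evaluate (%c::'a. c) (%_. 0) F : {0}}"
  have q: "prime_of ?kt q" unfolding q_def by (rule h.evaluate_prime[OF subr_kk subr_UNIV _ _ prime_of_zero]) auto
  have z: "prime_of ?kt {0}"
  proof -
   have "closedin (spec ?kt) {{0}}" using cl P0 by simp
   thus ?thesis using topspace_spec[OF kt] closedin_subset by fastforce
  qed
  have "mon (mon 0 1) 1 : q" unfolding q_def
   using polynomials_single[of 1 kk "mon 0 1" 1] subr_0[OF subr_kk] subr_1[OF subr_kk] by (simp add: h.evaluate_single monom_value_single)
  moreover have "(mon (mon 0 1) 1 :: 'a mpoly) ~= 0" by (metis lookup_single_eq lookup_zero zero_neq_one)
  ultimately have "q ~= {0}" by blast
  hence "q : topspace (spec ?kt) - {{0}}" using q topspace_spec[OF kt] by blast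
  moreover have "openin (spec ?kt) (topspace (spec ?kt) - {{0}})" using cl unfolding P0 by (simp add: closedin_def)
  ultimately obtain g where "g ~: q" "!!p. prime_of ?kt p ==> g ~: p ==> p : topspace (spec ?kt) - {{0}}"
   using spec_basis[OF kt] by metis
  thus False using z[THEN prime_ofD(1), THEN submod_0] q[THEN prime_ofD(1), THEN submod_0] z by blast
 qed
 then obtain F where F: "F : ?kt" "F ~= 0" "?ev F : mm (stk x)" by (auto simp: P_def)
 let ?I = "(%m. lk m 0) ` supp F"
 have mon1: "m = mon 0 (lk m 0)" if "m : supp F" for m
 proof (rule poly_mapping_eqI)
  fix i
  have "supp m <= {..<1}" using F(1) that by (auto simp: polynomials_def in_keys_iff)
  thus "lk m i = lk (mon 0 (lk m 0)) i" by (cases "i = 0") (auto simp: lookup_single in_keys_iff)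
 qed
 have inj: "inj_on (%m. lk m 0) (supp F)" by (rule inj_onI) (metis mon1)
 define c where "c i = (SOME a. lk F (mon 0 i) = \<iota> a)" for i
 have c: "lk F (mon 0 i) = \<iota> (c i)" for i unfolding c_def
  by (rule someI_ex) (use F(1) in \<open>auto simp: polynomials_def\<close>)
 have "?ev F = (\<Sum>m\<in>supp F. \<iota> (c (lk m 0)) * f ^ lk m 0)"
  unfolding evaluate_alt
 proof (rule sum.cong[OF refl])
  fix m assume "m : supp F"
  from mon1[OF this] show "lk F m * monom_value (%_. f) m = \<iota> (c (lk m 0)) * f ^ lk m 0"
   using c[of "lk m 0"] monom_value_single[of "%_. f" 0 "lk m 0"] by simp
 qed
 also have "\<dots> = evp (\<Sum>i\<in>?I. monom (c i) i) f" by (simp add: sum.reindex[OF inj])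
 finally have "evp (\<Sum>i\<in>?I. monom (c i) i) f : p"
  using F(3) x(2) evp_mem[OF affine_subr[OF U] kO f] unfolding point_prime_def by (metis IntI)
 moreover obtain m where m: "m : supp F" using F(2) by (metis ex_in_conv keys_eq_empty)
 hence "c (lk m 0) ~= 0" using c[of "lk m 0"] mon1[OF m] by (metis \<iota>_0 in_keys_iff)
 hence "(\<Sum>i\<in>?I. monom (c i) i) ~= 0" using m by (intro sum_monom_nz[of _ "lk m 0"]) auto
 ultimately show ?thesis using root_mod_prime[OF affine_subr[OF U] kO p(1) f] by blast
qed

text \<open>The closure of the graph of a rational map to affine space.\<close>

definition graph :: "nat => (nat => 'a) => ('p \<times> 'a mpoly set) set" where
 "graph n y = {(x, P) : asp n. ALL F:polynomials (stk x) n. evaluate (%c. c) y F = 0 --> F : P}"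

lemma graph_closed: "closedin (aso n) (graph n y)"
 unfolding closedin_def affine_space_over_topspace
proof
 interpret h: hom "%c::'a. c" by (rule hom_id)
 show "graph n y <= asp n" by (auto simp: graph_def)
 have "EX W. openin (aso n) W & (x, P) : W & W <= asp n - graph n y"
  if xP: "(x, P) : asp n - graph n y" for x P
 proof -
  have sp: "(x, P) : asp n" using xP by blast
  note P = affine_space_pointsD[OF sp]
  obtain F where F: "F : polynomials (stk x) n" "evaluate (%c. c) y F = 0" "F ~: P" using xP by (auto simp: graph_def)
  obtain U where U: "aff U" "x : U" using affine_cover[OF P(1)] by blast
  obtain s where s: "s : \<O> U" "s ~: pp U x" "mon 0 s * F : polynomials (\<O> U) n" by (rule clear_denominators[OF U F(1)])
  let ?G = "mon 0 s * F" note GU = s(3)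
  have sx: "s : stk x" using stalk_affine[OF U(1) U(2)] s by blast
  have "mon 0 s ~: P" using P(3)[OF sx] s by (auto simp: point_prime_def)
  moreover have "mon 0 s : polynomials (stk x) n" using polynomials_const[OF sx] subr_0[OF stalk_subr[OF P(1)]] by blast
  ultimately have GP: "?G ~: P" using prime_ofD(4)[OF P(2)] F by blast
  have G0: "evaluate (%c. c) y ?G = 0" using F by (simp add: h.evaluate_mult)
  let ?W = "{(x, P). (x, P) : asp n & x : U & ?G ~: P}"
  have "openin (aso n) ?W" unfolding affine_space_over_def
   by (rule topology_generated_by_Basis) (use U GU in blast)
  moreover have "(x, P) : ?W" using sp U GP by blast
  moreover have "?W <= asp n - graph n y"
  proof
   fix w assume "w : ?W"
   then obtain z Q where w: "w = (z, Q)" "(z, Q) : asp n" "z : U" "?G ~: Q" by blast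
   have "?G : polynomials (stk z) n"
    using polynomials_mono[OF stalk_affine[OF U(1) w(3)]] GU by blast
   thus "w : asp n - graph n y" using w G0 by (auto simp: graph_def)
  qed
  ultimately show ?thesis by blast
 qed
 thus "openin (aso n) (asp n - graph n y)"
  by (subst openin_subopen) auto
qed

text \<open>Valuative form of completeness: the image of the closure of the graph in affine space is closed and contains
 the generic point of the model, hence it contains every point of the model.\<close>

lemma complete_dominates:
 fixes y :: "nat => 'a"
 assumes q: "prime_of (adjoin (kk Un y ` {..<n})) q"
 obtains x P where "x : pts" "prime_of (adjoin (stk x Un y ` {..<n})) P"
  "stk x Int P = mm (stk x)" "q <= P"
proof -
 interpret h: hom "%c::'a. c" by (rule hom_id)
 let ?ev = "evaluate (%c::'a. c) y"
 let ?kt = "polynomials kk n" and ?f = "%(x, P). P Int polynomials kk n"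
 have kt: "subr ?kt" by (rule polynomials_subr[OF subr_kk])
 have kky: "adjoin (kk Un y ` {..<n}) = ?ev ` ?kt"
  using h.adjoin_eq_evaluate[OF subr_kk, of y n] by simp
 have "closed_map (aso n) (spec ?kt) ?f"
  using curve by (simp add: complete_integral_curve_def universally_closed_def)
 hence cl: "closedin (spec ?kt) (?f ` graph n y)" using graph_closed by (simp add: closed_map_def)
 define p0 where "p0 = {F : ?kt. ?ev F : {0}}"
 define q' where "q' = {F : ?kt. ?ev F : q}"
 have pq: "prime_of ?kt q'" unfolding q'_def
  by (rule h.evaluate_prime[OF subr_kk adjoin_subr _ _ q]) (use adjoin_incl[of "kk Un y ` {..<n}"] in auto)
 have p0: "prime_of ?kt p0" unfolding p0_def
  by (rule h.evaluate_prime[OF subr_kk, of UNIV]) (auto intro: prime_of_zero)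
 have p0q: "p0 <= q'" using submod_0[OF prime_ofD(1)[OF q]] by (auto simp: p0_def q'_def)
 have "p0 : ?f ` graph n y"
 proof -
  obtain x0 where "x0 : pts" using nopen_pts unfolding nopen_def by blast
  then obtain U where U: "aff U" using affine_cover by blast
  obtain x where x: "x : U" "stk x = UNIV" using generic_point[OF U] by blast
  have xp: "x : pts" using affine_sub[OF U] x by blast
  define P where "P = {F : polynomials UNIV n. ?ev F : {0}}"
  have "prime_of (polynomials UNIV n) P" unfolding P_def
   by (rule h.evaluate_prime[of UNIV UNIV]) (auto intro: prime_of_zero)
  hence "(x, P) : asp n"
   unfolding affine_space_points_def using xp x primeideal_iff[OF polynomials_subr[OF subr_UNIV]]
   by (auto simp: P_def h.evaluate_single intro: polynomials_const)
  hence "(x, P) : graph n y" using x by (auto simp: graph_def P_def)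
  moreover have "P Int ?kt = p0" using polynomials_mono[of kk UNIV n] by (auto simp: P_def p0_def)
  ultimately show ?thesis by force
 qed
 moreover have "q' : ?f ` graph n y"
 proof (rule ccontr)
  assume "q' ~: ?f ` graph n y"
  hence "q' : topspace (spec ?kt) - ?f ` graph n y" using pq topspace_spec[OF kt] by blast
  moreover have "openin (spec ?kt) (topspace (spec ?kt) - ?f ` graph n y)" using cl by (simp add: closedin_def)
  ultimately obtain f where f: "f : ?kt" "f ~: q'"
   "!!p. prime_of ?kt p ==> f ~: p ==> p : topspace (spec ?kt) - ?f ` graph n y"
   using spec_basis[OF kt] by metis
  hence "p0 ~: ?f ` graph n y" using p0 p0q by blast
  thus False using \<open>p0 : ?f ` graph n y\<close> by blast
 qed
 then obtain x P where xP: "(x, P) : graph n y" "P Int ?kt = q'" by force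
 hence "(x, P) : asp n" by (auto simp: graph_def)
 note P = affine_space_pointsD[OF this]
 have ker: "F : P" if "F : polynomials (stk x) n" "?ev F = 0" for F using xP that by (auto simp: graph_def)
 let ?B = "adjoin (stk x Un y ` {..<n})"
 note S = stalk_subr[OF P(1)]
 note Ps = polynomials_subr[OF S, of n]
 have B: "?B = ?ev ` polynomials (stk x) n" using h.adjoin_eq_evaluate[OF S, of y n] by simp
 have memP: "?ev F : ?ev ` P \<longleftrightarrow> F : P" if F: "F : polynomials (stk x) n" for F
 proof
  assume "?ev F : ?ev ` P"
  then obtain G where G: "?ev F = ?ev G" "G : P" by blast
  hence "F - G : P" using prime_ofD(2)[OF P(2)] F by (intro ker polynomials_diff[OF S]) (auto simp: h.evaluate_diff)
  hence "(F - G) + G : P" using submod_add[OF prime_ofD(1)[OF P(2)]] G by blast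
  thus "F : P" by simp
 qed blast
 have prime: "prime_of ?B (?ev ` P)" unfolding prime_of_def submod_def B
 proof (intro conjI ballI impI)
  note sP = prime_ofD(1)[OF P(2)] and subP = prime_ofD(2)[OF P(2)]
  show "0 : ?ev ` P" using submod_0[OF sP] by (intro image_eqI[of _ _ 0]) auto
  show "a + b : ?ev ` P" if "a : ?ev ` P" "b : ?ev ` P" for a b
   using that submod_add[OF sP] by (auto simp flip: h.evaluate_add)
  show "a * b : ?ev ` P" if "a : ?ev ` polynomials (stk x) n" "b : ?ev ` P" for a b
   using that submod_mult[OF sP] by (auto simp flip: h.evaluate_mult)
  show "?ev ` P <= ?ev ` polynomials (stk x) n" using subP by blast
  show "1 ~: ?ev ` P" using memP[OF subr_1[OF Ps]] prime_ofD(3)[OF P(2)] by (simp add: h.evaluate_1)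
  fix a b assume "a : ?ev ` polynomials (stk x) n" "b : ?ev ` polynomials (stk x) n" "a * b : ?ev ` P"
  then obtain F G where FG: "F : polynomials (stk x) n" "G : polynomials (stk x) n" "a = ?ev F" "b = ?ev G"
   "?ev (F * G) : ?ev ` P" by (auto simp: h.evaluate_mult)
  hence "F * G : P" using memP[OF polynomials_mult[OF S FG(1,2)]] by blast
  thus "a : ?ev ` P | b : ?ev ` P" using prime_ofD(4)[OF P(2) FG(1,2)] FG by blast
 qed
 show ?thesis
 proof (rule that[OF P(1) prime])
  have "c : ?ev ` P \<longleftrightarrow> c : mm (stk x)" if c: "c : stk x" for c
   using memP[OF polynomials_const[OF c subr_0[OF S]]] P(3)[OF c] by (simp add: h.evaluate_single)
  thus "stk x Int ?ev ` P = mm (stk x)" using nonunits_sub[of "stk x"] by blast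
  show "q <= ?ev ` P"
  proof
   fix z assume z: "z : q"
   then obtain F where F: "F : ?kt" "z = ?ev F" using prime_ofD(2)[OF q] unfolding kky by blast
   hence "F : q'" using z by (simp add: q'_def)
   thus "z : ?ev ` P" using xP(2) F by blast
  qed
 qed
qed

section \<open>The local rings of the curve\<close>

text \<open>Only the members of one finite cover are known to be of finite type.  For other affine open sets U the
 quotient by \<open>a\<close> embeds in the product of the quotients of the \<open>\<O>(U \<inter> V)\<close> by \<open>a\<close>, for V in the cover, and
 these rings are finite by the theorem of Krull and Akizuki.\<close>

lemma FD_affine: assumes U: "aff U" shows "FD (\<O> U)"
 unfolding FD_def
proof (intro conjI ballI impI)
 note Us = affine_subr[OF U]
 show "subr (\<O> U)" "kk <= \<O> U" using Us kk_sections[OF affine_nopen[OF U]] by auto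
 fix a assume a: "a : \<O> U" "a ~= 0"
 obtain \<U> where \<U>: "finite \<U>" "\<Union>\<U> = pts" "!!V. V : \<U> ==> aff V"
  "!!V. V : \<U> ==> EX S. finite S & \<O> V = adjoin (kk Un S)" using finite_cover by blast
 let ?O = "%V. \<O> (U Int V)"
 have nO: "nop (U Int V)" if "V : \<U>" for V using nopen_Int affine_nopen U \<U>(3)[OF that] by blast
 have fO: "fc (?O V) ((*) a ` ?O V)" if V: "V : \<U>" for V
 proof -
  obtain S where S: "finite S" "\<O> V = adjoin (kk Un S)" using \<U>(4)[OF V] by blast
  have "FD (\<O> V)" using FD_finitely_generated[OF S] residue_field[OF \<U>(3)[OF V]] by blast
  from krull_akizuki[OF this affine_fractions[OF \<U>(3)[OF V]] sections_subr[OF nO[OF V]]]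
  have "FD (?O V)" using sections_mono[OF affine_nopen[OF \<U>(3)[OF V]] nO[OF V]] by blast
  moreover have "a : ?O V" using a sections_mono[OF affine_nopen[OF U] nO[OF V]] by blast
  ultimately show ?thesis using a by (simp add: FD_def)
 qed
 have kO: "submod kk (\<O> W)" if "nop W" for W using submod_subr[OF sections_subr kk_sections] that by blast
 have UO: "\<O> U <= ?O V" if "V : \<U>" for V using sections_mono[OF affine_nopen[OF U] nO[OF that]] by blast
 have part: "fc (\<O> U) (\<O> U Int (\<Inter>V\<in>\<V>. (*) a ` ?O V))" if "finite \<V>" "\<V> <= \<U>" for \<V>
  using that
 proof induction
  case empty
  show ?case using fcI_span[OF kO[OF affine_nopen[OF U]], of "{}" "\<O> U"] by (auto intro: bexI[of _ 0])
 next
  case (insert V \<V>)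
  have "fc (\<O> U) ((\<O> U Int (\<Inter>V\<in>\<V>. (*) a ` ?O V)) Int (*) a ` ?O V)"
  proof (rule fc_Int)
   show "submod kk (\<O> U)" by (rule kO[OF affine_nopen[OF U]])
   have sm: "submod kk ((*) a ` ?O V)" if "V : \<U>" for V using kO[OF nO[OF that]] by (rule submod_times)
   thus "submod kk ((*) a ` ?O V)" using insert by blast
   have "submod kk (\<Inter>V\<in>\<V>. (*) a ` ?O V)" by (rule submod_INT) (use sm insert.prems in blast)
   thus "submod kk (\<O> U Int (\<Inter>V\<in>\<V>. (*) a ` ?O V))" by (rule submod_Int[OF kO[OF affine_nopen[OF U]]])
   show "fc (\<O> U) ((*) a ` ?O V)" using fc_mono[OF fO[of V] UO[of V]] insert by blast
  qed (use insert in auto)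
  moreover have "(\<O> U Int (\<Inter>V\<in>\<V>. (*) a ` ?O V)) Int (*) a ` ?O V = \<O> U Int (\<Inter>V\<in>insert V \<V>. (*) a ` ?O V)" by blast
  ultimately show ?case by simp
 qed
 have "\<O> U Int (\<Inter>V\<in>\<U>. (*) a ` ?O V) <= (*) a ` \<O> U"
 proof
  fix z assume z: "z : \<O> U Int (\<Inter>V\<in>\<U>. (*) a ` ?O V)"
  have "z / a : ?O V" if "V : \<U>" for V using z that a by (auto simp: image_iff)
  moreover have "\<O> (\<Union>((%V. U Int V) ` \<U>)) = (\<Inter>W\<in>(%V. U Int V) ` \<U>. \<O> W)"
   using nO \<U>(2) affine_nopen[OF U] nopen_sub[of U] by (intro sections_Union) (auto simp: nopen_def)
  moreover have "\<Union>((%V. U Int V) ` \<U>) = U" using \<U>(2) affine_sub[OF U] by auto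
  ultimately have "z / a : \<O> U" by auto
  moreover have "z = a * (z / a)" using a by simp
  ultimately show "z : (*) a ` \<O> U" by blast
 qed
 thus "fc (\<O> U) ((*) a ` \<O> U)" using fc_mono[OF part[OF \<U>(1)]] by blast
qed

lemma FD_stalk: "x : pts ==> FD (stk x)"
 using affine_cover[of x] krull_akizuki[OF FD_affine affine_fractions stalk_subr stalk_affine] by metis

lemma kk_stalk: "x : pts ==> kk <= stk x"
 by (rule FD_kk[OF FD_stalk])

lemma finite_complement:
 assumes "nop U" shows "finite (pts - U)"
proof -
 obtain \<U> where \<U>: "finite \<U>" "\<Union>\<U> = pts" "!!V. V : \<U> ==> aff V" using finite_cover by metis
 have "finite (V - U)" if V: "V : \<U>" for V
 proof -
  note aV = \<U>(3)[OF V]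
  obtain y where y: "y : V" "y : U" using nopen_Int[OF affine_nopen[OF aV] assms] by (auto simp: nopen_def)
  obtain f where f: "f : \<O> V" "f ~= 0" "bas V f <= U"
   using basic_open_basis[OF aV, of U y] assms y by (auto simp: nopen_def)
  have "V - U <= {x : V. f : pp V x}" using f basic_open_eq[OF aV f(1)] by blast
  moreover have "finite {x : V. f : pp V x}"
  proof (rule finite_imageD)
   show "finite (pp V ` {x : V. f : pp V x})"
    by (rule finite_subset[OF _ FD_finite_primes[OF FD_affine[OF aV] f(1,2)]]) (use pp_prime[OF aV] in auto)
   show "inj_on (pp V) {x : V. f : pp V x}" using pp_inj[OF aV] by (auto simp: inj_on_def)
  qed
  ultimately show ?thesis using finite_subset by blast
 qed
 hence "finite (\<Union>V\<in>\<U>. V - U)" using \<U>(1) by (intro finite_UN_I)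
 moreover have "pts - U = (\<Union>V\<in>\<U>. V - U)" using \<U> by auto
 ultimately show ?thesis by (simp only:)
qed

lemma finite_poles: "finite {x : pts. z ~: stk x}"
proof -
 have "z : (\<Union>V\<in>{V. nop V}. \<O> V)" using integral by (simp add: integral_scheme_def)
 then obtain V where V: "nop V" "z : \<O> V" by blast
 show ?thesis by (rule finite_subset[OF _ finite_complement[OF V(1)]]) (use stalk_nopen[OF V(1)] V(2) in blast)
qed

text \<open>The complement of a nonempty open set consists of finitely many closed points.\<close>

lemma superset_open:
 assumes V: "nop V" "V <= S" "S <= pts" shows "nop S"
proof -
 have "EX W. openin (points X) W & y : W & W <= S" if y: "y : S" "y ~: V" for y
 proof -
  obtain A where A: "aff A" "y : A" using affine_cover V(3) y(1) by blast
  have "EX f:pp A z. f ~: pp A y" if z: "z : A - V" "z ~= y" for z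
  proof -
   obtain x where x: "x : A" "x : V" using nopen_Int[OF affine_nopen[OF A(1)] V(1)] by (auto simp: nopen_def)
   obtain f where f: "f : \<O> A" "f ~= 0" "bas A f <= V"
    using basic_open_basis[OF A(1), of V x] V(1) x by (auto simp: nopen_def)
   hence "pp A z ~= {0}" using z basic_open_eq[OF A(1) f(1)] by auto
   thus ?thesis using FD_maximal[OF FD_affine[OF A(1)] pp_prime[OF A(1)] _ pp_prime[OF A]] pp_inj[OF A(1) A(2)] z by blast
  qed
  then obtain f where f: "!!z. z : A - V - {y} ==> f z : pp A z & f z ~: pp A y" by (metis DiffE insertCI)
  (* The product of the f z vanishes on A - V except at y. *)
  let ?Z = "A - V - {y}" and ?F = "\<Prod>z\<in>A - V - {y}. f z"
  have fin: "finite ?Z" by (rule finite_subset[OF _ finite_complement[OF V(1)]]) (use affine_sub[OF A(1)] in auto)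
  have fO: "f z : \<O> A" if "z : ?Z" for z using f[OF that] by (auto simp: point_prime_def)
  note As = affine_subr[OF A(1)]
  have P: "(\<Prod>z\<in>Z. f z) : \<O> A & (\<Prod>z\<in>Z. f z) ~: pp A y" if "finite Z" "Z <= ?Z" for Z using that
  proof (induction Z rule: finite_induct)
   case empty
   show ?case using subr_1[OF As] prime_ofD(3)[OF pp_prime[OF A]] by simp
  next
   case (insert z Z)
   hence z: "f z : \<O> A" "f z ~: pp A y" using f fO by auto
   show ?case using insert subr_mult[OF As z(1)] prime_ofD(4)[OF pp_prime[OF A] z(1)] z by auto
  qed
  have F: "?F : \<O> A" "?F ~: pp A y" using P[OF fin] by auto
  have "?F : pp A z" if "z : ?Z" for z
  proof -
   have z: "z : A" "?Z - {z} <= ?Z" "finite (?Z - {z})" using that fin by auto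
   show ?thesis unfolding prod.remove[OF fin that, of f]
    using submod_mult'[OF prime_ofD(1)[OF pp_prime[OF A(1) z(1)]] conjunct1[OF P[OF z(3,2)]]] f[OF that] by blast
  qed
  hence "bas A ?F <= S" using V(2) y(1) unfolding basic_open_eq[OF A(1) F(1)] by blast
  thus ?thesis using basic_open_openin[OF A(1) F(1)] F(2) A(2) unfolding basic_open_eq[OF A(1) F(1)] by blast
 qed
 hence "openin (points X) S" using V by (subst openin_subopen) (auto simp: nopen_def)
 thus ?thesis using V by (auto simp: nopen_def)
qed

text \<open>On the affine open set \<open>U \<inter> V\<close>, whose ring is generated by those of U and V, the local ring has a center, and this is the center
 on U as well as on V.\<close>

lemma center_unique:
 assumes R: "loc_ring R" and x: "x : pts" "dominated (stk x) R" and y: "y : pts" "dominated (stk y) R"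
 shows "x = y"
proof -
 obtain U V where U: "aff U" "x : U" and V: "aff V" "y : V" using affine_cover x y by metis
 let ?W = "U Int V"
 have W: "aff ?W" "\<O> ?W = adjoin (\<O> U Un \<O> V)" using sep U V by auto
 have "\<O> U <= R" "\<O> V <= R"
  using stalk_affine[OF U(1) U(2)] stalk_affine[OF V(1) V(2)] x y by (auto simp: dominated_def)
 hence WR: "\<O> ?W <= R" unfolding W(2) using loc_ring_subr[OF R] by (intro adjoin_min) auto
 have "prime_of (\<O> ?W) (\<O> ?W Int mm R)" by (rule center_prime[OF R affine_subr[OF W(1)] WR])
 then obtain z where z: "z : ?W" "pp ?W z = \<O> ?W Int mm R" using pp_surj[OF W(1)] by blast
 have eq: "z = u" if T: "aff T" "u : T" "?W <= T" "dominated (stk u) R" for T u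
 proof (rule pp_inj[OF T(1) _ T(2)])
  show "z : T" using z T by blast
  have TW: "\<O> T <= \<O> ?W" by (rule sections_mono[OF affine_nopen[OF T(1)] affine_nopen[OF W(1)] T(3)])
  have "pp T z = \<O> T Int pp ?W z" using TW by (auto simp: point_prime_def)
  also have "\<dots> = \<O> T Int mm R" using z TW by auto
  also have "\<dots> = pp T u" using T(4) stalk_affine[OF T(1) T(2)] by (auto simp: point_prime_def dominated_def)
  finally show "pp T z = pp T u" .
 qed
 show ?thesis using eq[OF U _ x(2)] eq[OF V _ y(2)] by blast
qed

end

section \<open>Coherent sheaves\<close>

abbreviation Sec :: "('p, 'a, 'm) omodule => 'p set => 'm set" where
 "Sec F U \<equiv> carrier (msections F U)"

lemma sheafD:
 assumes "sheaf_of_modules X F"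
 shows "!!U. nopen X U ==> module (ring_on (sections X U)) (msections F U)"
  and "!!U V s. nopen X U ==> nopen X V ==> V <= U ==> s : Sec F U ==> mrestrict F U V s : Sec F V"
  and "!!U V s t. nopen X U ==> nopen X V ==> V <= U ==> s : Sec F U ==> t : Sec F U ==>
   mrestrict F U V (s \<oplus>\<^bsub>msections F U\<^esub> t) = mrestrict F U V s \<oplus>\<^bsub>msections F V\<^esub> mrestrict F U V t"
  and "!!U V a s. nopen X U ==> nopen X V ==> V <= U ==> a : sections X U ==> s : Sec F U ==>
   mrestrict F U V (a \<odot>\<^bsub>msections F U\<^esub> s) = a \<odot>\<^bsub>msections F V\<^esub> mrestrict F U V s"
  and "!!U s. nopen X U ==> s : Sec F U ==> mrestrict F U U s = s"
  and "!!U V W s. nopen X U ==> nopen X V ==> nopen X W ==> W <= V ==> V <= U ==> s : Sec F U ==>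
   mrestrict F V W (mrestrict F U V s) = mrestrict F U W s"
 using assms unfolding sheaf_of_modules_def by (elim conjE; simp add: Pi_iff)+

lemma sheaf_glue:
 assumes "sheaf_of_modules X F" "\<V> ~= {}" "!!V. V : \<V> ==> nopen X V" "!!V. V : \<V> ==> \<sigma> V : Sec F V"
  "!!V W. V : \<V> ==> W : \<V> ==> mrestrict F V (V Int W) (\<sigma> V) = mrestrict F W (V Int W) (\<sigma> W)"
 shows "EX! s. s : Sec F (\<Union>\<V>) & (ALL V:\<V>. mrestrict F (\<Union>\<V>) V s = \<sigma> V)"
proof -
 have "ALL \<V>. \<V> ~= {} & (ALL V:\<V>. nopen X V) --> (ALL \<sigma>. (ALL V:\<V>. \<sigma> V : Sec F V)
   & (ALL V:\<V>. ALL W:\<V>. mrestrict F V (V Int W) (\<sigma> V) = mrestrict F W (V Int W) (\<sigma> W))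
   --> (EX! s. s : Sec F (\<Union>\<V>) & (ALL V:\<V>. mrestrict F (\<Union>\<V>) V s = \<sigma> V)))"
  using assms(1) unfolding sheaf_of_modules_def by (elim conjE)
 from mp[OF spec[OF this, of \<V>]] assms(2,3) have "(ALL V:\<V>. \<sigma> V : Sec F V)
   & (ALL V:\<V>. ALL W:\<V>. mrestrict F V (V Int W) (\<sigma> V) = mrestrict F W (V Int W) (\<sigma> W)) --> ?thesis" by blast
 thus ?thesis using assms(4,5) by blast
qed

lemma coherentD:
 assumes "coherent X F"
 shows "sheaf_of_modules X F"
  and "!!U. affine_open X U ==> EX S. finite S & S <= Sec F U
     & (ALL s:Sec F U. EX a:S \<rightarrow> sections X U. s = finsum (msections F U) (%b. a b \<odot>\<^bsub>msections F U\<^esub> b) S)"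
  and "!!U f s. affine_open X U ==> f : sections X U ==> f ~= 0 ==> s : Sec F (basic_open X U f) ==>
   EX n. EX u:Sec F U. mrestrict F U (basic_open X U f) u = f ^ n \<odot>\<^bsub>msections F (basic_open X U f)\<^esub> s"
  and "!!U f u. affine_open X U ==> f : sections X U ==> f ~= 0 ==> u : Sec F U ==>
   mrestrict F U (basic_open X U f) u = \<zero>\<^bsub>msections F (basic_open X U f)\<^esub> ==>
   EX n. f ^ n \<odot>\<^bsub>msections F U\<^esub> u = \<zero>\<^bsub>msections F U\<^esub>"
 using assms unfolding coherent_def by blast+

lemma ring_on_simps [simp]:
 "carrier (ring_on A) = A" "x \<otimes>\<^bsub>ring_on A\<^esub> y = x * y" "x \<oplus>\<^bsub>ring_on A\<^esub> y = x + y"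
 "\<one>\<^bsub>ring_on A\<^esub> = 1" "\<zero>\<^bsub>ring_on A\<^esub> = 0"
 by (auto simp: ring_on_def)

context scheme
begin

lemma sec_abelian: "sheaf_of_modules X F ==> nop U ==> abelian_group (msections F U)"
 using module.axioms(2)[OF sheafD(1)] by blast

lemma zero_mem: "sheaf_of_modules X F ==> nop U ==> \<zero>\<^bsub>msections F U\<^esub> : Sec F U"
 using abelian_group.axioms(1)[OF sec_abelian] abelian_monoid.zero_closed by blast

lemma restrict_zero:
 assumes F: "sheaf_of_modules X F" and U: "nop U" "nop V" "V <= U"
 shows "mrestrict F U V \<zero>\<^bsub>msections F U\<^esub> = \<zero>\<^bsub>msections F V\<^esub>"
proof -
 interpret A: abelian_group "msections F U" by (rule sec_abelian[OF F U(1)])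
 interpret B: abelian_group "msections F V" by (rule sec_abelian[OF F U(2)])
 let ?r = "mrestrict F U V \<zero>\<^bsub>msections F U\<^esub>"
 have c: "?r : Sec F V" using sheafD(2)[OF F U] by simp
 have "?r \<oplus>\<^bsub>msections F V\<^esub> ?r = ?r" using sheafD(3)[OF F U, of "\<zero>\<^bsub>msections F U\<^esub>" "\<zero>\<^bsub>msections F U\<^esub>"] by simp
 thus ?thesis using c B.add.l_cancel_one by blast
qed

lemma sec_eq_local:
 assumes F: "sheaf_of_modules X F" and V: "\<V> ~= {}" "!!V. V : \<V> ==> nop V" and U: "U = \<Union>\<V>"
  and s: "s : Sec F U" "s' : Sec F U" "!!V. V : \<V> ==> mrestrict F U V s = mrestrict F U V s'"
 shows "s = s'"
proof -
 have nU: "nop U" unfolding U by (rule nopen_Union[OF V])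
 have sub: "V <= U" if "V : \<V>" for V using that U by blast
 have "EX! s''. s'' : Sec F (\<Union>\<V>) & (ALL V:\<V>. mrestrict F (\<Union>\<V>) V s'' = mrestrict F U V s)"
 proof (rule sheaf_glue[OF F V])
  show "mrestrict F U V s : Sec F V" if "V : \<V>" for V by (rule sheafD(2)[OF F nU V(2)[OF that] sub[OF that] s(1)])
  fix V W assume VW: "V : \<V>" "W : \<V>"
  note n = nopen_Int[OF V(2)[OF VW(1)] V(2)[OF VW(2)]]
  show "mrestrict F V (V Int W) (mrestrict F U V s) = mrestrict F W (V Int W) (mrestrict F U W s)"
   using sheafD(6)[OF F nU V(2)[OF VW(1)] n _ sub[OF VW(1)] s(1)] sheafD(6)[OF F nU V(2)[OF VW(2)] n _ sub[OF VW(2)] s(1)] by simp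
 qed
 then obtain w where w: "!!s''. s'' : Sec F (\<Union>\<V>) & (ALL V:\<V>. mrestrict F (\<Union>\<V>) V s'' = mrestrict F U V s) ==> s'' = w" by (rule ex1E) blast
 show ?thesis using w[of s] w[of s'] s unfolding U by simp
qed

lemma glue_two:
 assumes F: "sheaf_of_modules X F" and S: "nop S" "s : Sec F S" and T: "nop T" "s' : Sec F T"
  and eq: "mrestrict F S (S Int T) s = mrestrict F T (S Int T) s'"
 obtains u where "u : Sec F (S Un T)" "mrestrict F (S Un T) S u = s" "mrestrict F (S Un T) T u = s'"
proof -
 have same: "s = s'" if "S = T" using eq sheafD(5)[OF F S] sheafD(5)[OF F T] that by simp
 define \<sigma> where "\<sigma> V = (if V = S then s else s')" for V
 have "EX! u. u : Sec F (\<Union>{S, T}) & (ALL V:{S, T}. mrestrict F (\<Union>{S, T}) V u = \<sigma> V)"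
  by (rule sheaf_glue[OF F]) (use S T eq same in \<open>auto simp: \<sigma>_def Int_commute\<close>)
 thus ?thesis using that same by (auto simp: \<sigma>_def split: if_splits)
qed

definition plain_module :: "'a set => ('a, 'a) module" where
 "plain_module N = \<lparr>carrier = N, monoid.mult = (*), one = 1, zero = 0, add = (+), module.smult = (*)\<rparr>"

lemma plain_module_simps [simp]:
 "carrier (plain_module N) = N" "\<zero>\<^bsub>plain_module N\<^esub> = 0" "x \<oplus>\<^bsub>plain_module N\<^esub> y = x + y"
 "a \<odot>\<^bsub>plain_module N\<^esub> x = a * x"
 by (auto simp: plain_module_def)

context
 fixes B N :: "'a set" assumes B: "subr B" and N: "submod B N"
begin

lemma plain_module: "module (ring_on B) (plain_module N)"
proof (rule moduleI[OF ring_on_cring[OF B] abelian_groupI])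
 fix x assume "x : carrier (plain_module N)"
 thus "EX y:carrier (plain_module N). y \<oplus>\<^bsub>plain_module N\<^esub> x = \<zero>\<^bsub>plain_module N\<^esub>"
  using submod_uminus[OF N B] by (intro bexI[of _ "- x"]) auto
qed (use submod_0[OF N] submod_add[OF N] submod_mult[OF N] in \<open>auto simp: algebra_simps\<close>)

lemma plain_minus: "x : N ==> y : N ==> x \<ominus>\<^bsub>plain_module N\<^esub> y = x - y"
proof -
 assume xy: "x : N" "y : N"
 interpret abelian_group "plain_module N" by (rule module.axioms(2)[OF plain_module])
 have "\<ominus>\<^bsub>plain_module N\<^esub> y = - y" by (rule minus_equality) (use xy submod_uminus[OF N B] in auto)
 thus ?thesis by (simp add: a_minus_def)
qed

lemma plain_finsum: "finite I ==> (!!i. i : I ==> f i : N) ==> finsum (plain_module N) f I = sum f I"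
proof (induction I rule: finite_induct)
 interpret abelian_group "plain_module N" by (rule module.axioms(2)[OF plain_module])
 case empty show ?case by simp
next
 interpret abelian_group "plain_module N" by (rule module.axioms(2)[OF plain_module])
 case (insert i I)
 thus ?case by (subst finsum_insert) auto
qed

end

end

context complete_curve
begin

subsection \<open>The sheaf of lattices spanned by rational functions\<close>

text \<open>A finite set S of functions spans a coherent subsheaf of the constant sheaf K; this is its stalk at x.\<close>

definition lat :: "'a set => 'p => 'a set" where "lat S x = lspan (stk x) S"

definition latU :: "'a set => 'p set => 'a set" where "latU S U = (\<Inter>x\<in>U. lat S x)"

definition lat_sheaf :: "'a set => ('p, 'a, 'a) omodule" where
 "lat_sheaf S = \<lparr>msections = (%U. plain_module (latU S U)), mrestrict = (%U V s. s)\<rparr>"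

lemma lat_sheaf_simps [simp]:
 "msections (lat_sheaf S) U = plain_module (latU S U)" "mrestrict (lat_sheaf S) U V s = s"
 by (auto simp: lat_sheaf_def)

lemma lat_submod: "x : pts ==> submod (stk x) (lat S x)"
 unfolding lat_def by (rule lspan_submod[OF stalk_subr])

lemma latU_submod:
 assumes U: "nop U" shows "submod (\<O> U) (latU S U)"
 unfolding latU_def
 by (rule submod_INT) (use submod_mono[OF lat_submod stalk_nopen[OF U]] nopen_sub[OF U] in blast)

lemma lat_eq_nloc:
 assumes U: "aff U" "x : U" shows "lat S x = nloc (\<O> U) (lspan (\<O> U) S) (pp U x)"
proof -
 note Us = affine_subr[OF U(1)] and p = pp_prime[OF U]
 have "lspan (stk x) (lspan (\<O> U) S) = lspan (stk x) S"
  by (rule lspan_lspan[OF Us]) (use stalk_affine[OF U(1) U(2)] stalk_subr affine_sub[OF U(1)] U in auto)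
 thus ?thesis unfolding lat_def nloc_eq_lspan[OF Us p lspan_submod[OF Us]] stalk_eq_localization[OF U] by simp
qed

lemma latU_basic:
 assumes U: "aff U" and f: "f : \<O> U" and z: "z : latU S (bas U f)"
 shows "EX n. f ^ n * z : lspan (\<O> U) S"
proof (rule local_global_module[OF affine_subr[OF U] lspan_submod[OF affine_subr[OF U]] f])
 fix p assume p: "prime_of (\<O> U) p" "f ~: p"
 then obtain x where x: "x : U" "pp U x = p" using pp_surj[OF U] by blast
 hence "x : bas U f" using p basic_open_eq[OF U f] by blast
 hence "z : lat S x" using z by (auto simp: latU_def)
 thus "z : nloc (\<O> U) (lspan (\<O> U) S) p" using lat_eq_nloc[OF U x(1)] x by simp
qed

lemma latU_affine: assumes U: "aff U" shows "latU S U = lspan (\<O> U) S"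
proof
 have "bas U 1 = U"
  using basic_open_eq[OF U, of 1] subr_1[OF affine_subr[OF U]] prime_ofD(3)[OF pp_prime[OF U]] by auto
 thus "latU S U <= lspan (\<O> U) S" using latU_basic[OF U subr_1[OF affine_subr[OF U]], of _ S] by auto
 show "lspan (\<O> U) S <= latU S U" unfolding latU_def lat_def
  using lspan_mono[OF stalk_affine[OF U]] by blast
qed

lemma lat_sheaf_coherent:
 assumes S: "finite S" shows "coherent X (lat_sheaf S)"
 unfolding coherent_def
proof (intro conjI allI impI ballI)
 show "sheaf_of_modules X (lat_sheaf S)" unfolding sheaf_of_modules_def lat_sheaf_simps plain_module_simps
 proof (intro conjI allI impI ballI)
  fix U assume U: "nop U"
  show "module (ring_on (\<O> U)) (plain_module (latU S U))"
   by (rule plain_module[OF sections_subr[OF U] latU_submod[OF U]])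
 next
  fix U V assume "nop U & nop V & V <= U"
  thus "(%s. s) : latU S U \<rightarrow> latU S V" by (auto simp: latU_def)
 next
  fix \<V> :: "'p set set" and \<sigma> assume V: "\<V> ~= {} & (ALL V:\<V>. nop V)"
   and \<sigma>: "(ALL V:\<V>. \<sigma> V : latU S V) & (ALL V:\<V>. ALL W:\<V>. \<sigma> V = \<sigma> W)"
  obtain V0 where V0: "V0 : \<V>" using V by blast
  have "\<sigma> V0 : latU S (\<Union>\<V>)" unfolding latU_def
  proof
   fix x assume "x : \<Union>\<V>"
   then obtain V where "V : \<V>" "x : V" by blast
   moreover from this have "\<sigma> V = \<sigma> V0" using \<sigma> V0 by blast
   ultimately show "\<sigma> V0 : lat S x" using \<sigma> unfolding latU_def by fastforce
  qed
  moreover have "ALL V:\<V>. \<sigma> V0 = \<sigma> V" using V0 \<sigma> by blast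
  ultimately show "EX! s. s : latU S (\<Union>\<V>) & (ALL V:\<V>. s = \<sigma> V)" using V0 by (intro ex1I[of _ "\<sigma> V0"]) blast+
 qed auto
next
 fix U assume U: "aff U"
 note nU = affine_nopen[OF U]
 have SU: "S <= latU S U" unfolding latU_affine[OF U] by (rule lspan_incl[OF affine_subr[OF U]])
 show "EX T. finite T & T <= Sec (lat_sheaf S) U & (ALL s:Sec (lat_sheaf S) U. EX a:T \<rightarrow> \<O> U.
   s = finsum (msections (lat_sheaf S) U) (%b. a b \<odot>\<^bsub>msections (lat_sheaf S) U\<^esub> b) T)"
 proof (intro exI[of _ S] conjI ballI)
  fix s assume "s : Sec (lat_sheaf S) U"
  hence "s : lspan (\<O> U) ((%x. x) ` S)" by (simp add: latU_affine[OF U])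
  from lspan_image_finite[OF affine_subr[OF U] S this] obtain b where
   b: "ALL i:S. b i : \<O> U" "s = (\<Sum>i\<in>S. b i * i)" by blast
  have "finsum (plain_module (latU S U)) (%i. b i * i) S = (\<Sum>i\<in>S. b i * i)"
   by (rule plain_finsum[OF affine_subr[OF U] latU_submod[OF nU] S]) (use b SU submod_mult[OF latU_submod[OF nU]] in auto)
  thus "EX a:S \<rightarrow> \<O> U. s = finsum (msections (lat_sheaf S) U) (%b. a b \<odot>\<^bsub>msections (lat_sheaf S) U\<^esub> b) S"
   using b by (intro bexI[of _ b]) auto
 qed (use S SU in auto)
 fix f assume f: "f : \<O> U" "f ~= 0"
 let ?D = "bas U f"
 have DU: "?D <= U" using basic_open_eq[OF U f(1)] by auto
 show "EX n. EX u:Sec (lat_sheaf S) U. mrestrict (lat_sheaf S) U ?D u = f ^ n \<odot>\<^bsub>msections (lat_sheaf S) ?D\<^esub> s"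
  if "s : Sec (lat_sheaf S) ?D" for s
  using latU_basic[OF U f(1), of s S] that by (auto simp: latU_affine[OF U])
 show "EX n. f ^ n \<odot>\<^bsub>msections (lat_sheaf S) U\<^esub> u = \<zero>\<^bsub>msections (lat_sheaf S) U\<^esub>"
  if "mrestrict (lat_sheaf S) U ?D u = \<zero>\<^bsub>msections (lat_sheaf S) ?D\<^esub>" for u
  using that by auto
qed

end

section \<open>Duality in terms of principal parts\<close>

lemma (in field_over) separating_functional:
 fixes Y :: "('p => 'a) set"
 assumes Y: "(%x. 0) : Y" "!!f g. f : Y ==> g : Y ==> (%x. f x + g x) : Y" "!!c f. f : Y ==> (%x. \<iota> c * f x) : Y"
  and s: "s ~: Y"
 obtains R :: "('p => 'a) => 'k" where "!!f g. R (%x. f x + g x) = R f + R g" "!!c f. R (%x. \<iota> c * f x) = c * R f"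
  "!!f. f : Y ==> R f = 0" "R s ~= 0"
proof -
 interpret vp: vector_space_pair "%c (f :: 'p => 'a) x. \<iota> c * f x" "(*) :: 'k => 'k => 'k"
  by unfold_locales (auto simp: fun_eq_iff \<iota>_add \<iota>_mult \<iota>_1 algebra_simps)
 have sub: "vp.vs1.subspace Y" unfolding vp.vs1.subspace_def
  using Y by (auto simp: zero_fun_def plus_fun_def)
 obtain B where B: "B <= Y" "vp.vs1.independent B" "Y <= vp.vs1.span B" using vp.vs1.maximal_independent_subset by blast
 have "vp.vs1.span B = Y" using B vp.vs1.span_minimal[OF B(1) sub] by blast
 hence ind: "vp.vs1.independent (insert s B)" using vp.vs1.independent_insertI[OF _ B(2)] s by blast
 obtain R where R: "Vector_Spaces.linear (%c (f :: 'p => 'a) x. \<iota> c * f x) (*) R"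
  "ALL x:insert s B. R x = (if x = s then 1 else 0)"
  using vp.linear_independent_extend[OF ind, of "%x. if x = s then 1 else 0"] by blast
 interpret R: Vector_Spaces.linear "%c (f :: 'p => 'a) x. \<iota> c * f x" "(*)" R by (rule R(1))
 have "R f = 0" if "f : Y" for f
 proof -
  have "R b = 0" if "b : B" for b using R(2) that B s by auto
  hence "R f = 0" if "f : vp.vs1.span B" for f using R.eq_0_on_span that by blast
  thus ?thesis using that B by blast
 qed
 thus ?thesis using that[of R] R.add R.scale R(2) by (auto simp: plus_fun_def)
qed

locale dual_curve = complete_curve X \<iota> for X :: "('p, 'a::field) rspace" and \<iota> :: "'k::alg_closed_field => 'a" +
 fixes \<omega> :: "('p, 'a, 'w) omodule" and t :: "('p set => 'p set => 'w) => 'k" and e :: "'p set => 'w => 'a"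
 assumes dual: "dualizing X \<iota> \<omega> t" and triv: "generic_trivialization X \<omega> e"
begin

abbreviation add_\<omega> ("(_ \<oplus>[_]/ _)" [65, 0, 66] 65) where "s \<oplus>[U] s' \<equiv> add (msections \<omega> U) s s'"

abbreviation smult_\<omega> ("(_ \<odot>[_]/ _)" [71, 0, 70] 70) where "a \<odot>[U] s \<equiv> module.smult (msections \<omega> U) a s"

abbreviation "rst \<equiv> mrestrict \<omega>"

abbreviation zero_\<omega> ("\<zero>[_]") where "\<zero>[U] \<equiv> zero (msections \<omega> U)"

lemma coh: "coherent X \<omega>" and func: "H1_functional X \<iota> \<omega> t"
 using dual by (auto simp: dualizing_def)

lemmas sh = coherentD(1)[OF coh]

lemma dual_existence:
 fixes F :: "('p, 'a, 'a) omodule"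
 assumes "coherent X F" "H1_functional X \<iota> F r"
 obtains \<phi> where "sheaf_hom X F \<omega> \<phi>" "!!c. c : cocycles1 X F ==> t (%U V. \<phi> (U Int V) (c U V)) = r c"
proof -
 have "EX \<phi>. sheaf_hom X F \<omega> \<phi> & (ALL c:cocycles1 X F. t (%U V. \<phi> (U Int V) (c U V)) = r c)"
  using dual assms unfolding dualizing_def by (elim conjE) simp
 thus ?thesis using that by blast
qed

lemma dual_uniqueness:
 fixes F :: "('p, 'a, 'a) omodule"
 assumes "coherent X F" "sheaf_hom X F \<omega> \<phi>" "sheaf_hom X F \<omega> \<psi>"
  and "!!c. c : cocycles1 X F ==> t (%U V. \<phi> (U Int V) (c U V)) = t (%U V. \<psi> (U Int V) (c U V))"
  and "nop U" "s : Sec F U"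
 shows "\<phi> U s = \<psi> U s"
proof -
 have "ALL F :: ('p, 'a, 'a) omodule. coherent X F --> (ALL \<phi> \<psi>. sheaf_hom X F \<omega> \<phi> & sheaf_hom X F \<omega> \<psi>
     & (ALL c:cocycles1 X F. t (%U V. \<phi> (U Int V) (c U V)) = t (%U V. \<psi> (U Int V) (c U V)))
     --> (ALL U. nop U --> (ALL s:Sec F U. \<phi> U s = \<psi> U s)))"
  using dual unfolding dualizing_def by (elim conjE) simp
 thus ?thesis using assms by blast
qed

lemma t_coboundary:
 assumes "c : cocycles1 X \<omega>" "s : cochains0 X \<omega>" "!!U V. aff U ==> aff V ==> c U V = coboundary \<omega> s U V"
 shows "t c = 0"
 using func assms unfolding H1_functional_def by blast

lemma t_add:
 assumes "c : cocycles1 X \<omega>" "d : cocycles1 X \<omega>" "c' : cocycles1 X \<omega>"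
  "!!U V. aff U ==> aff V ==> c' U V = c U V \<oplus>[U Int V] d U V"
 shows "t c' = t c + t d"
 using func assms unfolding H1_functional_def by blast

lemma t_smult:
 assumes "c : cocycles1 X \<omega>" "d : cocycles1 X \<omega>"
  "!!U V. aff U ==> aff V ==> d U V = \<iota> a \<odot>[U Int V] c U V"
 shows "t d = a * t c"
 using func assms unfolding H1_functional_def by blast

lemma sheaf_homD:
 assumes "sheaf_hom X F G \<phi>"
 shows "!!U s. nop U ==> s : Sec F U ==> \<phi> U s : Sec G U"
  and "!!U s t. nop U ==> s : Sec F U ==> t : Sec F U ==> \<phi> U (s \<oplus>\<^bsub>msections F U\<^esub> t) = \<phi> U s \<oplus>\<^bsub>msections G U\<^esub> \<phi> U t"
  and "!!U a s. nop U ==> a : \<O> U ==> s : Sec F U ==> \<phi> U (a \<odot>\<^bsub>msections F U\<^esub> s) = a \<odot>\<^bsub>msections G U\<^esub> \<phi> U s"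
  and "!!U V s. nop U ==> nop V ==> V <= U ==> s : Sec F U ==> \<phi> V (mrestrict F U V s) = mrestrict G U V (\<phi> U s)"
 using assms unfolding sheaf_hom_def by (auto simp: Pi_iff)

lemma hom_cocycle:
 assumes F: "sheaf_of_modules X F" and \<phi>: "sheaf_hom X F \<omega> \<phi>" and c: "c : cocycles1 X F"
 shows "(%U V. \<phi> (U Int V) (c U V)) : cocycles1 X \<omega>"
 unfolding cocycles1_def
proof (intro CollectI conjI allI impI)
 fix U V assume "aff U & aff V"
 hence nUV: "nop (U Int V)" and cUV: "c U V : Sec F (U Int V)"
  using c nopen_Int affine_nopen by (auto simp: cocycles1_def)
 thus "\<phi> (U Int V) (c U V) : Sec \<omega> (U Int V)" using sheaf_homD(1)[OF \<phi>] by blast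
next
 fix U V W assume a: "aff U & aff V & aff W"
 let ?T = "U Int V Int W"
 have n: "nop (U Int V)" "nop (V Int W)" "nop (U Int W)" "nop ?T" using a nopen_Int affine_nopen by auto
 have m: "c U V : Sec F (U Int V)" "c V W : Sec F (V Int W)" "c U W : Sec F (U Int W)" using a c by (auto simp: cocycles1_def)
 have eq: "mrestrict F (U Int V) ?T (c U V) \<oplus>\<^bsub>msections F ?T\<^esub> mrestrict F (V Int W) ?T (c V W) = mrestrict F (U Int W) ?T (c U W)"
  using a c unfolding cocycles1_def by blast
 have r: "rst A ?T (\<phi> A s) = \<phi> ?T (mrestrict F A ?T s)" if "nop A" "?T <= A" "s : Sec F A" for A s
  using sheaf_homD(4)[OF \<phi> that(1) n(4) that(2,3)] by simp
 have "\<phi> ?T (mrestrict F (U Int V) ?T (c U V)) \<oplus>[?T] \<phi> ?T (mrestrict F (V Int W) ?T (c V W))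
  = \<phi> ?T (mrestrict F (U Int W) ?T (c U W))"
  unfolding eq[symmetric] by (rule sheaf_homD(2)[OF \<phi> n(4), symmetric]) (use sheafD(2)[OF F] n m in auto)
 thus "rst (U Int V) ?T (\<phi> (U Int V) (c U V)) \<oplus>[?T] rst (V Int W) ?T (\<phi> (V Int W) (c V W))
  = rst (U Int W) ?T (\<phi> (U Int W) (c U W))"
  by (subst (1 2 3) r) (use n m in auto)
qed

subsection \<open>The dualizing sheaf is torsion-free\<close>

lemma module_\<omega>: "nop U ==> module (ring_on (\<O> U)) (msections \<omega> U)"
 by (rule sheafD(1)[OF sh])

lemma sc_closed: "nop U ==> a : \<O> U ==> s : Sec \<omega> U ==> a \<odot>[U] s : Sec \<omega> U"
 and sc_ldistr: "nop U ==> a : \<O> U ==> b : \<O> U ==> s : Sec \<omega> U ==>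
  (a + b) \<odot>[U] s = a \<odot>[U] s \<oplus>[U] b \<odot>[U] s"
 and sc_assoc: "nop U ==> a : \<O> U ==> b : \<O> U ==> s : Sec \<omega> U ==>
  (a * b) \<odot>[U] s = a \<odot>[U] (b \<odot>[U] s)"
 and sc_one: "nop U ==> s : Sec \<omega> U ==> 1 \<odot>[U] s = s"
 and sc_zero: "nop U ==> a : \<O> U ==> a \<odot>[U] \<zero>[U] = \<zero>[U]"
 and sc_null: "nop U ==> s : Sec \<omega> U ==> 0 \<odot>[U] s = \<zero>[U]"
 and zero_add: "nop U ==> \<zero>[U] \<oplus>[U] \<zero>[U] = \<zero>[U]"
proof -
 assume U: "nop U"
 interpret m: module "ring_on (\<O> U)" "msections \<omega> U" by (rule module_\<omega>[OF U])
 show "a : \<O> U ==> s : Sec \<omega> U ==> a \<odot>[U] s : Sec \<omega> U" using m.smult_closed by simp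
 show "a : \<O> U ==> b : \<O> U ==> s : Sec \<omega> U ==>
  (a + b) \<odot>[U] s = a \<odot>[U] s \<oplus>[U] b \<odot>[U] s" using m.smult_l_distr[of a b s] by simp
 show "a : \<O> U ==> b : \<O> U ==> s : Sec \<omega> U ==>
  (a * b) \<odot>[U] s = a \<odot>[U] (b \<odot>[U] s)" using m.smult_assoc1[of a b s] by simp
 show "s : Sec \<omega> U ==> 1 \<odot>[U] s = s" using m.smult_one[of s] by simp
 show "a : \<O> U ==> a \<odot>[U] \<zero>[U] = \<zero>[U]" using m.smult_r_null[of a] by simp
 show "s : Sec \<omega> U ==> 0 \<odot>[U] s = \<zero>[U]" using m.smult_l_null[of s] by simp
 show "\<zero>[U] \<oplus>[U] \<zero>[U] = \<zero>[U]" by simp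
qed

lemma e_add: "nop U ==> s : Sec \<omega> U ==> s' : Sec \<omega> U ==> e U (s \<oplus>[U] s') = e U s + e U s'"
 and e_smult: "nop U ==> a : \<O> U ==> s : Sec \<omega> U ==> e U (a \<odot>[U] s) = a * e U s"
 and e_zero_iff: "nop U ==> s : Sec \<omega> U ==> e U s = 0 \<longleftrightarrow> (EX V. nop V & V <= U & rst U V s = \<zero>[V])"
 and e_restrict: "nop U ==> nop V ==> V <= U ==> s : Sec \<omega> U ==> e V (rst U V s) = e U s"
 and e_UN: "(\<Union>U\<in>{U. nop U}. e U ` Sec \<omega> U) = UNIV"
 using triv unfolding generic_trivialization_def by simp_all

text \<open>A torsion section vanishes on a nonempty open set, so near a point x it can be extended by zero to a global section
 z that is supported at x.  Multiplication by z is a homomorphism from the structure sheaf.  It is zero in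
 cohomology: for a cocycle c the sections \<open>u\<^sub>T\<close> that are \<open>c\<^sub>A\<^sub>T z\<close> near x and zero away from x bound c z.  By
 the uniqueness part of duality the homomorphism is zero, and so is z.\<close>

lemma torsion_free:
 assumes U: "nop U" and s: "s : Sec \<omega> U" "e U s = 0" shows "s = \<zero>[U]"
proof -
 obtain V where V: "nop V" "V <= U" "rst U V s = \<zero>[V]" using e_zero_iff[OF U s(1)] s(2) by blast
 have "EX W. nop W & x : W & W <= U & rst U W s = \<zero>[W]" if x: "x : U" for x
 proof (cases "x : V")
  case False
  let ?W = "insert x V" and ?P = "pts - {x}"
  have xp: "x : pts" using nopen_sub[OF U] x by blast
  have W: "nop ?W" "?W <= U" and P: "nop ?P"
   using superset_open[OF V(1), of "insert x V"] superset_open[OF V(1), of "pts - {x}"] False x V(2) nopen_sub[OF U] nopen_sub[OF V(1)] by auto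
  have WP: "?W Int ?P = V" "?P Int ?W = V" "?W Un ?P = pts" using False nopen_sub[OF V(1)] xp by auto
  have rW: "rst U ?W s : Sec \<omega> ?W" by (rule sheafD(2)[OF sh U W s(1)])
  have "rst ?W V (rst U ?W s) = rst ?P V \<zero>[?P]"
   using sheafD(6)[OF sh U W(1) V(1) subset_insertI W(2) s(1)] V(3) restrict_zero[OF sh P V(1)] False nopen_sub[OF V(1)] by (simp add: subset_Diff_insert)
  then obtain z where z: "z : Sec \<omega> pts" "rst pts ?W z = rst U ?W s" "rst pts ?P z = \<zero>[?P]"
   using glue_two[OF sh W(1) rW P zero_mem[OF sh P]] unfolding WP by blast
  define zr where "zr T = rst pts T z" for T
  have zm: "zr T : Sec \<omega> T" if "nop T" for T
   unfolding zr_def by (rule sheafD(2)[OF sh nopen_pts that nopen_sub[OF that] z(1)])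
  have zres: "rst S T (zr S) = zr T" if "nop S" "nop T" "T <= S" for S T
   unfolding zr_def by (rule sheafD(6)[OF sh nopen_pts that nopen_sub[OF that(1)] z(1)])
  have z0: "zr T = \<zero>[T]" if T: "nop T" "T <= ?P" for T
   using zres[OF P T] z(3) restrict_zero[OF sh P T] by (simp add: zr_def)
  let ?F = "lat_sheaf {1}"
  have F: "Sec ?F T = \<O> T" if "nop T" for T
   using lspan_one[OF stalk_subr] nopen_sub[OF that] sections_eq_stalks[OF that] by (simp add: latU_def lat_def subset_iff)
  define \<phi> where "\<phi> T a = a \<odot>[T] zr T" for T a
  have \<phi>m: "\<phi> T a : Sec \<omega> T" if "nop T" "a : \<O> T" for T a unfolding \<phi>_def by (rule sc_closed[OF that zm[OF that(1)]])
  have \<phi>r: "rst S T (\<phi> S a) = \<phi> T a" if "nop S" "nop T" "T <= S" "a : \<O> S" for S T a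
   unfolding \<phi>_def sheafD(4)[OF sh that zm[OF that(1)]] zres[OF that(1-3)] ..
  have \<phi>0: "\<phi> T a = \<zero>[T]" if "nop T" "T <= ?P" "a : \<O> T" for T a
   unfolding \<phi>_def z0[OF that(1,2)] by (rule sc_zero[OF that(1,3)])
  have hom\<phi>: "sheaf_hom X ?F \<omega> \<phi>" unfolding sheaf_hom_def \<phi>_def
   using F sc_closed zm sc_ldistr[OF _ _ _ zm] sc_assoc[OF _ _ _ zm] sheafD(4)[OF sh _ _ _ _ zm] zres by simp
  define \<psi> where "\<psi> T (c::'a) = \<zero>[T]" for T c
  have hom\<psi>: "sheaf_hom X ?F \<omega> \<psi>" unfolding sheaf_hom_def \<psi>_def
   using zero_mem[OF sh] zero_add sc_zero restrict_zero[OF sh] F by simp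
  have coF: "coherent X ?F" by (rule lat_sheaf_coherent) simp
  note shF = coherentD(1)[OF coF]
  obtain A where A: "aff A" "x : A" using affine_cover[OF xp] by blast
  have "\<phi> ?W 1 = \<psi> ?W 1"
  proof (rule dual_uniqueness[OF coF hom\<phi> hom\<psi> _ W(1)])
   show "1 : Sec ?F ?W" unfolding F[OF W(1)] by (rule subr_1[OF sections_subr[OF W(1)]])
   fix c assume c: "c : cocycles1 X ?F"
   have c\<phi>: "(%U V. \<phi> (U Int V) (c U V)) : cocycles1 X \<omega>" and c\<psi>: "(%U V. \<psi> (U Int V) (c U V)) : cocycles1 X \<omega>"
    using hom_cocycle[OF shF _ c] hom\<phi> hom\<psi> by auto
   have cO: "c S T : \<O> (S Int T)" if "aff S" "aff T" for S T
    using c that F[OF nopen_Int] affine_nopen unfolding cocycles1_def by blast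
   have cc: "c A S + c S T = c A T" if "aff S" "aff T" for S T
    using c A(1) that unfolding cocycles1_def by simp
   have n: "nop (T Int A)" "nop (T Int ?P)" "T Int A Un T Int ?P = T" if "nop T" for T
    using that nopen_Int A P affine_nopen nopen_sub[OF that] by auto
   have "EX u. u : Sec \<omega> T & rst T (T Int A) u = \<phi> (T Int A) (c A T) & rst T (T Int ?P) u = \<zero>[T Int ?P]"
    if T: "aff T" for T
   proof -
    note m = n[OF affine_nopen[OF T]] and I = nopen_Int[OF n(1,2)[OF affine_nopen[OF T]]]
    have a: "c A T : \<O> (T Int A)" using cO[OF A(1) T] by (simp add: Int_commute)
    have "rst (T Int A) (T Int A Int (T Int ?P)) (\<phi> (T Int A) (c A T)) = rst (T Int ?P) (T Int A Int (T Int ?P)) \<zero>[T Int ?P]"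
     using \<phi>r[OF m(1) I Int_lower1 a] \<phi>0[OF I _ subsetD[OF sections_mono[OF m(1) I Int_lower1] a]] restrict_zero[OF sh m(2) I Int_lower2] by (simp add: le_infI2)
    from glue_two[OF sh m(1) \<phi>m[OF m(1) a] m(2) zero_mem[OF sh m(2)] this] show ?thesis unfolding m(3) by blast
   qed
   then obtain u where u: "!!T. aff T ==> u T : Sec \<omega> T & rst T (T Int A) (u T) = \<phi> (T Int A) (c A T)
     & rst T (T Int ?P) (u T) = \<zero>[T Int ?P]" by metis
   have uA: "rst T S (u T) = \<phi> S (c A T)" if T: "aff T" "nop S" "S <= T Int A" for T S
    using sheafD(6)[OF sh affine_nopen[OF T(1)] n(1)[OF affine_nopen[OF T(1)]] T(2,3) Int_lower1 conjunct1[OF u[OF T(1)]]] u[OF T(1)]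
     \<phi>r[OF n(1)[OF affine_nopen[OF T(1)]] T(2,3)] cO[OF A(1) T(1)] unfolding Int_commute[of A] by simp
   have uP: "rst T S (u T) = \<zero>[S]" if T: "aff T" "nop S" "S <= T Int ?P" for T S
    using sheafD(6)[OF sh affine_nopen[OF T(1)] n(2)[OF affine_nopen[OF T(1)]] T(2,3) Int_lower1 conjunct1[OF u[OF T(1)]]] u[OF T(1)]
     restrict_zero[OF sh n(2)[OF affine_nopen[OF T(1)]] T(2,3)] by simp
   have "t (%U V. \<phi> (U Int V) (c U V)) = 0"
   proof (rule t_coboundary[OF c\<phi>, of u])
    show "u : cochains0 X \<omega>" using u by (simp add: cochains0_def)
    fix S T assume ST: "aff S" "aff T"
    let ?I = "S Int T"
    have I: "nop ?I" and nS: "nop S" and nT: "nop T" using nopen_Int affine_nopen ST by auto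
    interpret G: abelian_group "msections \<omega> ?I" by (rule sec_abelian[OF sh I])
    have rS: "rst S ?I (u S) : Sec \<omega> ?I" and rT: "rst T ?I (u T) : Sec \<omega> ?I"
     using sheafD(2)[OF sh nS I] sheafD(2)[OF sh nT I] u ST by auto
    note f = \<phi>m[OF I cO[OF ST]]
    have eq: "\<phi> ?I (c S T) \<oplus>[?I] rst S ?I (u S) = rst T ?I (u T)"
    proof (rule sec_eq_local[OF sh, of "{?I Int A, ?I Int ?P}"])
     show "V : {?I Int A, ?I Int ?P} ==> nop V" for V using n[OF I] by blast
     show "?I = \<Union>{?I Int A, ?I Int ?P}" using n(3)[OF I] by simp
     show "\<phi> ?I (c S T) \<oplus>[?I] rst S ?I (u S) : Sec \<omega> ?I" by (rule G.a_closed[OF f rS])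
     fix V assume V: "V : {?I Int A, ?I Int ?P}"
     hence nV: "nop V" and VI: "V <= ?I" using n[OF I] by auto
     have a: "c S T : \<O> V" using sections_mono[OF I nV VI] cO[OF ST] by blast
     have l: "rst ?I V (\<phi> ?I (c S T) \<oplus>[?I] rst S ?I (u S))
      = \<phi> V (c S T) \<oplus>[V] rst S V (u S)"
      unfolding sheafD(3)[OF sh I nV VI f rS] \<phi>r[OF I nV VI cO[OF ST]]
      using sheafD(6)[OF sh nS I nV VI] u[OF ST(1)] by simp
     have r: "rst ?I V (rst T ?I (u T)) = rst T V (u T)"
      using sheafD(6)[OF sh nT I nV VI] u[OF ST(2)] by simp
     show "rst ?I V (\<phi> ?I (c S T) \<oplus>[?I] rst S ?I (u S)) = rst ?I V (rst T ?I (u T))"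
     proof (cases "V <= A")
      case True
      hence VA: "V <= S Int A" "V <= T Int A" using VI by auto
      have "c A S : \<O> (A Int S)" by (rule cO[OF A(1) ST(1)])
      hence a': "c A S : \<O> V" using sections_mono[OF nopen_Int[OF affine_nopen[OF A(1)] nS] nV] VA by blast
      show ?thesis unfolding l r uA[OF ST(1) nV VA(1)] uA[OF ST(2) nV VA(2)] cc[OF ST, symmetric]
       unfolding \<phi>_def sc_ldistr[OF nV a a' zm[OF nV], symmetric] by (simp add: add.commute)
     next
      case False
      hence VP: "V <= S Int ?P" "V <= T Int ?P" "V <= ?P" using V VI by auto
      show ?thesis unfolding l r uP[OF ST(1) nV VP(1)] uP[OF ST(2) nV VP(2)] \<phi>0[OF nV VP(3) a] by (rule zero_add[OF nV])
     qed
    qed (use rT in auto)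
    show "\<phi> ?I (c S T) = coboundary \<omega> u S T"
     unfolding coboundary_def eq[symmetric] using f rS by (simp add: a_minus_def G.a_assoc G.r_neg)
   qed
   moreover have "t (%U V. \<psi> (U Int V) (c U V)) = 0 * t (%U V. \<phi> (U Int V) (c U V))"
    by (rule t_smult[OF c\<phi> c\<psi>]) (use \<phi>m cO nopen_Int affine_nopen sc_null in \<open>simp add: \<psi>_def \<iota>_0\<close>)
   ultimately show "t (%U V. \<phi> (U Int V) (c U V)) = t (%U V. \<psi> (U Int V) (c U V))" by simp
  qed
  hence "zr ?W = \<zero>[?W]" using sc_one[OF W(1) zm[OF W(1)]] by (simp add: \<phi>_def \<psi>_def)
  thus ?thesis using W z(2) by (auto simp: zr_def)
 qed (use V in blast)
 then obtain W where W: "!!x. x : U ==> nop (W x) & W x <= U & x : W x & rst U (W x) s = \<zero>[W x]" by metis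
 show ?thesis
  by (rule sec_eq_local[OF sh, of "W ` U"]) (use W U s zero_mem[OF sh U] restrict_zero[OF sh U] in \<open>auto simp: nopen_def\<close>)
qed

end

section \<open>The dualizing sheaf as a sheaf of fractional ideals\<close>

context dual_curve
begin

text \<open>The trivialization identifies the dualizing sheaf with a subsheaf of the constant sheaf; MU and mst are
 its sections and stalks.\<close>

definition MU :: "'p set => 'a set" where "MU U = e U ` Sec \<omega> U"

definition mst :: "'p => 'a set" where "mst x = (\<Union>U\<in>{U. nop U & x : U}. MU U)"

definition einv :: "'p set => 'a => 'w" where "einv U z = (SOME s. s : Sec \<omega> U & e U s = z)"

lemma e_inj:
 assumes U: "nop U" and s: "s : Sec \<omega> U" "s' : Sec \<omega> U" "e U s = e U s'" shows "s = s'"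
proof -
 interpret A: abelian_group "msections \<omega> U" by (rule sec_abelian[OF sh U])
 have m: "- 1 : \<O> U" using sections_subr[OF U] by (simp add: subr_closed)
 have "s' \<oplus>[U] (- 1) \<odot>[U] s' = (1 + - 1) \<odot>[U] s'"
  using sc_ldistr[OF U subr_1[OF sections_subr[OF U]] m s(2)] sc_one[OF U s(2)] by simp
 hence i: "s' \<oplus>[U] (- 1) \<odot>[U] s' = \<zero>[U]" using sc_null[OF U s(2)] by simp
 have n: "(- 1) \<odot>[U] s' : Sec \<omega> U" by (rule sc_closed[OF U m s(2)])
 have "s \<oplus>[U] (- 1) \<odot>[U] s' = \<zero>[U]"
  by (rule torsion_free[OF U]) (use e_add[OF U s(1) n] e_smult[OF U m s(2)] s n in auto)
 thus ?thesis using i s n by (metis A.add.inv_equality A.add.m_comm)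
qed

lemma einv: "z : MU U ==> einv U z : Sec \<omega> U & e U (einv U z) = z"
 unfolding MU_def einv_def by (rule someI_ex) blast

lemma einv_eq: "nop U ==> s : Sec \<omega> U ==> einv U (e U s) = s"
 using einv[of "e U s" U] e_inj[of U] by (auto simp: MU_def)

lemma MU_submod: assumes U: "nop U" shows "submod (\<O> U) (MU U)"
 unfolding submod_def MU_def
proof (intro conjI ballI)
 have "e U (0 \<odot>[U] \<zero>[U]) = 0" using e_smult[OF U subr_0[OF sections_subr[OF U]] zero_mem[OF sh U]] by simp
 thus "0 : e U ` Sec \<omega> U" using sc_closed[OF U subr_0[OF sections_subr[OF U]] zero_mem[OF sh U]] by (metis imageI)
 interpret A: abelian_group "msections \<omega> U" by (rule sec_abelian[OF sh U])
 fix x assume x: "x : e U ` Sec \<omega> U"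
 then obtain s where s: "s : Sec \<omega> U" "x = e U s" by blast
 show "x + y : e U ` Sec \<omega> U" if "y : e U ` Sec \<omega> U" for y
 proof -
  from that obtain s' where s': "s' : Sec \<omega> U" "y = e U s'" by blast
  show ?thesis unfolding s(2) s'(2) e_add[OF U s(1) s'(1), symmetric] by (rule imageI[OF A.a_closed[OF s(1) s'(1)]])
 qed
 show "a * x : e U ` Sec \<omega> U" if a: "a : \<O> U" for a
  unfolding s(2) e_smult[OF U a s(1), symmetric] by (rule imageI[OF sc_closed[OF U a s(1)]])
qed

lemma MU_mono: assumes "nop U" "nop V" "V <= U" shows "MU U <= MU V"
 unfolding MU_def
proof (rule image_subsetI)
 fix s assume s: "s : Sec \<omega> U"
 show "e U s : e V ` Sec \<omega> V" unfolding e_restrict[OF assms s, symmetric] by (rule imageI[OF sheafD(2)[OF sh assms s]])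
qed

lemma einv_restrict:
 assumes "nop U" "nop V" "V <= U" "z : MU U" shows "rst U V (einv U z) = einv V z"
proof -
 note z = einv[OF assms(4)] and z' = einv[OF subsetD[OF MU_mono[OF assms(1-3)] assms(4)]]
 show ?thesis by (rule e_inj[OF assms(2)]) (use z z' sheafD(2)[OF sh assms(1-3)] e_restrict[OF assms(1-3)] in auto)
qed

lemma einv_add:
 assumes U: "nop U" and z: "z : MU U" "z' : MU U" shows "einv U (z + z') = einv U z \<oplus>[U] einv U z'"
proof -
 interpret A: abelian_group "msections \<omega> U" by (rule sec_abelian[OF sh U])
 note s = conjunct1[OF einv[OF z(1)]] conjunct1[OF einv[OF z(2)]]
 have "e U (einv U z \<oplus>[U] einv U z') = z + z'" unfolding e_add[OF U s] using einv[OF z(1)] einv[OF z(2)] by simp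
 thus ?thesis using einv_eq[OF U A.a_closed[OF s]] by simp
qed

lemma einv_smult:
 assumes U: "nop U" and z: "z : MU U" "a : \<O> U" shows "einv U (a * z) = a \<odot>[U] einv U z"
 proof -
 note s = conjunct1[OF einv[OF z(1)]]
 have "e U (a \<odot>[U] einv U z) = a * z" unfolding e_smult[OF U z(2) s] using einv[OF z(1)] by simp
 thus ?thesis using einv_eq[OF U sc_closed[OF U z(2) s]] by simp
qed

lemma MU_glue:
 assumes V: "\<V> ~= {}" "!!V. V : \<V> ==> nop V" and z: "!!V. V : \<V> ==> z : MU V" shows "z : MU (\<Union>\<V>)"
proof -
 have "EX! s. s : Sec \<omega> (\<Union>\<V>) & (ALL V:\<V>. rst (\<Union>\<V>) V s = einv V z)"
 proof (rule sheaf_glue[OF sh V])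
  show "einv W z : Sec \<omega> W" if "W : \<V>" for W using einv z that by blast
  show "rst W (W Int W') (einv W z) = rst W' (W Int W') (einv W' z)" if "W : \<V>" "W' : \<V>" for W W'
   using einv_restrict[OF V(2) nopen_Int[OF V(2) V(2)] _ z] that by simp
 qed
 then obtain s where s: "s : Sec \<omega> (\<Union>\<V>)" "!!V. V : \<V> ==> rst (\<Union>\<V>) V s = einv V z" by blast
 obtain V0 where V0: "V0 : \<V>" using V(1) by blast
 have "e (\<Union>\<V>) s = e V0 (einv V0 z)" using e_restrict[OF nopen_Union[OF V] V(2)[OF V0] Union_upper[OF V0] s(1)] s(2)[OF V0] by simp
 thus ?thesis using s(1) einv[OF z[OF V0]] by (auto simp: MU_def)
qed

lemma mst_iff: "z : mst x \<longleftrightarrow> (EX U. nop U & x : U & z : MU U)" by (auto simp: mst_def)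

lemma MU_mst: "nop U ==> x : U ==> MU U <= mst x" by (auto simp: mst_iff)

lemma MU_local: assumes W: "nop W" shows "z : MU W \<longleftrightarrow> (ALL x:W. z : mst x)"
proof
 assume a: "ALL x:W. z : mst x"
 let ?V = "{V. nop V & V <= W & z : MU V}"
 have c: "EX V:?V. x : V" if x: "x : W" for x
 proof -
  obtain U where U: "nop U" "x : U" "z : MU U" using a x mst_iff by blast
  thus ?thesis using nopen_Int[OF U(1) W] MU_mono[OF U(1), of "U Int W"] x by (intro bexI[of _ "U Int W"]) auto
 qed
 hence "\<Union>?V = W" by blast
 obtain x where "x : W" using W by (auto simp: nopen_def)
 with c have "?V ~= {}" by blast
 hence "z : MU (\<Union>?V)" by (rule MU_glue) blast+
 thus "z : MU W" using `\<Union>?V = W` by (simp only:)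
qed (use MU_mst[OF W] in blast)

lemma mst_submod: assumes x: "x : pts" shows "submod (stk x) (mst x)"
 unfolding submod_def
proof (intro conjI ballI)
 show "0 : mst x" using MU_mst[OF nopen_pts x] submod_0[OF MU_submod[OF nopen_pts]] by blast
 fix u assume "u : mst x"
 then obtain U where U: "nop U" "x : U" "u : MU U" by (auto simp: mst_iff)
 show "u + v : mst x" if v: "v : mst x" for v
 proof -
  obtain V where V: "nop V" "x : V" "v : MU V" using v by (auto simp: mst_iff)
  note n = nopen_Int[OF U(1) V(1)]
  have "u : MU (U Int V)" "v : MU (U Int V)" using MU_mono[OF _ n] U V by auto
  thus ?thesis using submod_add[OF MU_submod[OF n]] MU_mst[OF n, of x] U V by blast
 qed
 show "a * u : mst x" if a: "a : stk x" for a
 proof -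
  obtain V where V: "nop V" "x : V" "a : \<O> V" using a by (auto simp: stalk_iff nopen_def)
  note n = nopen_Int[OF U(1) V(1)]
  have "u : MU (U Int V)" "a : \<O> (U Int V)" using MU_mono[OF _ n] sections_mono[OF V(1) n] U V by auto
  thus ?thesis using submod_mult[OF MU_submod[OF n]] MU_mst[OF n, of x] U V by blast
 qed
qed

lemma mst_nloc: assumes U: "aff U" "x : U" shows "mst x = nloc (\<O> U) (MU U) (pp U x)"
proof
 note nU = affine_nopen[OF U(1)]
 have xp: "x : pts" using nopen_sub[OF nU] U by blast
 show "mst x <= nloc (\<O> U) (MU U) (pp U x)"
 proof
  fix z assume "z : mst x"
  then obtain W where W: "nop W" "x : W" "z : MU W" by (auto simp: mst_iff)
  obtain f where f: "f : \<O> U" "f ~: pp U x" "f ~= 0" "bas U f <= W"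
   by (rule basic_open_basis[OF U(1) _ W(2) U(2)]) (use W(1) in \<open>auto simp: nopen_def\<close>)
  note nD = basic_open_nopen[OF U(1) f(1,3)]
  have DU: "bas U f <= U" using basic_open_eq[OF U(1) f(1)] by auto
  have zD: "z : MU (bas U f)" using MU_mono[OF W(1) nD f(4)] W(3) by blast
  obtain n u where u: "u : Sec \<omega> U" "rst U (bas U f) u
   = f ^ n \<odot>[bas U f] einv (bas U f) z"
   using coherentD(3)[OF coh U(1) f(1,3)] einv[OF zD] by blast
  have "f ^ n : \<O> (bas U f)" using sections_mono[OF nU nD DU] subr_power[OF affine_subr[OF U(1)] f(1)] by blast
  from e_smult[OF nD this, of "einv (bas U f) z"] have "e U u = f ^ n * z"
   using e_restrict[OF nU nD DU u(1)] u(2) einv[OF zD] by simp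
  hence "f ^ n * z : MU U" using imageI[OF u(1), of "e U"] by (simp add: MU_def)
  moreover have "f ^ n ~: pp U x" using prime_of_power[OF pp_prime[OF U] affine_subr[OF U(1)] f(1)] f(2) by blast
  ultimately show "z : nloc (\<O> U) (MU U) (pp U x)" using subr_power[OF affine_subr[OF U(1)] f(1)] by (auto simp: nloc_def)
 qed
 have "MU U <= mst x" by (rule MU_mst[OF nU U(2)])
 hence "lspan (localization (\<O> U) (pp U x)) (MU U) <= mst x"
  using lspan_min[OF mst_submod[OF xp]] stalk_eq_localization[OF U] by metis
 thus "nloc (\<O> U) (MU U) (pp U x) <= mst x"
  using nloc_eq_lspan[OF affine_subr[OF U(1)] pp_prime[OF U] MU_submod[OF nU]] by metis
qed

lemma MU_nonzero: assumes U: "aff U" obtains m where "m : MU U" "m ~= 0"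
proof -
 obtain W where W: "nop W" "1 : MU W"
 proof -
  have "1 : (\<Union>U\<in>{U. nop U}. e U ` Sec \<omega> U)" using e_UN by (simp only: UNIV_I)
  thus ?thesis using that unfolding MU_def by blast
 qed
 obtain x where x: "x : U" "x : W" using nopen_Int[OF affine_nopen[OF U] W(1)] by (auto simp: nopen_def)
 have "1 : nloc (\<O> U) (MU U) (pp U x)" using mst_nloc[OF U x(1)] MU_mst[OF W(1) x(2)] W(2) by blast
 then obtain s where "s : \<O> U" "s ~: pp U x" "s * 1 : MU U" by (auto simp: nloc_def)
 thus ?thesis using that[of s] submod_0[OF prime_ofD(1)[OF pp_prime[OF U x(1)]]] by auto
qed

lemma e_finsum:
 assumes U: "nop U" and "finite S" "a : S \<rightarrow> \<O> U" "s : S \<rightarrow> Sec \<omega> U"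
 shows "finsum (msections \<omega> U) (%i. a i \<odot>[U] s i) S : Sec \<omega> U
  & e U (finsum (msections \<omega> U) (%i. a i \<odot>[U] s i) S) = (\<Sum>i\<in>S. a i * e U (s i))"
 using assms(2-)
proof (induction S rule: finite_induct)
 interpret A: abelian_group "msections \<omega> U" by (rule sec_abelian[OF sh U])
 case empty
 have "e U \<zero>[U] = 0" using e_smult[OF U subr_0[OF sections_subr[OF U]] zero_mem[OF sh U]] sc_null[OF U zero_mem[OF sh U]] by simp
 thus ?case by simp
next
 interpret A: abelian_group "msections \<omega> U" by (rule sec_abelian[OF sh U])
 case (insert b F)
 have "(%i. a i \<odot>[U] s i) : insert b F \<rightarrow> Sec \<omega> U" using insert.prems sc_closed[OF U] by (auto simp: Pi_iff)
 thus ?case using insert.IH insert.prems A.a_closed e_add[OF U] e_smult[OF U]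
  A.finsum_insert[OF insert.hyps, of "%i. a i \<odot>[U] s i"] insert.hyps by (simp add: Pi_iff)
qed

lemma MU_fg: assumes U: "aff U" obtains T where "finite T" "T <= MU U" "MU U = lspan (\<O> U) T"
proof -
 note nU = affine_nopen[OF U]
 obtain S where S: "finite S" "S <= Sec \<omega> U"
  "!!s. s : Sec \<omega> U ==> EX a:S \<rightarrow> \<O> U. s = finsum (msections \<omega> U) (%b. a b \<odot>[U] b) S"
  using coherentD(2)[OF coh U] by blast
 have T: "e U ` S <= MU U" using S(2) by (auto simp: MU_def)
 have "e U s : lspan (\<O> U) (e U ` S)" if s: "s : Sec \<omega> U" for s
 proof -
  obtain a where a: "a : S \<rightarrow> \<O> U" "s = finsum (msections \<omega> U) (%b. a b \<odot>[U] b) S" using S(3)[OF s] by blast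
  have "e U s = (\<Sum>b\<in>S. a b * e U b)" using e_finsum[OF nU S(1) a(1), of "%b. b"] S(2) a(2) by auto
  thus ?thesis using lspan_sum[OF S(1) affine_subr[OF U], of a "e U" "e U ` S"] a(1) by (auto simp: Pi_iff)
 qed
 hence "MU U <= lspan (\<O> U) (e U ` S)" unfolding MU_def by blast
 thus ?thesis using that[of "e U ` S"] lspan_min[OF MU_submod[OF nU] T] S(1) T by blast
qed

subsection \<open>The trace as a functional on principal parts\<close>

text \<open>An adele has a class in the first cohomology of the dualizing sheaf: choose on each affine open set a function with
 these principal parts, and take the differences.  The trace of the adele is the value of the dualizing
 functional on this class.\<close>

definition adele :: "('p => 'a) => bool" where "adele s \<longleftrightarrow> finite {x : pts. s x ~: stk x}"

definition represents :: "('p set => 'a) => ('p => 'a) => bool" where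
 "represents \<sigma> s \<longleftrightarrow> (ALL W. aff W --> (ALL x:W. \<sigma> W - s x : mst x))"

definition cech :: "('p set => 'a) => 'p set => 'p set => 'w" where
 "cech \<sigma> U V = einv (U Int V) (\<sigma> V - \<sigma> U)"

definition trace :: "('p => 'a) => 'k" where "trace s = t (cech (SOME \<sigma>. represents \<sigma> s))"

lemma approximate_lattice:
 assumes s: "adele s" and W: "aff W" and N: "submod (\<O> W) N" "n : N" "n ~= 0"
 shows "EX z. ALL x:W. z - s x : nloc (\<O> W) N (pp W x)"
proof -
 note Ws = affine_subr[OF W] and nW = affine_nopen[OF W]
 let ?B = "{x : pts. s x ~: stk x} Un {x : pts. inverse n ~: stk x}"
 have good: "s x : nloc (\<O> W) N (pp W x)" if x: "x : W" "x ~: ?B" for x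
 proof -
  have xp: "x : pts" using nopen_sub[OF nW] x by blast
  have "s x * inverse n * n : lspan (stk x) N"
   by (intro lspan_mult subr_mult stalk_subr[OF xp] subsetD[OF lspan_incl]) (use x xp N in auto)
  hence "s x : lspan (stk x) N" using N(3) by (simp add: mult.assoc)
  thus ?thesis using nloc_eq_lspan[OF Ws pp_prime[OF W x(1)] N(1)] stalk_eq_localization[OF W x(1)] by simp
 qed
 let ?T = "pp W ` (?B Int W)"
 define pt where "pt p = (THE x. x : W & pp W x = p)" for p
 have pt: "pt (pp W x) = x" if "x : W" for x unfolding pt_def by (rule the_equality) (use pp_inj[OF W _ that] that in auto)
 have "EX z. ALL p. prime_of (\<O> W) p --> z - (if p : ?T then s (pt p) else 0) : nloc (\<O> W) N p"
  by (rule approximation[OF FD_affine[OF W] affine_fractions[OF W] N])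
   (use s finite_poles pp_prime[OF W] in \<open>auto simp: adele_def\<close>)
 then obtain z where z: "!!p. prime_of (\<O> W) p ==> z - (if p : ?T then s (pt p) else 0) : nloc (\<O> W) N p" by blast
 have "z - s x : nloc (\<O> W) N (pp W x)" if x: "x : W" for x
 proof (cases "x : ?B")
  case True
  thus ?thesis using z[OF pp_prime[OF W x]] pt[OF x] x by auto
 next
  case False
  hence "pp W x ~: ?T" using pp_inj[OF W x] by blast
  hence "z : nloc (\<O> W) N (pp W x)" using z[OF pp_prime[OF W x]] by simp
  thus ?thesis using submod_diff[OF nloc_submod[OF Ws pp_prime[OF W x] N(1)] Ws _ good[OF x False]] by blast
 qed
 thus ?thesis by blast
qed

lemma represents_exists: assumes "adele s" obtains \<sigma> where "represents \<sigma> s"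
proof -
 have "EX z. ALL x:W. z - s x : mst x" if W: "aff W" for W
 proof -
  obtain m where "m : MU W" "m ~= 0" by (rule MU_nonzero[OF W])
  from approximate_lattice[OF assms W MU_submod[OF affine_nopen[OF W]] this] show ?thesis using mst_nloc[OF W] by metis
 qed
 thus ?thesis using that unfolding represents_def by metis
qed

lemma t_cong:
 assumes c: "c : cocycles1 X \<omega>" "d : cocycles1 X \<omega>" and eq: "!!U V. aff U ==> aff V ==> c U V = d U V"
 shows "t c = t d"
proof -
 have "1 \<odot>[U Int V] d U V = c U V" if "aff U" "aff V" for U V
  using that eq sc_one[OF nopen_Int] affine_nopen c(2) by (auto simp: cocycles1_def)
 hence "t c = 1 * t d" using \<iota>_1 by (intro t_smult c) auto
 thus ?thesis by simp
qed

lemma cech_cocycle: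
 assumes "!!U V. aff U ==> aff V ==> \<sigma> V - \<sigma> U : MU (U Int V)"
 shows "cech \<sigma> : cocycles1 X \<omega>"
 unfolding cocycles1_def cech_def
proof (intro CollectI conjI allI impI)
 fix U V assume "aff U & aff V"
 thus "einv (U Int V) (\<sigma> V - \<sigma> U) : Sec \<omega> (U Int V)" using assms einv by blast
next
 fix U V W assume a: "aff U & aff V & aff W"
 let ?T = "U Int V Int W"
 have n: "nop (U Int V)" "nop (V Int W)" "nop (U Int W)" "nop ?T" using a nopen_Int affine_nopen by auto
 have m: "\<sigma> V - \<sigma> U : MU (U Int V)" "\<sigma> W - \<sigma> V : MU (V Int W)" "\<sigma> W - \<sigma> U : MU (U Int W)" using a assms by auto
 have r: "rst A ?T (einv A z) = einv ?T z & z : MU ?T" if "nop A" "?T <= A" "z : MU A" for A z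
  using einv_restrict[OF that(1) n(4) that(2,3)] MU_mono[OF that(1) n(4) that(2)] that(3) by blast
 have "einv ?T (\<sigma> V - \<sigma> U) \<oplus>[?T] einv ?T (\<sigma> W - \<sigma> V) = einv ?T (\<sigma> V - \<sigma> U + (\<sigma> W - \<sigma> V))"
  by (rule einv_add[OF n(4), symmetric]) (use r[OF n(1) _ m(1)] r[OF n(2) _ m(2)] in auto)
 thus "rst (U Int V) ?T (einv (U Int V) (\<sigma> V - \<sigma> U)) \<oplus>[?T]
   rst (V Int W) ?T (einv (V Int W) (\<sigma> W - \<sigma> V)) = rst (U Int W) ?T (einv (U Int W) (\<sigma> W - \<sigma> U))"
  using r[OF n(1) _ m(1)] r[OF n(2) _ m(2)] r[OF n(3) _ m(3)] by (simp add: Int_assoc le_infI2)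
qed

lemma represents_diff:
 assumes "represents \<sigma> s" "aff U" "aff V" shows "\<sigma> V - \<sigma> U : MU (U Int V)"
proof -
 have n: "nop (U Int V)" using assms nopen_Int affine_nopen by blast
 have "\<sigma> V - \<sigma> U : mst x" if x: "x : U Int V" for x
 proof -
  have xp: "x : pts" using nopen_sub[OF n] x by blast
  have "(\<sigma> V - s x) - (\<sigma> U - s x) : mst x"
   by (rule submod_diff[OF mst_submod[OF xp] stalk_subr[OF xp]]) (use assms x in \<open>auto simp: represents_def\<close>)
  thus ?thesis by simp
 qed
 thus ?thesis using MU_local[OF n] by blast
qed

lemma cech_represents: "represents \<sigma> s ==> cech \<sigma> : cocycles1 X \<omega>"
 by (rule cech_cocycle[OF represents_diff])

lemma represents_add:
 assumes "represents \<sigma> s" "represents \<sigma>' s'" shows "represents (%W. \<sigma> W + \<sigma>' W) (%x. s x + s' x)"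
 unfolding represents_def
proof (intro allI impI ballI)
 fix W x assume W: "aff W" "x : W"
 hence xp: "x : pts" using affine_sub by blast
 have "(\<sigma> W - s x) + (\<sigma>' W - s' x) : mst x"
  by (rule submod_add[OF mst_submod[OF xp]]) (use assms W in \<open>auto simp: represents_def\<close>)
 thus "\<sigma> W + \<sigma>' W - (s x + s' x) : mst x" by (simp add: algebra_simps)
qed

lemma represents_smult:
 assumes "represents \<sigma> s" shows "represents (%W. \<iota> a * \<sigma> W) (%x. \<iota> a * s x)"
 unfolding represents_def
proof (intro allI impI ballI)
 fix W x assume W: "aff W" "x : W"
 hence xp: "x : pts" using affine_sub by blast
 have "\<iota> a * (\<sigma> W - s x) : mst x"
  by (rule submod_mult[OF mst_submod[OF xp]]) (use assms W kk_stalk[OF xp] in \<open>auto simp: represents_def\<close>)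
 thus "\<iota> a * \<sigma> W - \<iota> a * s x : mst x" by (simp add: algebra_simps)
qed

lemma t_cech_add:
 assumes "represents \<sigma> s" "represents \<sigma>' s'" shows "t (cech (%W. \<sigma> W + \<sigma>' W)) = t (cech \<sigma>) + t (cech \<sigma>')"
proof (rule t_add[OF cech_represents[OF assms(1)] cech_represents[OF assms(2)] cech_represents[OF represents_add[OF assms]]])
 fix U V assume UV: "aff U" "aff V"
 have "\<sigma> V + \<sigma>' V - (\<sigma> U + \<sigma>' U) = (\<sigma> V - \<sigma> U) + (\<sigma>' V - \<sigma>' U)" by simp
 thus "cech (%W. \<sigma> W + \<sigma>' W) U V = cech \<sigma> U V \<oplus>[U Int V] cech \<sigma>' U V"
  unfolding cech_def using einv_add[OF nopen_Int[OF UV[THEN affine_nopen]] represents_diff[OF assms(1) UV] represents_diff[OF assms(2) UV]]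
  by (simp only:)
qed

text \<open>A representative of the zero class is a coboundary.\<close>

lemma t_cech_zero:
 assumes \<sigma>: "!!W x. aff W ==> x : W ==> \<sigma> W - \<kappa> : mst x" shows "t (cech \<sigma>) = 0"
proof (rule t_coboundary[of _ "%W. einv W (\<sigma> W - \<kappa>)"])
 have m: "\<sigma> W - \<kappa> : MU W" if "aff W" for W using \<sigma> that MU_local[OF affine_nopen] by blast
 thus "(%W. einv W (\<sigma> W - \<kappa>)) : cochains0 X \<omega>" using einv by (simp add: cochains0_def)
 show "cech \<sigma> : cocycles1 X \<omega>" by (rule cech_represents[of _ "%x. \<kappa>"]) (use \<sigma> in \<open>auto simp: represents_def\<close>)
 fix U V assume UV: "aff U" "aff V"
 note nU = affine_nopen[OF UV(1)] and nV = affine_nopen[OF UV(2)]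
 note n = nopen_Int[OF nU nV]
 interpret A: abelian_group "msections \<omega> (U Int V)" by (rule sec_abelian[OF sh n])
 have mi: "\<sigma> U - \<kappa> : MU (U Int V)" "\<sigma> V - \<kappa> : MU (U Int V)" using m UV MU_mono[OF nU n] MU_mono[OF nV n] by auto
 have d: "\<sigma> V - \<sigma> U : MU (U Int V)" using submod_diff[OF MU_submod[OF n] sections_subr[OF n] mi(2,1)] by simp
 have "einv (U Int V) (\<sigma> V - \<sigma> U) \<oplus>[U Int V] einv (U Int V) (\<sigma> U - \<kappa>) = einv (U Int V) (\<sigma> V - \<kappa>)"
  using einv_add[OF n d mi(1)] by simp
 thus "cech \<sigma> U V = coboundary \<omega> (%W. einv W (\<sigma> W - \<kappa>)) U V"
  unfolding coboundary_def cech_def einv_restrict[OF nV n Int_lower2 m[OF UV(2)]] einv_restrict[OF nU n Int_lower1 m[OF UV(1)]]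
  using einv[OF mi(1)] einv[OF mi(2)] einv[OF d] by (metis A.add.inv_solve_right a_minus_def)
qed

lemma trace_represents: assumes "represents \<sigma> s" shows "trace s = t (cech \<sigma>)"
proof -
 define \<sigma>' where "\<sigma>' = (SOME \<sigma>. represents \<sigma> s)"
 have \<sigma>': "represents \<sigma>' s" unfolding \<sigma>'_def by (rule someI[of "%\<sigma>. represents \<sigma> s", OF assms])
 have d: "represents (%W. \<sigma> W + \<iota> (- 1) * \<sigma>' W) (%x. s x + \<iota> (- 1) * s x)"
  by (rule represents_add[OF assms represents_smult[OF \<sigma>']])
 hence "represents (%W. \<sigma> W - \<sigma>' W) (%x. 0)" by (simp add: \<iota>_uminus \<iota>_1)
 hence "t (cech (%W. \<sigma> W - \<sigma>' W)) = 0" by (intro t_cech_zero[of _ 0]) (auto simp: represents_def)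
 thus ?thesis using t_cech_add[OF `represents (%W. \<sigma> W - \<sigma>' W) (%x. 0)` \<sigma>'] by (simp add: trace_def \<sigma>'_def)
qed

lemma trace_add: "adele s ==> adele s' ==> trace (%x. s x + s' x) = trace s + trace s'"
 using t_cech_add trace_represents[OF represents_add] trace_represents by (elim represents_exists) simp

lemma trace_smult: assumes "adele s" shows "trace (%x. \<iota> a * s x) = a * trace s"
proof -
 obtain \<sigma> where \<sigma>: "represents \<sigma> s" by (rule represents_exists[OF assms])
 have "t (cech (%W. \<iota> a * \<sigma> W)) = a * t (cech \<sigma>)"
 proof (rule t_smult[OF cech_represents[OF \<sigma>] cech_represents[OF represents_smult[OF \<sigma>]]])
  fix U V assume UV: "aff U" "aff V"
  note n = nopen_Int[OF UV[THEN affine_nopen]]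
  show "cech (%W. \<iota> a * \<sigma> W) U V = \<iota> a \<odot>[U Int V] cech \<sigma> U V"
   unfolding cech_def right_diff_distrib[symmetric]
   by (rule einv_smult[OF n represents_diff[OF \<sigma> UV]]) (use kk_sections[OF n] in blast)
 qed
 thus ?thesis using trace_represents[OF \<sigma>] trace_represents[OF represents_smult[OF \<sigma>]] by simp
qed

lemma trace_zero: assumes "!!x. x : pts ==> s x - \<kappa> : mst x" shows "trace s = 0"
proof -
 have "represents (%_. \<kappa>) s" unfolding represents_def
 proof (intro allI impI ballI)
  fix W x assume "aff W" "x : W"
  hence x: "x : pts" using affine_sub by blast
  show "\<kappa> - s x : mst x" using submod_uminus[OF mst_submod[OF x] stalk_subr[OF x] assms[OF x]] by simp
 qed
 moreover have "t (cech (%_. \<kappa>)) = 0" by (rule t_cech_zero[of _ \<kappa>]) (use submod_0[OF mst_submod] affine_sub in auto)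
 ultimately show ?thesis using trace_represents by metis
qed

text \<open>Serre duality for the sheaf spanned by S: its homomorphisms to the dualizing sheaf are
 multiplications, so a class in its first cohomology is detected by the trace of a multiple.\<close>

theorem duality:
 assumes S: "finite S" "s0 : S" "s0 ~= 0" and s: "adele s" and ns: "\<nexists>\<kappa>. ALL x:pts. s x - \<kappa> : lat S x"
 obtains z where "!!y. y : S ==> z * y : MU pts" "trace (%x. z * s x) ~= 0"
proof -
 (* The adeles whose class in the cohomology of the lattice sheaf is zero; R separates s from them. *)
 define Y where "Y = {f. EX \<kappa>. ALL x:pts. f x - \<kappa> : lat S x}"
 have Y0: "(%x. 0) : Y" unfolding Y_def using submod_0[OF lat_submod] by (auto intro!: exI[of _ 0])
 have Y1: "(%x. f x + h x) : Y" if fh: "f : Y" "h : Y" for f h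
 proof -
  obtain a b where ab: "!!x. x : pts ==> f x - a : lat S x" "!!x. x : pts ==> h x - b : lat S x" using fh by (auto simp: Y_def)
  have "f x + h x - (a + b) : lat S x" if x: "x : pts" for x
   using submod_add[OF lat_submod[OF x] ab(1)[OF x] ab(2)[OF x]] by (simp add: algebra_simps)
  thus ?thesis by (auto simp: Y_def)
 qed
 have Y2: "(%x. \<iota> c * f x) : Y" if f: "f : Y" for c f
 proof -
  obtain a where a: "!!x. x : pts ==> f x - a : lat S x" using f by (auto simp: Y_def)
  have "\<iota> c * f x - \<iota> c * a : lat S x" if x: "x : pts" for x
   using submod_mult[OF lat_submod[OF x] _ a[OF x], of "\<iota> c"] kk_stalk[OF x] by (auto simp: right_diff_distrib)
  thus ?thesis by (auto simp: Y_def)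
 qed
 have "s ~: Y" using ns by (simp add: Y_def)
 then obtain R where R: "!!f g. R (%x. f x + g x) = R f + R g" "!!c f. R (%x. \<iota> c * f x) = c * R f"
  "!!f. f : Y ==> R f = 0" "R s ~= 0" using separating_functional[OF Y0 Y1 Y2] by blast
 obtain U0 where U0: "aff U0"
 proof -
  obtain x where "x : pts" using nopen_pts unfolding nopen_def by (metis ex_in_conv)
  thus ?thesis using affine_cover that by blast
 qed
 define Vc where "Vc x = (if x : pts then SOME V. aff V & x : V else U0)" for x
 have Vx: "aff (Vc x) & x : Vc x" if "x : pts" for x
  unfolding Vc_def using someI_ex[OF affine_cover[OF that]] that by simp
 have Va: "aff (Vc x)" for x using Vx U0 by (cases "x : pts") (auto simp: Vc_def)
 (* A cocycle c is evaluated on the adele whose component at x is the difference between an open set around x and U0. *)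
 define r where "r c = R (%x. c U0 (Vc x))" for c :: "'p set => 'p set => 'a"
 let ?F = "lat_sheaf S"
 note cF = lat_sheaf_coherent[OF S(1)]
 have "H1_functional X \<iota> ?F r" unfolding H1_functional_def
 proof (intro conjI ballI impI allI)
  fix c a assume a: "a : cochains0 X ?F" and ca: "ALL U V. aff U & aff V --> c U V = coboundary ?F a U V"
  have am: "a U : latU S U" if "aff U" for U using a that by (simp add: cochains0_def)
  have "c U0 (Vc x) - (- a U0) : lat S x" if x: "x : pts" for x
  proof -
   have n: "nop (U0 Int Vc x)" using nopen_Int affine_nopen U0 Va by blast
   have "c U0 (Vc x) = a (Vc x) \<ominus>\<^bsub>plain_module (latU S (U0 Int Vc x))\<^esub> a U0" using ca U0 Va by (simp add: coboundary_def)
   also have "\<dots> = a (Vc x) - a U0"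
    by (rule plain_minus[OF sections_subr[OF n] latU_submod[OF n]]) (use am[OF U0] am[OF Va] in \<open>auto simp: latU_def\<close>)
   finally show ?thesis using am[OF Va, of x] Vx[OF x] by (auto simp: latU_def)
  qed
  thus "r c = 0" unfolding r_def by (intro R(3)) (unfold Y_def, blast)
 next
  fix c d c' assume "ALL U V. aff U & aff V --> c' U V = c U V \<oplus>\<^bsub>msections ?F (U Int V)\<^esub> d U V"
  thus "r c' = r c + r d" using U0 Va by (simp add: r_def R(1))
 next
  fix c d a assume "ALL U V. aff U & aff V --> d U V = \<iota> a \<odot>\<^bsub>msections ?F (U Int V)\<^esub> c U V"
  thus "r d = a * r c" using U0 Va by (simp add: r_def R(2))
 qed
 then obtain \<phi> where \<phi>: "sheaf_hom X ?F \<omega> \<phi>" "!!c. c : cocycles1 X ?F ==> t (%U V. \<phi> (U Int V) (c U V)) = r c"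
  using dual_existence[OF cF] by blast
 note h = sheaf_homD[OF \<phi>(1), unfolded lat_sheaf_simps plain_module_simps]
 have S0: "s0 : latU S U" if "nop U" for U
  unfolding latU_def lat_def using lspan_incl[OF stalk_subr] S(2) nopen_sub[OF that] by blast
 (* The homomorphism that represents r is multiplication by z. *)
 define z where "z = e pts (\<phi> pts s0) / s0"
 have z: "e U (\<phi> U y) = z * y" if U: "nop U" and y: "y : latU S U" for U y
 proof -
  obtain x where x: "x : U" using U by (auto simp: nopen_def)
  then obtain V where V: "aff V" "x : V" using affine_cover nopen_sub[OF U] by blast
  obtain a b where ab: "a : \<O> V" "b : \<O> V" "b ~= 0" "y / s0 = a / b" using affine_fractions[OF V(1)] unfolding fractions_def by metis
  let ?W = "U Int V"
  have n: "nop ?W" by (rule nopen_Int[OF U affine_nopen[OF V(1)]])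
  have abW: "a : \<O> ?W" "b : \<O> ?W" using sections_mono[OF affine_nopen[OF V(1)] n] ab by auto
  have yW: "y : latU S ?W" using y by (auto simp: latU_def)
  have eq: "b * y = a * s0" using ab S(3) by (simp add: field_simps)
  have "e ?W (\<phi> ?W (b * y)) = b * e ?W (\<phi> ?W y)"
   using h(3)[OF n abW(2) yW] e_smult[OF n abW(2) h(1)[OF n yW]] by simp
  moreover have "e ?W (\<phi> ?W (a * s0)) = a * e ?W (\<phi> ?W s0)"
   using h(3)[OF n abW(1) S0[OF n]] e_smult[OF n abW(1) h(1)[OF n S0[OF n]]] by simp
  moreover have "e ?W (\<phi> ?W y) = e U (\<phi> U y)" using h(4)[OF U n Int_lower1 y] e_restrict[OF U n Int_lower1 h(1)[OF U y]] by simp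
  moreover have "e ?W (\<phi> ?W s0) = e pts (\<phi> pts s0)"
   using h(4)[OF nopen_pts n nopen_sub[OF n] S0[OF nopen_pts]] e_restrict[OF nopen_pts n nopen_sub[OF n] h(1)[OF nopen_pts S0[OF nopen_pts]]] by simp
  ultimately have "b * e U (\<phi> U y) = a * e pts (\<phi> pts s0)" using eq by metis
  hence "e U (\<phi> U y) = (a / b) * e pts (\<phi> pts s0)" using ab(3) by (simp add: field_simps)
  thus ?thesis unfolding ab(4)[symmetric] z_def by simp
 qed
 have zS: "z * y : MU pts" if "y : S" for y
 proof -
  have "y : latU S pts" unfolding latU_def lat_def using lspan_incl[OF stalk_subr] that by blast
  thus ?thesis using z[OF nopen_pts] h(1)[OF nopen_pts] unfolding MU_def by (metis imageI)
 qed
 have zlat: "z * y : mst x" if x: "x : pts" and y: "y : lat S x" for x y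
 proof -
  have "(*) z ` S <= mst x" using zS MU_mst[OF nopen_pts x] by blast
  from lspan_min[OF mst_submod[OF x] this] show ?thesis using y unfolding lat_def lspan_times by blast
 qed
 have "EX y. ALL x:W. y - s x : lat S x" if W: "aff W" for W
  using approximate_lattice[OF s W lspan_submod[OF affine_subr[OF W]], of s0 S] lspan_incl[OF affine_subr[OF W], of S] S
   lat_eq_nloc[OF W] by auto
 then obtain \<sigma> where \<sigma>: "!!W x. aff W ==> x : W ==> \<sigma> W - s x : lat S x" by metis
 have rep: "represents (%W. z * \<sigma> W) (%x. z * s x)" unfolding represents_def right_diff_distrib[symmetric]
  using zlat \<sigma> affine_sub by blast
 define c where "c U V = \<sigma> V - \<sigma> U" for U V
 have cm: "c U V : latU S (U Int V)" if UV: "aff U" "aff V" for U V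
  unfolding latU_def
 proof
  fix x assume x: "x : U Int V"
  hence xp: "x : pts" using affine_sub UV by blast
  have "(\<sigma> V - s x) - (\<sigma> U - s x) : lat S x" by (rule submod_diff[OF lat_submod[OF xp] stalk_subr[OF xp]]) (use \<sigma> UV x in auto)
  thus "c U V : lat S x" by (simp add: c_def)
 qed
 have cc: "c : cocycles1 X ?F" unfolding cocycles1_def using cm by (auto simp: c_def)
 have "t (cech (%W. z * \<sigma> W)) = t (%U V. \<phi> (U Int V) (c U V))"
 proof (rule t_cong[OF cech_represents[OF rep] hom_cocycle[OF coherentD(1)[OF cF] \<phi>(1) cc]])
  fix U V assume UV: "aff U" "aff V"
  have n: "nop (U Int V)" using nopen_Int affine_nopen UV by blast
  show "cech (%W. z * \<sigma> W) U V = \<phi> (U Int V) (c U V)"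
   unfolding cech_def right_diff_distrib[symmetric] using z[OF n cm[OF UV]] einv_eq[OF n h(1)[OF n cm[OF UV]]] by (simp add: c_def)
 qed
 also have "\<dots> = r c" by (rule \<phi>(2)[OF cc])
 finally have tr: "trace (%x. z * s x) = R (%x. \<sigma> (Vc x) - \<sigma> U0)" using trace_represents[OF rep] by (simp add: r_def c_def)
 have "(%x. \<sigma> (Vc x) - \<sigma> U0 + \<iota> (- 1) * s x) : Y"
  unfolding Y_def using \<sigma>[OF Va] Vx by (auto simp: \<iota>_uminus \<iota>_1 intro!: exI[of _ "- \<sigma> U0"])
 hence "R (%x. \<sigma> (Vc x) - \<sigma> U0) + - 1 * R s = 0" using R(1,2,3) by metis
 hence "trace (%x. z * s x) ~= 0" using tr R(4) by simp
 thus ?thesis using that zS by blast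
qed

end

section \<open>Nakayama's lemma and poles of elements that are not integral\<close>

text \<open>Nakayama's lemma for the finite module generated by 1 and T, modulo A.\<close>

lemma nakayama:
 fixes A :: "'a::field set"
 assumes A: "loc_ring A" and "finite T" and "!!x. x : T ==> EX r:A. x - r : lspan (mm A) T"
 shows "T <= A"
 using assms(2,3)
proof (induction T rule: finite_induct)
 case (insert x T)
 note As = loc_ring_subr[OF A] and N = nonunits_submod[OF A]
 have split: "EX r:A. EX m:mm A. EX w:lspan (mm A) T. y = r + m * x + w" if "y : insert x T" for y
 proof -
  obtain r where r: "r : A" "y - r : lspan (mm A) (insert x T)" using insert.prems `y : insert x T` by blast
  obtain m w where "m : mm A" "w : lspan (mm A) T" "y - r = m * x + w" using r(2) unfolding lspan_insert[OF N] by blast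
  thus ?thesis using r(1) by (intro bexI[of _ r] bexI[of _ m] bexI[of _ w]) (auto simp: algebra_simps)
 qed
 obtain r m w where x: "r : A" "m : mm A" "w : lspan (mm A) T" "x = r + m * x + w" using split[of x] by blast
 have u: "1 - m ~= 0" "inverse (1 - m) : A" using one_plus_nonunit[OF A x(2)] unit_inverse by blast+
 have "r + w = (1 - m) * x" using x(4) by (simp add: algebra_simps)
 hence "inverse (1 - m) * (r + w) = x" using u(1) by (simp flip: mult.assoc)
 hence xe: "x = inverse (1 - m) * r + inverse (1 - m) * w" by (simp add: distrib_left)
 have scale: "c * z : lspan (mm A) T" if "c : A" "z : lspan (mm A) T" for c z
  using that(2)
 proof induction
  case (lspan_step y b s)
  from lspan.lspan_step[OF lspan_step(4) submod_mult[OF N that(1) lspan_step(2)] lspan_step(3)] show ?case by (simp add: algebra_simps)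
 qed (simp add: lspan.lspan_0)
 have "T <= A"
 proof (rule insert.IH)
  fix y assume "y : T"
  then obtain r' m' w' where y: "r' : A" "m' : mm A" "w' : lspan (mm A) T" "y = r' + m' * x + w'" using split[of y] by blast
  let ?c = "m' * inverse (1 - m)"
  have c: "?c : A" using subr_mult[OF As _ u(2)] y(2) nonunits_sub by blast
  have "y - (r' + ?c * r) = ?c * w + w'" unfolding y(4) by (subst xe) (simp add: algebra_simps)
  hence "y - (r' + ?c * r) : lspan (mm A) T" using lspan_add[OF scale[OF c x(3)] y(3)] by simp
  thus "EX r:A. y - r : lspan (mm A) T" using subr_add[OF As y(1) subr_mult[OF As c x(1)]] by blast
 qed
 hence "lspan (mm A) T <= A" using lspan_mono[OF nonunits_sub order_refl] lspan_min[OF submod_self[OF As]] by blast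
 hence "x : A" by (subst xe) (use x(1,3) subr_mult[OF As u(2)] subr_add[OF As] in blast)
 thus ?case using `T <= A` by simp
qed simp

text \<open>An element that is not integral over a local ring has a pole over its closed point: a relation that expresses
 1 through p and 1/z, multiplied by a power of z, would be an equation of integral dependence.\<close>

lemma not_integral_prime:
 fixes z :: "'a::field"
 assumes F: "subr F" and p: "prime_of F p" and z: "z ~= 0" "~ integral_over (localization F p) z"
 obtains q where "prime_of (adjoin (F Un {inverse z})) q" "p <= q" "inverse z : q"
proof -
 let ?D = "adjoin (F Un {inverse z})"
 define I where "I = {poly Q (inverse z) | Q. Q : poly_over F & coeff Q 0 : p}"
 note D = adjoin_single[OF F, of "inverse z"]
 note ps = prime_ofD(1)[OF p]
 have "submod ?D I" unfolding submod_def
 proof (intro conjI ballI)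
  show "0 : I" unfolding I_def using submod_0[OF ps] subr_0[OF poly_over_subr[OF F]] by (intro CollectI exI[of _ 0]) auto
  fix x assume "x : I"
  then obtain Q where Q: "x = poly Q (inverse z)" "Q : poly_over F" "coeff Q 0 : p" by (auto simp: I_def)
  show "x + y : I" if "y : I" for y
  proof -
   from that obtain Q' where Q': "y = poly Q' (inverse z)" "Q' : poly_over F" "coeff Q' 0 : p" by (auto simp: I_def)
   thus ?thesis unfolding I_def using Q subr_add[OF poly_over_subr[OF F] Q(2) Q'(2)] submod_add[OF ps Q(3) Q'(3)]
    by (intro CollectI exI[of _ "Q + Q'"]) auto
  qed
  show "b * x : I" if b: "b : ?D" for b
  proof -
   from b obtain S where S: "b = poly S (inverse z)" "S : poly_over F" unfolding D by blast
   hence "coeff S 0 * coeff Q 0 : p" using submod_mult[OF ps _ Q(3)] by (auto simp: poly_over_def)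
   thus ?thesis unfolding I_def using S Q subr_mult[OF poly_over_subr[OF F] S(2) Q(2)]
    by (intro CollectI exI[of _ "S * Q"]) (auto simp: coeff_mult)
  qed
 qed
 moreover have "I <= ?D" unfolding D I_def by blast
 moreover have "1 ~: I"
 proof
  assume "1 : I"
  then obtain Q where Q: "1 = poly Q (inverse z)" "Q : poly_over F" "coeff Q 0 : p" by (auto simp: I_def)
  let ?u = "coeff (1 - Q) 0" and ?L = "localization F p"
  have o: "1 - Q : poly_over F" using subr_diff[OF poly_over_subr[OF F] subr_1[OF poly_over_subr[OF F]] Q(2)] .
  have uF: "?u : F" using o unfolding poly_over_def by blast
  have up: "?u ~: p" using submod_add[OF ps Q(3), of ?u] prime_ofD(3)[OF p] by auto
  have u0: "?u ~= 0" using up submod_0[OF ps] by auto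
  let ?P = "smult (inverse ?u) (reflect_poly (1 - Q))"
  have cL: "a : F ==> inverse ?u * a : ?L" for a unfolding localization_iff using uF up by (intro exI[of _ a] exI[of _ ?u]) (simp add: divide_inverse mult.commute)
  have "coeff (reflect_poly (1 - Q)) i : F" for i using o subr_0[OF F] unfolding coeff_reflect_poly poly_over_def by (simp del: coeff_diff)
  hence "?P : poly_over ?L" unfolding poly_over_def using cL by simp
  moreover have "lead_coeff ?P = 1"
  proof -
  have "lead_coeff (reflect_poly (1 - Q)) = ?u" unfolding degree_reflect_poly_eq[OF u0] coeff_reflect_poly by (simp del: coeff_diff)
  moreover have "degree ?P = degree (reflect_poly (1 - Q))" using u0 by (simp del: coeff_diff)
  ultimately show ?thesis using u0 by (simp del: coeff_diff)
  qed
  moreover have "poly ?P z = 0" using poly_reflect_poly_nz[OF z(1), of "1 - Q"] Q(1) by simp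
  ultimately show False using z(2) unfolding integral_over_def by blast
 qed
 ultimately obtain q where q: "prime_of ?D q" "I <= q" using prime_exists[OF adjoin_subr] by blast
 have "a : I" if "a : p" for a unfolding I_def using that prime_ofD(2)[OF p] poly_over_const[OF F, of a] by (intro CollectI exI[of _ "[:a:]"]) auto
 moreover have "inverse z : I" unfolding I_def using F submod_0[OF ps]
  by (intro CollectI exI[of _ "[:0, 1:]"]) (auto intro!: poly_over_pCons poly_over_const simp: subr_0 subr_1)
 ultimately show ?thesis using that q by blast
qed

section \<open>The canonical linear system\<close>

locale canonical_curve = dual_curve X \<iota> \<omega> t e
 for X :: "('p, 'a::field) rspace" and \<iota> :: "'k::alg_closed_field => 'a" and \<omega> :: "('p, 'a, 'w) omodule" and t e +
 fixes h :: "nat => 'w" and g :: nat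
 assumes basis: "global_basis X \<iota> \<omega> h g" and g2: "g >= 2"
begin

abbreviation V :: "'a set" where "V \<equiv> MU pts"

definition v :: "nat => 'a" where "v i = e pts (h i)"

abbreviation "vs \<equiv> v ` {..<g}"

lemma h_sec: "h : {..<g} \<rightarrow> Sec \<omega> pts" using basis by (simp add: global_basis_def Let_def)

lemma h_finsum:
 "finsum (msections \<omega> pts) (%i. \<iota> (a i) \<odot>[pts] h i) {..<g} : Sec \<omega> pts
  & e pts (finsum (msections \<omega> pts) (%i. \<iota> (a i) \<odot>[pts] h i) {..<g}) = (\<Sum>i<g. \<iota> (a i) * v i)"
 using e_finsum[OF nopen_pts _ _ h_sec, of "%i. \<iota> (a i)"] kk_sections[OF nopen_pts] by (auto simp: v_def)

lemma V_iff: "z : V \<longleftrightarrow> (EX c. z = (\<Sum>i<g. \<iota> (c i) * v i))"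
proof
 assume "z : V"
 then obtain s where s: "s : Sec \<omega> pts" "z = e pts s" by (auto simp: MU_def)
 then obtain l where "s = finsum (msections \<omega> pts) (%i. \<iota> (l i) \<odot>[pts] h i) {..<g}"
  using basis unfolding global_basis_def Let_def by blast
 thus "EX c. z = (\<Sum>i<g. \<iota> (c i) * v i)" using h_finsum[of l] s(2) by (intro exI[of _ l]) simp
next
 assume "EX c. z = (\<Sum>i<g. \<iota> (c i) * v i)"
 then obtain c where "z = (\<Sum>i<g. \<iota> (c i) * v i)" by blast
 thus "z : V" using imageI[OF conjunct1[OF h_finsum[of c]], of "e pts"] h_finsum[of c] by (simp add: MU_def)
qed

lemma V_independent: "(\<Sum>i<g. \<iota> (c i) * v i) = 0 ==> i < g ==> c i = 0"
proof -
 assume c: "(\<Sum>i<g. \<iota> (c i) * v i) = 0" and i: "i < g"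
 let ?f = "%l. finsum (msections \<omega> pts) (%i. \<iota> (l i) \<odot>[pts] h i) {..<g}"
 let ?r = "%l. restrict l {..<g} :: nat => 'k"
 have s: "?f l : Sec \<omega> pts" "e pts (?f l) = (\<Sum>i<g. \<iota> (l i) * v i)" for l using h_finsum[of l] by auto
 have "e pts (?f (?r c)) = 0" "e pts (?f (?r (%_. 0))) = 0" unfolding s(2) using c by (simp_all add: \<iota>_0)
 hence eq: "?f (?r c) = ?f (?r (%_. 0))" by (intro e_inj[OF nopen_pts s(1) s(1)]) (simp only:)
 have "EX! l. l : {..<g} \<rightarrow>\<^sub>E UNIV & ?f (?r c) = ?f l" using basis s(1) unfolding global_basis_def Let_def by blast
 moreover have "EX! l. P l ==> P a ==> P b ==> a = b" for P and a b :: "nat => 'k" by blast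
 ultimately have "?r c = ?r (%_. 0)" using eq by simp
 from fun_cong[OF this, of i] show "c i = 0" using i by simp
qed

lemma v_mem: "i < g ==> v i : V" using h_sec unfolding v_def MU_def by blast

lemma V_kk: "submod kk V" by (rule submod_mono[OF MU_submod[OF nopen_pts] kk_sections[OF nopen_pts]])

lemma V_lspan: "V = lspan kk vs"
proof
 show "V <= lspan kk vs"
 proof
  fix z assume "z : V"
  then obtain c where "z = (\<Sum>i<g. \<iota> (c i) * v i)" using V_iff by blast
  thus "z : lspan kk vs" using lspan_sum[of "{..<g}" kk "%i. \<iota> (c i)" v vs] subr_kk by simp
 qed
 show "lspan kk vs <= V" by (rule lspan_min[OF V_kk]) (use v_mem in blast)
qed

lemma v_nonzero: assumes "i < g" shows "v i ~= 0"
proof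
 assume "v i = 0"
 hence "(\<Sum>j<g. \<iota> (if j = i then 1 else 0) * v j) = 0" using assms by (intro sum.neutral) (auto simp: \<iota>_0)
 thus False using V_independent[of "%j. if j = i then 1 else 0" i] assms by auto
qed

lemma v_ndep: "~ dep {0} {..<g} v" unfolding dep_def using V_independent by auto

lemma submod_zero: "submod B {0}" by (auto simp: submod_def)

lemma V_fcn: "fcn (Suc g) V {0}"
 by (rule fcnI_span[OF submod_zero, of vs])
  (use card_image_le[of "{..<g}" v] in \<open>auto simp: V_lspan less_Suc_eq_le intro: bexI\<close>)

lemma V_iff_mst: "z : V \<longleftrightarrow> (ALL x:pts. z : mst x)" by (rule MU_local[OF nopen_pts])

lemma power_dependent_kk: assumes "w ~= 0" "!!i. z ^ i * w : W" "fcn n W {0}" shows "z : kk"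
proof -
 obtain c where c: "EX i<n. c i ~= 0" "(\<Sum>i<n. \<iota> (c i) * (z ^ i * w)) = 0"
  using fcnD[OF assms(3), of "%i. z ^ i * w"] assms(2) by (auto simp: dep_def)
 have "(\<Sum>i<n. \<iota> (c i) * z ^ i) * w = 0" using c(2) by (simp add: sum_distrib_right mult.assoc)
 hence "(\<Sum>i<n. \<iota> (c i) * z ^ i) = 0" using assms(1) by simp
 hence "evp (\<Sum>i<n. monom (c i) i) z = 0" by (simp only: sum_powers_evp)
 thus ?thesis using root_in_kk sum_monom_nz[of "{..<n}" _ c] c(1) by blast
qed

text \<open>Multiplication by z acts on a finite-dimensional space, so z is algebraic over k.\<close>

lemma V_stable: assumes "!!w. w : V ==> z * w : V" shows "z : kk"
proof (rule power_dependent_kk[OF _ _ V_fcn])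
 show "v 0 ~= 0" using v_nonzero g2 by simp
 show "z ^ i * v 0 : V" for i using assms v_mem g2 by (induction i) (auto simp: mult.assoc)
qed

lemma lat_adele: assumes S: "finite S" and s: "!!x. x : pts ==> s x : lat S x" shows "adele s"
proof -
 have "{x : pts. s x ~: stk x} <= (\<Union>y\<in>S. {x : pts. y ~: stk x})"
 proof
  fix x assume x: "x : {x : pts. s x ~: stk x}"
  show "x : (\<Union>y\<in>S. {x : pts. y ~: stk x})"
  proof (rule ccontr)
   assume "x ~: (\<Union>y\<in>S. {x : pts. y ~: stk x})"
   hence "lat S x <= stk x" unfolding lat_def using x by (intro lspan_min submod_self stalk_subr) auto
   thus False using s x by blast
  qed
 qed
 thus ?thesis unfolding adele_def using S finite_poles by (meson finite_UN finite_subset)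
qed

lemma point_duality:
 assumes S: "finite S" "s0 : S" "s0 ~= 0" and x: "x : pts"
  and H: "!!z. (!!y. y : S ==> z * y : V) ==> z * m : mst x"
 obtains \<kappa> where "!!y. y : pts ==> y ~= x ==> \<kappa> : lat S y" "m - \<kappa> : lat S x"
proof -
 let ?s = "%y. if y = x then m else 0"
 have "adele ?s" unfolding adele_def by (rule finite_subset[of _ "{x}"]) (use subr_0[OF stalk_subr] in auto)
 have "EX \<kappa>. ALL y:pts. ?s y - \<kappa> : lat S y"
 proof (rule ccontr)
  assume "\<nexists>\<kappa>. ALL y:pts. ?s y - \<kappa> : lat S y"
  from duality[OF S `adele ?s` this] obtain z where z: "!!y. y : S ==> z * y : V" "trace (%y. z * ?s y) ~= 0" by blast
  have "trace (%y. z * ?s y) = 0" by (rule trace_zero[of _ 0]) (use H[OF z(1)] submod_0[OF mst_submod] in auto)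
  thus False using z(2) by blast
 qed
 then obtain \<kappa> where \<kappa>: "!!y. y : pts ==> ?s y - \<kappa> : lat S y" by blast
 show ?thesis
 proof (rule that)
  show "m - \<kappa> : lat S x" using \<kappa>[OF x] by simp
  fix y assume y: "y : pts" "y ~= x"
  thus "\<kappa> : lat S y" using submod_uminus[OF lat_submod stalk_subr \<kappa>[OF y(1)]] by simp
 qed
qed

text \<open>The dualizing sheaf is generated by its global sections: if the lattice spanned by them were
 smaller at x, then duality would produce a non-constant endomorphism of the space of sections.\<close>

lemma mst_generated: assumes x: "x : pts" shows "mst x = lat vs x"
proof
 have sub: "lat vs y <= mst y" if "y : pts" for y
  unfolding lat_def by (rule lspan_min[OF mst_submod[OF that]]) (use v_mem MU_mst[OF nopen_pts that] in blast)
 show "lat vs x <= mst x" by (rule sub[OF x])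
 show "mst x <= lat vs x"
 proof
  fix m assume m: "m : mst x"
  have v0: "v 0 : vs" "v 0 ~= 0" using v_nonzero g2 by auto
  have H: "z * m : mst x" if z: "!!y. y : vs ==> z * y : V" for z
  proof -
   have "lspan kk ((*) z ` vs) <= V" by (rule lspan_min[OF V_kk]) (use z in blast)
   hence "z : kk" by (intro V_stable) (auto simp: V_lspan lspan_times)
   thus ?thesis using submod_mult[OF mst_submod[OF x] _ m] kk_stalk[OF x] by blast
  qed
  obtain \<kappa> where k: "!!y. y : pts ==> y ~= x ==> \<kappa> : lat vs y" "m - \<kappa> : lat vs x"
   using point_duality[OF _ v0 x H] by blast
  have "m - (m - \<kappa>) : mst x" using submod_diff[OF mst_submod[OF x] stalk_subr[OF x] m] sub[OF x] k(2) by blast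
  hence "\<kappa> : V" unfolding V_iff_mst using k(1) sub by auto
  hence "\<kappa> : lat vs x" unfolding V_lspan lat_def using lspan_mono[OF kk_stalk[OF x]] by blast
  from submod_add[OF lat_submod[OF x] this k(2)] show "m : lat vs x" by simp
 qed
qed

text \<open>Duality for the structure sheaf, the lattice spanned by 1: if w is a global section, then w z is a section
 at x, so the principal part z at x is that of a function \<open>\<kappa>\<close> that is regular elsewhere.  This \<open>\<kappa>\<close> multiplies V into
 itself and is constant.\<close>

lemma endomorphism_stalk: assumes x: "x : pts" and z: "!!m. m : mst x ==> z * m : mst x" shows "z : stk x"
proof -
 have l1: "lat {1} y = stk y" if "y : pts" for y
  unfolding lat_def using lspan_insert[OF submod_self[OF stalk_subr[OF that]], of 1 "{}"] by simp
 have "w * z : mst x" if "!!y. y : {1} ==> w * y : V" for w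
  using z[of w] that[of 1] MU_mst[OF nopen_pts x] by (auto simp: mult.commute)
 then obtain \<kappa> where k: "!!y. y : pts ==> y ~= x ==> \<kappa> : lat {1} y" "z - \<kappa> : lat {1} x"
  using point_duality[of "{1}" 1 x z] x by auto
 have "\<kappa> * w : V" if w: "w : V" for w unfolding V_iff_mst
 proof
  fix y assume y: "y : pts"
  have wy: "w : mst y" using w V_iff_mst y by blast
  show "\<kappa> * w : mst y"
  proof (cases "y = x")
   case True
   hence wx: "w : mst x" using wy by simp
   have "z * w - (z - \<kappa>) * w : mst x"
    by (rule submod_diff[OF mst_submod[OF x] stalk_subr[OF x] z[OF wx] submod_mult[OF mst_submod[OF x] _ wx]]) (use k(2) l1[OF x] in simp)
   thus ?thesis using True by (simp add: algebra_simps)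
  qed (use k(1) y l1 wy submod_mult[OF mst_submod[OF y]] in auto)
 qed
 hence "\<kappa> : stk x" using V_stable kk_stalk[OF x] by blast
 thus ?thesis using subr_add[OF stalk_subr[OF x], of \<kappa> "z - \<kappa>"] k(2) l1[OF x] by simp
qed

end

section \<open>Points of the blowup\<close>

lemma adjoin_absorb: "adjoin (adjoin S Un T) = adjoin (S Un T)"
 using adjoin_mono[of S "S Un T"] adjoin_incl[of "S Un T"] adjoin_incl[of S]
 by (intro equalityI adjoin_min[OF adjoin_subr] adjoin_mono) auto

lemma (in field_over) kk_nonunit: assumes "subr R" "kk <= R" "\<iota> a : mm R" shows "a = 0"
proof (rule ccontr)
 assume "a ~= 0"
 have "\<iota> (inverse a) : R" using assms(2) by blast
 from nonunits_mult[OF assms(1,3) this] show False using \<iota>_inverse[OF `a ~= 0`] nonunits_1[OF assms(1)] by simp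
qed

context canonical_curve
begin

definition ys :: "nat => 'a set" where "ys i = (%j. v j / v i) ` {..<g}"

text \<open>The ring kv i belongs to the chart of the canonical model on which the coordinate i does not vanish, and
 bring x i to the part of the blowup over the local ring of x where \<open>v\<^sub>i\<close> generates.  A bpoint is a local ring
 of the blowup at a point over x.\<close>

definition kv :: "nat => 'a set" where "kv i = adjoin (kk Un ys i)"

definition bring :: "'p => nat => 'a set" where "bring x i = adjoin (stk x Un ys i)"

definition bpoint :: "'p => nat => 'a set => bool" where
 "bpoint x i R \<longleftrightarrow> x : pts & i < g & loc_ring R & dominated (stk x) R & ys i <= R
  & R = local_at (bring x i) R"

lemma ratio_mem: assumes "subr S" "kk <= S" "ys i <= S" "w : V" shows "w / v i : S"
proof -
 obtain c where c: "w = (\<Sum>j<g. \<iota> (c j) * v j)" using assms(4) V_iff by blast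
 have "w / v i = (\<Sum>j<g. \<iota> (c j) * (v j / v i))" unfolding c by (simp add: sum_divide_distrib)
 also have "\<dots> : S" using assms(2,3) by (intro subr_sum[OF assms(1)] subr_mult[OF assms(1)]) (auto simp: ys_def)
 finally show ?thesis .
qed

lemma kv: "subr (kv i)" "kk <= kv i" "ys i <= kv i"
 unfolding kv_def using adjoin_subr adjoin_incl[of "kk Un ys i"] by auto

lemma kv_min: "subr S ==> kk <= S ==> ys i <= S ==> kv i <= S"
 unfolding kv_def by (rule adjoin_min) auto

lemma bring: "subr (bring x i)" "stk x <= bring x i" "ys i <= bring x i"
 unfolding bring_def using adjoin_subr adjoin_incl[of "stk x Un ys i"] by auto

lemma bpointD:
 assumes "bpoint x i R"
 shows "x : pts" "i < g" "loc_ring R" "subr R" "dominated (stk x) R" "ys i <= R" "stk x <= R" "kk <= R" "bring x i <= R" "kv i <= R"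
  and "R = local_at (bring x i) R" "FD R"
proof -
 show a: "x : pts" "i < g" "loc_ring R" "dominated (stk x) R" "ys i <= R" "R = local_at (bring x i) R"
  using assms by (auto simp: bpoint_def)
 show R: "subr R" by (rule loc_ring_subr[OF a(3)])
 show s: "stk x <= R" by (rule dominated_sub[OF a(4)])
 thus k: "kk <= R" using kk_stalk[OF a(1)] by blast
 show "bring x i <= R" unfolding bring_def using adjoin_min[OF R] s a by blast
 show "kv i <= R" by (rule kv_min[OF R k a(5)])
 show "FD R" by (rule krull_akizuki[OF FD_stalk[OF a(1)] stalk_fractions[OF a(1)] R s])
qed

lemma bpoint_frac:
 assumes "bpoint x i R" "z : R" shows "EX a s. z = a / s & a : bring x i & s : bring x i & s ~: mm R"
proof -
 have "z : local_at (bring x i) R" using assms(2) bpointD(11)[OF assms(1)] by simp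
 thus ?thesis unfolding localization_iff by blast
qed

subsection \<open>Curves without a pencil that almost preserves the canonical system\<close>

text \<open>Here E is a finite set that spans the hyperplane W, and E' consists of the quotients by \<open>v\<^sub>i\<close>.  Duality gives gen: every
 section of the dualizing sheaf lies in the lattice of W, up to a multiple of \<open>v\<^sub>i\<close> at x.  It follows that \<open>O\<^sub>x[V/v\<^sub>i]\<close> consists of
 constants modulo the ideal J generated by E', so that J generates the maximal ideal of R.\<close>

lemma point_without_pencil:
 assumes bp: "bpoint x i R" and nz: "mm R ~= {0}"
  and nA: "!!z u W. submod kk W ==> W <= V ==> (!!w. w : V ==> EX a. w - \<iota> a * u : W) ==> (!!w. w : W ==> z * w : V) ==> z : kk"
 shows "R = local_at (kv i) R"
proof -
 let ?m = "mm R" and ?B = "bring x i" and ?c = "inverse (v i)"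
 note D = bpointD[OF bp]
 note R = D(4) and pm = nonunits_prime[OF D(3)] and sm = nonunits_submod[OF D(3)]
 have vi: "v i ~= 0" by (rule v_nonzero[OF D(2)])
 have res: "EX a. z - \<iota> a : ?m" if "z : R" for z by (rule FD_residue[OF D(12) pm nz that])
 define W where "W = {w : V. ?c * w : ?m}"
 have Wk: "submod kk W" unfolding W_def submod_def
 proof (intro conjI ballI)
  show "0 : {w : V. ?c * w : ?m}" using submod_0[OF V_kk] submod_0[OF sm] by simp
  fix w assume w: "w : {w : V. ?c * w : ?m}"
  show "w + w' : {w : V. ?c * w : ?m}" if "w' : {w : V. ?c * w : ?m}" for w'
   using w that submod_add[OF V_kk] submod_add[OF sm] by (auto simp: distrib_left)
  show "a * w : {w : V. ?c * w : ?m}" if "a : kk" for a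
   using w that submod_mult[OF V_kk] submod_mult[OF sm, of a "?c * w"] D(8) by (auto simp: mult.left_commute)
 qed
 have WV: "W <= V" by (auto simp: W_def)
 have hyper: "EX a. w - \<iota> a * v i : W" if w: "w : V" for w
 proof -
  obtain a where a: "w / v i - \<iota> a : ?m" using res[OF ratio_mem[OF R D(8,6) w]] by blast
  have "?c * (w - \<iota> a * v i) = w / v i - \<iota> a" using vi by (simp add: field_simps)
  moreover have "w - \<iota> a * v i : V" by (rule submod_diff[OF V_kk subr_kk w submod_mult[OF V_kk _ v_mem[OF D(2)]]]) simp
  ultimately show ?thesis using a by (auto simp: W_def)
 qed
 have "fc W {0}" using fc_mono[of V "{0}" W "{0}"] V_fcn WV by (auto simp: fc_def)
 from fc_span[OF submod_zero this] obtain E where E: "finite E" "E <= W" "!!a. a : W ==> a : lspan kk E" by (metis eq_iff_diff_eq_0 singletonD)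
 have "EX e0:E. e0 ~= 0"
 proof (rule ccontr)
  assume "~ ?thesis"
  hence "lspan kk E <= {0}" by (intro lspan_min submod_zero) auto
  hence W0: "W <= {0}" using E(3) by blast
  have "fcn g V {0}"
  proof (rule fcnI_span[OF submod_zero, of "{v i}"])
   show "EX y:lspan kk {v i}. w - y : {0}" if w: "w : V" for w
    using hyper[OF w] W0 lspan_mult[OF subr_kk subsetD[OF lspan_incl[OF subr_kk]], of "v i" "{v i}"] by (fastforce intro: bexI)
  qed (use g2 in auto)
  thus False using v_ndep fcnD[of g V "{0}" v] v_mem by blast
 qed
 then obtain e0 where e0: "e0 : E" "e0 ~= 0" by blast
 have latm: "lat E y <= mst y" if "y : pts" for y
  unfolding lat_def by (rule lspan_min[OF mst_submod[OF that]]) (use E(2) WV MU_mst[OF nopen_pts that] in blast)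
 have Wlat: "W <= lat E y" if "y : pts" for y
  unfolding lat_def using E(3) lspan_mono[OF kk_stalk[OF that] order_refl] by blast
 define E' where "E' = (*) ?c ` E"
 have E'm: "E' <= ?m" using E(2) by (auto simp: E'_def W_def)
 have lat_scale: "?c * w : lspan S E'" if "w : lat E y" "stk y <= S" for w y S
  using that lspan_times[of "stk y" ?c E] lspan_mono[OF that(2) order_refl, of E'] unfolding lat_def E'_def by blast
 have gen: "EX a. m - \<iota> a * v i : lat E y & (y ~= x --> a = 0)" if y: "y : pts" and m: "m : mst y" for y m
 proof -
  have "z * m : mst y" if z: "!!w. w : E ==> z * w : V" for z
  proof -
   have "lspan kk ((*) z ` E) <= V" by (rule lspan_min[OF V_kk]) (use z in blast)
   hence "z * w : V" if "w : W" for w using E(3)[OF that] unfolding lspan_times by blast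
   hence "z : kk" using nA[OF Wk WV hyper] by blast
   thus ?thesis using submod_mult[OF mst_submod[OF y] _ m] kk_stalk[OF y] by blast
  qed
  then obtain \<kappa> where k: "!!y'. y' : pts ==> y' ~= y ==> \<kappa> : lat E y'" "m - \<kappa> : lat E y"
   using point_duality[OF E(1) e0 y] by blast
  have "m - (m - \<kappa>) : mst y" by (rule submod_diff[OF mst_submod[OF y] stalk_subr[OF y] m]) (use k(2) latm[OF y] in blast)
  hence kV: "\<kappa> : V" unfolding V_iff_mst using k(1) latm by auto
  show ?thesis
  proof (cases "y = x")
   case True
   obtain a where "\<kappa> - \<iota> a * v i : W" using hyper[OF kV] by blast
   hence "(m - \<kappa>) + (\<kappa> - \<iota> a * v i) : lat E y" using Wlat[OF y] by (intro submod_add[OF lat_submod[OF y] k(2)]) blast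
   thus ?thesis using True by (intro exI[of _ a]) simp
  next
   case False
   have "?c * \<kappa> : lspan R E'" using lat_scale[OF k(1)[OF D(1)] D(7)] False by blast
   hence "?c * \<kappa> : ?m" using lspan_min[OF sm E'm] by blast
   hence "\<kappa> : lat E y" using kV Wlat[OF y] by (auto simp: W_def)
   from submod_add[OF lat_submod[OF y] k(2) this] show ?thesis by (intro exI[of _ 0]) (simp add: \<iota>_0)
  qed
 qed
 define J where "J = lspan ?B E'"
 note B = bring[where x = x and i = i]
 have Jm: "J <= ?m" unfolding J_def by (rule lspan_min[OF submod_mono[OF sm D(9)] E'm])
 have Js: "submod ?B J" unfolding J_def by (rule lspan_submod[OF B(1)])
 have kB: "kk <= ?B" using B(2) kk_stalk[OF D(1)] by blast
 have BT: "EX a. b - \<iota> a : J" if "b : ?B" for b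
 proof -
  let ?T = "{b : ?B. EX a. b - \<iota> a : J}"
  have "subr ?T" unfolding subr_def
  proof (intro conjI ballI)
   show "1 : ?T" using subr_1[OF B(1)] submod_0[OF Js] \<iota>_1 by (auto intro!: exI[of _ 1])
   fix b b' assume "b : ?T" "b' : ?T"
   then obtain a a' where a: "b : ?B" "b' : ?B" "b - \<iota> a : J" "b' - \<iota> a' : J" by blast
   have "b - b' - \<iota> (a - a') : J" using submod_diff[OF Js B(1) a(3,4)] by (simp add: \<iota>_diff algebra_simps)
   thus "b - b' : ?T" using subr_diff[OF B(1) a(1,2)] by blast
   have "b * b' - \<iota> (a * a') = b * (b' - \<iota> a') + \<iota> a' * (b - \<iota> a)" by (simp add: \<iota>_mult algebra_simps)
   moreover have "\<iota> a' : ?B" using kB by blast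
   ultimately have "b * b' - \<iota> (a * a') : J" using submod_step[OF Js a(1,4) submod_mult[OF Js _ a(3)]] by simp
   thus "b * b' : ?T" using subr_mult[OF B(1) a(1,2)] by blast
  qed
  moreover have "stk x <= ?T"
  proof
   fix b assume b: "b : stk x"
   have "b * v i : mst x" using submod_mult[OF mst_submod[OF D(1)] b] v_mem[OF D(2)] MU_mst[OF nopen_pts D(1)] by blast
   then obtain a where "b * v i - \<iota> a * v i : lat E x" using gen[OF D(1)] by blast
   moreover have "?c * (b * v i - \<iota> a * v i) = b - \<iota> a" using vi by (simp add: field_simps)
   ultimately have "b - \<iota> a : J" using lat_scale[OF _ B(2)] unfolding J_def by metis
   thus "b : ?T" using b B(2) by blast
  qed
  moreover have "ys i <= ?T"
  proof
   fix b assume b: "b : ys i"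
   then obtain j where j: "j < g" "b = v j / v i" by (auto simp: ys_def)
   obtain a where "v j - \<iota> a * v i : W" using hyper[OF v_mem[OF j(1)]] by blast
   hence "?c * (v j - \<iota> a * v i) : J" using lat_scale[OF subsetD[OF Wlat[OF D(1)]] B(2)] by (auto simp: J_def)
   moreover have "?c * (v j - \<iota> a * v i) = b - \<iota> a" using vi j(2) by (simp add: field_simps)
   ultimately have "b - \<iota> a : J" by simp
   thus "b : ?T" using b B(3) by blast
  qed
  ultimately have "?B <= ?T" unfolding bring_def by (intro adjoin_min) auto
  thus ?thesis using that by blast
 qed
 have Bm: "b : J" if b: "b : ?B" "b : ?m" for b
 proof -
  obtain a where a: "b - \<iota> a : J" using BT[OF b(1)] by blast
  have "b - (b - \<iota> a) : ?m" by (rule submod_diff[OF sm R b(2)]) (use a Jm in blast)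
  hence "a = 0" using kk_nonunit[OF R D(8), of a] by simp
  thus ?thesis using a by (simp add: \<iota>_0)
 qed
 let ?p = "kv i Int ?m"
 let ?R = "localization (kv i) ?p"
 have pp: "prime_of (kv i) ?p" by (rule center_prime[OF D(3) kv(1) D(10)])
 note R' = localization_center[OF D(3) kv(1) D(10)] localization_loc_ring[OF kv(1) pp] localization_subr[OF kv(1) pp] localization_incl[OF kv(1) pp]
 have E'p: "E' <= ?p"
 proof -
  have "?c * w : kv i" if "w : V" for w using ratio_mem[OF kv(1-3) that] by (simp add: divide_inverse mult.commute)
  thus ?thesis using E(2) WV E'm by (auto simp: E'_def)
 qed
 (* Completeness is applied to the affine coordinates V/v_i together with 1/z. *)
 have int: "integral_over ?R z" if z: "z : R" for z
 proof (rule ccontr)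
  assume ni: "~ integral_over ?R z"
  hence z0: "z ~= 0" using integral_self[OF R'(4) subr_0[OF R'(4)]] by metis
  obtain q where q: "prime_of (adjoin (kv i Un {inverse z})) q" "?p <= q" "inverse z : q"
   by (rule not_integral_prime[OF kv(1) pp z0 ni])
  define y where "y j = (if j < g then v j / v i else inverse z)" for j
  have yi: "y ` {..<Suc g} = ys i Un {inverse z}" unfolding lessThan_Suc image_insert by (auto simp: y_def ys_def)
  have "adjoin (kk Un y ` {..<Suc g}) = adjoin (kv i Un {inverse z})"
   unfolding yi kv_def adjoin_absorb by (simp add: Un_assoc)
  then obtain x2 P2 where P2: "x2 : pts" "prime_of (adjoin (stk x2 Un y ` {..<Suc g})) P2" "q <= P2"
   using complete_dominates[of y "Suc g" q] q(1) by metis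
  let ?C = "adjoin (stk x2 Un y ` {..<Suc g})" and ?S = "localization (adjoin (stk x2 Un y ` {..<Suc g})) P2"
  note C = adjoin_subr[of "stk x2 Un y ` {..<Suc g}"] adjoin_incl[of "stk x2 Un y ` {..<Suc g}"]
  note S = localization_loc_ring[OF C(1) P2(2)] localization_subr[OF C(1) P2(2)] localization_incl[OF C(1) P2(2)]
  have sS: "stk x2 <= ?S" using C(2) S(3) by blast
  have "P2 <= mm ?S" using localization_contract[OF C(1) P2(2)] by blast
  hence m2: "E' <= mm ?S" "inverse z : mm ?S" using E'p q(2,3) P2(3) by blast+
  note sS2 = nonunits_submod[OF S(1)]
  have "x2 = x"
  proof (rule ccontr)
   assume ne: "x2 ~= x"
   have "v i : mst x2" using v_mem[OF D(2)] MU_mst[OF nopen_pts P2(1)] by blast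
   hence "v i : lat E x2" using gen[OF P2(1)] ne by (fastforce simp: \<iota>_0)
   from lat_scale[OF this sS] have "1 : lspan ?S E'" using vi by simp
   thus False using lspan_min[OF sS2 m2(1)] nonunits_1[OF S(2)] by blast
  qed
  hence "?B <= ?C" unfolding bring_def yi by (intro adjoin_mono) auto
  hence BS: "?B <= ?S" using S(3) by blast
  have JS: "J <= mm ?S" unfolding J_def by (rule lspan_min[OF submod_mono[OF sS2 BS] m2(1)])
  obtain a s where as: "z = a / s" "a : ?B" "s : ?B" "s ~: ?m" using bpoint_frac[OF bp z] by blast
  obtain b where b: "s - \<iota> b : J" using BT[OF as(3)] by blast
  have b0: "b ~= 0" using b as(4) Jm by (auto simp: \<iota>_0)
  have "s ~: mm ?S"
  proof
   assume "s : mm ?S"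
   from submod_diff[OF sS2 S(2) this, of "s - \<iota> b"] have "\<iota> b : mm ?S" using b JS by auto
   thus False using kk_nonunit[OF S(2), of b] b0 kB BS by auto
  qed
  hence "z : ?S" using unit_inverse[of s ?S] as BS subr_mult[OF S(2)] by (auto simp: divide_inverse)
  from submod_mult[OF sS2 this m2(2)] show False using z0 nonunits_1[OF S(2)] by simp
 qed
 obtain U G where U: "aff U" "x : U" "finite G" "\<O> U = adjoin (kk Un G)"
  using finite_cover D(1) by (metis UnionE)
 (* Adjoining generators G of an affine neighborhood of x to R' gives a finite R'-module C, and C is all of R. *)
 let ?C = "adjoin (?R Un G)"
 note C = adjoin_subr[of "?R Un G"] adjoin_incl[of "?R Un G"]
 have UR: "\<O> U <= R" using stalk_affine[OF U(1) U(2)] D(7) by blast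
 have GR: "G <= R" using UR U(4) adjoin_incl[of "kk Un G"] by blast
 then obtain T where T: "finite T" "T <= ?C" "?C <= lspan ?R T" using integral_finite[OF R'(4) U(3)] int by blast
 have CR: "?C <= R" by (rule adjoin_min[OF R]) (use R'(1) GR in auto)
 have inv: "inverse s : ?C" if s: "s : ?C" "s ~: ?m" for s
 proof -
  have "s ~= 0" "inverse s : R" using unit_inverse[of s R] s CR by blast+
  thus ?thesis using integral_inverse[OF int, of "inverse s" ?C] C s(1) by simp
 qed
 have frac: "a / s : ?C" if "a : ?C" "s : ?C" "s ~: ?m" for a s
  unfolding divide_inverse by (rule subr_mult[OF C(1) that(1) inv[OF that(2,3)]])
 have kR': "kk <= ?R" "ys i <= ?R" using kv R'(5) by blast+
 have UC: "\<O> U <= ?C" unfolding U(4) by (rule adjoin_mono) (use kR'(1) in auto)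
 have "stk x <= ?C"
 proof
  fix b assume b: "b : stk x"
  then obtain a s where as: "b = a / s" "a : \<O> U" "s : \<O> U" "s ~: pp U x" unfolding stalk_eq_localization[OF U(1,2)] localization_iff by blast
  have "s ~: mm (stk x)" using as(3,4) by (simp add: point_prime_def)
  hence "s ~: ?m" using D(5) as(3) stalk_affine[OF U(1) U(2)] unfolding dominated_def by blast
  thus "b : ?C" unfolding as(1) using frac UC as by blast
 qed
 hence BC: "?B <= ?C" unfolding bring_def using kR'(2) C by (intro adjoin_min[OF C(1)]) auto
 have RC: "R <= ?C"
 proof
  fix z assume "z : R"
  then obtain a s where "z = a / s" "a : ?B" "s : ?B" "s ~: ?m" using bpoint_frac[OF bp] by blast
  thus "z : ?C" using frac BC by blast
 qed
 hence RT: "R <= lspan ?R T" using T(3) by blast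
 let ?m' = "mm ?R"
 define N where "N = lspan ?m' T"
 note sm' = nonunits_submod[OF R'(3)]
 have Nmul: "a * b : N" if a: "a : ?m'" and b: "b : R" for a b
 proof -
  have "b : lspan ?R T" using RT b by blast
  thus ?thesis unfolding N_def
  proof induction
   case (lspan_step x c u)
   have "c * a * u + a * x : lspan ?m' T"
    by (rule lspan.lspan_step[OF lspan_step(4) submod_mult[OF sm' lspan_step(2) a] lspan_step(3)])
   thus ?case by (simp add: algebra_simps)
  qed (simp add: lspan.lspan_0)
 qed
 have Ns: "submod R N" unfolding submod_def
 proof (intro conjI ballI)
  show "0 : N" unfolding N_def by (rule lspan.lspan_0)
  fix z assume z: "z : N"
  show "z + z' : N" if "z' : N" for z' using lspan_add z that unfolding N_def by blast
  fix b assume b: "b : R"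
  show "b * z : N" using z unfolding N_def
  proof induction
   case (lspan_step x c u)
   have "b * u : R" using lspan_step(3) T(2) CR subr_mult[OF R b] by blast
   from lspan_add[OF Nmul[OF lspan_step(2) this, unfolded N_def] lspan_step(4)] show ?case by (simp add: algebra_simps)
  qed (simp add: lspan.lspan_0)
 qed
 have E'N: "E' <= N"
 proof
  fix w assume "w : E'"
  hence "w : mm ?R" using E'p localization_contract[OF kv(1) pp] by blast
  from Nmul[OF this subr_1[OF R]] show "w : N" by simp
 qed
 have mN: "?m <= N"
 proof
  fix z assume z: "z : ?m"
  hence "z : R" using nonunits_sub by blast
  then obtain a s where as: "z = a / s" "a : ?B" "s : ?B" "s ~: ?m" using bpoint_frac[OF bp] by blast
  have s: "s ~= 0" "inverse s : R" using unit_inverse[of s R] as(3,4) D(9) by blast+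
  have "a = s * z" using as(1) s by simp
  hence "a : ?m" using submod_mult[OF sm _ z] as(3) D(9) by blast
  hence "a : J" using Bm as(2) by blast
  moreover have "J <= N" unfolding J_def by (rule lspan_min[OF submod_mono[OF Ns D(9)] E'N])
  ultimately have "inverse s * a : N" using submod_mult[OF Ns s(2)] by blast
  thus "z : N" by (simp add: as(1) divide_inverse mult.commute)
 qed
 have "T <= ?R"
 proof (rule nakayama[OF R'(3) T(1)])
  fix u assume "u : T"
  hence "u : R" using T(2) CR by blast
  then obtain a where "u - \<iota> a : ?m" using res by blast
  hence "u - \<iota> a : lspan ?m' T" using mN unfolding N_def by blast
  thus "EX r:?R. u - r : lspan ?m' T" using kR'(1) by blast
 qed
 hence "lspan ?R T <= ?R" by (rule lspan_min[OF submod_self[OF R'(4)]])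
 thus ?thesis using RT R'(1) by blast
qed

end

lemma (in field_over) inverse_kk: "inverse x : kk ==> x : kk"
proof -
 assume "inverse x : kk"
 then obtain c where c: "inverse x = \<iota> c" by blast
 show ?thesis
 proof (cases "c = 0")
  case True
  thus ?thesis using c subr_0[OF subr_kk] by (simp add: \<iota>_0)
 next
  case False
  hence "x = \<iota> (inverse c)" using \<iota>_inverse[OF False] c[symmetric] by (metis inverse_inverse_eq inverse_unique mult.commute)
  thus ?thesis by blast
 qed
qed

section \<open>Pencils that almost preserve the canonical system\<close>

lemma infinite_alg_closed: "infinite (UNIV :: 'k::alg_closed_field set)"
proof
 assume f: "finite (UNIV :: 'k set)"
 let ?P = "\<Prod>a\<in>UNIV. [:- a, 1:] :: 'k poly"
 have d: "degree ?P = card (UNIV :: 'k set)" by (subst degree_prod_eq_sum_degree) auto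
 have "card (UNIV :: 'k set) > 0" using f by (simp add: finite_UNIV_card_ge_0)
 hence "degree (?P + 1) > 0" using degree_add_eq_left[of 1 ?P] d by simp
 then obtain b where "poly (?P + 1) b = 0" using alg_closed_imp_poly_has_root by blast
 moreover have "poly ?P b = 0" using f by (auto simp: poly_prod)
 ultimately show False by simp
qed

lemma localization_self: assumes "loc_ring R" shows "localization R (mm R) = R"
 using localization_center(1)[OF assms loc_ring_subr[OF assms] order_refl] nonunits_sub[of R]
  localization_incl[OF loc_ring_subr[OF assms] nonunits_prime[OF assms]] by (simp add: Int_absorb1)

context field_over
begin

definition ratfun :: "'a => 'a set" where "ratfun x = {evp p x / evp q x | p q. q ~= 0}"

lemma evp_nonzero: "x ~: kk ==> p ~= 0 ==> evp p x ~= 0"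
 using root_in_kk by blast

lemma evp_diff [simp]: "evp (p - q) x = evp p x - evp q x"
 using evp_add[of "p - q" q x] by simp

lemma evp_sum_coeff: assumes "degree p <= n" shows "evp p x = (\<Sum>i\<le>n. \<iota> (coeff p i) * x ^ i)"
proof -
 have "p = (\<Sum>i\<le>n. monom (coeff p i) i)" by (rule poly_as_sum_of_monoms'[OF assms, symmetric])
 hence "evp p x = evp (\<Sum>i\<le>n. monom (coeff p i) i) x" by simp
 thus ?thesis by (simp only: sum_powers_evp)
qed

lemma evp_reflect: assumes "x ~= 0" shows "evp p x = x ^ degree p * evp (reflect_poly p) (inverse x)"
proof -
 have "reflect_poly (map_poly \<iota> p) = map_poly \<iota> (reflect_poly p)"
  by (rule poly_eqI) (simp add: coeff_reflect_poly coeff_map_poly \<iota>_0 degree_map_poly)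
 thus ?thesis using poly_reflect_poly_nz[of "inverse x" "map_poly \<iota> p"] assms
  by (simp add: evp_def degree_map_poly \<iota>_0 field_simps)
qed

lemma ratfun_inverse: assumes "x ~= 0" shows "ratfun x <= ratfun (inverse x)"
proof
 fix z assume "z : ratfun x"
 then obtain p q where z: "z = evp p x / evp q x" "q ~= 0" by (auto simp: ratfun_def)
 let ?p = "reflect_poly p * monom 1 (degree q)" and ?q = "reflect_poly q * monom 1 (degree p)"
 have "z = evp ?p (inverse x) / evp ?q (inverse x)"
  unfolding z(1) evp_reflect[OF assms, of p] evp_reflect[OF assms, of q] using assms by (simp add: \<iota>_1 field_simps)
 moreover have "?q ~= 0" using z(2) by simp
 ultimately show "z : ratfun (inverse x)" unfolding ratfun_def by blast
qed

text \<open>The local rings of the line at finite distance are valuation rings: a common zero of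
 numerator and denominator can be cancelled.\<close>

lemma ratfun_valuation:
 assumes R: "loc_ring R" "kk <= R" and x: "x : R" "x ~: kk"
 shows "z : ratfun x ==> z : R | inverse z : R"
proof -
 note Rs = loc_ring_subr[OF R(1)] and m = nonunits_prime[OF R(1)] and sm = nonunits_submod[OF R(1)]
 have ev: "evp p x : R" for p by (rule evp_mem[OF Rs R(2) x(1)])
 have "q ~= 0 ==> evp p x / evp q x : R | evp q x / evp p x : R" for p q
 proof (induction "degree q" arbitrary: p q rule: less_induct)
  case less
  show ?case
  proof (cases "evp p x : mm R & evp q x : mm R")
   case False
   thus ?thesis using unit_inverse[OF ev] ev subr_mult[OF Rs] by (fastforce simp: divide_inverse)
  next
   case True
   then obtain r where r: "x - \<iota> r : mm R" using root_mod_prime[OF Rs R(2) m x(1) less.prems] by blast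
   have root: "poly s r = 0" if s: "evp s x : mm R" for s
   proof -
    have s': "s = [:poly s r:] + [:- r, 1:] * synthetic_div s r" using synthetic_div_correct'[of r s] by (simp add: add.commute)
    have "evp s x = \<iota> (poly s r) + (x - \<iota> r) * evp (synthetic_div s r) x"
     by (subst s', simp only: evp_add evp_mult) (simp add: \<iota>_0 \<iota>_1 \<iota>_uminus)
    moreover have "(x - \<iota> r) * evp (synthetic_div s r) x : mm R" using submod_mult'[OF sm ev r] .
    ultimately have "\<iota> (poly s r) : mm R" using submod_diff[OF sm Rs s, of "(x - \<iota> r) * evp (synthetic_div s r) x"] by simp
    thus ?thesis by (rule kk_nonunit[OF Rs R(2)])
   qed
   obtain p' q' where pq: "p = [:- r, 1:] * p'" "q = [:- r, 1:] * q'" using root True by (metis dvdE poly_eq_0_iff_dvd)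
   have "q' ~= 0" "degree q' < degree q" using pq(2) less.prems by (auto simp: degree_mult_eq simp del: mult_pCons_left)
   hence "evp p' x / evp q' x : R | evp q' x / evp p' x : R" by (rule less.hyps[rotated])
   moreover have "evp [:- r, 1:] x ~= 0" by (rule evp_nonzero[OF x(2)]) simp
   ultimately show ?thesis unfolding pq evp_mult by simp
  qed
 qed
 hence *: "q ~= 0 ==> evp p x / evp q x : R | inverse (evp p x / evp q x) : R" for p q by simp
 assume "z : ratfun x"
 then obtain p q where "z = evp p x / evp q x" "q ~= 0" by (auto simp: ratfun_def)
 thus "z : R | inverse z : R" using * by blast
qed

end

lemma (in complete_curve) adele_times: assumes "finite {y : pts. s y ~: stk y}" shows "finite {y : pts. c * s y ~: stk y}"
 by (rule finite_subset[of _ "{y : pts. s y ~: stk y} Un {y : pts. c ~: stk y}"])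
  (use assms finite_poles[of c] subr_mult[OF stalk_subr] in auto)

context canonical_curve
begin

text \<open>The space of the w with \<open>w, z w, \<dots>, z\<^sup>j w\<close> in V loses at most one dimension when j grows by one, because
 multiplication by z is defined on a hyperplane.  Hence it is not zero for j = g - 1, and for f in it the
 g independent elements \<open>f z\<^sup>l\<close> are a basis of V.\<close>

lemma pencil_basis:
 assumes W: "submod kk W" "W <= V" "!!w. w : V ==> EX a. w - \<iota> a * u : W" and z: "!!w. w : W ==> z * w : V" "z ~: kk"
 obtains f where "f ~= 0" "!!w. w : V \<longleftrightarrow> (EX p. degree p <= g - 1 & w = f * evp p z)"
proof -
 define Z where "Z j = {w. ALL l<=j. z ^ l * w : V}" for j :: nat
 have Zk: "submod kk (Z j)" for j unfolding Z_def submod_def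
  using submod_0[OF V_kk] submod_add[OF V_kk] submod_mult[OF V_kk] by (auto simp: distrib_left mult.left_commute)
 have step: "fcn (Suc 1) (V Int Z j) (Z (Suc j))" for j unfolding fcn_def
 proof (intro allI impI)
  fix w :: "nat => 'a" assume "ALL i<Suc 1. w i : V Int Z j"
  hence w: "w 0 : Z j" "w 1 : Z j" by auto
  hence "z ^ j * w 0 : V" "z ^ j * w 1 : V" by (auto simp: Z_def)
  then obtain a b where ab: "z ^ j * w 0 - \<iota> a * u : W" "z ^ j * w 1 - \<iota> b * u : W" using W(3) by blast
  have comb: "\<iota> c * w 0 + \<iota> d * w 1 : Z (Suc j)" if cd: "c * a + d * b = 0" for c d
  proof -
   have "\<iota> c * (z ^ j * w 0 - \<iota> a * u) + \<iota> d * (z ^ j * w 1 - \<iota> b * u) : W" by (intro submod_step[OF W(1)] submod_mult[OF W(1)] ab) auto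
   moreover have "\<iota> c * (z ^ j * w 0 - \<iota> a * u) + \<iota> d * (z ^ j * w 1 - \<iota> b * u) = z ^ j * (\<iota> c * w 0 + \<iota> d * w 1) - \<iota> (c * a + d * b) * u"
    by (simp add: \<iota>_add \<iota>_mult algebra_simps)
   ultimately have "z * (z ^ j * (\<iota> c * w 0 + \<iota> d * w 1)) : V" using z(1) cd by (simp add: \<iota>_0)
   moreover have "\<iota> c * w 0 + \<iota> d * w 1 : Z j" by (intro submod_step[OF Zk] submod_mult[OF Zk] w) auto
   ultimately show ?thesis unfolding Z_def by (auto simp: le_Suc_eq mult.assoc)
  qed
  show "dep (Z (Suc j)) {..<Suc 1} w"
  proof (cases "a = 0 & b = 0")
   case True
   thus ?thesis unfolding dep_def using comb[of 1 0] by (intro exI[of _ "%i. if i = 0 then 1 else 0"]) (auto simp: lessThan_Suc \<iota>_0 \<iota>_1)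
  next
   case False
   thus ?thesis unfolding dep_def using comb[of b "- a"]
    by (intro exI[of _ "%i. if i = 0 then b else - a"]) (auto simp: lessThan_Suc add.commute mult.commute)
  qed
 qed
 have "fcn (Suc j) V (Z j)" for j
 proof (induction j)
  case 0
  show ?case by (rule fcnI_span[OF Zk, of "{}"]) (auto simp: Z_def)
 next
  case (Suc j)
  from fcn_trans[OF V_kk Zk Zk Suc step] show ?case by simp
 qed
 from this[of "g - 1"] have "dep (Z (g - 1)) {..<g} v" using g2 v_mem fcnD[of g V "Z (g - 1)" v] by simp
 then obtain c i where c: "i < g" "c i ~= 0" "(\<Sum>i<g. \<iota> (c i) * v i) : Z (g - 1)" by (auto simp: dep_def)
 define f where "f = (\<Sum>i<g. \<iota> (c i) * v i)"
 have f0: "f ~= 0" using V_independent c(1,2) unfolding f_def by blast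
 have fz: "f * z ^ l : V" if "l < g" for l using c(3) that unfolding Z_def f_def[symmetric] by (auto simp: mult.commute)
 have "w : V \<longleftrightarrow> (EX p. degree p <= g - 1 & w = f * evp p z)" for w
 proof
  assume w: "w : V"
  let ?w = "%i. if i < g then f * z ^ i else w"
  have "dep {0} {..<Suc g} ?w" by (rule fcnD[OF V_fcn]) (use fz w in auto)
  then obtain b where b: "EX i<Suc g. b i ~= 0" "(\<Sum>i<Suc g. \<iota> (b i) * ?w i) = 0" by (auto simp: dep_def)
  let ?P = "\<Sum>i<g. monom (b i) i"
  have "(\<Sum>i<g. \<iota> (b i) * (f * z ^ i)) = f * evp ?P z" unfolding sum_powers_evp[symmetric] by (simp add: sum_distrib_left mult.left_commute)
  hence eq: "f * evp ?P z + \<iota> (b g) * w = 0" using b(2) by simp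
  have "b g ~= 0"
  proof
   assume bg: "b g = 0"
   hence "?P ~= 0" using b(1) sum_monom_nz[of "{..<g}" _ b] by (auto simp: less_Suc_eq)
   from evp_nonzero[OF z(2) this] show False using eq f0 unfolding bg \<iota>_0 mult_zero_left add_0_right mult_eq_0_iff by blast
  qed
  hence "w = \<iota> (inverse (b g)) * (\<iota> (b g) * w)" using \<iota>_inverse by (simp flip: mult.assoc)
  also have "\<iota> (b g) * w = - (f * evp ?P z)" using eq by (metis add_eq_0_iff)
  finally have "w = f * evp (smult (- inverse (b g)) ?P) z" unfolding evp_smult by (simp add: \<iota>_uminus del: evp_sum)
  moreover have "degree ?P <= g - 1" using g2 by (intro degree_sum_le) (auto intro: order_trans[OF degree_monom_le])
  ultimately show "EX p. degree p <= g - 1 & w = f * evp p z" using degree_smult_le order_trans by blast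
 next
  assume "EX p. degree p <= g - 1 & w = f * evp p z"
  then obtain p where p: "degree p <= g - 1" "w = f * evp p z" by blast
  have "w = (\<Sum>i\<le>g - 1. \<iota> (coeff p i) * (f * z ^ i))" unfolding p(2) evp_sum_coeff[OF p(1)] by (simp add: sum_distrib_left mult.left_commute)
  moreover have "\<dots> : V" using fz g2 by (intro submod_kk_sum[OF V_kk]) auto
  ultimately show "w : V" by simp
 qed
 thus ?thesis using that f0 by blast
qed

end

locale pencil = canonical_curve X \<iota> \<omega> t e h g
 for X :: "('p, 'a::field) rspace" and \<iota> :: "'k::alg_closed_field => 'a" and \<omega> :: "('p, 'a, 'w) omodule" and t e h g +
 fixes x f :: 'a
 assumes x: "x ~: kk" and f0: "f ~= 0" and V_poly: "!!w. w : V \<longleftrightarrow> (EX p. degree p <= g - 1 & w = f * evp p x)"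
begin

definition N where "N = g - 1"

lemma N: "N >= 1" using g2 by (simp add: N_def)

lemma V_N: "w : V \<longleftrightarrow> (EX p. degree p <= N & w = f * evp p x)" unfolding N_def by (rule V_poly)

lemma x0: "x ~= 0" using x subr_0[OF subr_kk] by auto

text \<open>The stalks G n y are those of the line bundle of order n along the poles of x, if x or 1/x is regular at y;
 the dualizing sheaf is f G N.\<close>

definition pw :: "nat => 'a set" where "pw n = (%j. x ^ j) ` {..n}"

abbreviation "G n y \<equiv> lat (pw n) y"

lemma G_submod: "y : pts ==> submod (stk y) (G n y)" by (rule lat_submod)

lemma G_kk: "y : pts ==> submod kk (G n y)" by (rule submod_mono[OF G_submod FD_kk[OF FD_stalk]])

lemma G_mono: "m <= n ==> G m y <= G n y"
 unfolding lat_def by (rule lspan_mono[OF order_refl]) (auto simp: pw_def)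

lemma G_evp: assumes "y : pts" "degree p <= n" shows "evp p x : G n y"
proof -
 have "x ^ i : G n y" if "i <= n" for i
  unfolding lat_def by (rule subsetD[OF lspan_incl[OF stalk_subr[OF assms(1)]]]) (use that in \<open>simp add: pw_def\<close>)
 thus ?thesis unfolding evp_sum_coeff[OF assms(2)] by (intro submod_kk_sum[OF G_kk[OF assms(1)]]) auto
qed

lemma G_mult: assumes y: "y : pts" and q: "degree q <= d" and w: "w : G n y" shows "evp q x * w : G (n + d) y"
proof -
 have "(*) (evp q x) ` pw n <= G (n + d) y"
 proof
  fix z assume "z : (*) (evp q x) ` pw n"
  then obtain j where j: "j <= n" "z = evp (q * monom 1 j) x" by (auto simp: pw_def \<iota>_1)
  have "degree (q * monom 1 j) <= n + d" using degree_mult_le[of q "monom 1 j"] degree_monom_le[of "1::'k" j] q j(1) by linarith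
  thus "z : G (n + d) y" unfolding j(2) by (rule G_evp[OF y])
 qed
 from lspan_min[OF G_submod[OF y] this] show ?thesis using w unfolding lspan_times lat_def by blast
qed

lemma G_x: "y : pts ==> w : G n y ==> x * w : G (Suc n) y"
 using G_mult[of y "monom 1 1" 1 w n] by (simp add: \<iota>_1 degree_monom_eq)

lemma G_split: assumes "y : pts" "s : G (Suc n) y" obtains a w where "a : stk y" "w : G n y" "s = a + x * w"
proof -
 have "pw (Suc n) = insert 1 ((*) x ` pw n)" unfolding pw_def atMost_Suc_eq_insert_0 by (auto simp: image_image)
 hence "s : {b * 1 + z | b z. b : stk y & z : (*) x ` lspan (stk y) (pw n)}"
  using assms(2) by (simp only: lat_def lspan_insert[OF submod_self[OF stalk_subr[OF assms(1)]]] lspan_times)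
 thus ?thesis using that by (auto simp: lat_def)
qed

lemma mst_G: assumes y: "y : pts" shows "mst y = (*) f ` G N y"
proof
 have Vf: "V = (*) f ` {evp p x | p. degree p <= N}" unfolding set_eq_iff image_iff using V_N by blast
 show "mst y <= (*) f ` G N y" unfolding mst_generated[OF y] lat_def
 proof (rule lspan_min, fold lat_def, rule submod_times[OF G_submod[OF y]])
  show "vs <= (*) f ` G N y"
  proof
   fix w assume "w : vs"
   then obtain p where "degree p <= N" "w = f * evp p x" using v_mem V_N by blast
   thus "w : (*) f ` G N y" using G_evp[OF y] by blast
  qed
 qed
 have "f * x ^ j : mst y" if "j <= N" for j
  using V_N[of "f * x ^ j"] MU_mst[OF nopen_pts y] that by (auto intro!: exI[of _ "monom 1 j"] simp: \<iota>_1 degree_monom_eq)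
 hence "lspan (stk y) ((*) f ` pw N) <= mst y" by (intro lspan_min[OF mst_submod[OF y]]) (auto simp: pw_def)
 thus "(*) f ` G N y <= mst y" by (simp add: lat_def lspan_times)
qed

definition GG :: "nat => ('p => 'a) set" where "GG n = {s. ALL y:pts. s y : G n y}"

lemma GG_comb: "s : GG n ==> s' : GG n ==> (%y. s y - \<iota> a * s' y) : GG n"
 unfolding GG_def using submod_diff[OF G_kk subr_kk] submod_mult[OF G_kk] by blast

lemma GG_adele: "s : GG n ==> adele (%y. c * s y)"
 unfolding adele_def by (rule adele_times, fold adele_def, rule lat_adele[of "pw n"]) (auto simp: GG_def pw_def)

text \<open>Modulo adeles of order n, the adeles of order n + 1 are spanned by two elements.\<close>

definition spans :: "nat => ('p => 'a) => ('p => 'a) => bool" where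
 "spans n \<sigma> \<rho> \<longleftrightarrow> (ALL s:GG (Suc n). EX a b. (%y. s y - \<iota> a * \<sigma> y - \<iota> b * \<rho> y) : GG n)"

lemma spans_Suc: assumes "spans n \<sigma> \<rho>" shows "spans (Suc n) (%y. x * \<sigma> y) (%y. x * \<rho> y)"
 unfolding spans_def
proof
 fix s assume s: "s : GG (Suc (Suc n))"
 have "ALL y:pts. EX a w. a : stk y & w : G (Suc n) y & s y = a + x * w" using s G_split unfolding GG_def by blast
 then obtain a w where aw: "!!y. y : pts ==> a y : stk y & w y : G (Suc n) y & s y = a y + x * w y" by metis
 hence "w : GG (Suc n)" by (auto simp: GG_def)
 then obtain c d where cd: "(%y. w y - \<iota> c * \<sigma> y - \<iota> d * \<rho> y) : GG n" using assms by (auto simp: spans_def)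
 have "s y - \<iota> c * (x * \<sigma> y) - \<iota> d * (x * \<rho> y) : G (Suc n) y" if y: "y : pts" for y
 proof -
  have "x * (w y - \<iota> c * \<sigma> y - \<iota> d * \<rho> y) : G (Suc n) y" using G_x[OF y] cd y by (auto simp: GG_def)
  moreover have "1 : G (Suc n) y" using G_evp[OF y, of 1 "Suc n"] by simp
  from submod_mult[OF G_submod[OF y] conjunct1[OF aw[OF y]] this] have "a y * 1 : G (Suc n) y" .
  ultimately have "a y * 1 + x * (w y - \<iota> c * \<sigma> y - \<iota> d * \<rho> y) : G (Suc n) y" using submod_add[OF G_submod[OF y]] by blast
  thus ?thesis using aw[OF y] by (simp add: algebra_simps)
 qed
 thus "EX c d. (%y. s y - \<iota> c * (x * \<sigma> y) - \<iota> d * (x * \<rho> y)) : GG (Suc n)" by (auto simp: GG_def)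
qed

lemma spans_later: "spans n \<sigma> \<rho> ==> EX \<sigma>'. spans (n + j) \<sigma>' (%y. x ^ j * \<rho> y)"
proof (induction j)
 case (Suc j)
 then obtain \<sigma>' where "spans (n + j) \<sigma>' (%y. x ^ j * \<rho> y)" by blast
 from spans_Suc[OF this] show ?case by (auto simp: mult.assoc)
qed auto

text \<open>A multiplier z of f G (N - 1) into V is of the form a + b x, and constants have trace zero on the dualizing sheaf.  So
 the trace of x f s is the only obstruction for an adele s of order N to be a polynomial in x of degree
 N, modulo adeles of order N - 1: one element \<open>\<sigma>\<close> accounts for the obstruction, and \<open>x\<^sup>N\<close> for the polynomial.\<close>

lemma spans_N: "EX \<sigma>:GG N. spans (N - 1) \<sigma> (%y. x ^ N)"
proof -
 let ?t = "%s. trace (%y. x * f * s y)"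
 have "EX \<sigma>:GG N. ?t \<sigma> ~= 0 | (ALL s:GG N. ?t s = 0)"
 proof (cases "ALL s:GG N. ?t s = 0")
  case True
  have "(%_. 0) : GG N" using submod_0[OF G_kk] by (auto simp: GG_def)
  thus ?thesis using True by blast
 qed blast
 then obtain \<sigma> where \<sigma>: "\<sigma> : GG N" "?t \<sigma> ~= 0 | (ALL s:GG N. ?t s = 0)" by blast
 have SN: "Suc (N - 1) = N" using N by simp
 have "spans (N - 1) \<sigma> (%y. x ^ N)" unfolding spans_def SN
 proof
  fix s assume s: "s : GG N"
  define a where "a = (if ?t \<sigma> = 0 then 0 else ?t s / ?t \<sigma>)"
  define r where "r y = s y - \<iota> a * \<sigma> y" for y
  have r: "r : GG N" unfolding r_def by (rule GG_comb[OF s \<sigma>(1)])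
  have tc: "trace (%y. \<iota> b * (c * q y)) = b * trace (%y. c * q y)" if "q : GG N" for b c q
   by (rule trace_smult[OF GG_adele[OF that]])
  have "?t r = 0"
  proof -
   have "(%y. x * f * r y) = (%y. x * f * s y + x * f * \<iota> (- a) * \<sigma> y)" by (simp add: r_def \<iota>_uminus algebra_simps)
   moreover have "trace (%y. x * f * s y + x * f * \<iota> (- a) * \<sigma> y) = ?t s + trace (%y. x * f * \<iota> (- a) * \<sigma> y)"
    by (rule trace_add[OF GG_adele[OF s] GG_adele[OF \<sigma>(1)]])
   moreover have "(%y. x * f * \<iota> (- a) * \<sigma> y) = (%y. \<iota> (- a) * (x * f * \<sigma> y))" by (simp add: ac_simps)
   ultimately have "?t r = ?t s - a * ?t \<sigma>" using tc[OF \<sigma>(1)] by simp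
   thus ?thesis using \<sigma>(2) s by (auto simp: a_def)
  qed
  have rm: "f * r y : mst y" if "y : pts" for y using r that mst_G by (auto simp: GG_def)
  have "EX \<kappa>. ALL y:pts. f * r y - \<kappa> : lat ((*) f ` pw (N - 1)) y"
  proof (rule ccontr)
   assume no: "~ ?thesis"
   have fp: "f : (*) f ` pw (N - 1)" by (rule image_eqI[of _ _ 1]) (auto simp: pw_def intro: image_eqI[of _ _ 0])
   obtain z where z: "!!w. w : (*) f ` pw (N - 1) ==> z * w : V" "trace (%y. z * (f * r y)) ~= 0"
    by (rule duality[of "(*) f ` pw (N - 1)" f "%y. f * r y"]) (use no f0 fp GG_adele[OF r] in \<open>auto simp: pw_def\<close>)
   obtain p where p: "z * f = f * evp p x" using z(1)[OF fp] V_N[of "z * f"] by blast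
   hence zp: "z = evp p x" using f0 by simp
   obtain p' where p': "degree p' <= N" "z * (f * x ^ (N - 1)) = f * evp p' x" using z(1)[of "f * x ^ (N - 1)"] V_N by (auto simp: pw_def)
   have "evp (p * monom 1 (N - 1)) x = evp p' x" using p'(2) f0 zp by (simp add: \<iota>_1 ac_simps)
   hence "evp (p * monom 1 (N - 1) - p') x = 0" by (simp only: evp_diff diff_self)
   hence "p * monom 1 (N - 1) = p'" using evp_nonzero[OF x] by (metis eq_iff_diff_eq_0)
   hence "degree p <= 1" using p'(1) N by (cases "p = 0") (auto simp: degree_mult_eq degree_monom_eq)
   hence zab: "z = \<iota> (coeff p 0) + \<iota> (coeff p 1) * x" unfolding zp by (simp add: evp_sum_coeff)
   have "(%y. z * (f * r y)) = (%y. \<iota> (coeff p 0) * (f * r y) + \<iota> (coeff p 1) * (x * f * r y))" by (simp add: zab algebra_simps)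
   hence "trace (%y. z * (f * r y)) = coeff p 0 * trace (%y. f * r y) + coeff p 1 * ?t r"
    using trace_add[of "%y. \<iota> (coeff p 0) * (f * r y)" "%y. \<iota> (coeff p 1) * (x * f * r y)"] tc[OF r, of "coeff p 0" f] tc[OF r, of "coeff p 1" "x * f"]
     GG_adele[OF r, of "\<iota> (coeff p 0) * f"] GG_adele[OF r, of "\<iota> (coeff p 1) * (x * f)"] by (simp add: mult.assoc)
   moreover have "trace (%y. f * r y) = 0" by (rule trace_zero[of _ 0]) (use rm in simp)
   ultimately show False using z(2) `?t r = 0` by simp
  qed
  then obtain \<kappa> where k: "!!y. y : pts ==> f * r y - \<kappa> : lat ((*) f ` pw (N - 1)) y" by blast
  have lf: "lat ((*) f ` pw (N - 1)) y = (*) f ` G (N - 1) y" for y by (simp add: lat_def lspan_times)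
  have "\<kappa> : V" unfolding V_iff_mst
  proof
   fix y assume y: "y : pts"
   have "f * r y - \<kappa> : mst y" using k[OF y] G_mono[of "N - 1" N y] unfolding lf mst_G[OF y] by auto
   from submod_diff[OF mst_submod[OF y] stalk_subr[OF y] rm[OF y] this] show "\<kappa> : mst y" by simp
  qed
  then obtain p where p: "degree p <= N" "\<kappa> = f * evp p x" using V_N by blast
  have "r y - \<iota> (coeff p N) * x ^ N : G (N - 1) y" if y: "y : pts" for y
  proof -
   have "f * (r y - evp p x) : (*) f ` G (N - 1) y" using k[OF y] unfolding lf p(2) by (simp add: right_diff_distrib)
   hence 1: "r y - evp p x : G (N - 1) y" using f0 by auto
   let ?p = "p - monom (coeff p N) N"
   have "degree ?p <= N - 1" using p(1) N by (intro degree_le) (auto simp: coeff_eq_0)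
   from submod_add[OF G_submod[OF y] 1 G_evp[OF y this]] show ?thesis by simp
  qed
  thus "EX a b. (%y. s y - \<iota> a * \<sigma> y - \<iota> b * x ^ N) : GG (N - 1)" unfolding GG_def r_def by blast
 qed
 thus ?thesis using \<sigma>(1) by blast
qed

end

lemma (in field_over) evp_uminus [simp]: "evp (- p) x = - evp p x"
 using evp_diff[of 0 p x] by simp

lemma (in field_over) evp_pow: "evp (p ^ j) x = evp p x ^ j"
 by (induction j) auto

context pencil
begin

definition H :: "nat => 'a set" where "H n = {z. ALL y:pts. z : G n y}"

lemma H_kk: "submod kk (H n)"
 unfolding H_def submod_def using submod_0[OF G_kk] submod_add[OF G_kk] submod_mult[OF G_kk] by blast

lemma H_mono: "m <= n ==> H m <= H n" unfolding H_def using G_mono by blast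

lemma coordinates_unique: assumes "\<iota> a + \<iota> b * x = 0" shows "a = 0" "b = 0"
 using evp_nonzero[OF x, of "[:a, b:]"] assms by (auto simp: mult.commute \<iota>_0)

text \<open>A family of global elements becomes dependent modulo H n as soon as its coordinates with respect to \<open>\<sigma>\<close> and \<open>\<rho>\<close>
 are; the pairs of coordinates are encoded as a + b x.\<close>

lemma spans_fcn:
 assumes sp: "spans n \<sigma> \<rho>" and E: "finite E" "1 : E" "\<rho> ~= (%_. 0) ==> x : E" "card E < r"
 shows "fcn r (H (Suc n)) (H n)"
 unfolding fcn_def
proof (intro allI impI)
 fix w assume w: "ALL i<r. w i : H (Suc n)"
 define Q where "Q i a b \<longleftrightarrow> (%y. w i - \<iota> a * \<sigma> y - \<iota> b * \<rho> y) : GG n & (\<rho> = (%_. 0) --> b = 0)" for i a b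
 have "EX a b. Q i a b" if "i < r" for i
 proof -
  have "(%y. w i) : GG (Suc n)" using w that by (simp add: H_def GG_def)
  then obtain a b where "(%y. w i - \<iota> a * \<sigma> y - \<iota> b * \<rho> y) : GG n" using sp by (auto simp: spans_def)
  thus ?thesis by (intro exI[of "%a. EX b. Q i a b" a] exI[of "Q i a" "if \<rho> = (%_. 0) then 0 else b"]) (auto simp: Q_def)
 qed
 then obtain a b where "!!i. i < r ==> Q i (a i) (b i)" by metis
 hence ab: "(%y. w i - \<iota> (a i) * \<sigma> y - \<iota> (b i) * \<rho> y) : GG n & (\<rho> = (%_. 0) --> b i = 0)" if "i < r" for i
  using that by (simp add: Q_def)
 have "dep {0} {..<r} (%i. \<iota> (a i) * 1 + \<iota> (b i) * x)"
 proof (rule steinitz[OF submod_zero E(1)])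
  fix i assume i: "i : {..<r}"
  have "\<iota> (b i) * x : lspan kk E"
  proof (cases "\<rho> = (%_. 0)")
   case True
   thus ?thesis using ab i lspan.lspan_0 by (simp add: \<iota>_0)
  next
   case False
   thus ?thesis using lspan_mult[OF subr_kk subsetD[OF lspan_incl[OF subr_kk] E(3)]] by simp
  qed
  hence "\<iota> (a i) * 1 + \<iota> (b i) * x : lspan kk E" by (intro lspan.lspan_step) (use E(2) in auto)
  thus "EX z:lspan kk E. \<iota> (a i) * 1 + \<iota> (b i) * x - z : {0}" by (intro bexI) auto
 qed (use E(4) in auto)
 then obtain c where c: "EX i<r. c i ~= 0" "(\<Sum>i<r. \<iota> (c i) * (\<iota> (a i) * 1 + \<iota> (b i) * x)) = 0" by (auto simp: dep_def)
 have "\<iota> (\<Sum>i<r. c i * a i) + \<iota> (\<Sum>i<r. c i * b i) * x = 0"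
  using c(2) by (simp add: \<iota>_sum \<iota>_mult sum_distrib_right distrib_left sum.distrib mult.assoc)
 note z = coordinates_unique[OF this]
 have "(\<Sum>i<r. \<iota> (c i) * w i) : G n y" if y: "y : pts" for y
 proof -
  have "(\<Sum>i<r. \<iota> (c i) * (w i - \<iota> (a i) * \<sigma> y - \<iota> (b i) * \<rho> y)) : G n y"
   using ab y by (intro submod_kk_sum[OF G_kk[OF y]]) (auto simp: GG_def)
  moreover have "(\<Sum>i<r. \<iota> (c i) * (w i - \<iota> (a i) * \<sigma> y - \<iota> (b i) * \<rho> y))
   = (\<Sum>i<r. \<iota> (c i) * w i) - \<iota> (\<Sum>i<r. c i * a i) * \<sigma> y - \<iota> (\<Sum>i<r. c i * b i) * \<rho> y"
   by (simp add: \<iota>_sum \<iota>_mult sum_distrib_right right_diff_distrib sum_subtractf mult.assoc)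
  ultimately show ?thesis using z by (simp add: \<iota>_0)
 qed
 thus "dep (H n) {..<r} w" using c(1) unfolding dep_def H_def by auto
qed

lemma spans_at: assumes "n >= N - 1" shows "EX \<sigma>. spans n \<sigma> (%y. x ^ Suc n)"
proof -
 obtain \<sigma> where "spans (N - 1) \<sigma> (%y. x ^ N)" using spans_N by blast
 from spans_later[OF this, of "n - (N - 1)"] obtain \<sigma>' where "spans n \<sigma>' (%y. x ^ (n - (N - 1)) * x ^ N)" using assms by auto
 moreover have "n - (N - 1) + N = Suc n" using assms N by simp
 ultimately show ?thesis by (metis power_add)
qed

lemma H_finite: "n >= N ==> fc (H n) {0}"
proof (induction n rule: nat_induct_at_least)
 case base
 show ?case
 proof (rule fcI_span[OF submod_zero, of "pw N"])
  fix z assume "z : H N"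
  hence "f * z : V" unfolding V_iff_mst using mst_G by (auto simp: H_def)
  then obtain p where "degree p <= N" "z = evp p x" using V_N f0 by auto
  hence "z : lspan kk (pw N)" unfolding pw_def by (simp add: evp_sum_coeff) (intro lspan_sum, auto simp: subr_kk)
  thus "EX y:lspan kk (pw N). z - y : {0}" by auto
 qed (simp add: pw_def)
next
 case (Suc n)
 obtain \<sigma> where "spans n \<sigma> (%y. x ^ Suc n)" using spans_at[OF order_trans[OF diff_le_self Suc.hyps]] by blast
 from spans_fcn[OF this, of "{1, x}" 3] have "fcn 3 (H (Suc n)) (H n)" by (simp add: card_insert_if)
 hence "fc (H (Suc n)) (H n)" unfolding fc_def by blast
 thus ?case by (rule fc_trans[OF H_kk H_kk submod_zero _ fc_mono[OF Suc.IH]]) auto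
qed

text \<open>At a single point this holds because \<open>O\<^sub>y[x]\<close> modulo the denominator of u has finite dimension, so that a
 polynomial in x vanishes there; only the poles of u matter.\<close>

lemma polynomial_denominator:
 obtains q n where "q ~= 0" "evp q x * u : H n"
proof -
 have loc: "EX q n. q ~= 0 & evp q x * u : G n y" if y: "y : pts" for y
 proof -
  let ?B = "adjoin (stk y Un {x})"
  have B: "subr ?B" "stk y <= ?B" "x : ?B" using adjoin_subr adjoin_incl[of "stk y Un {x}"] by auto
  have F: "FD ?B" by (rule krull_akizuki[OF FD_stalk[OF y] stalk_fractions[OF y] B(1,2)])
  obtain a b where ab: "a : stk y" "b : stk y" "b ~= 0" "u = a / b" using stalk_fractions[OF y] unfolding fractions_def by metis
  have "fc ?B ((*) b ` ?B)" using F ab B(2) unfolding FD_def by blast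
  from dep_powers[OF B(1) FD_kk[OF F] submod_principal[OF B(1)] this B(3)] obtain q where q: "q ~= 0" "evp q x : (*) b ` ?B" by blast
  then obtain c where c: "evp q x = b * c" "c : ?B" by blast
  have "evp q x * u = c * a" using c(1) ab(3,4) by simp
  hence "evp q x * u : ?B" using subr_mult[OF B(1) c(2)] ab(1) B(2) by auto
  then obtain Q where Q: "evp q x * u = poly Q x" "Q : poly_over (stk y)" unfolding adjoin_single[OF stalk_subr[OF y]] by blast
  have "poly Q x : G (degree Q) y" unfolding poly_altdef
  proof (rule submod_sum[OF G_submod[OF y]])
   fix i assume "i : {..degree Q}"
   hence "x ^ i : G (degree Q) y" using G_evp[OF y, of "monom 1 i" "degree Q"] by (simp add: \<iota>_1 degree_monom_eq)
   thus "coeff Q i * x ^ i : G (degree Q) y" using submod_mult[OF G_submod[OF y]] Q(2) by (auto simp: poly_over_def)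
  qed
  thus ?thesis using q(1) Q(1) by metis
 qed
 have "EX q n. q ~= 0 & (ALL y:F. evp q x * u : G n y)" if "finite F" "F <= pts" for F
  using that
 proof (induction F rule: finite_induct)
  case empty
  show ?case by (intro exI[of _ 1] exI[of _ 0]) simp
 next
  case (insert y F)
  then obtain q n q' n' where q: "q ~= 0" "ALL y:F. evp q x * u : G n y" "q' ~= 0" "evp q' x * u : G n' y" using loc[of y] by auto
  let ?n = "n + n' + degree q + degree q'"
  have "evp q' x * (evp q x * u) : G ?n z" if "z : F" for z
   using G_mult[of z q' "degree q'" "evp q x * u" n] q(2) G_mono[of "n + degree q'" ?n z] that insert.prems by auto
  moreover have "evp q x * (evp q' x * u) : G ?n y"
   using G_mult[of y q "degree q" "evp q' x * u" n'] q(4) G_mono[of "n' + degree q" ?n y] insert.prems by auto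
  ultimately show ?case using q(1,3) by (intro exI[of _ "q * q'"] exI[of _ ?n]) (auto simp: ac_simps)
 qed
 from this[OF finite_poles[of u]] obtain q n where q: "q ~= 0" "!!y. y : pts ==> u ~: stk y ==> evp q x * u : G n y" by blast
 have "evp q x * u : G (n + degree q) y" if y: "y : pts" for y
 proof (cases "u : stk y")
  case True
  thus ?thesis using submod_mult'[OF G_submod[OF y] True G_evp[OF y, of q "n + degree q"]] by simp
 next
  case False
  thus ?thesis using q(2)[OF y False] G_mono[of n "n + degree q" y] by auto
 qed
 thus ?thesis using that q(1) unfolding H_def by blast
qed

text \<open>The spaces H n grow by at most r dimensions in each step, so the function field has degree
 at most r over the field of rational functions in x.\<close>

lemma growth:
 assumes step: "!!n. n >= m ==> fcn (Suc r) (H (Suc n)) (H n)" and m: "m >= N"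
 obtains p where "EX i<=r. p i ~= 0" "(\<Sum>i\<le>r. evp (p i) x * u i) = 0"
proof -
 obtain c0 where "fcn c0 (H m) {0}" using H_finite[OF m] by (auto simp: fc_def)
 hence c0: "fcn (Suc c0) (H m) {0}" unfolding fcn_def[of "Suc c0"] using fcn_family[of c0 "H m" "{0}" "{..<Suc c0}"] by auto
 have dim: "fcn (Suc (r * j + c0)) (H (m + j)) {0}" for j
 proof (induction j)
  case (Suc j)
  hence "fcn (Suc (r * j + c0)) (H (Suc (m + j)) Int H (m + j)) {0}" by (auto simp: fcn_def)
  from fcn_trans[OF H_kk H_kk submod_zero step this] show ?case by (simp add: add.assoc)
 qed (use c0 in simp)
 have "EX q n. q ~= 0 & evp q x * u i : H n" for i using polynomial_denominator[of "u i"] by blast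
 then obtain q n where qn: "!!i. q i ~= 0" "!!i. evp (q i) x * u i : H (n i)" by metis
 define k where "k = (\<Sum>i\<le>r. n i)"
 define U where "U i = evp (q i) x * u i" for i
 have Uk: "U i : H k" if "i <= r" for i
  using qn(2)[of i] H_mono[of "n i" k] that member_le_sum[of i "{..r}" n] unfolding U_def k_def by auto
 (* With this j the number of products x^l u_i exceeds the dimension of the space that contains them. *)
 define j where "j = r * k + c0"
 let ?X = "{..r} \<times> {..j}"
 have "dep {0} ?X (%(i, l). x ^ l * U i)"
 proof (rule fcn_family[OF dim[of "k + j"]])
  show "card ?X >= Suc (r * (k + j) + c0)" by (simp add: j_def algebra_simps)
  fix il assume "il : ?X"
  then obtain i l where il: "il = (i, l)" "i <= r" "l <= j" by auto
  have "x ^ l * U i : G (k + l) y" if y: "y : pts" for y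
   using G_mult[OF y, of "monom 1 l" l "U i" k] Uk[OF il(2)] y by (simp add: H_def \<iota>_1 degree_monom_eq)
  hence "x ^ l * U i : H (k + l)" by (simp add: H_def)
  thus "(case il of (i, l) => x ^ l * U i) : H (m + (k + j))" using H_mono[of "k + l" "m + (k + j)"] il by auto
 qed simp
 then obtain c where c: "EX i<=r. EX l<=j. c (i, l) ~= 0" "(\<Sum>(i, l)\<in>?X. \<iota> (c (i, l)) * (x ^ l * U i)) = 0"
  by (auto simp: dep_def case_prod_beta)
 define p where "p i = (\<Sum>l\<le>j. monom (c (i, l)) l) * q i" for i
 have "(\<Sum>i\<le>r. evp (p i) x * u i) = (\<Sum>i\<le>r. \<Sum>l\<le>j. \<iota> (c (i, l)) * (x ^ l * U i))"
  by (intro sum.cong refl) (simp add: p_def U_def sum_distrib_left sum_distrib_right ac_simps)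
 also have "\<dots> = 0" using c(2) by (simp add: sum.cartesian_product)
 finally have "(\<Sum>i\<le>r. evp (p i) x * u i) = 0" .
 moreover have "EX i<=r. p i ~= 0"
 proof -
  obtain i l where "i <= r" "l <= j" "c (i, l) ~= 0" using c(1) by blast
  thus ?thesis unfolding p_def using sum_monom_nz[of "{..j}" l "%l. c (i, l)"] qn(1) by auto
 qed
 ultimately show ?thesis using that by blast
qed

lemma spans_swap: "spans n \<sigma> \<rho> ==> spans n \<rho> \<sigma>"
 unfolding spans_def by (metis (no_types, lifting) diff_diff_eq add.commute ext)

lemma spans_reduce:
 assumes sp: "spans n \<sigma> \<rho>" and k: "(%y. \<iota> a * \<sigma> y + \<iota> b * \<rho> y) : GG n" and a: "a ~= 0"
 shows "spans n \<rho> (%_. 0)"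
 unfolding spans_def
proof
 fix s assume "s : GG (Suc n)"
 then obtain c d where cd: "(%y. s y - \<iota> c * \<sigma> y - \<iota> d * \<rho> y) : GG n" using sp by (auto simp: spans_def)
 define l where "l = - c * inverse a"
 have "\<iota> l * \<iota> a = - \<iota> c" unfolding l_def using \<iota>_inverse[OF a] by (simp add: \<iota>_mult \<iota>_uminus mult.assoc)
 hence eq: "\<iota> l * (\<iota> a * \<sigma> y + \<iota> b * \<rho> y) = - \<iota> c * \<sigma> y + \<iota> (l * b) * \<rho> y" for y
  by (simp add: distrib_left \<iota>_mult flip: mult.assoc)
 have "(%y. (s y - \<iota> c * \<sigma> y - \<iota> d * \<rho> y) - \<iota> l * (\<iota> a * \<sigma> y + \<iota> b * \<rho> y)) = (%y. s y - \<iota> (d + l * b) * \<rho> y - \<iota> 0 * 0)"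
  unfolding eq by (simp add: \<iota>_add algebra_simps)
 with GG_comb[OF cd k, of l] show "EX a b. (%y. s y - \<iota> a * \<rho> y - \<iota> b * 0) : GG n" by metis
qed

text \<open>The adele that is u at P and zero elsewhere does not leave order n + 1 when it is multiplied by x.  Its
 coordinates give a relation between the two spanning elements in the next order, one of them becomes
 superfluous, and from there on the spaces H n grow by one dimension only, so that the degree of the function field over
 k(x) is one.\<close>

lemma drop_rational:
 assumes n: "n >= N - 1" and P: "P : pts" and u: "u : G (Suc n) P" "u ~: G n P" "x * u : G (Suc n) P"
 shows "w : ratfun x"
proof -
 obtain \<sigma> where \<sigma>: "spans n \<sigma> (%y. x ^ Suc n)" using spans_at[OF n] by blast
 let ?d = "%y. if y = P then u else 0" and ?\<rho> = "%y. x ^ Suc n"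
 have d: "?d : GG (Suc n)" "(%y. x * ?d y) : GG (Suc n)" using u submod_0[OF G_submod] by (auto simp: GG_def)
 then obtain a b where ab: "(%y. ?d y - \<iota> a * \<sigma> y - \<iota> b * ?\<rho> y) : GG n" using bspec[OF \<sigma>[unfolded spans_def] d(1)] by blast
 have "a ~= 0 | b ~= 0" using ab P u(2) by (auto simp: GG_def \<iota>_0)
 have "(%y. x * (?d y - \<iota> a * \<sigma> y - \<iota> b * ?\<rho> y)) : GG (Suc n)" using ab G_x unfolding GG_def by blast
 from GG_comb[OF d(2) this, of 1] have k: "(%y. \<iota> a * (x * \<sigma> y) + \<iota> b * (x * ?\<rho> y)) : GG (Suc n)" by (simp add: \<iota>_1 algebra_simps)
 hence k': "(%y. \<iota> b * (x * ?\<rho> y) + \<iota> a * (x * \<sigma> y)) : GG (Suc n)" by (simp add: add.commute)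
 have "EX \<tau>. spans (Suc n) \<tau> (%_. 0)"
  using spans_reduce[OF spans_Suc[OF \<sigma>] k] spans_reduce[OF spans_swap[OF spans_Suc[OF \<sigma>]] k'] `a ~= 0 | b ~= 0` by blast
 then obtain \<tau> where \<tau>: "spans (Suc n) \<tau> (%_. 0)" by blast
 have step: "fcn (Suc 1) (H (Suc m)) (H m)" if "m >= Suc n" for m
 proof -
  obtain \<tau>' where "spans m \<tau>' (%_. 0)" using spans_later[OF \<tau>, of "m - Suc n"] `m >= Suc n` by auto
  thus ?thesis by (rule spans_fcn[of _ _ _ "{1}"]) auto
 qed
 obtain p :: "nat => 'k poly" where p: "EX i<=1. p i ~= 0" "(\<Sum>i\<le>1. evp (p i) x * (if i = 0 then w else 1)) = 0"
  by (rule growth[of "Suc n" 1 "%i. if i = 0 then w else 1"]) (use step n N in auto)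
 have eq: "evp (p 0) x * w + evp (p 1) x = 0" using p(2) by simp
 have "p 0 ~= 0"
 proof
  assume z: "p 0 = 0"
  hence "p 1 ~= 0" using p(1) by (metis le_SucE le_zero_eq One_nat_def)
  thus False using eq z evp_nonzero[OF x] by simp
 qed
 hence "w = evp (- p 1) x / evp (p 0) x" using eq evp_nonzero[OF x, of "p 0"] evp_diff[of 0 "p 1" x] by (simp add: field_simps add_eq_0_iff)
 thus ?thesis unfolding ratfun_def using `p 0 ~= 0` by blast
qed

text \<open>For most constants \<open>a\<close> the function x - a has no zero over P, because only finitely many primes of \<open>O\<^sub>P[x]\<close> lie over P; then its
 inverse w is integral over the local ring.  So w has some finite order, the hypothesis lowers this order to N - 1,
 and w becomes a multiplier of the dualizing sheaf at P.\<close>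

lemma no_drop_regular:
 assumes nd: "!!n u. n >= N - 1 ==> u : G (Suc n) P ==> x * u : G (Suc n) P ==> u : G n P" and P: "P : pts"
 shows "x : stk P | inverse x : stk P"
proof (cases "mm (stk P) = {0}")
 case True
 thus ?thesis using fractions_nonunits_zero[OF stalk_subr[OF P] stalk_fractions[OF P]] by blast
next
 case False
 note L = stalk_loc_ring[OF P] and Ls = stalk_subr[OF P]
 note kL = kk_stalk[OF P]
 obtain b where b: "b : mm (stk P)" "b ~= 0" using False nonunits_0[OF Ls] by blast
 let ?D = "adjoin (stk P Un {x})"
 have D: "subr ?D" "stk P <= ?D" "x : ?D" using adjoin_subr adjoin_incl[of "stk P Un {x}"] by auto
 have FDD: "FD ?D" by (rule krull_akizuki[OF FD_stalk[OF P] stalk_fractions[OF P] D(1,2)])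
 have xa: "x - \<iota> a ~= 0" for a using x by auto
 have "EX a. integral_over (stk P) (inverse (x - \<iota> a))"
 proof (rule ccontr)
  assume ni: "~ ?thesis"
  have "EX q. prime_of ?D q & b : q & x - \<iota> a : q" for a
  proof -
   have "~ integral_over (localization (stk P) (mm (stk P))) (inverse (x - \<iota> a))" unfolding localization_self[OF L] using ni by blast
   from not_integral_prime[OF Ls nonunits_prime[OF L] _ this] xa obtain q where
    q: "prime_of (adjoin (stk P Un {x - \<iota> a})) q" "mm (stk P) <= q" "x - \<iota> a : q" by auto
   have "adjoin (stk P Un {x - \<iota> a}) = ?D"
   proof (intro equalityI adjoin_min[OF adjoin_subr])
    show "stk P Un {x - \<iota> a} <= ?D" using D kL subr_diff[OF D(1,3)] by blast
    let ?D' = "adjoin (stk P Un {x - \<iota> a})"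
    have D': "stk P <= ?D'" "x - \<iota> a : ?D'" using adjoin_incl[of "stk P Un {x - \<iota> a}"] by auto
    have "\<iota> a : ?D'" using D'(1) kL by blast
    from subr_add[OF adjoin_subr D'(2) this] show "stk P Un {x} <= ?D'" using D'(1) by simp
   qed
   thus ?thesis using q b by auto
  qed
  then obtain q where q: "!!a. prime_of ?D (q a) & b : q a & x - \<iota> a : q a" by metis
  have "inj q"
  proof (rule injI, rule ccontr)
   fix a c assume ac: "q a = q c" "a ~= c"
   have "(x - \<iota> c) - (x - \<iota> a) : q a" by (rule submod_diff[OF prime_ofD(1) D(1)]) (use q ac(1) in metis)+
   hence "\<iota> (a - c) : q a" by (simp add: \<iota>_diff)
   hence "\<iota> (inverse (a - c)) * \<iota> (a - c) : q a" using D(2) kL by (intro submod_mult[OF prime_ofD(1)]) (use q in auto)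
   thus False using \<iota>_inverse[of "a - c"] ac(2) prime_ofD(3) q by fastforce
  qed
  moreover have "finite (range q)" by (rule finite_subset[OF _ FD_finite_primes[OF FDD, of b]]) (use q b D nonunits_sub in blast)+
  ultimately show False using infinite_alg_closed finite_imageD by blast
 qed
 then obtain a where a: "integral_over (stk P) (inverse (x - \<iota> a))" by blast
 let ?y = "x - \<iota> a" let ?w = "inverse ?y"
 have yG: "?y ^ j : G j P" for j
  using G_evp[OF P, of "[:- a, 1:] ^ j" j] degree_power_eq[of "[:- a, 1:]" j] evp_pow[of "[:- a, 1:]" j x] by (simp add: \<iota>_uminus \<iota>_1)
 obtain d where d: "adjoin (stk P Un {?w}) <= lspan (stk P) ((%i. ?w ^ i) ` {..<d})" using integral_power_span[OF Ls a] by blast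
 have "?w ^ Suc d : adjoin (stk P Un {?w})" using adjoin_incl[of "stk P Un {?w}"] by (intro subr_power[OF adjoin_subr]) auto
 then obtain c where c: "ALL i<d. c i : stk P" "?w ^ Suc d = (\<Sum>i<d. c i * ?w ^ i)" using d lspan_image_finite[OF Ls, of "{..<d}" _ "%i. ?w ^ i"] by blast
 have "?w = ?y ^ d * ?w ^ Suc d" using xa by (simp flip: power_mult_distrib mult.assoc)
 also have "\<dots> = (\<Sum>i<d. c i * (?y ^ d * ?w ^ i))" unfolding c(2) by (simp add: sum_distrib_left mult.left_commute)
 also have "\<dots> : G d P"
 proof (rule submod_sum[OF G_submod[OF P]])
  fix i assume i: "i : {..<d}"
  hence "?y ^ d * ?w ^ i = ?y ^ (d - i)" using xa power_add[of ?y "d - i" i] by (simp flip: power_mult_distrib mult.assoc add: mult.assoc)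
  thus "c i * (?y ^ d * ?w ^ i) : G d P" using submod_mult[OF G_submod[OF P]] c(1) i yG[of "d - i"] G_mono[of "d - i" d P] by auto
 qed
 finally have "?w : G (N - 1 + d) P" using G_mono[of d "N - 1 + d" P] by auto
 moreover have "?w : G (N - 1 + j) P ==> ?w : G (N - 1) P" for j
 proof (induction j)
  case (Suc j)
  have w: "?w : G (Suc (N - 1 + j)) P" using Suc.prems by simp
  have "x * ?w = 1 + \<iota> a * ?w" using xa[of a] by (simp add: field_simps)
  moreover have "1 + \<iota> a * ?w : G (Suc (N - 1 + j)) P"
   using G_evp[OF P, of 1] by (intro submod_add[OF G_kk[OF P]] submod_mult[OF G_kk[OF P] _ w]) auto
  ultimately show ?case using nd[of "N - 1 + j" ?w] w Suc.IH by simp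
 qed simp
 ultimately have w: "?w : G (N - 1) P" by blast
 have GN: "?w * s : G N P" if "s : G n P" "n <= N" for s n
  using that
 proof (induction n arbitrary: s)
  case 0
  hence "s : stk P" unfolding lat_def pw_def using lspan_insert[OF submod_self[OF Ls], of 1 "{}"] by auto
  thus ?case using submod_mult'[OF G_submod[OF P] _ w] G_mono[of "N - 1" N P] by (auto simp: mult.commute)
 next
  case (Suc n)
  obtain e r where er: "e : stk P" "r : G n P" "s = e + x * r" by (rule G_split[OF P Suc.prems(1)])
  have "x * ?w = 1 + \<iota> a * ?w" using xa[of a] by (simp add: field_simps)
  hence "?w * s = e * ?w + (\<iota> a * (?w * r) + r)" unfolding er(3) by (simp add: distrib_left mult.left_commute) (simp add: algebra_simps)
  moreover have "r : G N P" "?w : G N P" using G_mono[of n N P] G_mono[of "N - 1" N P] er(2) w Suc.prems(2) by auto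
  moreover have "?w * r : G N P" using Suc er(2) by simp
  ultimately show ?case using er(1) kL by (auto intro!: submod_step[OF G_submod[OF P]])
 qed
 have wL: "?w : stk P"
 proof (rule endomorphism_stalk[OF P])
  fix m assume "m : mst P"
  then obtain s where "m = f * s" "s : G N P" unfolding mst_G[OF P] by blast
  thus "?w * m : mst P" unfolding mst_G[OF P] using GN[of s N] by (auto simp: mult.left_commute)
 qed
 have aL: "\<iota> a : stk P" using kL by blast
 show ?thesis
 proof (cases "?w : mm (stk P)")
  case False
  hence "?y : stk P" using unit_inverse[OF wL] by simp
  from subr_add[OF Ls this aL] show ?thesis by simp
 next
  case True
  hence "\<iota> a * ?w : mm (stk P)" by (rule nonunits_mult[OF Ls _ aL])
  from one_plus_nonunit[OF L this] have "inverse (1 + \<iota> a * ?w) : stk P" using unit_inverse by blast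
  moreover have "inverse x = ?w * inverse (1 + \<iota> a * ?w)" using xa[of a] x0 by (simp add: field_simps)
  ultimately show ?thesis using subr_mult[OF Ls wL] by simp
 qed
qed

text \<open>If some local drop occurs, then x generates the function field; otherwise \<open>no_drop_regular\<close> applies at every point, and
 the spaces H n grow by two dimensions at most.\<close>

lemma rational_or_double:
 "(ALL w. w : ratfun x) | (ALL P:pts. x : stk P | inverse x : stk P) &
  (EX u. u ~: ratfun x & (ALL w. EX a:ratfun x. EX b:ratfun x. w = a + b * u))"
proof (cases "ALL w. w : ratfun x")
 case False
 then obtain u where u: "u ~: ratfun x" by blast
 have "x : stk P | inverse x : stk P" if P: "P : pts" for P
  by (rule no_drop_regular[OF _ P]) (use drop_rational[OF _ P, of _ _ u] u in blast)
 moreover have "EX a:ratfun x. EX b:ratfun x. w = a + b * u" for w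
 proof -
  have step: "fcn (Suc 2) (H (Suc n)) (H n)" if n: "n >= N" for n
  proof -
   obtain \<sigma> where "spans n \<sigma> (%y. x ^ Suc n)" using spans_at[OF order_trans[OF diff_le_self n]] by blast
   thus ?thesis by (rule spans_fcn[of _ _ _ "{1, x}"]) (auto simp: card_insert_if)
  qed
  obtain p :: "nat => 'k poly" where p: "EX i<=2. p i ~= 0" "(\<Sum>i\<le>2. evp (p i) x * (if i = 0 then w else if i = 1 then u else 1)) = 0"
   by (rule growth[of N 2 "%i. if i = 0 then w else if i = 1 then u else 1"]) (use step in auto)
  have eq: "evp (p 0) x * w + evp (p 1) x * u + evp (p 2) x = 0" using p(2) by (simp add: numeral_2_eq_2)
  have "p 0 ~= 0"
  proof
   assume z: "p 0 = 0"
   show False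
   proof (cases "p 1 = 0")
    case True
    have "p 2 ~= 0" using p(1) z True by (auto simp: numeral_2_eq_2 le_Suc_eq)
    thus False using eq z True evp_nonzero[OF x] by simp
   next
    case False
    have "evp (p 1) x * u = evp (0 - p 2) x" using eq z by (simp add: add_eq_0_iff2)
    hence "u = evp (0 - p 2) x / evp (p 1) x" using evp_nonzero[OF x False] by (simp add: field_simps)
    thus False using u False unfolding ratfun_def by blast
   qed
  qed
  moreover from this have "w = evp (0 - p 2) x / evp (p 0) x + evp (0 - p 1) x / evp (p 0) x * u"
   using eq evp_nonzero[OF x, of "p 0"] by (simp add: field_simps) (metis add.commute add_eq_0_iff2 add.assoc)
  ultimately show ?thesis unfolding ratfun_def by blast
 qed
 ultimately show ?thesis using u by blast
qed auto

text \<open>Some \<open>x\<^sup>j f / v\<^sub>i\<close> is a unit of the local ring of the canonical model; its neighbours show that x or 1/x is regular there, so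
 that the local ring is a valuation ring of k(x).\<close>

lemma point_rational:
 assumes K: "!!w. w : ratfun x" and bp: "bpoint y i R"
 shows "R = local_at (kv i) R"
proof -
 let ?R = "local_at (kv i) R"
 note D = bpointD[OF bp]
 have pp: "prime_of (kv i) (kv i Int mm R)" by (rule center_prime[OF D(3) kv(1) D(10)])
 note R' = localization_center[OF D(3) kv(1) D(10)] localization_loc_ring[OF kv(1) pp] localization_subr[OF kv(1) pp] localization_incl[OF kv(1) pp]
 have vi: "v i ~= 0" by (rule v_nonzero[OF D(2)])
 have kR: "kk <= ?R" using kv(2) R'(5) by blast
 have q: "x ^ j * f / v i : ?R" if "j <= N" for j
 proof -
  have "x ^ j * f : V" unfolding V_N using that by (intro exI[of _ "monom 1 j"]) (simp add: \<iota>_1 degree_monom_eq mult.commute)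
  thus ?thesis using ratio_mem[OF kv(1-3)] R'(5) by blast
 qed
 obtain p where p: "degree p <= N" "v i = f * evp p x" using v_mem[OF D(2)] V_N by blast
 have "EX j<=N. x ^ j * f / v i ~: mm ?R"
 proof (rule ccontr)
  assume "~ ?thesis"
  hence "(\<Sum>j\<le>N. \<iota> (coeff p j) * (x ^ j * f / v i)) : mm ?R"
   by (intro submod_kk_sum[OF submod_mono[OF nonunits_submod[OF R'(3)] kR]]) auto
  moreover have "(\<Sum>j\<le>N. \<iota> (coeff p j) * (x ^ j * f / v i)) = v i / v i"
   unfolding p(2) evp_sum_coeff[OF p(1)] by (simp add: sum_divide_distrib[symmetric] sum_distrib_left ac_simps)
  ultimately show False using vi nonunits_1[OF R'(4)] by simp
 qed
 then obtain j where j: "j <= N" "x ^ j * f / v i ~: mm ?R" by blast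
 note ji = unit_inverse[OF q[OF j(1)] j(2)]
 have val: "z : ?R | inverse z : ?R" for z
 proof (cases "j < N")
  case True
  have eq: "(x ^ Suc j * f / v i) * inverse (x ^ j * f / v i) = x" using ji by (simp add: field_simps)
  have "x : ?R" using subr_mult[OF R'(4) q[of "Suc j"] conjunct2[OF ji]] True unfolding eq by simp
  thus ?thesis using ratfun_valuation[OF R'(3) kR _ x K] by blast
 next
  case False
  hence jN: "j = Suc (N - 1)" using j(1) N by simp
  have eq: "(x ^ (N - 1) * f / v i) * inverse (x ^ j * f / v i) = inverse x" using ji x0 unfolding jN by (simp add: field_simps)
  have "inverse x : ?R" using subr_mult[OF R'(4) q[of "N - 1"] conjunct2[OF ji]] unfolding eq by simp
  moreover have "inverse x ~: kk" using inverse_kk x by blast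
  ultimately show ?thesis using ratfun_valuation[OF R'(3) kR, of "inverse x"] ratfun_inverse[OF x0] K by blast
 qed
 show ?thesis by (rule dominated_valuation[OF R'(2,4) val])
qed

end

section \<open>Glued schemes\<close>

lemma glued_points_iff: "ALL B:\<B>. subr B ==> R : glued_points \<B> \<longleftrightarrow> (EX B:\<B>. EX p. prime_of B p & R = localization B p)"
 unfolding glued_points_def using primeideal_iff by blast

lemma glued_open:
 assumes B: "ALL B:\<B>. subr B" shows "openin (glued_topology \<B>) {R : glued_points \<B>. z : R}"
 unfolding openin_glued_topology
proof (intro conjI ballI)
 fix B assume BB: "B : \<B>"
 note Bs = bspec[OF B BB]
 have "{p. primeideal p (ring_on B) & localization B p : {R : glued_points \<B>. z : R}}
  = \<Union>{{p. prime_of B p & s ~: p} | s. s : B & s * z : B}" (is "?L = ?R")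
 proof (intro equalityI subsetI)
  fix p assume "p : ?L"
  hence p: "prime_of B p" "z : localization B p" unfolding primeideal_iff[OF Bs] by auto
  then obtain a s where "z = a / s" "a : B" "s : B" "s ~: p" unfolding localization_iff by blast
  moreover from this have "s * z : B" using loc_den[OF Bs p(1)] by simp
  ultimately show "p : ?R" using p(1) by blast
 next
  fix p assume "p : ?R"
  then obtain s where s: "s : B" "s * z : B" "prime_of B p" "s ~: p" by blast
  have "z = s * z / s" using loc_den[OF Bs s(3,1,4)] by simp
  hence "z : localization B p" unfolding localization_iff using s by blast
  moreover have "localization B p : glued_points \<B>" using glued_points_iff[OF B] BB s(3) by blast
  ultimately show "p : ?L" using s(3) unfolding primeideal_iff[OF Bs] by simp
 qed
 moreover have "openin (spec B) ?R" using openin_spec_basic[OF _ Bs] by blast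
 ultimately show "openin (spec B) ?L" by simp
qed auto

lemma glued_open_set:
 assumes B: "ALL B:\<B>. subr B" and Z: "finite Z" shows "openin (glued_topology \<B>) {R : glued_points \<B>. Z <= R}"
 using Z
proof (induction Z rule: finite_induct)
 case empty
 have "{R : glued_points \<B>. 0 : R} = {R : glued_points \<B>. {} <= R}"
 proof -
  have "0 : R" if R: "R : glued_points \<B>" for R
  proof -
   obtain C p where "C : \<B>" "prime_of C p" "R = localization C p" using R unfolding glued_points_iff[OF B] by blast
   thus ?thesis using subr_0[OF localization_subr] B by blast
  qed
  thus ?thesis by blast
 qed
 thus ?case using glued_open[OF B, of 0] by simp
next
 case (insert z Z)
 have "{R : glued_points \<B>. insert z Z <= R} = {R : glued_points \<B>. z : R} Int {R : glued_points \<B>. Z <= R}" by auto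
 thus ?case using openin_Int[OF glued_open[OF B, of z] insert.IH] by (simp only:)
qed

lemma glue_topspace: assumes "ALL B:\<B>. subr B" shows "topspace (points (glue \<B>)) = glued_points \<B>"
 unfolding topspace_def glue_def using glued_open_set[OF assms finite.emptyI] by (auto simp: openin_glued_topology)

lemma glue_nbhd:
 assumes B: "ALL B:\<B>. subr B" and W: "openin (glued_topology \<B>) W" "B : \<B>" "prime_of B p" "localization B p : W"
 obtains b where "b : B" "b ~: p" "!!q. prime_of B q ==> b ~: q ==> localization B q : W"
proof -
 note Bs = bspec[OF B W(2)]
 have "openin (spec B) {q. prime_of B q & localization B q : W}" using W(1,2) unfolding openin_glued_topology primeideal_iff[OF Bs, symmetric] by blast
 from spec_basis[OF Bs this, of p] show ?thesis using W that by blast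
qed

lemma glue_stalk: assumes B: "ALL B:\<B>. subr B" and R: "R : glued_points \<B>" shows "stalk (glue \<B>) R = R"
proof (intro equalityI subsetI)
 fix z assume z: "z : R"
 let ?W = "{R : glued_points \<B>. z : R}"
 have "z : sections (glue \<B>) ?W" by (auto simp: glue_def)
 moreover have "openin (points (glue \<B>)) ?W" using glued_open[OF B] by (simp add: glue_def)
 ultimately show "z : stalk (glue \<B>) R" unfolding stalk_def using R z by blast
qed (auto simp: stalk_def glue_def)

section \<open>The double covering of the line\<close>

lemma const_field: "field_over (fract_const :: 'k::alg_closed_field => 'k poly fract)"
 by unfold_locales (auto simp: fract_const_def One_fract_def one_pCons mult.commute)

lemma const_evp: "field_over.evp fract_const p (fract_var :: 'k::alg_closed_field poly fract) = Fract p 1"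
proof -
 interpret c: field_over "fract_const :: 'k => 'k poly fract" by (rule const_field)
 show ?thesis
 proof (induction p)
  case (pCons a p)
  thus ?case unfolding c.evp_pCons pCons.IH by (simp add: fract_const_def fract_var_def)
 qed (simp add: Zero_fract_def)
qed

lemma line_point:
 fixes S :: "'k::alg_closed_field poly fract set"
 assumes S: "loc_ring S" "range fract_const <= S" "t' : S" and t': "t' = fract_var | t' = inverse fract_var"
 shows "S = localization (adjoin (range fract_const Un {t'})) (adjoin (range fract_const Un {t'}) Int mm S)"
proof -
 interpret c: field_over "fract_const :: 'k => 'k poly fract" by (rule const_field)
 let ?B = "adjoin (range fract_const Un {t'})" and ?t = "fract_var :: 'k poly fract"
 let ?L = "local_at ?B S"
 have t: "?t ~: range fract_const"
 proof
  assume "?t : range fract_const"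
  then obtain a :: 'k where "Fract [:0, 1:] 1 = Fract [:a:] (1 :: 'k poly)" by (auto simp: fract_const_def fract_var_def)
  thus False by (simp add: eq_fract)
 qed
 hence t0: "?t ~= 0" using subr_0[OF c.subr_kk] by auto
 have all: "z : c.ratfun ?t" for z
 proof (cases z rule: Fract_cases)
  case (Fract a b)
  hence "z = c.evp a ?t / c.evp b ?t" unfolding const_evp by (simp add: divide_fract)
  thus ?thesis unfolding c.ratfun_def using Fract by blast
 qed
 hence all': "z : c.ratfun t'" for z using t' c.ratfun_inverse[OF t0] by blast
 have it: "t' ~: range fract_const" using t t' c.inverse_kk by metis
 have B: "subr ?B" "range fract_const <= ?B" "t' : ?B" "?B <= S"
  using adjoin_subr adjoin_incl[of "range fract_const Un {t'}"] adjoin_min[OF loc_ring_subr[OF S(1)]] S(2,3) by auto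
 have p: "prime_of ?B (?B Int mm S)" by (rule center_prime[OF S(1) B(1,4)])
 note L = localization_center[OF S(1) B(1,4)] localization_incl[OF B(1) p] localization_loc_ring[OF B(1) p]
 show ?thesis
  by (rule dominated_valuation[OF L(2) loc_ring_subr[OF L(4)] c.ratfun_valuation[OF L(4) _ _ it all']]) (use L(3) B(2,3) in blast)+
qed

context pencil
begin

text \<open>The embedding of k(t) in the function field that maps t to x.\<close>

definition pull :: "'k poly fract => 'a" where "pull r = (SOME z. EX a b. b ~= 0 & r = Fract a b & z = evp a x / evp b x)"

lemma pull_Fract: assumes "b ~= 0" shows "pull (Fract a b) = evp a x / evp b x"
proof -
 have "EX z a' b'. b' ~= 0 & Fract a b = Fract a' b' & z = evp a' x / evp b' x" using assms by blast
 from someI_ex[OF this] obtain a' b' where *: "b' ~= 0" "Fract a b = Fract a' b'" "pull (Fract a b) = evp a' x / evp b' x" unfolding pull_def by blast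
 hence "evp (a' * b) x = evp (a * b') x" using eq_fract(1)[OF assms *(1)] by simp
 thus ?thesis unfolding *(3) using evp_nonzero[OF x assms] evp_nonzero[OF x *(1)] by (simp add: frac_eq_eq)
qed

lemma pull_hom: "pull (r + s) = pull r + pull s" "pull (r * s) = pull r * pull s" "pull 1 = 1" "pull (fract_const c) = \<iota> c" "pull fract_var = x"
proof -
 obtain a b where r: "r = Fract a b" "b ~= 0" by (cases r rule: Fract_cases) auto
 obtain c d where s: "s = Fract c d" "d ~= 0" by (cases s rule: Fract_cases) auto
 note nz = evp_nonzero[OF x r(2)] evp_nonzero[OF x s(2)]
 show "pull (r + s) = pull r + pull s" "pull (r * s) = pull r * pull s" unfolding r(1) s(1) add_fract[OF r(2) s(2)] mult_fract
  using r s nz by (simp_all add: pull_Fract field_simps)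
qed (simp_all add: One_fract_def fract_const_def fract_var_def pull_Fract \<iota>_0 \<iota>_1)

lemma pull_0: "pull 0 = 0" using pull_hom(1)[of 0 0] by (metis add.right_neutral add_left_cancel)

lemma pull_inverse: "pull (inverse r) = inverse (pull r)"
proof (cases "r = 0")
 case False
 hence "pull r * pull (inverse r) = 1" using pull_hom(2)[of r "inverse r"] pull_hom(3) by simp
 thus ?thesis by (metis inverse_unique)
qed (simp add: pull_0)

lemma pull_zero_iff: "pull r = 0 \<longleftrightarrow> r = 0"
 using pull_inverse[of r] pull_hom(2)[of r "inverse r"] pull_hom(3) pull_0 by (cases "r = 0") auto

lemma pull_uminus: "pull (- r) = - pull r" using pull_hom(1)[of r "- r"] by (simp add: pull_0 eq_neg_iff_add_eq_0 add.commute)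

lemma range_pull: "range pull = ratfun x"
proof
 show "range pull <= ratfun x"
 proof
  fix z assume "z : range pull"
  then obtain r where r: "z = pull r" by blast
  obtain a b where "r = Fract a b" "b ~= 0" by (cases r rule: Fract_cases) auto
  thus "z : ratfun x" unfolding r ratfun_def by (auto simp: pull_Fract)
 qed
 show "ratfun x <= range pull"
 proof
  fix z assume "z : ratfun x"
  then obtain p q where "z = evp p x / evp q x" "q ~= 0" by (auto simp: ratfun_def)
  thus "z : range pull" using pull_Fract by (metis rangeI)
 qed
qed

text \<open>The map sends P to the local ring that the stalk at P induces on the field k(x).\<close>

lemma double_cover_hyperelliptic:
 assumes reg: "!!P. P : pts ==> x : stk P | inverse x : stk P"
  and u: "u ~: ratfun x" "!!w. EX a:ratfun x. EX b:ratfun x. w = a + b * u"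
 shows "hyperelliptic X \<iota>"
proof -
 let ?t = "fract_var :: 'k poly fract"
 let ?A = "%t'. adjoin (range fract_const Un {t'}) :: 'k poly fract set"
 let ?\<B> = "{?A ?t, ?A (inverse ?t)}"
 define f where "f P = {r. pull r : stk P}" for P
 have sub: "ALL B:?\<B>. subr B" using adjoin_subr by blast
 have f_nonunits: "r : mm (f P) \<longleftrightarrow> pull r : mm (stk P)" for r P
  unfolding nonunits_def f_def by (auto simp: pull_inverse pull_zero_iff)
 have f_loc: "loc_ring (f P)" "range fract_const <= f P" if P: "P : pts" for P
 proof -
  note L = stalk_subr[OF P]
  have "pull (r - s) = pull r - pull s" for r s using pull_hom(1)[of r "- s"] pull_uminus by simp
  hence "subr (f P)" unfolding subr_def f_def using subr_1[OF L] subr_diff[OF L] subr_mult[OF L] by (auto simp: pull_hom)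
  thus "loc_ring (f P)" unfolding loc_ring_def f_nonunits using stalk_loc_ring[OF P] by (auto simp: loc_ring_def pull_hom f_nonunits)
  show "range fract_const <= f P" using kk_stalk[OF P] by (auto simp: f_def pull_hom)
 qed
 have f_chart: "prime_of (?A t') (?A t' Int mm (f P))" "f P = local_at (?A t') (f P)"
  if P: "P : pts" and t': "t' : f P" "t' = ?t | t' = inverse ?t" for P t'
 proof -
  have "?A t' <= f P" by (rule adjoin_min[OF loc_ring_subr[OF f_loc(1)[OF P]]]) (use f_loc(2)[OF P] t' in auto)
  thus "prime_of (?A t') (?A t' Int mm (f P))" using center_prime[OF f_loc(1)[OF P] adjoin_subr] by blast
  show "f P = local_at (?A t') (f P)" by (rule line_point[OF f_loc(1)[OF P] f_loc(2)[OF P] t'])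
 qed
 have f_t: "EX t'. t' : f P & (t' = ?t | t' = inverse ?t)" if "P : pts" for P
  using reg[OF that] unfolding f_def by (metis mem_Collect_eq pull_hom(5) pull_inverse)
 have f_pt: "f P : glued_points ?\<B>" if P: "P : pts" for P
  unfolding glued_points_iff[OF sub] using f_t[OF P] f_chart[OF P] by blast
 have open_reg: "openin (points X) {P : pts. z : stk P}" for z
 proof -
  have "{P : pts. z : stk P} = \<Union>{U. openin (points X) U & z : \<O> U}" unfolding stalk_iff using openin_subset by fastforce
  thus ?thesis by auto
 qed
 have cont: "openin (points X) {P : pts. f P : W}" if W: "openin (glued_topology ?\<B>) W" for W
 proof (subst openin_subopen, intro ballI)
  fix P assume "P : {P : pts. f P : W}"
  hence P: "P : pts" "f P : W" by auto
  obtain t' where t': "t' : f P" "t' = ?t | t' = inverse ?t" using f_t[OF P(1)] by blast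
  note c = f_chart[OF P(1) t']
  have BB: "?A t' : ?\<B>" using t'(2) by blast
  obtain b where b: "b : ?A t'" "b ~: ?A t' Int mm (f P)" "!!q. prime_of (?A t') q ==> b ~: q ==> localization (?A t') q : W"
   by (rule glue_nbhd[OF sub W BB c(1)]) (use P(2) c(2) in auto)
  let ?Z = "{Q : pts. pull t' : stk Q} Int {Q : pts. pull (inverse b) : stk Q}"
  have "openin (points X) ?Z" by (rule openin_Int[OF open_reg open_reg])
  moreover have "b : f P" using b(1) localization_incl[OF adjoin_subr c(1)] c(2) by blast
  hence "P : ?Z" using unit_inverse[of b "f P"] b(1,2) P t'(1) by (auto simp: f_def)
  moreover have "f Q : W" if Q: "Q : ?Z" for Q
  proof -
   have tQ: "t' : f Q" "inverse b : f Q" "Q : pts" using Q by (auto simp: f_def)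
   note cQ = f_chart[OF tQ(3,1) t'(2)]
   have "b ~= 0" using b(1,2) c(1) prime_ofD(1) submod_0 by blast
   have "b ~: mm (f Q)" using tQ(2) `b ~= 0` by (auto simp: nonunits_def)
   thus ?thesis using b(3)[OF cQ(1)] cQ(2) by auto
  qed
  ultimately show "EX T. openin (points X) T & P : T & T <= {P : pts. f P : W}" by blast
 qed
 have pl: "projective_line = glue ?\<B>" by (simp add: projective_line_def)
 have top: "points (glue ?\<B>) = glued_topology ?\<B>" by (simp add: glue_def)
 note tops = glue_topspace[OF sub, unfolded top]
 have "dominant_morphism X projective_line f pull" unfolding dominant_morphism_def pl
 proof (intro conjI allI impI ballI)
  show "continuous_map (points X) (points (glue ?\<B>)) f" unfolding continuous_map_def top tops using f_pt cont by auto
  fix W assume "nopen (glue ?\<B>) W"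
  hence W: "openin (glued_topology ?\<B>) W" "W ~= {}" unfolding nopen_def top by blast+
  have pre: "preimage X f W = {P : pts. f P : W}" by (simp add: preimage_def)
  obtain U where U: "aff U" using affine_cover nopen_pts by (metis ex_in_conv nopen_def)
  obtain P where P: "P : U" "stk P = UNIV" using generic_point[OF U] by blast
  hence Pp: "P : pts" using affine_sub[OF U] by blast
  have fU: "f P = UNIV" by (simp add: f_def P(2))
  obtain R where "R : W" using W(2) by blast
  moreover from this have "R : glued_points ?\<B>" using W(1) openin_subset tops by blast
  then obtain B p where Bp: "B : ?\<B>" "prime_of B p" "R = localization B p" unfolding glued_points_iff[OF sub] by blast
  ultimately obtain b where b: "b : B" "b ~: p" "!!q. prime_of B q ==> b ~: q ==> localization B q : W"
   using glue_nbhd[OF sub W(1) Bp(1,2)] by blast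
  have "b ~= 0" using b(2) submod_0[OF prime_ofD(1)[OF Bp(2)]] by auto
  obtain t' where t': "B = ?A t'" "t' = ?t | t' = inverse ?t" using Bp(1) by blast
  have "B Int mm (f P) = {0}" unfolding fU using subr_0[OF bspec[OF sub Bp(1)]] by auto
  hence "f P = localization B {0}" using f_chart(2)[OF Pp _ t'(2)] fU t'(1) by simp
  hence "f P : W" using b(3)[OF prime_of_zero[OF bspec[OF sub Bp(1)]]] `b ~= 0` by simp
  thus ne: "preimage X f W ~= {}" unfolding pre using Pp by blast
  have n: "nop (preimage X f W)" unfolding nopen_def using ne cont[OF W(1)] by (simp add: pre)
  have "pull r : \<O> (preimage X f W)" if "r : sections (glue ?\<B>) W" for r
   unfolding sections_eq_stalks[OF n] using that by (auto simp: pre glue_def f_def)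
  thus "pull : ring_hom (ring_on (sections (glue ?\<B>) W)) (ring_on (\<O> (preimage X f W)))"
   by (intro ring_hom_memI) (auto simp: pull_hom)
 next
  fix P r assume P: "P : pts" and r: "r : mm (stalk (glue ?\<B>) (f P))"
  thus "pull r : mm (stk P)" unfolding glue_stalk[OF sub f_pt[OF P]] f_nonunits by simp
 qed
 moreover have "vector_space.dim (%b a. pull b * a) (UNIV :: 'a set) = 2"
 proof -
  interpret vs: vector_space "%b a. pull b * a" by unfold_locales (auto simp: pull_hom algebra_simps)
  have one: "1 : ratfun x" using range_pull pull_hom(3) by (metis rangeI)
  have "u ~= 1" using u(1) one by blast
  have sp: "w : vs.span {1, u}" for w
  proof -
   obtain a b where "w = pull a + pull b * u" using u(2)[of w] unfolding range_pull[symmetric] by blast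
   hence "w = pull a * 1 + pull b * u" by simp
   thus ?thesis by (metis insertI1 insertI2 vs.span_add vs.span_base vs.span_scale)
  qed
  have "u ~: vs.span {1}"
  proof
   assume "u : vs.span {1}"
   then obtain k where "u = pull k * 1" unfolding vs.span_singleton by auto
   thus False using u(1) range_pull by (metis mult.right_neutral rangeI)
  qed
  hence "vs.independent {u, 1}" by (intro vs.independent_insertI) (auto simp: vs.dependent_single vs.independent_empty)
  hence ind: "vs.independent {1, u}" by (simp add: insert_commute)
  have "vs.dim UNIV = card {1, u}" by (rule vs.dim_unique[OF _ _ ind]) (use sp in auto)
  thus ?thesis using `u ~= 1` by simp
 qed
 ultimately show ?thesis unfolding hyperelliptic_def using pull_hom(4) by blast
qed

end

section \<open>Local rings of the canonical model\<close>

context canonical_curve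
begin

text \<open>In a valuation ring one of the \<open>v\<^sub>i\<close> divides all others.\<close>

lemma normal_point:
 assumes U: "aff U" and P: "prime_of (icl (\<O> U)) P"
 defines "S \<equiv> localization (icl (\<O> U)) P"
 obtains x i where "x : pts" "dominated (stk x) S" "loc_ring S" "i < g" "ys i <= S"
proof -
 note B = integral_closure_props[OF FD_affine[OF U] affine_fractions[OF U]]
 have S: "loc_ring S" "\<O> U <= S" unfolding S_def using localization_loc_ring[OF B(1) P] localization_incl[OF B(1) P] B(2) by auto
 obtain x where x: "x : U" "pp U x = \<O> U Int mm S" using pp_surj[OF U center_prime[OF S(1) affine_subr[OF U] S(2)]] by blast
 have dom: "dominated (stk x) S" using localization_center(2)[OF S(1) affine_subr[OF U] S(2)] stalk_eq_localization[OF U x(1)] x(2) by simp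
 have "n >= 1 ==> n <= g ==> EX i<n. ALL j<n. v j / v i : S" for n
 proof (induction n rule: nat_induct_at_least)
  case base
  thus ?case using v_nonzero[of 0] subr_1[OF loc_ring_subr[OF S(1)]] by auto
 next
  case (Suc n)
  then obtain i where i: "i < n" "ALL j<n. v j / v i : S" by auto
  have nz: "v n ~= 0" "v i ~= 0" using v_nonzero Suc.prems i(1) by auto
  show ?case
  proof (cases "v n / v i : S")
   case True
   thus ?thesis using i by (intro exI[of _ i]) (auto simp: less_Suc_eq)
  next
   case False
   hence "inverse (v n / v i) : S" using localized_closure_valuation[OF FD_affine[OF U] affine_fractions[OF U] P, of "v n / v i"] nz unfolding S_def by simp
   hence in': "v i / v n : S" by simp
   have "v j / v n : S" if "j < n" for j using subr_mult[OF loc_ring_subr[OF S(1)] i(2)[rule_format, OF that] in'] nz by simp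
   thus ?thesis using nz subr_1[OF loc_ring_subr[OF S(1)]] by (intro exI[of _ n]) (auto simp: less_Suc_eq)
  qed
 qed
 from this[of g] obtain i where "i < g" "ALL j<g. v j / v i : S" using g2 by auto
 thus ?thesis using that[of x i] dom S(1) x(1) affine_sub[OF U] by (auto simp: ys_def)
qed

lemma dominated_bpoint:
 assumes x: "x : pts" and S: "loc_ring S" "dominated (stk x) S" and i: "i < g" "ys i <= S"
 obtains R where "bpoint x i R" "dominated R S"
proof -
 have b: "bring x i <= S" unfolding bring_def by (rule adjoin_min[OF loc_ring_subr[OF S(1)]]) (use dominated_sub[OF S(2)] i(2) in auto)
 let ?p = "bring x i Int mm S" let ?R = "localization (bring x i) ?p"
 have p: "prime_of (bring x i) ?p" by (rule center_prime[OF S(1) bring(1) b])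
 note R = localization_center[OF S(1) bring(1) b] localization_incl[OF bring(1) p] localization_contract[OF bring(1) p]
 have "dominated (stk x) ?R" using S(2) R(1,2,3) bring(2)[of x i] unfolding dominated_def by blast
 hence "bpoint x i ?R" unfolding bpoint_def R(4) using x i(1) localization_loc_ring[OF bring(1) p] R(3) bring(3)[of i x] by blast
 thus ?thesis using that R(2) by blast
qed

lemma bpoint_normal:
 assumes bp: "bpoint x i R"
 obtains U P where "aff U" "prime_of (icl (\<O> U)) P" "dominated R (localization (icl (\<O> U)) P)"
proof -
 note D = bpointD[OF bp]
 obtain U where U: "aff U" "x : U" using affine_cover D(1) by blast
 have "\<O> U <= R" using stalk_affine[OF U(1) U(2)] D(7) by blast
 from lying_over[OF FD_affine[OF U(1)] affine_fractions[OF U(1)] D(3) this] show ?thesis using that[OF U(1)] by blast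
qed

lemma closed_bpoint: obtains x i R where "bpoint x i R" "mm R ~= {0}"
proof -
 have "EX x:pts. mm (stk x) ~= {0}"
 proof (rule ccontr)
  assume "~ ?thesis"
  hence st: "z : stk x" if "x : pts" for x z using fractions_nonunits_zero[OF stalk_subr stalk_fractions] that by blast
  have "z * w : V" if "w : V" for z w unfolding V_iff_mst using submod_mult[OF mst_submod st] that V_iff_mst by blast
  hence k: "z : kk" for z using V_stable by blast
  obtain a where a: "v 1 / v 0 = \<iota> a" using k by blast
  have "v 1 = \<iota> a * v 0" using a v_nonzero[of 0] g2 by (simp add: field_simps)
  hence "(\<Sum>j<g. \<iota> (if j = 0 then - a else if j = 1 then 1 else 0) * v j) = 0"
   using g2 by (subst sum.mono_neutral_right[of _ "{0, 1}"]) (auto simp: \<iota>_0 \<iota>_1 \<iota>_uminus)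
  from V_independent[OF this, of 1] show False using g2 by simp
 qed
 then obtain x where x: "x : pts" "mm (stk x) ~= {0}" by blast
 obtain U where U: "aff U" "x : U" using affine_cover x by blast
 obtain P where P: "prime_of (icl (\<O> U)) P" "dominated (stk x) (localization (icl (\<O> U)) P)"
  by (rule lying_over[OF FD_affine[OF U(1)] affine_fractions[OF U(1)] stalk_loc_ring[OF x(1)] stalk_affine[OF U(1) U(2)]])
 obtain y i where yi: "loc_ring (localization (icl (\<O> U)) P)" "i < g" "ys i <= localization (icl (\<O> U)) P"
  by (rule normal_point[OF U(1) P(1)]) blast
 obtain R where R: "bpoint x i R" by (rule dominated_bpoint[OF x(1) yi(1) P(2) yi(2,3)])
 have "mm (stk x) <= mm R" "0 : mm (stk x)" using bpointD(5)[OF R] nonunits_0[OF stalk_subr[OF x(1)]] by (auto simp: dominated_def)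
 thus ?thesis using that[OF R] x(2) by blast
qed

text \<open>The case distinction asks for a hyperplane W of V that a nonconstant z multiplies into V.  The generic point of
 the blowup is reduced to a closed point, whose local ring has the same fractions.\<close>

theorem canonical_local:
 assumes nh: "~ hyperelliptic X \<iota>" and bp: "bpoint x i R"
 shows "R = local_at (kv i) R"
proof (cases "EX z u W. submod kk W & W <= V & (ALL w:V. EX a. w - \<iota> a * u : W) & (ALL w:W. z * w : V) & z ~: kk")
 case True
 then obtain z u W where z: "submod kk W" "W <= V" "!!w. w : V ==> EX a. w - \<iota> a * u : W" "!!w. w : W ==> z * w : V" "z ~: kk" by blast
 obtain f where "f ~= 0" "!!w. w : V \<longleftrightarrow> (EX p. degree p <= g - 1 & w = f * evp p z)" by (rule pencil_basis[OF z]) (assumption | rule that)+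
 then interpret pencil X \<iota> \<omega> t e h g z f by unfold_locales (use z(5) in auto)
 have "w : ratfun z" for w using rational_or_double double_cover_hyperelliptic nh by blast
 thus ?thesis by (rule point_rational[OF _ bp])
next
 case False
 hence main: "S = local_at (kv j) S" if "bpoint y j S" "mm S ~= {0}" for y j S
  by (intro point_without_pencil[OF that]) blast
 note D = bpointD[OF bp]
 show ?thesis
 proof (cases "mm R = {0}")
  case True
  let ?L = "local_at (kv i) R"
  have pp: "prime_of (kv i) (kv i Int mm R)" by (rule center_prime[OF D(3) kv(1) D(10)])
  note L = localization_center(1)[OF D(3) kv(1) D(10)] localization_subr[OF kv(1) pp] localization_incl[OF kv(1) pp]
  have inv: "a / b : ?L" if "a : ?L" "b : ?L" for a b
  proof (cases "b = 0")
   case False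
   obtain c s where c: "b = c / s" "c : kv i" "s : kv i" using `b : ?L` unfolding localization_iff by blast
   hence "c ~: kv i Int mm R" using False True by auto
   hence "s / c : ?L" unfolding localization_iff using c(2,3) by blast
   from subr_mult[OF L(2) that(1) this] show ?thesis by (simp add: c(1))
  qed (use subr_0[OF L(2)] in simp)
  obtain y j S where S: "bpoint y j S" "mm S ~= {0}" by (rule closed_bpoint)
  note DS = bpointD[OF S(1)]
  have "ys j <= ?L"
  proof
   fix w assume "w : ys j"
   then obtain l where l: "l < g" "w = (v l / v i) / (v j / v i)" using v_nonzero[OF D(2)] by (auto simp: ys_def)
   have "v l / v i : ?L" "v j / v i : ?L" using kv(3)[of i] L(3) l(1) DS(2) by (auto simp: ys_def)
   thus "w : ?L" unfolding l(2) by (rule inv)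
  qed
  hence "kv j <= ?L" using kv_min[OF L(2)] kv(2)[of i] L(3) by blast
  have SL: "S <= ?L"
  proof (intro subsetI)
   fix w assume "w : S"
   then obtain a s where "w = a / s" "a : kv j" "s : kv j" using main[OF S] unfolding localization_def by blast
   thus "w : ?L" using inv `kv j <= ?L` by blast
  qed
  have "z : ?L" for z
  proof -
   obtain a b where "a : stk y" "b : stk y" "z = a / b" using stalk_fractions[OF DS(1)] unfolding fractions_def by metis
   thus ?thesis using inv SL DS(7) by blast
  qed
  thus ?thesis using L(1) by blast
 qed (use main[OF bp] in blast)
qed

text \<open>The ratio \<open>v\<^sub>i / v\<^sub>j\<close> is a unit of S, hence of R; so R contains the chart of the canonical model on which
 S lies, and then also S.\<close>

lemma bpoint_dominated_eq:
 assumes nh: "~ hyperelliptic X \<iota>" and R: "bpoint x i R" and S: "bpoint y j S" and dom: "dominated R S"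
 shows "R = S"
proof
 note D = bpointD[OF R] and E = bpointD[OF S]
 note nz = v_nonzero[OF D(2)] v_nonzero[OF E(2)]
 have "v j / v i : R" using D(6) E(2) by (auto simp: ys_def)
 moreover have "v i / v j : S" using E(6) D(2) by (auto simp: ys_def)
 hence "v j / v i ~: mm S" using nz by (auto simp: nonunits_def)
 ultimately have u: "v i / v j : R" using dominated_unit[OF dom] by fastforce
 have "ys j <= R"
 proof
  fix w assume "w : ys j"
  then obtain l where l: "l < g" "w = (v l / v i) * (v i / v j)" using nz by (auto simp: ys_def)
  show "w : R" unfolding l(2) by (rule subr_mult[OF D(4) _ u]) (use D(6) l(1) in \<open>auto simp: ys_def\<close>)
 qed
 hence "kv j <= R" by (rule kv_min[OF D(4,8)])
 thus "S <= R" using localization_min[OF E(3) kv(1) dom _ D(3) refl] canonical_local[OF nh S] by blast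
qed (rule dominated_sub[OF dom])

subsection \<open>Homogeneous polynomials\<close>

abbreviation "Pg \<equiv> polynomials (UNIV :: 'k set) g"
abbreviation "ev \<equiv> evaluate \<iota> v"

lemma monomial_degree_superset: "finite I ==> supp m <= I ==> monomial_degree m = (\<Sum>i\<in>I. lk m i)"
 unfolding monomial_degree_def by (rule sum.mono_neutral_left) (auto simp: in_keys_iff)

lemma monomial_degree_add: "monomial_degree (m + n) = monomial_degree m + monomial_degree n"
 using monomial_degree_superset[of "supp m Un supp n" m] monomial_degree_superset[of "supp m Un supp n" n]
  monomial_degree_superset[OF _ Poly_Mapping.keys_add[of m n]] by (simp add: lookup_add sum.distrib)

lemma monom_value_scale: "monom_value (%j. v j / c) m = monom_value v m / (c :: 'a) ^ monomial_degree m"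
 by (simp add: monom_value_def monomial_degree_def power_divide prod_dividef power_sum)

lemma ev_scale: assumes "homog d F" shows "ev F / c ^ d = evaluate \<iota> (%j. v j / c) F"
 using assms unfolding evaluate_alt monom_value_scale homogeneous_of_degree_def sum_divide_distrib by (intro sum.cong) auto

lemma component_homogeneous: "homog d F ==> hcomp d' F = (if d' = d then F else 0)"
proof -
 assume "homog d F"
 hence "{m : supp F. monomial_degree m = d'} = (if d' = d then supp F else {})" by (auto simp: homogeneous_of_degree_def)
 thus ?thesis unfolding homogeneous_component_def using mpoly_sum_single[of F] by auto
qed

lemma homogeneous_mult: assumes "homog d F" "homog d' G" shows "homog (d + d') (F * G)"
 using assms keys_mult[of F G] unfolding homogeneous_of_degree_def by (auto simp: monomial_degree_add subset_iff)

lemma homogeneous_diff: assumes "homog d F" "homog d G" shows "homog d (F - G)"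
 using assms keys_diff[of F G] unfolding homogeneous_of_degree_def by blast

lemma homogeneous_component_homogeneous: "homog d (hcomp d F)"
proof -
 have "supp (hcomp d F) <= (\<Union>m\<in>{m : supp F. monomial_degree m = d}. supp (mon m (lk F m)))"
  unfolding homogeneous_component_def by (rule Poly_Mapping.keys_sum)
 thus ?thesis unfolding homogeneous_of_degree_def by (auto split: if_splits)
qed

lemma homogeneous_component_Pg: "F : Pg ==> hcomp d F : Pg"
 unfolding homogeneous_component_def by (intro polynomials_sum polynomials_single) (auto simp: polynomials_def in_keys_iff)

definition Xv :: "nat => 'k mpoly" where "Xv i = mon (mon i 1) 1"

lemma Xv: "i < g ==> Xv i : Pg" "homog 1 (Xv i)" "ev (Xv i) = v i"
proof -
 interpret hom \<iota> by (rule hom_iota)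
 show "i < g ==> Xv i : Pg" unfolding Xv_def by (rule polynomials_single) auto
 show "homog 1 (Xv i)" by (auto simp: Xv_def homogeneous_of_degree_def monomial_degree_def)
 show "ev (Xv i) = v i" by (simp add: Xv_def evaluate_single monom_value_single \<iota>_1)
qed

lemma Xv_power: "i < g ==> Xv i ^ k : Pg & homog k (Xv i ^ k) & ev (Xv i ^ k) = v i ^ k"
proof (induction k)
 interpret hom \<iota> by (rule hom_iota)
 case 0
 show ?case using polynomials_1[of UNIV g] evaluate_1 by (auto simp: homogeneous_of_degree_def monomial_degree_def)
next
 interpret hom \<iota> by (rule hom_iota)
 case (Suc k)
 thus ?case using polynomials_mult[OF subr_UNIV Xv(1)] homogeneous_mult[OF Xv(2)] by (auto simp: evaluate_mult Xv(3))
qed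

lemma kv_homogeneous:
 assumes i: "i < g" shows "a : kv i \<longleftrightarrow> (EX d F. F : Pg & homog d F & a = ev F / v i ^ d)"
proof
 interpret hom \<iota> by (rule hom_iota)
 have vi: "v i ~= 0" by (rule v_nonzero[OF i])
 let ?T = "{a. EX d F. F : Pg & homog d F & a = ev F / v i ^ d}"
 have mem: "\<iota> c : ?T" for c
  by (intro CollectI exI[of _ 0] exI[of _ "mon 0 c"]) (auto simp: polynomials_const evaluate_single homogeneous_of_degree_def monomial_degree_def)
 have "subr ?T" unfolding subr_def
 proof (intro conjI ballI)
  show "1 : ?T" using mem[of 1] \<iota>_1 by simp
  fix a b assume "a : ?T" "b : ?T"
  then obtain d F d' G where F: "F : Pg" "homog d F" "a = ev F / v i ^ d"
   and G: "G : Pg" "homog d' G" "b = ev G / v i ^ d'" by blast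
  have "F * G : Pg & homog (d + d') (F * G) & a * b = ev (F * G) / v i ^ (d + d')"
   using polynomials_mult[OF subr_UNIV F(1) G(1)] homogeneous_mult[OF F(2) G(2)] F(3) G(3) by (simp add: evaluate_mult power_add)
  thus "a * b : ?T" by blast
  let ?H = "F * Xv i ^ d' - Xv i ^ d * G"
  note p = Xv_power[OF i, of d] Xv_power[OF i, of d']
  have "?H : Pg" by (intro polynomials_diff polynomials_mult) (use p F G in auto)
  moreover have "homog (d + d') ?H" using homogeneous_diff[OF homogeneous_mult homogeneous_mult] p F G by blast
  moreover have "a - b = ev ?H / v i ^ (d + d')"
  proof -
   have "ev F = a * v i ^ d" "ev G = b * v i ^ d'" using vi F(3) G(3) by simp_all
   thus ?thesis using vi p by (simp add: evaluate_diff evaluate_mult power_add field_simps)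
  qed
  ultimately show "a - b : ?T" by blast
 qed
 moreover have "ys i <= ?T"
 proof
  fix w assume "w : ys i"
  then obtain j where "j < g" "w = v j / v i ^ 1" by (auto simp: ys_def)
  thus "w : ?T" by (intro CollectI exI[of _ 1] exI[of _ "Xv j"]) (use Xv in simp)
 qed
 moreover assume "a : kv i"
 ultimately show "EX d F. F : Pg & homog d F & a = ev F / v i ^ d" using kv_min[of ?T i] mem by blast
next
 interpret hom \<iota> by (rule hom_iota)
 assume "EX d F. F : Pg & homog d F & a = ev F / v i ^ d"
 then obtain d F where F: "F : Pg" "a = evaluate \<iota> (%j. v j / v i) F" using ev_scale by metis
 show "a : kv i" unfolding F(2) by (rule evaluate_mem[OF kv(1) _ _ F(1)]) (use kv(2,3)[of i] in \<open>auto simp: ys_def\<close>)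
qed

subsection \<open>The canonical map\<close>

abbreviation \<kappa> where "\<kappa> \<equiv> canonical_map X \<iota> \<omega> e h g"

lemma pullback_eq:
 assumes x: "x : pts" and R: "loc_ring R" "dominated (stk x) R"
 shows "pullback_stalk X \<omega> e R = lspan R vs"
proof -
 have "center X R = x" unfolding center_def
  by (rule the_equality) (use x R(2) center_unique[OF R(1)] in \<open>auto simp: dominated_def\<close>)
 hence "pullback_stalk X \<omega> e R = set_product R (mst x)" unfolding pullback_stalk_def mst_def MU_def by simp
 also have "\<dots> = lspan R (lspan (stk x) vs)" unfolding set_product_self[OF loc_ring_subr[OF R(1)]] mst_generated[OF x] lat_def ..
 also have "\<dots> = lspan R vs" by (rule lspan_lspan[OF stalk_subr[OF x] loc_ring_subr[OF R(1)] dominated_sub[OF R(2)]])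
 finally show ?thesis .
qed

text \<open>The forms that vanish at the image of R can be tested with any generator \<open>v\<^sub>i\<close>, since two generators differ by
 a unit.\<close>

lemma canonical_map_eq:
 assumes x: "x : pts" and R: "loc_ring R" "dominated (stk x) R" and i: "i < g" "ys i <= R"
 shows "\<kappa> R = {F : Pg. ALL d. ev (hcomp d F) / v i ^ d : mm R}"
proof -
 note Rs = loc_ring_subr[OF R(1)]
 have gen: "lspan R vs = {a * v j | a. a : R} \<longleftrightarrow> ys j <= R" if j: "j < g" for j
 proof
  have vj: "v j ~= 0" by (rule v_nonzero[OF j])
  assume eq: "lspan R vs = {a * v j | a. a : R}"
  show "ys j <= R"
  proof
   fix w assume "w : ys j"
   then obtain l where l: "l < g" "w = v l / v j" by (auto simp: ys_def)
   have "v l : lspan R vs" by (rule subsetD[OF lspan_incl[OF Rs]]) (use l(1) in blast)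
   thus "w : R" using vj unfolding eq l(2) by auto
  qed
 next
  have vj: "v j ~= 0" by (rule v_nonzero[OF j])
  assume "ys j <= R"
  hence "vs <= (*) (v j) ` R" using vj by (auto simp: ys_def intro!: image_eqI[of _ _ "v _ / v j"])
  hence "lspan R vs <= (*) (v j) ` R" by (rule lspan_min[OF submod_principal[OF Rs]])
  moreover have "a * v j : lspan R vs" if "a : R" for a by (rule lspan_mult[OF Rs subsetD[OF lspan_incl[OF Rs]] that]) (use j in blast)
  ultimately show "lspan R vs = {a * v j | a. a : R}" by (auto simp: mult.commute)
 qed
 have indep: "ev F / v j ^ d : mm R" if jl: "j < g" "l < g" "ys j <= R" "ev F / v l ^ d : mm R" for j l d F
 proof -
  have "(v l / v j) ^ d : R" using jl(2,3) by (intro subr_power[OF Rs]) (auto simp: ys_def)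
  from nonunits_mult[OF Rs jl(4) this] show ?thesis using v_nonzero[OF jl(1)] v_nonzero[OF jl(2)] by (simp add: power_divide)
 qed
 have vv: "(%i. e pts (h i)) = v" by (simp add: fun_eq_iff v_def)
 show ?thesis unfolding canonical_map_def vv Let_def pullback_eq[OF x R]
 proof (intro Collect_cong conj_cong refl iffI)
  fix F assume "EX j<g. lspan R vs = {a * v j | a. a : R} & (ALL d. ev (hcomp d F) / v j ^ d : mm R)"
  thus "ALL d. ev (hcomp d F) / v i ^ d : mm R" using indep[OF i(1) _ i(2)] by blast
 next
  fix F assume "ALL d. ev (hcomp d F) / v i ^ d : mm R"
  thus "EX j<g. lspan R vs = {a * v j | a. a : R} & (ALL d. ev (hcomp d F) / v j ^ d : mm R)"
   using gen[OF i(1)] i by blast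
 qed
qed

text \<open>The lemma of Gauss: the product of the first coefficients outside of m is a coefficient modulo m.\<close>

lemma poly_over_prime:
 assumes R: "subr R" and m: "prime_of R m" shows "prime_of (poly_over R) (poly_over m)"
 unfolding prime_of_def
proof (intro conjI ballI impI)
 note ms = prime_ofD(1)[OF m] and mR = prime_ofD(2)[OF m]
 show "submod (poly_over R) (poly_over m)" unfolding submod_def poly_over_def
  using submod_0[OF ms] submod_add[OF ms] by (auto simp: coeff_mult intro!: submod_sum[OF ms] submod_mult[OF ms])
 show "poly_over m <= poly_over R" using mR by (auto simp: poly_over_def)
 show "1 ~: poly_over m" using prime_ofD(3)[OF m] by (auto simp: poly_over_def intro!: exI[of _ 0])
 fix p q assume pq: "p : poly_over R" "q : poly_over R" "p * q : poly_over m"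
 show "p : poly_over m | q : poly_over m"
 proof (rule ccontr)
  assume "~ ?thesis"
  then obtain a b where "coeff p a ~: m" "coeff q b ~: m" by (auto simp: poly_over_def)
  define i j where "i = (LEAST a. coeff p a ~: m)" and "j = (LEAST b. coeff q b ~: m)"
  have i: "coeff p i ~: m" "!!l. l < i ==> coeff p l : m" unfolding i_def using LeastI[of "%a. coeff p a ~: m"] `coeff p a ~: m` not_less_Least by blast+
  have j: "coeff q j ~: m" "!!l. l < j ==> coeff q l : m" unfolding j_def using LeastI[of "%a. coeff q a ~: m"] `coeff q b ~: m` not_less_Least by blast+
  have c: "coeff p l : R" "coeff q l : R" for l using pq(1,2) by (auto simp: poly_over_def)
  have "coeff (p * q) (i + j) = coeff p i * coeff q j + (\<Sum>l\<in>{..i + j} - {i}. coeff p l * coeff q (i + j - l))"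
   unfolding coeff_mult by (subst sum.remove[of _ i]) auto
  moreover have "(\<Sum>l\<in>{..i + j} - {i}. coeff p l * coeff q (i + j - l)) : m"
  proof (rule submod_sum[OF ms])
   fix l assume l: "l : {..i + j} - {i}"
   show "coeff p l * coeff q (i + j - l) : m"
   proof (cases "l < i")
    case True
    thus ?thesis using submod_mult'[OF ms c(2) i(2)] by blast
   next
    case False
    hence "i + j - l < j" using l by auto
    thus ?thesis using submod_mult[OF ms c(1) j(2)] by blast
   qed
  qed
  moreover have "coeff (p * q) (i + j) : m" using pq(3) by (auto simp: poly_over_def)
  ultimately have "coeff p i * coeff q j : m" using submod_diff[OF ms R] by (metis add_diff_cancel_right')
  thus False using prime_ofD(4)[OF m c] i(1) j(1) by blast
 qed
qed

lemma canonical_map_homogeneous: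
 assumes x: "x : pts" and R: "loc_ring R" "dominated (stk x) R" and i: "i < g" "ys i <= R" and F: "F : Pg" "homog d F"
 shows "F : \<kappa> R \<longleftrightarrow> ev F / v i ^ d : mm R"
proof -
 interpret hom \<iota> by (rule hom_iota)
 show ?thesis unfolding canonical_map_eq[OF assms(1-5)] mem_Collect_eq component_homogeneous[OF F(2)]
  using F(1) nonunits_0[OF loc_ring_subr[OF R(1)]] by auto
qed

text \<open>The forms vanishing at a point form a prime ideal: they are the polynomials whose images under
 the substitution of \<open>(v\<^sub>j / v\<^sub>i) T\<close> for the variables have all coefficients in the maximal ideal.\<close>

lemma canonical_map_prime:
 assumes x: "x : pts" and R: "loc_ring R" "dominated (stk x) R" and i: "i < g" "ys i <= R"
 shows "homogeneous_prime g (\<kappa> R)" "Xv i ~: \<kappa> R"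
proof -
 note Rs = loc_ring_subr[OF R(1)]
 interpret hom \<iota> by (rule hom_iota)
 interpret c: hom "%c. [:\<iota> c:]" by unfold_locales (auto simp: hom_add hom_mult hom_1 one_pCons)
 (* The substitution homomorphism; its d-th coefficient is the value of the d-th homogeneous component. *)
 let ?y = "%j. monom (v j / v i) 1" let ?\<Phi> = "evaluate (%c. [:\<iota> c:]) ?y"
 have pm: "(\<Prod>j\<in>A. monom (a j) 1 ^ k j) = monom (\<Prod>j\<in>A. a j ^ k j) (\<Sum>j\<in>A. k j)" for A and a :: "nat => 'a" and k
  by (induction A rule: infinite_finite_induct) (auto simp: monom_power mult_monom)
 have "monom_value ?y m = monom (monom_value v m / v i ^ monomial_degree m) (monomial_degree m)" for m
  unfolding monom_value_scale[symmetric] unfolding monom_value_def monomial_degree_def pm ..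
 hence co: "coeff (?\<Phi> F) d = ev (hcomp d F) / v i ^ d" for F d
  unfolding evaluate_alt[of "%c. [:\<iota> c:]"] homogeneous_component_def evaluate_sum evaluate_single sum_divide_distrib
  by (simp add: coeff_sum smult_monom if_distrib[of "%z. _ * z"] sum.If_cases Int_def cong: if_cong)
 have eq: "\<kappa> R = {F : Pg. ?\<Phi> F : poly_over (mm R)}" unfolding canonical_map_eq[OF assms] poly_over_def mem_Collect_eq co ..
 have k: "kk <= R" using kk_stalk[OF x] dominated_sub[OF R(2)] by blast
 have "prime_of Pg (\<kappa> R)" unfolding eq
 proof (rule c.evaluate_prime[OF subr_UNIV poly_over_subr[OF Rs] _ _ poly_over_prime[OF Rs nonunits_prime[OF R(1)]]])
  show "range (%c. [:\<iota> c:]) <= poly_over R" using k poly_over_const[OF Rs] by blast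
  show "?y ` {..<g} <= poly_over R" using i(2) poly_over_monom[OF _ Rs] by (auto simp: ys_def)
 qed
 moreover have "hcomp d F : \<kappa> R" if F: "F : \<kappa> R" for F d
 proof -
  have "F : Pg" "ev (hcomp d F) / v i ^ d : mm R" using F unfolding canonical_map_eq[OF assms] by auto
  thus ?thesis using canonical_map_homogeneous[OF assms homogeneous_component_Pg homogeneous_component_homogeneous] by blast
 qed
 ultimately show "homogeneous_prime g (\<kappa> R)" unfolding homogeneous_prime_def primeideal_iff[OF polynomials_subr[OF subr_UNIV]] by blast
 show "Xv i ~: \<kappa> R" unfolding canonical_map_homogeneous[OF assms Xv(1)[OF i(1)] Xv(2)] Xv(3) using v_nonzero[OF i(1)] nonunits_1[OF Rs] by simp
qed

abbreviation "cms \<equiv> canonical_model_stalk \<iota> v g"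

lemma model_stalk:
 assumes x: "x : pts" and R: "loc_ring R" "dominated (stk x) R" and i: "i < g" "ys i <= R"
 shows "cms (\<kappa> R) = local_at (kv i) R"
proof (intro equalityI subsetI)
 have vi: "v i ~= 0" by (rule v_nonzero[OF i(1)])
 note hom = canonical_map_homogeneous[OF assms]
 { fix z assume "z : cms (\<kappa> R)"
  then obtain F G d where z: "z = ev F / ev G" "F : Pg" "G : Pg" "homog d F" "homog d G" "G ~: \<kappa> R"
   unfolding canonical_model_stalk_def by blast
  hence "z = (ev F / v i ^ d) / (ev G / v i ^ d)" using vi by simp
  moreover have "ev F / v i ^ d : kv i" "ev G / v i ^ d : kv i" using kv_homogeneous[OF i(1)] z by blast+
  ultimately show "z : local_at (kv i) R" unfolding localization_iff using hom[OF z(3,5)] z(6) by blast }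
 fix z assume "z : local_at (kv i) R"
 then obtain a s where as: "z = a / s" "a : kv i" "s : kv i" "s ~: mm R" unfolding localization_iff by blast
 then obtain d F d' G where F: "F : Pg" "homog d F" "a = ev F / v i ^ d"
  and G: "G : Pg" "homog d' G" "s = ev G / v i ^ d'" using kv_homogeneous[OF i(1)] by blast
 interpret hom \<iota> by (rule hom_iota)
 let ?F = "F * Xv i ^ d'" and ?G = "Xv i ^ d * G"
 note p = Xv_power[OF i(1), of d] Xv_power[OF i(1), of d']
 have m: "?F : Pg" "?G : Pg" using polynomials_mult[OF subr_UNIV] p F(1) G(1) by blast+
 have hm: "homog (d + d') ?F" "homog (d + d') ?G" using homogeneous_mult p F(2) G(2) by blast+
 have e: "ev ?F / v i ^ (d + d') = a" "ev ?G / v i ^ (d + d') = s" using p F(3) G(3) vi by (simp_all add: evaluate_mult power_add)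
 hence "ev ?F = a * v i ^ (d + d')" "ev ?G = s * v i ^ (d + d')" using vi by (metis nonzero_divide_eq_eq power_not_zero)+
 hence "z = ev ?F / ev ?G" unfolding as(1) using vi by simp
 moreover have "?G ~: \<kappa> R" unfolding hom[OF m(2) hm(2)] e(2) by (rule as(4))
 ultimately show "z : cms (\<kappa> R)" unfolding canonical_model_stalk_def using m hm by blast
qed

end

section \<open>The charts of the blowup\<close>

context
 fixes A M :: "'a::field set" and m assumes A: "subr A" and M: "submod A M" and m: "m : M" "m ~= 0"
begin

lemma module_power_submod: "submod A (module_power A M n)"
proof (induction n)
 case (Suc n)
 thus ?case by (simp add: set_product_lspan[OF A] lspan_submod[OF A])
qed (use A in \<open>simp add: submod_self\<close>)

lemma module_power_Suc: "module_power A M (Suc n) = lspan A {x * y | x y. x : module_power A M n & y : M}"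
 by (simp add: set_product_lspan[OF A module_power_submod])

lemma module_power_mult: "a : module_power A M n ==> b : module_power A M k ==> a * b : module_power A M (n + k)"
proof (induction k arbitrary: b)
 case 0
 thus ?case using submod_mult'[OF module_power_submod] by simp
next
 case (Suc k)
 let ?N = "{b. a * b : module_power A M (n + Suc k)}"
 have "submod A ?N" unfolding submod_def
  using submod_0[OF module_power_submod] submod_add[OF module_power_submod] submod_mult[OF module_power_submod]
  by (auto simp: distrib_left mult.left_commute simp del: module_power.simps)
 moreover have "{x * y | x y. x : module_power A M k & y : M} <= ?N"
 proof clarify
  fix x y assume xy: "x : module_power A M k" "y : M"
  have "a * x * y : module_power A M (Suc (n + k))" unfolding module_power_Suc
   by (rule subsetD[OF lspan_incl[OF A]]) (use Suc.IH[OF Suc.prems(1) xy(1)] xy(2) in blast)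
  thus "a * (x * y) : module_power A M (n + Suc k)" by (simp add: mult.assoc)
 qed
 ultimately show ?case using lspan_min Suc.prems(2) unfolding module_power_Suc by blast
qed

lemma proj_chart_eq: "proj_chart A M m = adjoin (A Un (%w. w / m) ` M)"
proof
 let ?D = "adjoin (A Un (%w. w / m) ` M)"
 note D = adjoin_subr[of "A Un (%w. w / m) ` M"] adjoin_incl[of "A Un (%w. w / m) ` M"]
 have "a : module_power A M n ==> a / m ^ n : ?D" for a n
 proof (induction n arbitrary: a)
  case 0
  thus ?case using D(2) by auto
 next
  case (Suc n)
  let ?N = "{a. a / m ^ Suc n : ?D}"
  have "submod A ?N" by (rule submod_divide[OF submod_self[OF D(1)]]) (use D(2) in blast)
  moreover have "{x * y | x y. x : module_power A M n & y : M} <= ?N"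
  proof clarify
   fix x y assume xy: "x : module_power A M n" "y : M"
   have "x / m ^ n * (y / m) : ?D" by (rule subr_mult[OF D(1) Suc.IH[OF xy(1)]]) (use xy(2) D(2) in auto)
   thus "x * y / m ^ Suc n : ?D" by (simp add: mult.commute)
  qed
  ultimately show ?case using lspan_min Suc.prems unfolding module_power_Suc by blast
 qed
 thus "proj_chart A M m <= ?D" unfolding proj_chart_def by blast
 have one: "M <= module_power A M 1" unfolding One_nat_def module_power_Suc
 proof
  fix w assume "w : M"
  hence "1 * w : {x * y | x y. x : module_power A M 0 & y : M}" using subr_1[OF A] by fastforce
  from subsetD[OF lspan_incl[OF A] this] show "w : lspan A {x * y | x y. x : module_power A M 0 & y : M}" by simp
 qed
 have mp: "m ^ n : module_power A M n" for n
 proof (induction n)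
  case (Suc n)
  thus ?case using module_power_mult[OF Suc subsetD[OF one m(1)]] by (simp add: mult.commute del: module_power.simps)
 qed (use subr_1[OF A] in simp)
 show "?D <= proj_chart A M m"
 proof (rule adjoin_min)
  show "subr (proj_chart A M m)" unfolding subr_def
  proof (intro conjI ballI)
   show "1 : proj_chart A M m" unfolding proj_chart_def using subr_1[OF A] by (intro CollectI exI[of _ 1] exI[of _ 0]) simp
   fix x y assume "x : proj_chart A M m" "y : proj_chart A M m"
   then obtain a n b k where x: "x = a / m ^ n" "a : module_power A M n" and y: "y = b / m ^ k" "b : module_power A M k"
    unfolding proj_chart_def by blast
   have "x * y = a * b / m ^ (n + k)" using x y by (simp add: power_add)
   thus "x * y : proj_chart A M m" unfolding proj_chart_def using module_power_mult[OF x(2) y(2)] by blast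
   have "a / m ^ n - b / m ^ k = (a * m ^ k - m ^ n * b) / m ^ (n + k)" using m(2) by (simp add: power_add diff_frac_eq mult.commute)
   hence "x - y = (a * m ^ k - m ^ n * b) / m ^ (n + k)" unfolding x(1) y(1) .
   moreover have "a * m ^ k - m ^ n * b : module_power A M (n + k)"
    by (intro submod_diff[OF module_power_submod A] module_power_mult mp x y)
   ultimately show "x - y : proj_chart A M m" unfolding proj_chart_def by blast
  qed
  have "a : proj_chart A M m" if "a : A" for a unfolding proj_chart_def using that by (intro CollectI exI[of _ a] exI[of _ 0]) simp
  moreover have "w / m : proj_chart A M m" if "w : M" for w unfolding proj_chart_def using that one by (intro CollectI exI[of _ w] exI[of _ 1]) auto
  ultimately show "A Un (%w. w / m) ` M <= proj_chart A M m" by blast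
 qed
qed

end

context canonical_curve
begin

definition charts :: "'a set set" where
 "charts = {adjoin (\<O> U Un (%w. w / m) ` MU U) | U m. aff U & m : MU U & m ~= 0}"

lemma blowup_glue: "blowup X \<omega> e = glue charts"
proof -
 have "proj_chart (\<O> U) (MU U) m = adjoin (\<O> U Un (%w. w / m) ` MU U)" if "aff U & m : MU U & m ~= 0" for U m
  using that proj_chart_eq[OF affine_subr MU_submod[OF affine_nopen]] by blast
 thus ?thesis unfolding blowup_def MU_def[symmetric] charts_def by (intro arg_cong[of _ _ glue]) blast
qed

lemma charts_subr: "ALL B:charts. subr B" unfolding charts_def using adjoin_subr by blast

abbreviation "BP \<equiv> glued_points charts"

lemma bring_ratio: assumes x: "x : pts" "w : mst x" shows "w / v i : bring x i"
proof -
 note B = bring[where x = x and i = i]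
 have "submod (stk x) {w. w / v i : bring x i}" by (rule submod_divide[OF submod_self[OF B(1)] B(2)])
 moreover have "vs <= {w. w / v i : bring x i}" using B(3) by (auto simp: ys_def)
 ultimately show ?thesis using lspan_min x(2) unfolding mst_generated[OF x(1)] lat_def by blast
qed

text \<open>Over an affine neighborhood of x the sections of the dualizing sheaf are multiples of \<open>v\<^sub>i\<close> by elements of R.\<close>

lemma bpoint_chart:
 assumes bp: "bpoint x i R" and U: "aff U" "x : U"
 defines "B \<equiv> adjoin (\<O> U Un (%w. w / v i) ` MU U)"
 shows "B : charts" "B <= R" "R = local_at B R"
 unfolding B_def
proof -
 note D = bpointD[OF bp]
 let ?B = "adjoin (\<O> U Un (%w. w / v i) ` MU U)"
 note B = adjoin_subr[of "\<O> U Un (%w. w / v i) ` MU U"] adjoin_incl[of "\<O> U Un (%w. w / v i) ` MU U"]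
 have VU: "V <= MU U" by (rule MU_mono[OF nopen_pts affine_nopen[OF U(1)] affine_sub[OF U(1)]])
 have "v i : MU U" "v i ~= 0" using v_mem[OF D(2)] VU v_nonzero[OF D(2)] by auto
 thus Bc: "?B : charts" unfolding charts_def using U(1) by blast
 show BR: "?B <= R"
 proof (rule adjoin_min[OF D(4)])
  have "\<O> U <= R" using stalk_affine[OF U(1) U(2)] D(7) by blast
  moreover have "w / v i : R" if "w : MU U" for w using bring_ratio[OF D(1)] MU_mst[OF affine_nopen[OF U(1)] U(2)] that D(9) by blast
  ultimately show "\<O> U Un (%w. w / v i) ` MU U <= R" by blast
 qed
 let ?p = "?B Int mm R" let ?L = "localization ?B ?p"
 have p: "prime_of ?B ?p" by (rule center_prime[OF D(3) B(1) BR])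
 note L = localization_center[OF D(3) B(1) BR] localization_loc_ring[OF B(1) p] localization_incl[OF B(1) p]
 have "stk x <= ?L"
 proof
  fix z assume "z : stk x"
  then obtain a s where as: "z = a / s" "a : \<O> U" "s : \<O> U" "s ~: pp U x" unfolding stalk_eq_localization[OF U] localization_iff by blast
  have "s ~: mm R" using as(3,4) D(5) stalk_affine[OF U(1) U(2)] unfolding dominated_def point_prime_def by blast
  thus "z : ?L" unfolding localization_iff using as B(2) by blast
 qed
 moreover have "ys i <= ?L"
 proof
  fix w assume "w : ys i"
  then obtain j where "j < g" "w = v j / v i" by (auto simp: ys_def)
  hence "w : ?B" using subsetD[OF VU v_mem] B(2) by blast
  thus "w : ?L" by (rule subsetD[OF L(4)])
 qed
 ultimately have "bring x i <= ?L" unfolding bring_def by (intro adjoin_min[OF loc_ring_subr[OF L(3)]]) blast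
 from localization_min[OF D(3) bring(1) L(2) this L(3) refl] have "R <= ?L" using D(11) by simp
 thus "R = ?L" using L(1) by blast
qed

text \<open>A chart is given by an arbitrary section m, but the \<open>v\<^sub>i\<close> generate the dualizing sheaf, so at every point
 some \<open>v\<^sub>i / m\<close> is a unit and \<open>v\<^sub>i\<close> may replace m.\<close>

lemma blowup_points: "R : BP \<longleftrightarrow> (EX x i. bpoint x i R)"
proof
 assume "R : BP"
 obtain U m p where U: "aff U" "m : MU U" "m ~= 0"
  and p: "prime_of (adjoin (\<O> U Un (%w. w / m) ` MU U)) p" "R = localization (adjoin (\<O> U Un (%w. w / m) ` MU U)) p"
 proof -
  obtain B p where B: "B : charts" "prime_of B p" "R = localization B p" using `R : BP` unfolding glued_points_iff[OF charts_subr] by blast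
  thus ?thesis using that unfolding charts_def by blast
 qed
 let ?B = "adjoin (\<O> U Un (%w. w / m) ` MU U)"
 note B = adjoin_subr[of "\<O> U Un (%w. w / m) ` MU U"] adjoin_incl[of "\<O> U Un (%w. w / m) ` MU U"]
 have R: "loc_ring R" "?B <= R" unfolding p(2) using localization_loc_ring[OF B(1) p(1)] localization_incl[OF B(1) p(1)] by auto
 note Rs = loc_ring_subr[OF R(1)]
 have OR: "\<O> U <= R" using B(2) R(2) by blast
 obtain x where x: "x : U" "pp U x = \<O> U Int mm R" using pp_surj[OF U(1) center_prime[OF R(1) affine_subr[OF U(1)] OR]] by blast
 have dom: "dominated (stk x) R" using localization_center(2)[OF R(1) affine_subr[OF U(1)] OR] stalk_eq_localization[OF U(1) x(1)] x(2) by simp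
 have xp: "x : pts" using affine_sub[OF U(1)] x(1) by blast
 have Mx: "MU U <= mst x" by (rule MU_mst[OF affine_nopen[OF U(1)] x(1)])
 have VU: "V <= MU U" by (rule MU_mono[OF nopen_pts affine_nopen[OF U(1)] affine_sub[OF U(1)]])
 have vm: "v j / m : R" if "j < g" for j using v_mem[OF that] VU B(2) R(2) by blast
 have "EX i<g. v i / m ~: mm R"
 proof (rule ccontr)
  assume "~ ?thesis"
  hence vs: "vs <= {w. w / m : mm R}" by auto
  have "submod (stk x) {w. w / m : mm R}" by (rule submod_divide[OF nonunits_submod[OF R(1)] dominated_sub[OF dom]])
  from lspan_min[OF this vs] have "m / m : mm R" using U(2) Mx unfolding mst_generated[OF xp] lat_def by blast
  thus False using U(3) nonunits_1[OF Rs] by simp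
 qed
 then obtain i where i: "i < g" "v i / m ~: mm R" by blast
 have vi: "v i ~= 0" by (rule v_nonzero[OF i(1)])
 have mi: "m / v i : R" using unit_inverse[OF vm[OF i(1)] i(2)] by simp
 have ysR: "ys i <= R"
 proof
  fix w assume "w : ys i"
  then obtain j where j: "j < g" "w = (v j / m) * (m / v i)" using U(3) by (auto simp: ys_def)
  show "w : R" unfolding j(2) by (rule subr_mult[OF Rs vm[OF j(1)] mi])
 qed
 obtain S where S: "bpoint x i S" "dominated S R" by (rule dominated_bpoint[OF xp R(1) dom i(1) ysR])
 note D = bpointD[OF S(1)]
 have "v i / m : S"
 proof -
  have "m / v i : S" using bring_ratio[OF xp, of m i] U(2) Mx D(9) by blast
  moreover have "m / v i ~: mm R" using vm[OF i(1)] vi U(3) by (auto simp: nonunits_def)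
  ultimately show ?thesis using dominated_unit[OF S(2)] by fastforce
 qed
 moreover have "w / m = (w / v i) * (v i / m)" for w using vi by simp
 ultimately have "w / m : S" if "w : MU U" for w using subr_mult[OF D(4)] bring_ratio[OF xp, of w i] that Mx D(9) by (metis subsetD)
 moreover have "\<O> U <= S" using stalk_affine[OF U(1) x(1)] D(7) by blast
 ultimately have "?B <= S" by (intro adjoin_min[OF D(4)]) auto
 from localization_min[OF R(1) B(1) S(2) this D(3) refl] have "local_at ?B R <= S" .
 moreover have "local_at ?B R = R" using localization_contract[OF B(1) p(1)] p(2) by simp
 ultimately have "R = S" using dominated_sub[OF S(2)] by blast
 thus "EX x i. bpoint x i R" using S(1) by blast
next
 assume "EX x i. bpoint x i R"
 then obtain x i where bp: "bpoint x i R" by blast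
 obtain U where U: "aff U" "x : U" using affine_cover bpointD(1)[OF bp] by blast
 note c = bpoint_chart[OF bp U]
 thus "R : BP" unfolding glued_points_iff[OF charts_subr]
  using center_prime[OF bpointD(3)[OF bp] bspec[OF charts_subr c(1)] c(2)] by blast
qed

section \<open>The canonical map on the blowup\<close>

lemma canonical_map_dominated:
 assumes R: "bpoint x i R" and S: "loc_ring S" "dominated R S" shows "\<kappa> S = \<kappa> R"
proof -
 note D = bpointD[OF R]
 have RS: "R <= S" "mm R = R Int mm S" using S(2) by (auto simp: dominated_def)
 have "ev (hcomp d F) / v i ^ d : R" if "F : Pg" for d F
  using kv_homogeneous[OF D(2)] homogeneous_component_Pg[OF that] homogeneous_component_homogeneous D(10) by blast
 thus ?thesis using RS D(6) canonical_map_eq[OF D(1) S(1) dominated_trans[OF D(5) S(2)] D(2)] canonical_map_eq[OF D(1,3,5,2,6)] by auto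
qed

lemma kappa_homogeneous:
 assumes "bpoint x i R" "F : Pg" "homog d F" shows "F : \<kappa> R \<longleftrightarrow> ev F / v i ^ d : mm R"
 using canonical_map_homogeneous[of x R i F d] bpointD[OF assms(1)] assms(2,3) by blast

text \<open>The canonical model is the image of the normalization.  Each point of the blowup is dominated by a point of the
 normalization and conversely, and \<open>\<kappa>\<close> does not change under domination.\<close>

lemma kappa_normalization: "\<kappa> ` topspace (points (normalization X)) = \<kappa> ` BP"
proof -
 let ?\<N> = "{icl (\<O> U) | U. aff U}"
 have N: "ALL B:?\<N>. subr B" using integral_closure_props(1)[OF FD_affine affine_fractions] by blast
 have "topspace (points (normalization X)) = glued_points ?\<N>" unfolding normalization_def by (rule glue_topspace[OF N])
 moreover have "\<kappa> ` glued_points ?\<N> = \<kappa> ` BP"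
 proof (intro equalityI image_subsetI)
  fix S assume "S : glued_points ?\<N>"
  then obtain U P where UP: "aff U" "prime_of (icl (\<O> U)) P" "S = localization (icl (\<O> U)) P"
   unfolding glued_points_iff[OF N] by blast
  obtain x i where x: "x : pts" "dominated (stk x) S" "loc_ring S" "i < g" "ys i <= S" using normal_point[OF UP(1,2)] UP(3) by metis
  obtain R where R: "bpoint x i R" "dominated R S" by (rule dominated_bpoint[OF x(1,3,2,4,5)])
  show "\<kappa> S : \<kappa> ` BP" using canonical_map_dominated[OF R(1) x(3) R(2)] R(1) blowup_points by blast
 next
  fix R assume "R : BP"
  then obtain x i where R: "bpoint x i R" using blowup_points by blast
  obtain U P where UP: "aff U" "prime_of (icl (\<O> U)) P" "dominated R (localization (icl (\<O> U)) P)"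
   by (rule bpoint_normal[OF R])
  have "loc_ring (localization (icl (\<O> U)) P)" using localization_loc_ring N UP(1,2) by blast
  from canonical_map_dominated[OF R this UP(3)] show "\<kappa> R : \<kappa> ` glued_points ?\<N>"
   unfolding image_iff glued_points_iff[OF N] using UP by (intro bexI[of _ "localization (icl (\<O> U)) P"]) (auto simp: glued_points_iff[OF N])
 qed
 ultimately show ?thesis by simp
qed

text \<open>Where the form does not vanish, its value relative to \<open>v\<^sub>i\<close> and the inverse of this value are regular.\<close>

lemma kappa_continuous:
 assumes F: "F : Pg" "homog d F" shows "openin (glued_topology charts) {R : BP. F ~: \<kappa> R}"
proof (subst openin_subopen, intro ballI)
 fix R assume "R : {R : BP. F ~: \<kappa> R}"
 then obtain x i where R: "bpoint x i R" "R : BP" "F ~: \<kappa> R" using blowup_points by blast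
 note D = bpointD[OF R(1)]
 let ?a = "ev F / v i ^ d" let ?Z = "insert (inverse ?a) (ys i)"
 have "?a : R" using kv_homogeneous[OF D(2)] F D(10) by blast
 moreover have "?a ~: mm R" using kappa_homogeneous[OF R(1) F] R(3) by blast
 ultimately have a: "?a ~= 0" "inverse ?a : R" using unit_inverse by blast+
 have "F ~: \<kappa> S" if S: "S : BP" "?Z <= S" for S
 proof -
  obtain y j where "bpoint y j S" using S(1) blowup_points by blast
  note E = bpointD[OF this]
  have "?a ~: mm S" using a(1) S(2) by (auto simp: nonunits_def)
  thus ?thesis using canonical_map_homogeneous[OF E(1,3,5) D(2) _ F] S(2) by blast
 qed
 thus "EX T. openin (glued_topology charts) T & R : T & T <= {R : BP. F ~: \<kappa> R}"
  using glued_open_set[OF charts_subr, of ?Z] a(2) D(6) R(2) by (intro exI[of _ "{S : BP. ?Z <= S}"]) (auto simp: ys_def)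
qed

text \<open>Conversely, an open subset of the blowup contains with a point the nonvanishing locus of a form:
 the finitely many generators of a chart are regular where a suitable form does not vanish.\<close>

lemma kappa_open:
 assumes nh: "~ hyperelliptic X \<iota>" and W: "openin (glued_topology charts) W" "R : W"
 obtains F d where "F : Pg" "homog d F" "F ~: \<kappa> R" "!!S. S : BP ==> F ~: \<kappa> S ==> S : W"
proof -
 have "W <= BP" using W(1) by (simp add: openin_glued_topology)
 then obtain x i where R: "bpoint x i R" using W(2) blowup_points by blast
 note D = bpointD[OF R] and main = canonical_local[OF nh R]
 have vi: "v i ~= 0" by (rule v_nonzero[OF D(2)])
 obtain U G where U: "aff U" "x : U" "finite G" "\<O> U = adjoin (kk Un G)"
  using finite_cover D(1) by (metis UnionE)
 obtain T where T: "finite T" "T <= MU U" "MU U = lspan (\<O> U) T" by (rule MU_fg[OF U(1)])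
 let ?B = "adjoin (\<O> U Un (%w. w / v i) ` MU U)"
 note B = bpoint_chart[OF R U(1,2)]
 note Bs = bspec[OF charts_subr B(1)]
 have incl: "\<O> U <= ?B" "(%w. w / v i) ` MU U <= ?B" using adjoin_incl[of "\<O> U Un (%w. w / v i) ` MU U"] by auto
 obtain b where b: "b : ?B" "b ~: ?B Int mm R" "!!q. prime_of ?B q ==> b ~: q ==> localization ?B q : W"
  by (rule glue_nbhd[OF charts_subr W(1) B(1) center_prime[OF D(3) Bs B(2)]]) (use W(2) B(3) in auto)
 let ?Z = "insert (inverse b) (G Un (%w. w / v i) ` T)"
 have b0: "b ~= 0" "inverse b : R" using unit_inverse[of b R] b(1,2) B(2) by blast+
 have ZR: "?Z <= R" using b0 U(4) adjoin_incl[of "kk Un G"] incl T(2) B(2) by blast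
 have "finite ?Z" "?Z <= local_at (kv i) R" using U(3) T(1) ZR main by auto
 then obtain s where s: "s : kv i" "s ~: mm R" "!!z. z : ?Z ==> s * z : kv i"
  using localization_denominator[OF kv(1) center_prime[OF D(3) kv(1) D(10)], of ?Z] by blast
 obtain d F where F: "F : Pg" "homog d F" "s = ev F / v i ^ d" using kv_homogeneous[OF D(2)] s(1) by blast
 interpret hom \<iota> by (rule hom_iota)
 (* The factor Xv i makes v_i a generator wherever the form does not vanish. *)
 let ?F = "Xv i * F"
 have FP: "?F : Pg" "homog (1 + d) ?F" using polynomials_mult[OF subr_UNIV Xv(1)[OF D(2)] F(1)] homogeneous_mult[OF Xv(2) F(2)] by auto
 have evF: "ev ?F = v i * ev F" by (simp add: evaluate_mult Xv(3))
 show ?thesis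
 proof (rule that[OF FP])
  show "?F ~: \<kappa> R" unfolding kappa_homogeneous[OF R FP] evF using s(2) F(3) vi by simp
  fix S assume S: "S : BP" "?F ~: \<kappa> S"
  then obtain y j where S': "bpoint y j S" using blowup_points by blast
  note E = bpointD[OF S']
  have vj: "v j ~= 0" by (rule v_nonzero[OF E(2)])
  have FR: "ev F / v j ^ d : S" using kv_homogeneous[OF E(2)] F E(10) by blast
  have iR: "v i / v j : S" using E(6) D(2) by (auto simp: ys_def)
  have eq: "ev ?F / v j ^ (1 + d) = (ev F / v j ^ d) * (v i / v j)" unfolding evF by (simp add: mult.commute)
  have nu: "(ev F / v j ^ d) * (v i / v j) ~: mm S" using S(2) unfolding kappa_homogeneous[OF S' FP] eq .
  hence u: "v i / v j ~: mm S" "ev F / v j ^ d ~: mm S"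
   using nonunits_mult[OF E(4) _ FR, of "v i / v j"] nonunits_mult[OF E(4) _ iR, of "ev F / v j ^ d"] unfolding mult.commute[of "v i / v j"] by blast+
  have ji: "v j / v i : S" using unit_inverse[OF iR u(1)] by simp
  have "ys i <= S"
  proof
   fix w assume "w : ys i"
   then obtain l where l: "l < g" "w = (v l / v j) * (v j / v i)" using vj by (auto simp: ys_def)
   show "w : S" unfolding l(2) by (rule subr_mult[OF E(4) _ ji]) (use E(6) l(1) in \<open>auto simp: ys_def\<close>)
  qed
  hence kS: "kv i <= S" by (rule kv_min[OF E(4,8)])
  have "inverse s = inverse (ev F / v j ^ d) * (v i / v j) ^ d" unfolding F(3) using vi vj by (simp add: power_divide field_simps)
  hence si: "inverse s : S" using subr_mult[OF E(4) _ subr_power[OF E(4) iR]] unit_inverse[OF FR u(2)] by metis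
  have s0: "s ~= 0" using s(2) nonunits_0[OF D(4)] by auto
  have ZS: "?Z <= S"
  proof
   fix z assume "z : ?Z"
   hence "inverse s * (s * z) : S" using s(3) kS subr_mult[OF E(4) si] by blast
   thus "z : S" using s0 by (simp flip: mult.assoc)
  qed
  have "\<O> U <= S" unfolding U(4) by (rule adjoin_min[OF E(4)]) (use E(8) ZS in auto)
  moreover have "w / v i : S" if "w : MU U" for w
  proof -
   have "submod (\<O> U) {w. w / v i : S}" by (rule submod_divide[OF submod_self[OF E(4)] `\<O> U <= S`])
   moreover have "T <= {w. w / v i : S}" using ZS by auto
   ultimately show ?thesis using lspan_min `w : MU U` unfolding T(3) by blast
  qed
  ultimately have BS: "?B <= S" by (intro adjoin_min[OF E(4)]) auto
  let ?q = "?B Int mm S" let ?L = "localization ?B ?q"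
  have q: "prime_of ?B ?q" by (rule center_prime[OF E(3) Bs BS])
  have "inverse b : S" using ZS by blast
  hence "b ~: ?q" using b0(1) by (auto simp: nonunits_def)
  hence LW: "?L : W" by (rule b(3)[OF q])
  then obtain y' j' where "bpoint y' j' ?L" using `W <= BP` blowup_points by blast
  hence "?L = S" by (rule bpoint_dominated_eq[OF nh _ S' localization_center(2)[OF E(3) Bs BS]])
  thus "S : W" using LW by simp
 qed
qed

lemma stalk_kappa: "~ hyperelliptic X \<iota> ==> bpoint x i R ==> cms (\<kappa> R) = R"
 using model_stalk[of x R i] bpointD[of x i R] canonical_local[of x i R] by simp

lemma kappa_inj: "~ hyperelliptic X \<iota> ==> inj_on \<kappa> BP"
 using stalk_kappa blowup_points by (metis inj_onI)

theorem canonical_isomorphism: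
 assumes nh: "~ hyperelliptic X \<iota>"
 shows "isomorphism (blowup X \<omega> e) (canonical_model X \<iota> \<omega> e h g) \<kappa> (%a. a)"
proof -
 let ?X = "glue charts" and ?Y = "canonical_model X \<iota> \<omega> e h g" and ?T = "glued_topology charts"
 let ?G = "{{P. homogeneous_prime g P & (EX i<g. mon (mon i 1) 1 ~: P) & F ~: P} | F. F : Pg & (EX d. homog d F)}"
 have vv: "(%i. e pts (h i)) = v" by (simp add: fun_eq_iff v_def)
 have pX: "points ?X = ?T" and tX: "topspace ?T = BP" using glue_topspace[OF charts_subr] by (simp_all add: glue_def)
 have pY: "points ?Y = subtopology (projective_space g) (\<kappa> ` BP)" unfolding canonical_model_def kappa_normalization by simp
 have sY: "sections ?Y W = (\<Inter>P\<in>W. cms P)" for W unfolding canonical_model_def vv by simp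
 have pt: "homogeneous_prime g (\<kappa> R) & (EX i<g. mon (mon i 1) 1 ~: \<kappa> R)" "cms (\<kappa> R) = R" if R: "R : BP" for R
 proof -
  obtain x i where b: "bpoint x i R" using R blowup_points by blast
  note D = bpointD[OF b]
  show "homogeneous_prime g (\<kappa> R) & (EX i<g. mon (mon i 1) 1 ~: \<kappa> R)"
   using canonical_map_prime[OF D(1,3,5,2,6)] D(2) unfolding Xv_def by blast
  show "cms (\<kappa> R) = R" by (rule stalk_kappa[OF nh b])
 qed
 have cont: "continuous_map ?T (projective_space g) \<kappa>" unfolding projective_space_def
 proof (rule continuous_on_generated_topo)
  fix Z assume "Z : ?G"
  then obtain F d where F: "F : Pg" "homog d F" "Z = {P. homogeneous_prime g P & (EX i<g. mon (mon i 1) 1 ~: P) & F ~: P}" by blast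
  hence "\<kappa> -` Z Int topspace ?T = {R : BP. F ~: \<kappa> R}" unfolding tX using pt(1) by blast
  thus "openin ?T (\<kappa> -` Z Int topspace ?T)" using kappa_continuous[OF F(1,2)] by simp
 next
  have "R : BP ==> 1 ~: \<kappa> R" for R using pt(1)[of R] unfolding homogeneous_prime_def primeideal_iff[OF polynomials_subr[OF subr_UNIV]]
   using prime_ofD(3) by blast
  moreover have "(1 :: 'k mpoly) : Pg" "homog 0 (1 :: 'k mpoly)" using polynomials_1[OF subr_UNIV] by (auto simp: homogeneous_of_degree_def monomial_degree_def)
  ultimately have "\<kappa> R : {P. homogeneous_prime g P & (EX i<g. mon (mon i 1) 1 ~: P) & 1 ~: P}" "{P. homogeneous_prime g P & (EX i<g. mon (mon i 1) 1 ~: P) & 1 ~: P} : ?G" if "R : BP" for R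
   using pt(1)[OF that] that by blast+
  thus "\<kappa> ` topspace ?T <= \<Union>?G" unfolding tX by (intro image_subsetI UnionI)
 qed
 have tY: "topspace (points ?Y) = \<kappa> ` BP"
  using continuous_map_image_subset_topspace[OF cont] unfolding pY tX by auto
 have contY: "continuous_map ?T (points ?Y) \<kappa>" unfolding pY using cont by (rule continuous_map_into_subtopology) (auto simp: tX)
 have opn: "openin (points ?Y) (\<kappa> ` W)" if W: "openin ?T W" for W
 proof (subst openin_subopen, intro ballI)
  fix P assume "P : \<kappa> ` W"
  then obtain R where R: "R : W" "P = \<kappa> R" by blast
  obtain F d where F: "F : Pg" "homog d F" "F ~: \<kappa> R" "!!S. S : BP ==> F ~: \<kappa> S ==> S : W" by (rule kappa_open[OF nh W R(1)]) (rule that; assumption)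
  let ?Z = "{P. homogeneous_prime g P & (EX i<g. mon (mon i 1) 1 ~: P) & F ~: P}"
  have "openin (projective_space g) ?Z" unfolding projective_space_def by (rule topology_generated_by_Basis) (use F(1,2) in blast)
  hence "openin (points ?Y) (?Z Int \<kappa> ` BP)" unfolding pY openin_subtopology by blast
  moreover have "R : BP" using openin_subset[OF W] R(1) unfolding tX by blast
  hence "P : ?Z Int \<kappa> ` BP" using pt(1) F(3) R(2) by blast
  moreover have "?Z Int \<kappa> ` BP <= \<kappa> ` W" using F(4) by blast
  ultimately show "EX Z. openin (points ?Y) Z & P : Z & Z <= \<kappa> ` W" by blast
 qed
 have homeo: "homeomorphic_map (points ?X) (points ?Y) \<kappa>" unfolding pX
  by (rule bijective_open_imp_homeomorphic_map[OF contY]) (use opn tX tY kappa_inj[OF nh] in \<open>auto simp: open_map_def\<close>)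
 have pre: "preimage ?X \<kappa> W = {R : BP. \<kappa> R : W}" for W by (simp add: preimage_def pX tX)
 have sec: "sections ?Y W = sections ?X (preimage ?X \<kappa> W)" and ne: "preimage ?X \<kappa> W ~= {}" if W: "nopen ?Y W" for W
 proof -
  have WB: "W <= \<kappa> ` BP" "W ~= {}" using W openin_subset unfolding nopen_def tY[symmetric] by blast+
  thus "preimage ?X \<kappa> W ~= {}" unfolding pre by blast
  have "W = \<kappa> ` {R : BP. \<kappa> R : W}" using WB(1) by blast
  from arg_cong[OF this, of "%W. \<Inter>P\<in>W. cms P"]
  have "sections ?Y W = (\<Inter>R\<in>{R : BP. \<kappa> R : W}. cms (\<kappa> R))" unfolding sY image_image .
  also have "\<dots> = (\<Inter>R\<in>{R : BP. \<kappa> R : W}. R)" using pt(2) by auto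
  finally show "sections ?Y W = sections ?X (preimage ?X \<kappa> W)" unfolding pre by (simp add: glue_def)
 qed
 have stY: "stalk ?Y (\<kappa> R) = R" if R: "R : BP" for R
 proof (intro equalityI subsetI)
  fix z assume "z : stalk ?Y (\<kappa> R)"
  thus "z : R" unfolding stalk_def sY using pt(2)[OF R] by blast
 next
  fix z assume z: "z : R"
  let ?W = "{S : BP. z : S}"
  have "openin (points ?Y) (\<kappa> ` ?W)" by (rule opn[OF glued_open[OF charts_subr]])
  moreover have "z : sections ?Y (\<kappa> ` ?W)" unfolding sY using pt(2) by auto
  ultimately show "z : stalk ?Y (\<kappa> R)" unfolding stalk_def using R z by blast
 qed
 have hom: "(%a. a) : ring_iso (ring_on A) (ring_on A)" for A :: "'a set" by (auto simp: ring_iso_def ring_hom_def bij_betw_def)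
 show ?thesis unfolding blowup_glue isomorphism_def dominant_morphism_def
  using contY homeo sec ne hom stY glue_stalk[OF charts_subr] by (auto simp: pX tX ring_iso_def)
qed

end

theorem theorem6p4:
  fixes C :: "('p, 'a::field) rspace"
    and \<iota> :: "'k::alg_closed_field \<Rightarrow> 'a"
    and \<omega> :: "('p, 'a, 'w) omodule"
    and t :: "('p set \<Rightarrow> 'p set \<Rightarrow> 'w) \<Rightarrow> 'k"
    and e :: "'p set \<Rightarrow> 'w \<Rightarrow> 'a"
    and h :: "nat \<Rightarrow> 'w"
    and g :: nat
  assumes "complete_integral_curve C \<iota>"
    and "arithmetic_genus C \<iota> g"
    and "g \<ge> 2"
    and "dualizing C \<iota> \<omega> t"
    and "generic_trivialization C \<omega> e"
    and "global_basis C \<iota> \<omega> h g"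
    and "\<not> hyperelliptic C \<iota>"
  shows "isomorphism (blowup C \<omega> e) (canonical_model C \<iota> \<omega> e h g)
           (canonical_map C \<iota> \<omega> e h g) (\<lambda>a. a)"
proof -
 interpret canonical_curve C \<iota> \<omega> t e h g by unfold_locales fact+
 show ?thesis by (rule canonical_isomorphism) fact
qed

end
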